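(* Let $m\geq 3$ be an integer. Then for any integer $n\geq 0$, there is an isomorphism $$(D_{2^m})^n\cong \mathbf{1}\oplus (5^n-1)\cdot\partial C_2\oplus\bigoplus_{l=4}^m\frac{(3+2^{l-2})^n-(3+2^{l-3})^n}{2^{l-3}}\cdot\partial D_{2^l}$$ in the Roquette category $\mathcal{R}_2$.
   Context: $C_n$ and $D_n$ denote the cyclic and dihedral groups of order $n$; $(D_{2^m})^n$ is the direct product of $n$ copies of $D_{2^m}$. $n\cdot Y$ denotes the direct sum of $n$ copies of $Y$. Roquette category ($p$ is a prime; here $p=2$). For finite groups $G,H$, let $B(H,G)$ be the Grothendieck group (for disjoint union) of finite $(H,G)$-bisets, i.e. the Burnside group of $H\times G^{op}$. Composition $B(K,H)\times B(H,G)\to B(K,G)$ is the bilinear map induced by $(V,U)\mapsto V\times_H U$, and $\mathrm{Id}_G\in B(G,G)$ is the class of $G$ with left and right multiplication. Write $\mathbf{1}$ for the trivial group and $B(G)=B(G,\mathbf{1})$. Let $X$ be a Sylow $p$-subgroup of $\mathrm{PGL}(3,\mathbb{F}_p)$, and let $\delta=\mathbb{L}-\mathbb{P}\in B(X)$, where $\mathbb{L}$ and $\mathbb{P}$ are the $X$-sets of lines and points of the projective plane over $\mathbb{F}_p$; equivalently $\delta=(X/I-X/IZ)-(X/J-X/JZ)$, where $I,J$ are non-conjugate non-central subgroups of order $p$ of $X$ and $Z=Z(X)$. Let $B_\delta$ be the subfunctor of $B$ (on finite $p$-groups) generated by $\delta$, i.e. $B_\delta(P)=\{\varphi\circ\delta\mid\varphi\in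 B(P,X)\}\subseteq B(P)$ (this does not depend on the choices), and let $B_\delta(Q,P)\subseteq B(Q,P)$ correspond to $B_\delta(Q\times P^{op})\subseteq B(Q\times P^{op})$. The category $\mathcal{R}_p^\sharp$ has the finite $p$-groups as objects, $\mathrm{Hom}(P,Q)=B(Q,P)/B_\delta(Q,P)$, composition induced by that of bisets, and identities the images of $\mathrm{Id}_P$. The Roquette category $\mathcal{R}_p$ is its idempotent additive completion: objects are formal finite direct sums of pairs $(P,e)$ with $P$ a finite $p$-group and $e$ an idempotent of $\mathrm{End}_{\mathcal{R}_p^\sharp}(P)$; morphisms are matrices whose entry from $(P,e)$ to $(Q,f)$ lies in $f\,\mathrm{Hom}_{\mathcal{R}_p^\sharp}(P,Q)\,e$, composed by matrix multiplication. A finite $p$-group $P$ is viewed as the object $(P,\mathrm{Id}_P)$. Edge. For a finite $p$-group $P$, let $f_{\mathbf 1}^P=\sum_{M\trianglelefteq P}\mu(\mathbf{1},M)\,[P/M]\in B(P,P)$, where $\mu$ is the Möbius function of the poset of normal subgroups of $P$ and $P/M$ is the $(P,P)$-biset with left and right multiplication. It is an idempotent, and the edge of $P$ is the object $\partial P=(P,f_{\mathbf 1}^P)$ of $\mathcal{R}_p$. *)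

theory Defs
  imports
    "HOL-Algebra.Group_Action"
    "HOL-Algebra.Product_Groups"
    "HOL-Algebra.Elementary_Groups"
    "HOL-Algebra.Weak_Morphisms"
    "HOL-Analysis.Cartesian_Space"
    "HOL-Library.Z2"
begin

section \<open>Groups\<close>

definition opp_group :: "'a monoid \<Rightarrow> 'a monoid" where
  "opp_group G = \<lparr>carrier = carrier G, mult = (\<lambda>x y. y \<otimes>\<^bsub>G\<^esub> x), one = \<one>\<^bsub>G\<^esub>\<rparr>"

definition two_group :: "'a monoid \<Rightarrow> bool" where
  "two_group G \<longleftrightarrow> group G \<and> finite (carrier G) \<and> (\<exists>k. order G = 2 ^ k)"

text \<open>The dihedral group of order \<open>n\<close>, for \<open>n\<close> even: \<open>(a, False)\<close> is the rotation
  \<open>r\<^sup>a\<close> and \<open>(a, True)\<close> is the reflection \<open>r\<^sup>a s\<close>, where \<open>r\<close> has order \<open>n div 2\<close> and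
  \<open>s r s = r\<^sup>-\<^sup>1\<close>.\<close>

definition dihedral_group :: "nat \<Rightarrow> (int \<times> bool) monoid" where
  "dihedral_group n =
    \<lparr>carrier = {0..<int (n div 2)} \<times> UNIV,
     mult = (\<lambda>(a, s) (b, t). ((if s then a - b else a + b) mod int (n div 2), s \<noteq> t)),
     one = (0, False)\<rparr>"

abbreviation trivial_grp :: "unit monoid" where
  "trivial_grp \<equiv> singleton_group ()"

text \<open>The objects of the categories below are groups carried by sets of natural numbers.  Every
  finite group has an isomorphic copy of this kind.\<close>

definition nat_copy :: "'a monoid \<Rightarrow> nat monoid" where
  "nat_copy G = image_group (to_nat_on (carrier G)) G"


section \<open>Bisets\<close>

text \<open>An \<open>(H, G)\<close>-biset is a set with an action of \<open>H \<times> G\<^sup>o\<^sup>p\<close>; the pair \<open>(h, g)\<close> acts by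
  \<open>u \<mapsto> h \<cdot> u \<cdot> g\<close>.\<close>

type_synonym ('h, 'g, 'x) biset = "'x set \<times> ('h \<times> 'g \<Rightarrow> 'x \<Rightarrow> 'x)"

definition fin_biset :: "'h monoid \<Rightarrow> 'g monoid \<Rightarrow> ('h, 'g, 'x) biset \<Rightarrow> bool" where
  "fin_biset H G U \<longleftrightarrow> finite (fst U) \<and> group_action (H \<times>\<times> opp_group G) (fst U) (snd U)"

definition lact :: "'g monoid \<Rightarrow> ('h, 'g, 'x) biset \<Rightarrow> 'h \<Rightarrow> 'x \<Rightarrow> 'x" where
  "lact G U h u = snd U (h, \<one>\<^bsub>G\<^esub>) u"

definition ract :: "'h monoid \<Rightarrow> ('h, 'g, 'x) biset \<Rightarrow> 'x \<Rightarrow> 'g \<Rightarrow> 'x" where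
  "ract H U u g = snd U (\<one>\<^bsub>H\<^esub>, g) u"

definition biset_iso ::
    "'h monoid \<Rightarrow> 'g monoid \<Rightarrow> ('h, 'g, 'x) biset \<Rightarrow> ('h, 'g, 'y) biset \<Rightarrow> bool" where
  "biset_iso H G U V \<longleftrightarrow> (\<exists>f. bij_betw f (fst U) (fst V) \<and>
     (\<forall>h\<in>carrier H. \<forall>g\<in>carrier G. \<forall>u\<in>fst U. f (snd U (h, g) u) = snd V (h, g) (f u)))"

definition biset_sum ::
    "('h, 'g, 'x) biset \<Rightarrow> ('h, 'g, 'y) biset \<Rightarrow> ('h, 'g, 'x + 'y) biset"  (infixr "\<uplus>" 65) where
  "U \<uplus> V = (fst U <+> fst V,
     (\<lambda>x. restrict (map_sum (snd U x) (snd V x)) (fst U <+> fst V)))"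

definition empty_biset :: "('h, 'g, nat) biset" where
  "empty_biset = ({}, (\<lambda>x. restrict id {}))"

text \<open>\<open>tensor_rel\<close> identifies \<open>(v \<cdot> h, u)\<close> with \<open>(v, h \<cdot> u)\<close>; since \<open>h\<close> ranges over a group,
  it is already an equivalence relation.  \<open>biset_tensor K H G V U\<close> is \<open>V \<times>\<^sub>H U\<close>.\<close>

definition tensor_rel :: "'k monoid \<Rightarrow> 'h monoid \<Rightarrow> 'g monoid \<Rightarrow>
    ('k, 'h, 'x) biset \<Rightarrow> ('h, 'g, 'y) biset \<Rightarrow> (('x \<times> 'y) \<times> ('x \<times> 'y)) set" where
  "tensor_rel K H G V U =
    {((ract K V v h, u), (v, lact G U h u)) | v h u. v \<in> fst V \<and> h \<in> carrier H \<and> u \<in> fst U}"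

definition biset_tensor :: "'k monoid \<Rightarrow> 'h monoid \<Rightarrow> 'g monoid \<Rightarrow>
    ('k, 'h, 'x) biset \<Rightarrow> ('h, 'g, 'y) biset \<Rightarrow> ('k, 'g, ('x \<times> 'y) set) biset" where
  "biset_tensor K H G V U =
    ((fst V \<times> fst U) // tensor_rel K H G V U,
     (\<lambda>(k, g). \<lambda>c\<in>(fst V \<times> fst U) // tensor_rel K H G V U.
        map_prod (lact H V k) (\<lambda>u. ract H U u g) ` c))"

definition id_biset :: "'g monoid \<Rightarrow> ('g, 'g, 'g) biset" where
  "id_biset G = (carrier G, (\<lambda>(a, b). \<lambda>x\<in>carrier G. a \<otimes>\<^bsub>G\<^esub> x \<otimes>\<^bsub>G\<^esub> b))"

definition quot_biset :: "'g monoid \<Rightarrow> 'g set \<Rightarrow> ('g, 'g, 'g set) biset" where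
  "quot_biset P M = (rcosets\<^bsub>P\<^esub> M, (\<lambda>(a, b). \<lambda>c\<in>rcosets\<^bsub>P\<^esub> M. (a <#\<^bsub>P\<^esub> c) #>\<^bsub>P\<^esub> b))"


section \<open>The groups \<open>B(H, G)\<close>\<close>

text \<open>Elements of the Grothendieck group are equivalence classes of pairs of finite bisets carried
  by sets of natural numbers, \<open>(V, W)\<close> standing for \<open>V - W\<close>.  \<open>vbiset H G U U'\<close> is the
  class of \<open>U - U'\<close>, where \<open>U\<close> and \<open>U'\<close> may be carried by any types.\<close>

type_synonym ('h, 'g) vbiset = "(('h, 'g, nat) biset \<times> ('h, 'g, nat) biset) set"

definition vbiset :: "'h monoid \<Rightarrow> 'g monoid \<Rightarrow>
    ('h, 'g, 'x) biset \<Rightarrow> ('h, 'g, 'y) biset \<Rightarrow> ('h, 'g) vbiset" where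
  "vbiset H G U U' = {(V, W). fin_biset H G V \<and> fin_biset H G W \<and>
     (\<exists>K :: ('h, 'g, nat) biset. fin_biset H G K \<and> biset_iso H G (V \<uplus> U' \<uplus> K) (U \<uplus> W \<uplus> K))}"

abbreviation bclass :: "'h monoid \<Rightarrow> 'g monoid \<Rightarrow> ('h, 'g, 'x) biset \<Rightarrow> ('h, 'g) vbiset" where
  "bclass H G U \<equiv> vbiset H G U empty_biset"

text \<open>The group operation of \<open>B(H, G)\<close> is addition, although the library writes groups
  multiplicatively.\<close>

definition burnside :: "'h monoid \<Rightarrow> 'g monoid \<Rightarrow> ('h, 'g) vbiset monoid" where
  "burnside H G =
    \<lparr>carrier = {vbiset H G U U' | (U :: ('h, 'g, nat) biset) (U' :: ('h, 'g, nat) biset).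
        fin_biset H G U \<and> fin_biset H G U'},
     mult = (\<lambda>x y. \<Union>(V, W)\<in>x. \<Union>(V', W')\<in>y. vbiset H G (V \<uplus> V') (W \<uplus> W')),
     one = bclass H G (empty_biset :: ('h, 'g, nat) biset)\<rparr>"

definition bcomp :: "'k monoid \<Rightarrow> 'h monoid \<Rightarrow> 'g monoid \<Rightarrow>
    ('k, 'h) vbiset \<Rightarrow> ('h, 'g) vbiset \<Rightarrow> ('k, 'g) vbiset" where
  "bcomp K H G y x = (\<Union>(V, V')\<in>y. \<Union>(U, U')\<in>x.
     vbiset K G (biset_tensor K H G V U \<uplus> biset_tensor K H G V' U')
                (biset_tensor K H G V U' \<uplus> biset_tensor K H G V' U))"

definition bid :: "'g monoid \<Rightarrow> ('g, 'g) vbiset" where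
  "bid G = bclass G G (id_biset G)"

abbreviation burnside1 :: "'g monoid \<Rightarrow> ('g, unit) vbiset monoid" where
  "burnside1 G \<equiv> burnside G trivial_grp"


section \<open>The group \<open>X\<close>, the element \<open>\<delta>\<close> and the subfunctor \<open>B\<^sub>\<delta>\<close>\<close>

definition GL3 :: "(bit ^ 3 ^ 3) monoid" where
  "GL3 = \<lparr>carrier = {A. invertible A}, mult = (**), one = mat 1\<rparr>"

definition scalars3 :: "(bit ^ 3 ^ 3) set" where
  "scalars3 = {mat c | c. c \<noteq> 0}"

definition PGL3 :: "(bit ^ 3 ^ 3) set monoid" where
  "PGL3 = GL3 Mod scalars3"

text \<open>As Sylow 2-subgroup of \<open>PGL3\<close> we take the image of the upper unitriangular matrices:
  it has order 8, and \<open>PGL3\<close> has order 168.\<close>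

definition unitriangular3 :: "(bit ^ 3 ^ 3) set" where
  "unitriangular3 = {A. (\<forall>i. A $ i $ i = 1) \<and> A $ 2 $ 1 = 0 \<and> A $ 3 $ 1 = 0 \<and> A $ 3 $ 2 = 0}"

definition sylow3 :: "(bit ^ 3 ^ 3) set monoid" where
  "sylow3 = PGL3 \<lparr>carrier := (\<lambda>A. scalars3 #>\<^bsub>GL3\<^esub> A) ` unitriangular3\<rparr>"

definition proj_points :: "(bit ^ 3) set set" where
  "proj_points = {S. vec.subspace S \<and> vec.dim S = 1}"

definition proj_lines :: "(bit ^ 3) set set" where
  "proj_lines = {S. vec.subspace S \<and> vec.dim S = 2}"

text \<open>All matrices in a coset \<open>c \<in> PGL3\<close> map a subspace to the same subspace.\<close>

definition proj_act :: "(bit ^ 3 ^ 3) set \<Rightarrow> (bit ^ 3) set \<Rightarrow> (bit ^ 3) set" where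
  "proj_act c S = (\<Union>A\<in>c. (*v) A ` S)"

definition proj_set :: "(bit ^ 3) set set \<Rightarrow> ((bit ^ 3 ^ 3) set, unit, (bit ^ 3) set) biset" where
  "proj_set F = (F, (\<lambda>(c, _). restrict (proj_act c) F))"

definition delta :: "((bit ^ 3 ^ 3) set, unit) vbiset" where
  "delta = vbiset sylow3 trivial_grp (proj_set proj_lines) (proj_set proj_points)"

definition burnside1_delta :: "'p monoid \<Rightarrow> ('p, unit) vbiset set" where
  "burnside1_delta P = {bcomp P sylow3 trivial_grp \<phi> delta | \<phi>. \<phi> \<in> carrier (burnside P sylow3)}"

text \<open>The identification of \<open>B(Q, P)\<close> with \<open>B(Q \<times> P\<^sup>o\<^sup>p)\<close>.\<close>

definition to_opset :: "('q, 'p, 'x) biset \<Rightarrow> ('q \<times> 'p, unit, 'x) biset" where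
  "to_opset U = (fst U, (\<lambda>(x, _). snd U x))"

definition to_burnside1 :: "'q monoid \<Rightarrow> 'p monoid \<Rightarrow> ('q, 'p) vbiset \<Rightarrow> ('q \<times> 'p, unit) vbiset" where
  "to_burnside1 Q P x = (\<Union>(U, V)\<in>x. vbiset (Q \<times>\<times> opp_group P) trivial_grp (to_opset U) (to_opset V))"

definition burnside_delta :: "'q monoid \<Rightarrow> 'p monoid \<Rightarrow> ('q, 'p) vbiset set" where
  "burnside_delta Q P = {x \<in> carrier (burnside Q P). to_burnside1 Q P x \<in> burnside1_delta (Q \<times>\<times> opp_group P)}"


section \<open>The category \<open>\<R>\<^sub>2\<^sup>\<sharp>\<close>\<close>

text \<open>Its objects are the finite 2-groups.  A morphism is a coset of \<open>B\<^sub>\<delta>\<close>.\<close>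

type_synonym ('q, 'p) smor = "('q, 'p) vbiset set"

definition Hom_sharp :: "'p monoid \<Rightarrow> 'q monoid \<Rightarrow> ('q, 'p) smor monoid" where
  "Hom_sharp P Q = burnside Q P Mod burnside_delta Q P"

definition comp_sharp :: "'r monoid \<Rightarrow> 'q monoid \<Rightarrow> 'p monoid \<Rightarrow>
    ('r, 'q) smor \<Rightarrow> ('q, 'p) smor \<Rightarrow> ('r, 'p) smor" where
  "comp_sharp R Q P g f = (\<Union>y\<in>g. \<Union>x\<in>f. burnside_delta R P #>\<^bsub>burnside R P\<^esub> bcomp R Q P y x)"

definition to_sharp :: "'q monoid \<Rightarrow> 'p monoid \<Rightarrow> ('q, 'p) vbiset \<Rightarrow> ('q, 'p) smor" where
  "to_sharp Q P x = burnside_delta Q P #>\<^bsub>burnside Q P\<^esub> x"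

definition id_sharp :: "'p monoid \<Rightarrow> ('p, 'p) smor" where
  "id_sharp P = to_sharp P P (bid P)"


section \<open>The Roquette category \<open>\<R>\<^sub>2\<close>\<close>

text \<open>A formal direct sum is a list of pairs \<open>(P, e)\<close>.\<close>

type_synonym roq_ob = "(nat monoid \<times> (nat, nat) smor) list"

definition roq_object :: "roq_ob \<Rightarrow> bool" where
  "roq_object A \<longleftrightarrow> (\<forall>(P, e) \<in> set A.
     two_group P \<and> e \<in> carrier (Hom_sharp P P) \<and> comp_sharp P P P e e = e)"

text \<open>The morphisms from \<open>(P, e)\<close> to \<open>(Q, f)\<close>.\<close>

definition comp_hom :: "nat monoid \<times> (nat, nat) smor \<Rightarrow> nat monoid \<times> (nat, nat) smor \<Rightarrow>
    (nat, nat) smor set" where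
  "comp_hom = (\<lambda>(P, e) (Q, f).
     {comp_sharp Q Q P f (comp_sharp Q P P a e) | a. a \<in> carrier (Hom_sharp P Q)})"

text \<open>A morphism from \<open>A\<close> to \<open>C\<close> is a matrix with rows indexed by the summands of \<open>C\<close> and
  columns indexed by those of \<open>A\<close>.\<close>

type_synonym roq_mor = "nat \<times> nat \<Rightarrow> (nat, nat) smor"

definition roq_hom :: "roq_ob \<Rightarrow> roq_ob \<Rightarrow> roq_mor set" where
  "roq_hom A C = (\<Pi>\<^sub>E (i, j)\<in>{..<length C} \<times> {..<length A}. comp_hom (A ! j) (C ! i))"

definition roq_comp :: "roq_ob \<Rightarrow> roq_ob \<Rightarrow> roq_ob \<Rightarrow> roq_mor \<Rightarrow> roq_mor \<Rightarrow> roq_mor" where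
  "roq_comp A C D g f = (\<lambda>(i, j)\<in>{..<length D} \<times> {..<length A}.
     finprod (Hom_sharp (fst (A ! j)) (fst (D ! i)))
       (\<lambda>k. comp_sharp (fst (D ! i)) (fst (C ! k)) (fst (A ! j)) (g (i, k)) (f (k, j)))
       {..<length C})"

definition roq_id :: "roq_ob \<Rightarrow> roq_mor" where
  "roq_id A = (\<lambda>(i, j)\<in>{..<length A} \<times> {..<length A}.
     if i = j then snd (A ! i) else \<one>\<^bsub>Hom_sharp (fst (A ! j)) (fst (A ! i))\<^esub>)"

definition roq_iso :: "roq_ob \<Rightarrow> roq_ob \<Rightarrow> bool"  (infix "\<cong>\<^sub>R" 50) where
  "A \<cong>\<^sub>R C \<longleftrightarrow> roq_object A \<and> roq_object C \<and>
     (\<exists>f \<in> roq_hom A C. \<exists>g \<in> roq_hom C A.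
        roq_comp A C A g f = roq_id A \<and> roq_comp C A C f g = roq_id C)"

definition group_ob :: "nat monoid \<Rightarrow> roq_ob" where
  "group_ob P = [(P, id_sharp P)]"

text \<open>Direct sums of objects are concatenations of lists.\<close>

definition copies :: "nat \<Rightarrow> roq_ob \<Rightarrow> roq_ob" where
  "copies n Y = concat (replicate n Y)"


section \<open>Edges\<close>

text \<open>The Moebius function of the finite poset \<open>S\<close>.  The finiteness test ensures termination.\<close>

function moebius :: "'a::order set \<Rightarrow> 'a \<Rightarrow> 'a \<Rightarrow> int" where
  "moebius S x y =
    (if \<not> finite S then 0 else if x = y then 1
     else - (\<Sum>z\<in>{z\<in>S. x \<le> z \<and> z < y}. moebius S x z))"
  by auto
termination
proof (relation "measure (\<lambda>(S, x, y). card {w\<in>S. w < y})", simp)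
  fix S :: "'a set" and x y z
  assume "\<not> infinite S" "z \<in> {z\<in>S. x \<le> z \<and> z < y}"
  then have "{w\<in>S. w < z} \<subset> {w\<in>S. w < y}" "finite {w\<in>S. w < y}" by auto
  then show "((S, x, z), S, x, y) \<in> measure (\<lambda>(S, x, y). card {w\<in>S. w < y})"
    by (simp add: psubset_card_mono)
qed

declare moebius.simps [simp del]

definition f_one :: "'p monoid \<Rightarrow> ('p, 'p) vbiset" where
  "f_one P = finprod (burnside P P)
     (\<lambda>M. bclass P P (quot_biset P M) [^]\<^bsub>burnside P P\<^esub> moebius {N. N \<lhd> P} {\<one>\<^bsub>P\<^esub>} M)
     {M. M \<lhd> P}"

definition edge :: "nat monoid \<Rightarrow> roq_ob" where
  "edge P = [(P, to_sharp P P (f_one P))]"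

end

theory Submission
  imports Defs "HOL-Library.Function_Algebras" "HOL-Combinatorics.List_Permutation"
begin

text \<open>Finite bisets are determined up to isomorphism by their marks, that is, by the numbers of fixed
  points of the subgroups, so \<open>B(Q, P)\<close> embeds into the integer-valued functions on the subsets of
  \<open>Q \<times> P\<close>.  Composing \<open>\<delta>\<close> with the biset of a homomorphism from a subgroup of \<open>Q \<times> P\<close> to
  the group \<open>X\<close>, which is dihedral of order 8, yields two kinds of elements of \<open>B\<^sub>\<delta>(Q, P)\<close>, according to
  whether the image of the homomorphism is \<open>X\<close> or a Klein four-group.

  The second kind splits the edge of \<open>P\<close> at a central involution \<open>z\<close> along a further central involution
  \<open>a\<close> into the corresponding edges of \<open>P/\<langle>a\<rangle>\<close> and \<open>P/\<langle>az\<rangle>\<close>.  If the conjugates of a non-central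
  involution \<open>i\<close> are \<open>i\<close> and \<open>iz\<close>, the two kinds together identify the edge of \<open>P\<close> at \<open>z\<close> with that of
  \<open>C\<^sub>P(i)/\<langle>i\<rangle>\<close> at the image of \<open>z\<close>.  These steps are applied to direct products of dihedral groups with
  an arbitrary further factor, so that the factors of \<open>(D\<^bsub>2^m\<^esub>)\<^sup>n\<close> can be treated one at a time.  The
  multiplicity \<open>q\<^sub>l(n)\<close> of \<open>\<partial>D\<^bsub>2^l\<^esub>\<close> then satisfies
  \<open>q\<^sub>l(n + 1) = (3 + 2^(l - 3)) q\<^sub>l(n) + (3 + 2^(l - 2))^n\<close>, which is solved by the stated quotient.\<close>

section \<open>Bisets and their marks\<close>

text \<open>The obstacle is the edge of \<open>G\<close> times a dihedral group at an involution z
  of \<open>G\<close>. Splitting it along the centre of the dihedral factor leaves a summand in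
  which that centre is identified with z. If \<open>G\<close> begins with a dihedral group, the pair
  i of quarter turns squares to the product s of the two half turns, so it is an involution only
  modulo s. This is why the second reduction is formulated through a homomorphism \<kappa> that may
  have a kernel. Modulo s the conjugates of i are i and iz, and the centralizer of i divided by i is
  a dihedral extension of a product of two cyclic groups. Central splittings cut its edge into equal
  pieces, whence the powers of two in the recursion.

  The homomorphisms to X come from the Klein group E generated by i and z. Pairs of elements of P
  congruent modulo E form an extension of P by E; the two coordinates in E and the character telling
  whether an element of P moves i are its matrix entries. The four terms of \<delta> then become the
  edge of P at z and the edge induced from the centralizer quotient.\<close>

lemma opp_group_sel [simp]:
  "carrier (opp_group G) = carrier G" "monoid.mult (opp_group G) x y = y \<otimes>\<^bsub>G\<^esub> x"
  "one (opp_group G) = \<one>\<^bsub>G\<^esub>"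
  by (simp_all add: opp_group_def)

lemma group_opp_group: assumes "group G" shows "group (opp_group G)"
proof -
  interpret group G by fact
  show ?thesis
    by (rule groupI) (auto simp: m_assoc intro: l_inv_ex r_inv_ex)
qed

lemma inv_opp_group: assumes "group G" "x \<in> carrier G"
  shows "inv\<^bsub>opp_group G\<^esub> x = inv\<^bsub>G\<^esub> x"
proof -
  interpret group G by fact
  interpret o: group "opp_group G" by (rule group_opp_group) fact
  show ?thesis by (rule o.inv_equality) (use assms in auto)
qed

lemma DirProd_sel [simp]: "carrier (G \<times>\<times> H) = carrier G \<times> carrier H"
  "(a, b) \<otimes>\<^bsub>G \<times>\<times> H\<^esub> (c, d) = (a \<otimes>\<^bsub>G\<^esub> c, b \<otimes>\<^bsub>H\<^esub> d)" "\<one>\<^bsub>G \<times>\<times> H\<^esub> = (\<one>\<^bsub>G\<^esub>, \<one>\<^bsub>H\<^esub>)"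
  by (simp_all add: DirProd_def)

definition finite_group :: "'a monoid \<Rightarrow> bool" where
  "finite_group G \<longleftrightarrow> group G \<and> finite (carrier G)"

lemma finite_groupD: assumes "finite_group G" shows "group G" "finite (carrier G)"
  using assms by (auto simp: finite_group_def)

lemma finite_group_DirProd: "finite_group G \<Longrightarrow> finite_group H \<Longrightarrow> finite_group (G \<times>\<times> H)"
  by (auto simp: finite_group_def DirProd_group)

lemma finite_group_opp: "finite_group G \<Longrightarrow> finite_group (opp_group G)"
  by (auto simp: finite_group_def group_opp_group)

lemma finite_group_trivial: "finite_group trivial_grp"
  by (auto simp: finite_group_def singleton_group_def intro: groupI)

abbreviation biset_group (infixr "\<bowtie>" 80) where "H \<bowtie> G \<equiv> H \<times>\<times> opp_group G"

text \<open>Unfolds an action by permutations into elementary axioms. Permutations are extensional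
  functions here, hence the extensionality clause, and the opposite group reverses the product in
  the second component.\<close>

lemma fin_biset_iff:
  fixes H (structure)
  assumes "group H" "group G"
  shows "fin_biset H G U \<longleftrightarrow> finite (fst U) \<and>
    (\<forall>h\<in>carrier H. \<forall>g\<in>carrier G. snd U (h, g) \<in> extensional (fst U) \<inter> (fst U \<rightarrow> fst U)) \<and>
    (\<forall>u\<in>fst U. snd U (\<one>, \<one>\<^bsub>G\<^esub>) u = u) \<and>
    (\<forall>h\<in>carrier H. \<forall>g\<in>carrier G. \<forall>h'\<in>carrier H. \<forall>g'\<in>carrier G. \<forall>u\<in>fst U.
       snd U (h, g) (snd U (h', g') u) = snd U (h \<otimes> h', g' \<otimes>\<^bsub>G\<^esub> g) u)" (is "?L \<longleftrightarrow> ?R")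
proof
  let ?C = "carrier (H \<bowtie> G)"
  interpret HG: group "H \<bowtie> G" by (intro DirProd_group group_opp_group assms)
  {
    assume L: ?L
    then interpret group_action "H \<bowtie> G" "fst U" "snd U" by (simp add: fin_biset_def)
    have "snd U x \<in> carrier (BijGroup (fst U))" if "x \<in> ?C" for x
      using bij_prop0[OF that] by (simp add: BijGroup_def)
    then have "snd U x \<in> extensional (fst U) \<inter> (fst U \<rightarrow> fst U)" if "x \<in> carrier H \<times> carrier G" for x
      using that by (auto simp: BijGroup_def Bij_def bij_betw_def)
    moreover have "snd U (\<one>, \<one>\<^bsub>G\<^esub>) u = u" if "u \<in> fst U" for u
      using id_eq_one that by (metis DirProd_sel(3) opp_group_sel(3) restrict_apply')
    moreover have "snd U (h, g) (snd U (h', g') u) = snd U (h \<otimes> h', g' \<otimes>\<^bsub>G\<^esub> g) u"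
      if "h\<in>carrier H" "g\<in>carrier G" "h'\<in>carrier H" "g'\<in>carrier G" "u\<in>fst U" for h g h' g' u
      using composition_rule[of u "(h,g)" "(h',g')"] that by simp
    ultimately show ?R using L by (auto simp: fin_biset_def)
  next
    assume R: ?R
    interpret H: group H by fact
    interpret G: group G by fact
    have bij: "bij_betw (snd U (h, g)) (fst U) (fst U)" if "h \<in> carrier H" "g \<in> carrier G" for h g
      by (rule bij_betwI[where g = "snd U (inv h, inv\<^bsub>G\<^esub> g)"]) (use R that in auto)
    have B: "snd U x \<in> Bij (fst U)" if "x \<in> ?C" for x
      using that R bij by (auto simp: Bij_def)
    have "group_action (H \<bowtie> G) (fst U) (snd U)"
      unfolding group_action_def group_hom_def group_hom_axioms_def
    proof (intro conjI homI)
      fix x y assume *: "x \<in> ?C" "y \<in> ?C"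
      obtain h g h' g' where xy: "x = (h, g)" "y = (h', g')" by (cases x; cases y)
      show "snd U (x \<otimes>\<^bsub>H \<bowtie> G\<^esub> y) = snd U x \<otimes>\<^bsub>BijGroup (fst U)\<^esub> snd U y"
        using R * B[OF *(1)] B[OF *(2)] B[OF HG.m_closed[OF *]] unfolding xy
        by (intro extensionalityI[of _ "fst U"]) (auto simp: BijGroup_def compose_def Bij_def)
    qed (auto simp: B BijGroup_def group_BijGroup[unfolded BijGroup_def] HG.is_group)
    then show ?L using R by (auto simp: fin_biset_def)
  }
qed

definition stab_of :: "'h monoid \<Rightarrow> 'g monoid \<Rightarrow> ('h, 'g, 'x) biset \<Rightarrow> 'x \<Rightarrow> ('h \<times> 'g) set" where
  "stab_of H G U u = {(h, g). h \<in> carrier H \<and> g \<in> carrier G \<and> snd U (h, g) u = u}"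

text \<open>Outside the subsets of \<open>H \<times> G\<close> the mark is set to 0, so that isomorphic bisets
  have equal marks.\<close>

definition mark ::
    "'h monoid \<Rightarrow> 'g monoid \<Rightarrow> ('h, 'g, 'x) biset \<Rightarrow> ('h \<times> 'g) set \<Rightarrow> int" where
  "mark H G U L = (if L \<subseteq> carrier H \<times> carrier G then int (card {u \<in> fst U. L \<subseteq> stab_of H G U u}) else 0)"

definition part_of :: "('h, 'g, 'x) biset \<Rightarrow> 'x set \<Rightarrow> ('h, 'g, 'x) biset" where
  "part_of U Y = (Y, \<lambda>x. restrict (snd U x) Y)"

definition orbit_of :: "'h monoid \<Rightarrow> 'g monoid \<Rightarrow> ('h, 'g, 'x) biset \<Rightarrow> 'x \<Rightarrow> 'x set" where
  "orbit_of H G U u = {snd U (h, g) u | h g. h \<in> carrier H \<and> g \<in> carrier G}"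

locale two_groups =
  fixes H :: "'h monoid" and G :: "'g monoid" (structure)
  assumes fin_H: "finite_group H" and fin_G: "finite_group G"

sublocale two_groups \<subseteq> H: group H by (rule finite_groupD[OF fin_H])
sublocale two_groups \<subseteq> G: group G by (rule finite_groupD[OF fin_G])

context two_groups begin

lemma finite_carriers [simp]: "finite (carrier H)" "finite (carrier G)"
  using fin_H fin_G by (auto simp: finite_group_def)

lemma fin_bisetD:
  assumes "fin_biset H G U"
  shows "finite (fst U)"
    "\<And>h g. h \<in> carrier H \<Longrightarrow> g \<in> carrier G \<Longrightarrow> snd U (h, g) \<in> extensional (fst U)"
    "\<And>h g u. h \<in> carrier H \<Longrightarrow> g \<in> carrier G \<Longrightarrow> u \<in> fst U \<Longrightarrow> snd U (h, g) u \<in> fst U"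
    "\<And>u. u \<in> fst U \<Longrightarrow> snd U (\<one>\<^bsub>H\<^esub>, \<one>) u = u"
    "\<And>h g h' g' u. h \<in> carrier H \<Longrightarrow> g \<in> carrier G \<Longrightarrow> h' \<in> carrier H \<Longrightarrow> g' \<in> carrier G \<Longrightarrow> u \<in> fst U
      \<Longrightarrow> snd U (h, g) (snd U (h', g') u) = snd U (h \<otimes>\<^bsub>H\<^esub> h', g' \<otimes> g) u"
  using assms unfolding fin_biset_iff[OF H.is_group G.is_group] by auto

lemma fin_bisetI:
  assumes "finite (fst U)"
    "\<And>h g. h \<in> carrier H \<Longrightarrow> g \<in> carrier G \<Longrightarrow> snd U (h, g) \<in> extensional (fst U)"
    "\<And>h g u. h \<in> carrier H \<Longrightarrow> g \<in> carrier G \<Longrightarrow> u \<in> fst U \<Longrightarrow> snd U (h, g) u \<in> fst U"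
    "\<And>u. u \<in> fst U \<Longrightarrow> snd U (\<one>\<^bsub>H\<^esub>, \<one>) u = u"
    "\<And>h g h' g' u. h \<in> carrier H \<Longrightarrow> g \<in> carrier G \<Longrightarrow> h' \<in> carrier H \<Longrightarrow> g' \<in> carrier G \<Longrightarrow> u \<in> fst U
      \<Longrightarrow> snd U (h, g) (snd U (h', g') u) = snd U (h \<otimes>\<^bsub>H\<^esub> h', g' \<otimes> g) u"
  shows "fin_biset H G U"
  using assms unfolding fin_biset_iff[OF H.is_group G.is_group] by auto

lemma act_eq_iff:
  assumes U: "fin_biset H G U" and "h \<in> carrier H" "g \<in> carrier G" "u \<in> fst U" "v \<in> fst U"
  shows "snd U (h, g) u = v \<longleftrightarrow> u = snd U (inv\<^bsub>H\<^esub> h, inv g) v"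
  using assms by (auto simp: fin_bisetD[OF U])

lemma biset_iso_sym: assumes U: "fin_biset H G U" and iso: "biset_iso H G U V"
  shows "biset_iso H G V U"
proof -
  obtain f where f: "bij_betw f (fst U) (fst V)"
    and e: "\<And>h g u. h \<in> carrier H \<Longrightarrow> g \<in> carrier G \<Longrightarrow> u \<in> fst U \<Longrightarrow> f (snd U (h, g) u) = snd V (h, g) (f u)"
    using iso by (auto simp: biset_iso_def)
  have "inv_into (fst U) f (snd V (h, g) v) = snd U (h, g) (inv_into (fst U) f v)"
    if "h \<in> carrier H" "g \<in> carrier G" "v \<in> fst V" for h g v
  proof -
    have *: "inv_into (fst U) f v \<in> fst U" "f (inv_into (fst U) f v) = v"
      using f that by (auto simp: bij_betw_def inv_into_into f_inv_into_f)
    then have "snd V (h, g) v = f (snd U (h, g) (inv_into (fst U) f v))" using e that by simp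
    then show ?thesis
      using f fin_bisetD(3)[OF U that(1,2) *(1)] by (simp add: bij_betw_def)
  qed
  then show ?thesis unfolding biset_iso_def using bij_betw_inv_into[OF f] by blast
qed

lemma biset_iso_trans: assumes "biset_iso H G U V" "biset_iso H G V W" shows "biset_iso H G U W"
proof -
  obtain f where f: "bij_betw f (fst U) (fst V)"
    "\<forall>h\<in>carrier H. \<forall>g\<in>carrier G. \<forall>u\<in>fst U. f (snd U (h, g) u) = snd V (h, g) (f u)"
    using assms(1) by (auto simp: biset_iso_def)
  obtain k where k: "bij_betw k (fst V) (fst W)"
    "\<forall>h\<in>carrier H. \<forall>g\<in>carrier G. \<forall>u\<in>fst V. k (snd V (h, g) u) = snd W (h, g) (k u)"
    using assms(2) by (auto simp: biset_iso_def)
  show ?thesis unfolding biset_iso_def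
    by (rule exI[of _ "k \<circ> f"]) (use f k bij_betwE[OF f(1)] in \<open>auto intro: bij_betw_trans\<close>)
qed

lemma biset_iso_sum: assumes "biset_iso H G U U'" "biset_iso H G V V'"
  shows "biset_iso H G (U \<uplus> V) (U' \<uplus> V')"
proof -
  obtain f where f: "bij_betw f (fst U) (fst U')"
    "\<forall>h\<in>carrier H. \<forall>g\<in>carrier G. \<forall>u\<in>fst U. f (snd U (h, g) u) = snd U' (h, g) (f u)"
    using assms(1) by (auto simp: biset_iso_def)
  obtain k where k: "bij_betw k (fst V) (fst V')"
    "\<forall>h\<in>carrier H. \<forall>g\<in>carrier G. \<forall>u\<in>fst V. k (snd V (h, g) u) = snd V' (h, g) (k u)"
    using assms(2) by (auto simp: biset_iso_def)
  have "bij_betw (map_sum f k) (fst U <+> fst V) (fst U' <+> fst V')"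
    unfolding bij_betw_def
  proof
    show "inj_on (map_sum f k) (fst U <+> fst V)"
      using f(1) k(1) by (auto intro!: inj_onI elim!: PlusE simp: bij_betw_def dest: inj_onD)
    show "map_sum f k ` (fst U <+> fst V) = fst U' <+> fst V'"
    proof -
      have "map_sum f k ` (A <+> B) = f ` A <+> k ` B" for A B
        by (auto simp: Plus_def image_Un image_image)
      then show ?thesis using f(1) k(1) by (simp add: bij_betw_def)
    qed
  qed
  then show ?thesis unfolding biset_iso_def
    by (intro exI[of _ "map_sum f k"]) (use f k bij_betwE[OF f(1)]  bij_betwE[OF k(1)] in \<open>auto simp: biset_sum_def\<close>)
qed

lemma fin_biset_sum: assumes "fin_biset H G U" "fin_biset H G V" shows "fin_biset H G (U \<uplus> V)"
  by (rule fin_bisetI) (auto simp: biset_sum_def fin_bisetD[OF assms(1)] fin_bisetD[OF assms(2)])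

lemma fin_biset_empty: "fin_biset H G empty_biset"
  by (rule fin_bisetI) (auto simp: empty_biset_def)

definition stable :: "('h, 'g, 'x) biset \<Rightarrow> 'x set \<Rightarrow> bool" where
  "stable U Y \<longleftrightarrow> Y \<subseteq> fst U \<and> (\<forall>h\<in>carrier H. \<forall>g\<in>carrier G. \<forall>u\<in>Y. snd U (h, g) u \<in> Y)"

lemma fin_biset_part_of: assumes U: "fin_biset H G U" and "stable U Y"
  shows "fin_biset H G (part_of U Y)"
proof -
  have "Y \<subseteq> fst U" using assms by (auto simp: stable_def)
  then show ?thesis
    using assms fin_bisetD[OF U]
    by (intro fin_bisetI) (auto simp: part_of_def stable_def intro: finite_subset)
qed

lemma stable_Diff: assumes U: "fin_biset H G U" and Y: "stable U Y" shows "stable U (fst U - Y)"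
  unfolding stable_def
proof (intro conjI ballI)
  fix h g u assume *: "h \<in> carrier H" "g \<in> carrier G" "u \<in> fst U - Y"
  have "snd U (h, g) u \<notin> Y"
  proof
    assume "snd U (h, g) u \<in> Y"
    then have "snd U (inv\<^bsub>H\<^esub> h, inv g) (snd U (h, g) u) \<in> Y" using Y * by (auto simp: stable_def)
    then show False using * by (simp add: fin_bisetD[OF U])
  qed
  then show "snd U (h, g) u \<in> fst U - Y" using * fin_bisetD(3)[OF U] by auto
qed auto

lemma iso_split: assumes U: "fin_biset H G U" and Y: "stable U Y"
  shows "biset_iso H G U (part_of U Y \<uplus> part_of U (fst U - Y))"
proof -
  have "Y \<subseteq> fst U" using Y by (auto simp: stable_def)
  let ?f = "\<lambda>u. if u \<in> Y then Inl u else Inr u"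
  have "bij_betw ?f (fst U) (Y <+> (fst U - Y))"
    using \<open>Y \<subseteq> fst U\<close> by (auto simp: bij_betw_def inj_on_def)
  then show ?thesis unfolding biset_iso_def
    by (intro exI[of _ ?f])
      (use \<open>Y \<subseteq> fst U\<close> Y stable_Diff[OF U Y] in \<open>auto simp: part_of_def biset_sum_def stable_def\<close>)
qed

lemma orbit_stable: assumes U: "fin_biset H G U" and "u \<in> fst U" shows "stable U (orbit_of H G U u)"
  using assms(2) fin_bisetD(3,5)[OF U] unfolding stable_def orbit_of_def
  using H.m_closed G.m_closed by fastforce

lemma orbit_self: assumes U: "fin_biset H G U" and "u \<in> fst U" shows "u \<in> orbit_of H G U u"
  using assms(2) fin_bisetD(4)[OF U] by (force simp: orbit_of_def)

lemma mark_iso: assumes U: "fin_biset H G U" and "biset_iso H G U V" shows "mark H G U = mark H G V"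
proof
  fix L
  obtain f where f: "bij_betw f (fst U) (fst V)"
    "\<And>h g u. h \<in> carrier H \<Longrightarrow> g \<in> carrier G \<Longrightarrow> u \<in> fst U \<Longrightarrow> f (snd U (h, g) u) = snd V (h, g) (f u)"
    using assms(2) by (auto simp: biset_iso_def)
  show "mark H G U L = mark H G V L"
  proof (cases "L \<subseteq> carrier H \<times> carrier G")
    case True
    have inj: "f x = f y \<longleftrightarrow> x = y" if "x \<in> fst U" "y \<in> fst U" for x y
      using f(1) that by (auto simp: bij_betw_def inj_on_def)
    have *: "stab_of H G V (f u) = stab_of H G U u" if "u \<in> fst U" for u
      using that by (auto simp: stab_of_def f(2)[symmetric] inj fin_bisetD[OF U])
    have "bij_betw f {u \<in> fst U. L \<subseteq> stab_of H G U u} {u \<in> fst V. L \<subseteq> stab_of H G V u}"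
      unfolding bij_betw_def
    proof
      show "f ` {u \<in> fst U. L \<subseteq> stab_of H G U u} = {u \<in> fst V. L \<subseteq> stab_of H G V u}"
        using f(1) * by (fastforce simp: bij_betw_def)
    qed (use f(1) in \<open>auto simp: bij_betw_def inj_on_def\<close>)
    then show ?thesis using True by (simp add: mark_def bij_betw_same_card)
  qed (simp add: mark_def)
qed

lemma mark_sum: assumes "fin_biset H G U" "fin_biset H G V"
  shows "mark H G (U \<uplus> V) L = mark H G U L + mark H G V L"
proof (cases "L \<subseteq> carrier H \<times> carrier G")
  case True
  have "{u \<in> fst (U \<uplus> V). L \<subseteq> stab_of H G (U \<uplus> V) u} =
    {u \<in> fst U. L \<subseteq> stab_of H G U u} <+> {u \<in> fst V. L \<subseteq> stab_of H G V u}"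
    using True by (fastforce simp: biset_sum_def stab_of_def)
  then show ?thesis using True assms[THEN fin_bisetD(1)]
    by (simp add: mark_def card_Plus)
qed (simp add: mark_def)

lemma mark_empty: "mark H G empty_biset L = 0"
  by (simp add: mark_def empty_biset_def)

lemma mark_split: assumes U: "fin_biset H G U" and Y: "stable U Y"
  shows "mark H G U L = mark H G (part_of U Y) L + mark H G (part_of U (fst U - Y)) L"
  using mark_iso[OF U iso_split[OF assms]] mark_sum
    fin_biset_part_of[OF U] Y stable_Diff[OF U Y] by metis

text \<open>Whether (h, g) and (h', g') move u to the same point is decided by membership of one
  quotient of the two pairs in the stabilizer. The stabilizer is common to u and v, so sending u to
  v extends equivariantly to the orbits.\<close>

lemma orbit_iso:
  assumes U: "fin_biset H G U" and V: "fin_biset H G V" and u: "u \<in> fst U" and v: "v \<in> fst V"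
    and eq: "stab_of H G U u = stab_of H G V v"
  shows "biset_iso H G (part_of U (orbit_of H G U u)) (part_of V (orbit_of H G V v))"
proof -
  have eq': "snd U (h, g) u = snd U (h', g') u \<longleftrightarrow> snd V (h, g) v = snd V (h', g') v"
    if "h \<in> carrier H" "g \<in> carrier G" "h' \<in> carrier H" "g' \<in> carrier G" for h g h' g'
  proof -
    have "snd U (h, g) u = snd U (h', g') u \<longleftrightarrow>
      (inv\<^bsub>H\<^esub> h' \<otimes>\<^bsub>H\<^esub> h, g \<otimes> inv g') \<in> stab_of H G U u"
      using act_eq_iff[OF U, of h' g' u "snd U (h, g) u"] that u
      by (auto simp: stab_of_def fin_bisetD[OF U])
    moreover have "snd V (h, g) v = snd V (h', g') v \<longleftrightarrow>
      (inv\<^bsub>H\<^esub> h' \<otimes>\<^bsub>H\<^esub> h, g \<otimes> inv g') \<in> stab_of H G V v"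
      using act_eq_iff[OF V, of h' g' v "snd V (h, g) v"] that v
      by (auto simp: stab_of_def fin_bisetD[OF V])
    ultimately show ?thesis using eq by simp
  qed
  define f where "f w = (SOME w'. \<exists>h\<in>carrier H. \<exists>g\<in>carrier G. w = snd U (h, g) u \<and> w' = snd V (h, g) v)" for w
  have f: "f (snd U (h, g) u) = snd V (h, g) v" if "h \<in> carrier H" "g \<in> carrier G" for h g
    unfolding f_def by (rule some1_equality) (use that eq' in auto)
  have "bij_betw f (orbit_of H G U u) (orbit_of H G V v)"
    unfolding bij_betw_def
    using f eq' by (force simp: orbit_of_def inj_on_def image_iff)
  moreover have "f (snd U (h, g) w) = snd V (h, g) (f w)"
    if "h \<in> carrier H" "g \<in> carrier G" "w \<in> orbit_of H G U u" for h g w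
    using that u v by (auto simp: orbit_of_def f fin_bisetD[OF U] fin_bisetD[OF V])
  moreover have "f w \<in> orbit_of H G V v" if "w \<in> orbit_of H G U u" for w
    using that f by (auto simp: orbit_of_def)
  ultimately show ?thesis unfolding biset_iso_def part_of_def by (intro exI[of _ f]) auto
qed

text \<open>The mark of \<open>U\<close> at the stabilizer of u is positive because u itself is
  counted; equality of marks then supplies v.\<close>

lemma fixed_point_transfer:
  assumes "mark H G U = mark H G V" "u \<in> fst U" "fin_biset H G U"
  obtains v where "v \<in> fst V" "stab_of H G U u \<subseteq> stab_of H G V v"
proof -
  have L: "stab_of H G U u \<subseteq> carrier H \<times> carrier G" by (auto simp: stab_of_def)
  have "finite {w \<in> fst U. stab_of H G U u \<subseteq> stab_of H G U w}"
    using fin_bisetD(1)[OF assms(3)] by simp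
  then have "mark H G U (stab_of H G U u) > 0"
    using assms(2,3) L by (auto simp: mark_def card_gt_0_iff)
  then have "{v \<in> fst V. stab_of H G U u \<subseteq> stab_of H G V v} \<noteq> {}"
    unfolding assms(1) using L by (auto simp: mark_def card_gt_0_iff simp del: Collect_empty_eq)
  then show thesis using that by blast
qed

text \<open>Burnside's theorem: a point of \<open>U\<close> whose stabilizer has maximal order has a partner in \<open>V\<close>
  with the same stabilizer; split off the two orbits.\<close>

theorem biset_iso_iff_mark:
  assumes U: "fin_biset H G U" and V: "fin_biset H G V"
  shows "biset_iso H G U V \<longleftrightarrow> mark H G U = mark H G V"
proof
  show "mark H G U = mark H G V \<Longrightarrow> biset_iso H G U V"
    using U V
  proof (induction "card (fst U)" arbitrary: U V rule: less_induct)
    case less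
    note U = less.prems(2) and V = less.prems(3)
    show ?case
    proof (cases "fst U = {}")
      case True
      have "mark H G U {} = 0" using True by (simp add: mark_def)
      then have "mark H G V {} = 0" using less.prems(1) by simp
      then have "fst V = {}" using fin_bisetD(1)[OF V] by (simp add: mark_def)
      then show ?thesis using True by (auto simp: biset_iso_def bij_betw_def)
    next
      case False
      let ?c = "\<lambda>u. card (stab_of H G U u)"
      have fin: "finite (stab_of H G U w)" for w
        by (rule finite_subset[of _ "carrier H \<times> carrier G"]) (auto simp: stab_of_def)
      have "\<exists>u\<in>fst U. \<forall>w\<in>fst U. ?c w \<le> ?c u"
      proof -
        have f: "finite (?c ` fst U)" "?c ` fst U \<noteq> {}" using False fin_bisetD(1)[OF U] by auto
        obtain u where "u \<in> fst U" "Max (?c ` fst U) = ?c u" using Max_in[OF f] by auto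
        then show ?thesis using Max_ge[OF f(1)] by (intro bexI[of _ u]) auto
      qed
      then obtain u where u: "u \<in> fst U" "\<And>w. w \<in> fst U \<Longrightarrow> ?c w \<le> ?c u" by blast
      obtain v where v: "v \<in> fst V" "stab_of H G U u \<subseteq> stab_of H G V v"
        using fixed_point_transfer[OF less.prems(1) u(1) U] .
      obtain w where w: "w \<in> fst U" "stab_of H G V v \<subseteq> stab_of H G U w"
        using fixed_point_transfer[OF less.prems(1)[symmetric] v(1) V] .
      \<comment> \<open>The chain of stabilizers from u through v to w begins and ends in
        \<open>U\<close>, so the maximal order at u collapses it.\<close>
      have "stab_of H G U u = stab_of H G U w"
        by (rule card_seteq) (use v w u fin in auto)
      then have eq: "stab_of H G U u = stab_of H G V v" using v w by auto
      let ?A = "orbit_of H G U u" and ?B = "orbit_of H G V v"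
      have A: "stable U ?A" and B: "stable V ?B" using orbit_stable[OF U u(1)] orbit_stable[OF V v(1)] by auto
      have i1: "biset_iso H G (part_of U ?A) (part_of V ?B)"
        by (rule orbit_iso) (use U V u v eq in auto)
      have "mark H G (part_of U (fst U - ?A)) = mark H G (part_of V (fst V - ?B))"
      proof
        fix L show "mark H G (part_of U (fst U - ?A)) L = mark H G (part_of V (fst V - ?B)) L"
          using mark_split[OF U A, of L] mark_split[OF V B, of L] less.prems(1)
            mark_iso[OF fin_biset_part_of[OF U A] i1] by simp
      qed
      moreover have "card (fst (part_of U (fst U - ?A))) < card (fst U)"
        using fin_bisetD(1)[OF U] orbit_self[OF U u(1)] u(1)
        by (auto simp: part_of_def intro!: psubset_card_mono)
      ultimately have "biset_iso H G (part_of U (fst U - ?A)) (part_of V (fst V - ?B))"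
        by (intro less.hyps) (use fin_biset_part_of[OF U stable_Diff[OF U A]]
          fin_biset_part_of[OF V stable_Diff[OF V B]] in auto)
      then have "biset_iso H G (part_of U ?A \<uplus> part_of U (fst U - ?A)) (part_of V ?B \<uplus> part_of V (fst V - ?B))"
        using i1 by (rule biset_iso_sum[rotated])
      then show ?thesis
        by (intro biset_iso_trans[OF iso_split[OF U A]]
          biset_iso_trans[OF _ biset_iso_sym[OF V iso_split[OF V B]]])
    qed
  qed
qed (rule mark_iso[OF U])

end

section \<open>The group \<open>B(H, G)\<close> in terms of marks\<close>

type_synonym ('h, 'g) vmark = "('h \<times> 'g) set \<Rightarrow> int"

text \<open>The image of the Burnside group under the mark homomorphism. Bisets on natural numbers
  suffice because every finite biset has such a copy.\<close>

definition vmarks :: "'h monoid \<Rightarrow> 'g monoid \<Rightarrow> ('h, 'g) vmark set" where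
  "vmarks H G = {mark H G V - mark H G W | (V :: ('h, 'g, nat) biset) (W :: ('h, 'g, nat) biset). fin_biset H G V \<and> fin_biset H G W}"

text \<open>The fibre of the mark homomorphism over x, in the shape of the classes of pairs that
  make up \<open>vbiset\<close>.\<close>

definition of_mark :: "'h monoid \<Rightarrow> 'g monoid \<Rightarrow> ('h, 'g) vmark \<Rightarrow> ('h, 'g) vbiset" where
  "of_mark H G x = {(V, W). fin_biset H G V \<and> fin_biset H G W \<and> mark H G V - mark H G W = x}"

context two_groups begin

text \<open>Classes of virtual bisets contain only bisets on natural numbers, so a biset on another
  type has to be copied there before it can serve as a representative.\<close>

lemma nat_biset:
  assumes U: "fin_biset H G U"
  obtains V :: "('h, 'g, nat) biset" where "fin_biset H G V" "biset_iso H G U V"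
proof -
  obtain f :: "'a \<Rightarrow> nat" where f: "inj_on f (fst U)"
    using finite_imp_inj_to_nat_seg[OF fin_bisetD(1)[OF U]] by auto
  define V :: "('h, 'g, nat) biset"
    where "V = (f ` fst U, \<lambda>x. \<lambda>y\<in>f ` fst U. f (snd U x (inv_into (fst U) f y)))"
  have "fin_biset H G V"
    by (rule fin_bisetI)
      (auto simp: V_def fin_bisetD[OF U] inj_on_eq_iff[OF f] inv_into_f_f[OF f])
  moreover have "biset_iso H G U V"
    unfolding biset_iso_def
    by (rule exI[of _ f]) (use f in \<open>auto simp: V_def bij_betw_def\<close>)
  ultimately show thesis by (rule that)
qed

lemma mark_sum': assumes "fin_biset H G U" "fin_biset H G V"
  shows "mark H G (U \<uplus> V) = mark H G U + mark H G V"
  using mark_sum[OF assms] by (auto simp: fun_eq_iff)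

lemma mark_empty': "mark H G empty_biset = 0"
  using mark_empty by (auto simp: fun_eq_iff)

lemma mark_diff_vmarks:
  assumes U: "fin_biset H G U" and V: "fin_biset H G V"
  shows "mark H G U - mark H G V \<in> vmarks H G"
proof -
  obtain U' :: "('h, 'g, nat) biset" where U': "fin_biset H G U'" "biset_iso H G U U'"
    using nat_biset[OF U] .
  obtain V' :: "('h, 'g, nat) biset" where V': "fin_biset H G V'" "biset_iso H G V V'"
    using nat_biset[OF V] .
  have "mark H G U - mark H G V = mark H G U' - mark H G V'"
    using mark_iso[OF U U'(2)] mark_iso[OF V V'(2)] by simp
  then show ?thesis using U' V' unfolding vmarks_def by blast
qed

lemma mark_vmarks: "fin_biset H G U \<Longrightarrow> mark H G U \<in> vmarks H G"
  using mark_diff_vmarks[OF _ fin_biset_empty, of U] by (simp add: mark_empty')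

lemma vmarksE:
  assumes "x \<in> vmarks H G"
  obtains V W :: "('h, 'g, nat) biset"
    where "fin_biset H G V" "fin_biset H G W" "x = mark H G V - mark H G W"
  using assms by (auto simp: vmarks_def)

lemma vmarks_zero: "0 \<in> vmarks H G"
  using mark_vmarks[OF fin_biset_empty] by (simp add: mark_empty')

lemma vmarks_minus: "x \<in> vmarks H G \<Longrightarrow> - x \<in> vmarks H G"
  by (erule vmarksE) (simp add: mark_diff_vmarks)

lemma vmarks_add: assumes "x \<in> vmarks H G" "y \<in> vmarks H G" shows "x + y \<in> vmarks H G"
proof -
  obtain V W :: "('h, 'g, nat) biset"
    where 1: "fin_biset H G V" "fin_biset H G W" "x = mark H G V - mark H G W"
    using assms(1) by (rule vmarksE)
  obtain V' W' :: "('h, 'g, nat) biset"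
    where 2: "fin_biset H G V'" "fin_biset H G W'" "y = mark H G V' - mark H G W'"
    using assms(2) by (rule vmarksE)
  have "x + y = mark H G (V \<uplus> V') - mark H G (W \<uplus> W')"
    using 1 2 by (simp add: mark_sum')
  then show ?thesis using 1 2 by (simp add: mark_diff_vmarks fin_biset_sum)
qed

lemma vmarks_diff: "x \<in> vmarks H G \<Longrightarrow> y \<in> vmarks H G \<Longrightarrow> x - y \<in> vmarks H G"
  using vmarks_add[OF _ vmarks_minus] by fastforce

lemma vmarks_induct [consumes 1, case_names mark diff]:
  assumes "x \<in> vmarks H G" and "\<And>U :: ('h, 'g, nat) biset. fin_biset H G U \<Longrightarrow> P (mark H G U)"
    and "\<And>x y. x \<in> vmarks H G \<Longrightarrow> y \<in> vmarks H G \<Longrightarrow> P x \<Longrightarrow> P y \<Longrightarrow> P (x - y)"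
  shows "P x"
  using assms(1) by (rule vmarksE) (simp add: assms(2,3) mark_vmarks)

text \<open>Marks are additive with values in the integers, so the stabilizing summand
  \<open>K\<close> cancels, and Burnside's theorem turns the existence of an isomorphism into an
  equation of marks.\<close>

lemma vbiset_eq:
  assumes U: "fin_biset H G U" and U': "fin_biset H G U'"
  shows "vbiset H G U U' = of_mark H G (mark H G U - mark H G U')"
proof -
  have "(\<exists>K :: ('h, 'g, nat) biset. fin_biset H G K \<and> biset_iso H G (V \<uplus> U' \<uplus> K) (U \<uplus> W \<uplus> K))
      \<longleftrightarrow> mark H G V - mark H G W = mark H G U - mark H G U'" (is "?L \<longleftrightarrow> ?R")
    if V: "fin_biset H G V" and W: "fin_biset H G W" for V W :: "('h, 'g, nat) biset"
  proof -
    have "biset_iso H G (V \<uplus> U' \<uplus> K) (U \<uplus> W \<uplus> K) \<longleftrightarrow> ?R" if "fin_biset H G K" for K :: "('h, 'g, nat) biset"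
      by (subst biset_iso_iff_mark)
        (use U U' V W that in \<open>auto simp: fin_biset_sum mark_sum' algebra_simps\<close>)
    then show ?thesis using fin_biset_empty by blast
  qed
  then show ?thesis unfolding vbiset_def of_mark_def by (intro Collect_cong) blast
qed

lemma bclass_eq: "fin_biset H G U \<Longrightarrow> bclass H G U = of_mark H G (mark H G U)"
  by (simp add: vbiset_eq fin_biset_empty mark_empty')

lemma of_mark_eq_iff:
  assumes "x \<in> vmarks H G" shows "of_mark H G x = of_mark H G y \<longleftrightarrow> x = y"
  using assms by (auto simp: vmarks_def of_mark_def)

text \<open>Operations on classes are defined as unions over all representatives. Once the value is
  the same for all of them the union collapses, because the fibre is nonempty.\<close>

lemma UN_of_mark:
  assumes x: "x \<in> vmarks H G" and
    f: "\<And>V W :: ('h, 'g, nat) biset. fin_biset H G V \<Longrightarrow> fin_biset H G W \<Longrightarrow> x = mark H G V - mark H G W \<Longrightarrow> f V W = c"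
  shows "(\<Union>(V, W)\<in>of_mark H G x. f V W) = c"
proof -
  have "(\<Union>(V, W)\<in>of_mark H G x. f V W) = (\<Union>p\<in>of_mark H G x. c)"
    by (rule SUP_cong[OF refl]) (auto simp: of_mark_def f)
  moreover have "of_mark H G x \<noteq> {}"
    using x by (elim vmarksE) (auto simp: of_mark_def)
  ultimately show ?thesis by simp
qed

lemma burnside_carrier: "carrier (burnside H G) = of_mark H G ` vmarks H G"
proof (intro equalityI subsetI)
  fix z assume "z \<in> carrier (burnside H G)"
  then obtain U U' :: "('h, 'g, nat) biset"
    where "fin_biset H G U" "fin_biset H G U'" "z = vbiset H G U U'"
    unfolding burnside_def partial_object.simps by blast
  then show "z \<in> of_mark H G ` vmarks H G" by (simp add: vbiset_eq mark_diff_vmarks)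
next
  fix z assume "z \<in> of_mark H G ` vmarks H G"
  then obtain x where z: "z = of_mark H G x" "x \<in> vmarks H G" by blast
  obtain U U' :: "('h, 'g, nat) biset"
    where "fin_biset H G U" "fin_biset H G U'" "x = mark H G U - mark H G U'"
    using z(2) by (rule vmarksE)
  then have "z = vbiset H G U U' \<and> fin_biset H G U \<and> fin_biset H G U'" by (simp add: z vbiset_eq)
  then show "z \<in> carrier (burnside H G)" unfolding burnside_def partial_object.simps by blast
qed

lemma burnside_one: "\<one>\<^bsub>burnside H G\<^esub> = of_mark H G 0"
  by (simp add: burnside_def bclass_eq fin_biset_empty mark_empty')

lemma burnside_mult:
  assumes x: "x \<in> vmarks H G" and y: "y \<in> vmarks H G"
  shows "of_mark H G x \<otimes>\<^bsub>burnside H G\<^esub> of_mark H G y = of_mark H G (x + y)"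
  unfolding burnside_def monoid.simps
proof (intro UN_of_mark x y)
  fix V W V' W' :: "('h, 'g, nat) biset"
  assume "fin_biset H G V" "fin_biset H G W" "x = mark H G V - mark H G W"
    "fin_biset H G V'" "fin_biset H G W'" "y = mark H G V' - mark H G W'"
  then show "vbiset H G (V \<uplus> V') (W \<uplus> W') = of_mark H G (x + y)"
    by (simp add: vbiset_eq fin_biset_sum mark_sum' add_diff_add)
qed

lemma burnside_comm_group: "comm_group (burnside H G)"
proof (rule comm_groupI)
  show "\<exists>y\<in>carrier (burnside H G). y \<otimes>\<^bsub>burnside H G\<^esub> x = \<one>\<^bsub>burnside H G\<^esub>"
    if "x \<in> carrier (burnside H G)" for x
    using that vmarks_minus burnside_mult[OF vmarks_minus]
    by (fastforce simp: burnside_carrier burnside_one)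
qed (auto simp: burnside_carrier burnside_one burnside_mult vmarks_add vmarks_zero add_ac)

lemma burnside_inv: assumes "x \<in> vmarks H G"
  shows "inv\<^bsub>burnside H G\<^esub> (of_mark H G x) = of_mark H G (- x)"
proof -
  interpret comm_group "burnside H G" by (rule burnside_comm_group)
  show ?thesis
    by (rule inv_equality) (use assms in \<open>auto simp: burnside_carrier burnside_one burnside_mult vmarks_minus\<close>)
qed

end

section \<open>Composition of bisets\<close>

context two_groups begin

lemma lact_ract [simp]:
  assumes U: "fin_biset H G U" and [simp]: "u \<in> fst U"
  shows "h \<in> carrier H \<Longrightarrow> lact G U h u \<in> fst U"
    "g \<in> carrier G \<Longrightarrow> ract H U u g \<in> fst U"
    "lact G U \<one>\<^bsub>H\<^esub> u = u" "ract H U u \<one> = u"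
    "h \<in> carrier H \<Longrightarrow> h' \<in> carrier H \<Longrightarrow> lact G U h (lact G U h' u) = lact G U (h \<otimes>\<^bsub>H\<^esub> h') u"
    "g \<in> carrier G \<Longrightarrow> g' \<in> carrier G \<Longrightarrow> ract H U (ract H U u g) g' = ract H U u (g \<otimes> g')"
    "h \<in> carrier H \<Longrightarrow> g \<in> carrier G \<Longrightarrow> ract H U (lact G U h u) g = lact G U h (ract H U u g)"
  by (simp_all add: lact_def ract_def fin_bisetD[OF U])

lemma act_lact_ract:
  assumes U: "fin_biset H G U" and "u \<in> fst U" "h \<in> carrier H" "g \<in> carrier G"
  shows "snd U (h, g) u = lact G U h (ract H U u g)"
  using assms by (simp add: lact_def ract_def fin_bisetD[OF U])

lemma lact_eq_iff:
  assumes U: "fin_biset H G U" and "u \<in> fst U" "v \<in> fst U" "h \<in> carrier H"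
  shows "lact G U h u = v \<longleftrightarrow> u = lact G U (inv\<^bsub>H\<^esub> h) v"
  using assms by (metis H.inv_closed H.l_inv H.r_inv lact_ract(3,5))

lemma ract_eq_iff:
  assumes U: "fin_biset H G U" and "u \<in> fst U" "v \<in> fst U" "g \<in> carrier G"
  shows "ract H U u g = v \<longleftrightarrow> u = ract H U v (inv g)"
  using assms by (metis G.inv_closed G.l_inv G.r_inv lact_ract(4,6))

end

text \<open>Says that f presents W as the quotient of \<open>fst V \<times> fst U\<close> by the
  balancing relation. Concrete models of a tensor product are recognized by checking this, without
  computing with equivalence classes.\<close>

definition is_tensor :: "'k monoid \<Rightarrow> 'h monoid \<Rightarrow> 'g monoid \<Rightarrow> ('k, 'h, 'x) biset \<Rightarrow> ('h, 'g, 'y) biset \<Rightarrow>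
    ('x \<Rightarrow> 'y \<Rightarrow> 'z) \<Rightarrow> ('k, 'g, 'z) biset \<Rightarrow> bool" where
  "is_tensor K H G V U f W \<longleftrightarrow>
    (\<forall>v\<in>fst V. \<forall>u\<in>fst U. f v u \<in> fst W) \<and>
    (\<forall>w\<in>fst W. \<exists>v\<in>fst V. \<exists>u\<in>fst U. w = f v u) \<and>
    (\<forall>v\<in>fst V. \<forall>u\<in>fst U. \<forall>v'\<in>fst V. \<forall>u'\<in>fst U.
       f v u = f v' u' \<longleftrightarrow> (\<exists>h\<in>carrier H. v = ract K V v' h \<and> u' = lact G U h u)) \<and>
    (\<forall>k\<in>carrier K. \<forall>g\<in>carrier G. \<forall>v\<in>fst V. \<forall>u\<in>fst U.
       snd W (k, g) (f v u) = f (lact H V k v) (ract H U u g))"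

definition tensor_cls :: "'k monoid \<Rightarrow> 'h monoid \<Rightarrow> 'g monoid \<Rightarrow> ('k, 'h, 'x) biset \<Rightarrow> ('h, 'g, 'y) biset \<Rightarrow>
    'x \<Rightarrow> 'y \<Rightarrow> ('x \<times> 'y) set" where
  "tensor_cls K H G V U v u = tensor_rel K H G V U `` {(v, u)}"

abbreviation tmark where "tmark K H G V U \<equiv> mark K G (biset_tensor K H G V U)"

abbreviation dmark where
  "dmark K H G V V' U U' \<equiv> (tmark K H G V U - tmark K H G V' U) - (tmark K H G V U' - tmark K H G V' U')"

locale three_groups = KH: two_groups K H + HG: two_groups H G
  for K :: "'k monoid" and H :: "'h monoid" (structure) and G :: "'g monoid"

sublocale three_groups \<subseteq> KG: two_groups K G
  by unfold_locales (rule KH.fin_H HG.fin_G)+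

context three_groups begin

context
  fixes V :: "('k, 'h, 'x) biset" and U :: "('h, 'g, 'y) biset"
  assumes V: "fin_biset K H V" and U: "fin_biset H G U"
begin

lemma tensor_rel_iff: "((v, u), (v', u')) \<in> tensor_rel K H G V U \<longleftrightarrow>
    v \<in> fst V \<and> u \<in> fst U \<and> v' \<in> fst V \<and> u' \<in> fst U \<and>
    (\<exists>h\<in>carrier H. v = ract K V v' h \<and> u' = lact G U h u)"
  using V U by (auto simp: tensor_rel_def)

lemma equiv_tensor_rel: "equiv (fst V \<times> fst U) (tensor_rel K H G V U)"
proof (rule equivI)
  let ?T = "tensor_rel K H G V U"
  show "?T \<subseteq> (fst V \<times> fst U) \<times> (fst V \<times> fst U)" by (auto simp: tensor_rel_iff)
  show "refl_on (fst V \<times> fst U) ?T"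
    by (auto simp: refl_on_def tensor_rel_iff V U intro!: bexI[of _ "\<one>"])
  show "sym ?T"
  proof (rule symI)
    fix p q assume "(p, q) \<in> ?T"
    then obtain v' u h where "p = (ract K V v' h, u)" "q = (v', lact G U h u)"
      "v' \<in> fst V" "u \<in> fst U" "h \<in> carrier H"
      by (cases p; cases q) (auto simp: tensor_rel_iff)
    then show "(q, p) \<in> ?T"
      by (auto simp: tensor_rel_iff V U intro!: bexI[of _ "inv h"])
  qed
  show "trans ?T"
  proof (rule transI)
    fix p q r assume "(p, q) \<in> ?T" "(q, r) \<in> ?T"
    then obtain v u h k where "p = (ract K V (ract K V v k) h, u)" "r = (v, lact G U k (lact G U h u))"
      "v \<in> fst V" "u \<in> fst U" "h \<in> carrier H" "k \<in> carrier H"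
      by (cases p; cases q; cases r) (auto simp: tensor_rel_iff)
    then show "(p, r) \<in> ?T"
      by (auto simp: tensor_rel_iff V U intro!: bexI[of _ "k \<otimes> h"])
  qed
qed

abbreviation cls where "cls \<equiv> tensor_cls K H G V U"

lemma cls_eq_iff:
  assumes "v \<in> fst V" "u \<in> fst U" "v' \<in> fst V" "u' \<in> fst U"
  shows "cls v u = cls v' u' \<longleftrightarrow> (\<exists>h\<in>carrier H. v = ract K V v' h \<and> u' = lact G U h u)"
  unfolding tensor_cls_def using assms
  by (subst eq_equiv_class_iff[OF equiv_tensor_rel]) (auto simp: tensor_rel_iff)

lemma cls_mem: "v \<in> fst V \<Longrightarrow> u \<in> fst U \<Longrightarrow> cls v u \<in> fst (biset_tensor K H G V U)"
  by (simp add: biset_tensor_def tensor_cls_def quotientI)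

lemma cls_cases:
  assumes "c \<in> fst (biset_tensor K H G V U)"
  obtains v u where "v \<in> fst V" "u \<in> fst U" "c = cls v u"
  using assms by (auto simp: biset_tensor_def tensor_cls_def elim!: quotientE)

text \<open>The action takes images of whole classes. Such an image fills the target class because
  the inverse elements lead back into the original one.\<close>

lemma cls_act:
  assumes v: "v \<in> fst V" and u: "u \<in> fst U" and k: "k \<in> carrier K" and g: "g \<in> carrier G"
  shows "snd (biset_tensor K H G V U) (k, g) (cls v u) = cls (lact H V k v) (ract H U u g)"
proof -
  let ?m = "map_prod (lact H V k) (\<lambda>u. ract H U u g)"
  have "?m ` cls v u = cls (lact H V k v) (ract H U u g)"
  proof (intro equalityI subsetI)
    fix p assume "p \<in> ?m ` cls v u"
    then obtain v' u' where *: "((v, u), (v', u')) \<in> tensor_rel K H G V U" "p = ?m (v', u')"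
      by (auto simp: tensor_cls_def)
    then obtain h where "h \<in> carrier H" "v = ract K V v' h" "u' = lact G U h u" "v' \<in> fst V" "u' \<in> fst U"
      by (auto simp: tensor_rel_iff)
    then show "p \<in> cls (lact H V k v) (ract H U u g)"
      using *(2) u k g by (auto simp: tensor_cls_def tensor_rel_iff V U)
  next
    fix p assume "p \<in> cls (lact H V k v) (ract H U u g)"
    then obtain v' u' h where p: "p = (v', u')" "h \<in> carrier H" "v' \<in> fst V" "u' \<in> fst U"
      "lact H V k v = ract K V v' h" "u' = lact G U h (ract H U u g)"
      by (cases p) (auto simp: tensor_cls_def tensor_rel_iff)
    let ?q = "(lact H V (inv\<^bsub>K\<^esub> k) v', ract H U u' (inv\<^bsub>G\<^esub> g))"
    have "v = lact H V (inv\<^bsub>K\<^esub> k) (ract K V v' h)"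
      using KH.lact_eq_iff[OF V v _ k, of "ract K V v' h"] p V by simp
    then have "?q \<in> cls v u"
      using p(2-4,6) v u k g by (auto simp: tensor_cls_def tensor_rel_iff V U)
    moreover have "p = ?m ?q" using p(1-4) k g by (simp add: V U)
    ultimately show "p \<in> ?m ` cls v u" by blast
  qed
  then show ?thesis using cls_mem[OF v u] by (simp add: biset_tensor_def)
qed

lemma fin_biset_tensor: "fin_biset K G (biset_tensor K H G V U)"
proof (rule KG.fin_bisetI)
  show "finite (fst (biset_tensor K H G V U))"
    using KH.fin_bisetD(1)[OF V] HG.fin_bisetD(1)[OF U] equiv_type[OF equiv_tensor_rel]
    by (auto simp: biset_tensor_def intro: finite_quotient)
  show "snd (biset_tensor K H G V U) (k, g) \<in> extensional (fst (biset_tensor K H G V U))" for k g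
    by (simp add: biset_tensor_def)
qed (auto elim!: cls_cases simp: cls_act cls_mem V U)

text \<open>f separates exactly the balanced classes and therefore descends to a bijection;
  \<open>F\<close> is this descent, computed on chosen representatives.\<close>

lemma tensor_iso:
  assumes W: "is_tensor K H G V U f W"
  shows "biset_iso K G (biset_tensor K H G V U) W"
proof -
  let ?B = "biset_tensor K H G V U"
  have w: "\<And>v u. v \<in> fst V \<Longrightarrow> u \<in> fst U \<Longrightarrow> f v u \<in> fst W"
    "\<And>w. w \<in> fst W \<Longrightarrow> \<exists>v\<in>fst V. \<exists>u\<in>fst U. w = f v u"
    "\<And>v u v' u'. v \<in> fst V \<Longrightarrow> u \<in> fst U \<Longrightarrow> v' \<in> fst V \<Longrightarrow> u' \<in> fst U \<Longrightarrow> f v u = f v' u' \<longleftrightarrow> cls v u = cls v' u'"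
    "\<And>k g v u. k \<in> carrier K \<Longrightarrow> g \<in> carrier G \<Longrightarrow> v \<in> fst V \<Longrightarrow> u \<in> fst U \<Longrightarrow>
      snd W (k, g) (f v u) = f (lact H V k v) (ract H U u g)"
    using W by (auto simp: is_tensor_def cls_eq_iff)
  define F where "F c = (let (v, u) = (SOME (v, u). v \<in> fst V \<and> u \<in> fst U \<and> c = cls v u) in f v u)" for c
  have F: "F (cls v u) = f v u" if "v \<in> fst V" "u \<in> fst U" for v u
  proof -
    have "case SOME (v', u'). v' \<in> fst V \<and> u' \<in> fst U \<and> cls v u = cls v' u' of
        (v', u') \<Rightarrow> v' \<in> fst V \<and> u' \<in> fst U \<and> cls v u = cls v' u'"
      by (rule someI[of _ "(v, u)"]) (use that in auto)
    then show ?thesis using that w(3) by (auto simp: F_def split: prod.splits)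
  qed
  have "bij_betw F (fst ?B) (fst W)"
    unfolding bij_betw_def
  proof
    show "inj_on F (fst ?B)"
      by (rule inj_onI) (auto elim!: cls_cases simp: F w(3))
    show "F ` fst ?B = fst W"
    proof (intro equalityI subsetI)
      fix w assume "w \<in> fst W"
      then obtain v u where "v \<in> fst V" "u \<in> fst U" "w = F (cls v u)" using w(2) F by metis
      then show "w \<in> F ` fst ?B" using cls_mem by blast
    qed (auto elim!: cls_cases simp: F w(1))
  qed
  moreover have "F (snd ?B (k, g) c) = snd W (k, g) (F c)"
    if "k \<in> carrier K" "g \<in> carrier G" "c \<in> fst ?B" for k g c
    using that by (auto elim!: cls_cases simp: F cls_act w(4) V U)
  ultimately show ?thesis unfolding biset_iso_def by blast
qed

lemma mark_tensor: "is_tensor K H G V U f W \<Longrightarrow> tmark K H G V U = mark K G W"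
  by (rule KG.mark_iso[OF fin_biset_tensor tensor_iso])

end
end

text \<open>Serves to define a map on tensor classes by its values on representatives.\<close>

lemma factor_map:
  assumes "\<And>x y. x \<in> A \<Longrightarrow> y \<in> A \<Longrightarrow> p x = p y \<Longrightarrow> f x = f y"
  obtains F where "\<And>x. x \<in> A \<Longrightarrow> F (p x) = f x"
proof
  show "(f \<circ> inv_into A p) (p x) = f x" if "x \<in> A" for x
    using assms[of "inv_into A p (p x)" x] that by (simp add: inv_into_into f_inv_into_f)
qed

context three_groups begin

lemma cls_lact_ract:
  assumes V: "fin_biset K H V" and U: "fin_biset H G U" and "v \<in> fst V" "u \<in> fst U"
  shows "k \<in> carrier K \<Longrightarrow> lact G (biset_tensor K H G V U) k (tensor_cls K H G V U v u) =
      tensor_cls K H G V U (lact H V k v) u"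
    "g \<in> carrier G \<Longrightarrow> ract K (biset_tensor K H G V U) (tensor_cls K H G V U v u) g =
      tensor_cls K H G V U v (ract H U u g)"
  using assms by (simp_all add: lact_def[of G "biset_tensor K H G V U"] ract_def[of K "biset_tensor K H G V U"] cls_act)

lemma cls_balanced:
  assumes V: "fin_biset K H V" and U: "fin_biset H G U" and "v \<in> fst V" "u \<in> fst U" "h \<in> carrier H"
  shows "tensor_cls K H G V U (ract K V v h) u = tensor_cls K H G V U v (lact G U h u)"
  using assms by (subst cls_eq_iff) auto

text \<open>Equal marks give isomorphisms \<open>p\<close> and \<open>q\<close>. Pulled back along
  them, the classes of the primed tensor product make it a model of the other one.\<close>

lemma mark_tensor_cong:
  assumes V: "fin_biset K H V" and V': "fin_biset K H V'" and U: "fin_biset H G U" and U': "fin_biset H G U'"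
    and v: "mark K H V = mark K H V'" and u: "mark H G U = mark H G U'"
  shows "tmark K H G V U = tmark K H G V' U'"
proof -
  obtain p where p: "bij_betw p (fst V) (fst V')"
    "\<And>k h v. k \<in> carrier K \<Longrightarrow> h \<in> carrier H \<Longrightarrow> v \<in> fst V \<Longrightarrow> p (snd V (k, h) v) = snd V' (k, h) (p v)"
    using v KH.biset_iso_iff_mark[OF V V'] by (auto simp: biset_iso_def)
  obtain q where q: "bij_betw q (fst U) (fst U')"
    "\<And>h g u. h \<in> carrier H \<Longrightarrow> g \<in> carrier G \<Longrightarrow> u \<in> fst U \<Longrightarrow> q (snd U (h, g) u) = snd U' (h, g) (q u)"
    using u HG.biset_iso_iff_mark[OF U U'] by (auto simp: biset_iso_def)
  note pq = bij_betw_apply[OF p(1)] bij_betw_apply[OF q(1)]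
  have inj: "v = v' \<longleftrightarrow> p v = p v'" "u = u' \<longleftrightarrow> q u = q u'"
    if "v \<in> fst V" "v' \<in> fst V" "u \<in> fst U" "u' \<in> fst U" for v v' u u'
    using p(1) q(1) that by (auto simp: bij_betw_def inj_on_def)
  let ?c = "\<lambda>v u. tensor_cls K H G V' U' (p v) (q u)"
  have "is_tensor K H G V U ?c (biset_tensor K H G V' U')"
    unfolding is_tensor_def
  proof (intro conjI ballI)
    fix w assume "w \<in> fst (biset_tensor K H G V' U')"
    then obtain v' u' where "v' \<in> fst V'" "u' \<in> fst U'" "w = tensor_cls K H G V' U' v' u'" by (rule cls_cases[OF V' U'])
    then show "\<exists>v\<in>fst V. \<exists>u\<in>fst U. w = ?c v u"
      unfolding bij_betw_imp_surj_on[OF p(1), symmetric] bij_betw_imp_surj_on[OF q(1), symmetric] by blast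
  next
    fix v u v' u' assume "v \<in> fst V" "u \<in> fst U" "v' \<in> fst V" "u' \<in> fst U"
    then show "?c v u = ?c v' u' \<longleftrightarrow> (\<exists>h\<in>carrier H. v = ract K V v' h \<and> u' = lact G U h u)"
      by (subst cls_eq_iff[OF V' U'])
        (auto simp: pq inj V U lact_def ract_def p(2) q(2) KH.fin_bisetD[OF V] HG.fin_bisetD[OF U] cong: bex_cong)
  qed (auto simp: cls_mem[OF V' U'] pq cls_act[OF V' U'] lact_def ract_def p(2) q(2))
  then show ?thesis by (rule mark_tensor[OF V U])
qed

end

lemma bex_Plus: "(\<exists>s\<in>A <+> B. P s) \<longleftrightarrow> (\<exists>a\<in>A. P (Inl a)) \<or> (\<exists>b\<in>B. P (Inr b))"
  by auto

lemma sum_act [simp]: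
  "u \<in> fst V \<Longrightarrow> snd (V \<uplus> W) x (Inl u) = Inl (snd V x u)"
  "w \<in> fst W \<Longrightarrow> snd (V \<uplus> W) x (Inr w) = Inr (snd W x w)"
  "u \<in> fst V \<Longrightarrow> lact H (V \<uplus> W) h (Inl u) = Inl (lact H V h u)"
  "w \<in> fst W \<Longrightarrow> lact H (V \<uplus> W) h (Inr w) = Inr (lact H W h w)"
  "u \<in> fst V \<Longrightarrow> ract K (V \<uplus> W) (Inl u) g = Inl (ract K V u g)"
  "w \<in> fst W \<Longrightarrow> ract K (V \<uplus> W) (Inr w) g = Inr (ract K W w g)"
  "fst (V \<uplus> W) = fst V <+> fst W"
  by (auto simp: lact_def ract_def biset_sum_def)

context three_groups begin

lemma mark_tensor_sum_left:
  assumes V: "fin_biset K H V" and W: "fin_biset K H W" and U: "fin_biset H G U"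
  shows "tmark K H G (V \<uplus> W) U =
    tmark K H G V U + tmark K H G W U"
proof -
  let ?B = "biset_tensor K H G V U \<uplus> biset_tensor K H G W U"
  let ?f = "\<lambda>s u. case s of Inl v \<Rightarrow> Inl (tensor_cls K H G V U v u) | Inr w \<Rightarrow> Inr (tensor_cls K H G W U w u)"
  have "is_tensor K H G (V \<uplus> W) U ?f ?B"
    unfolding is_tensor_def
  proof (intro conjI ballI)
    fix c assume "c \<in> fst ?B"
    then show "\<exists>v\<in>fst (V \<uplus> W). \<exists>u\<in>fst U. c = ?f v u"
      by (auto elim!: cls_cases[OF V U] cls_cases[OF W U] simp: bex_Plus)
  next
    fix v u v' u' assume "v \<in> fst (V \<uplus> W)" "u \<in> fst U" "v' \<in> fst (V \<uplus> W)" "u' \<in> fst U"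
    then show "?f v u = ?f v' u' \<longleftrightarrow>
        (\<exists>h\<in>carrier H. v = ract K (V \<uplus> W) v' h \<and> u' = lact G U h u)"
      by (auto simp: cls_eq_iff[OF V U] cls_eq_iff[OF W U])
  qed (auto simp: cls_mem[OF V U] cls_mem[OF W U] cls_act[OF V U] cls_act[OF W U])
  then have "tmark K H G (V \<uplus> W) U = mark K G ?B"
    by (rule mark_tensor[OF KH.fin_biset_sum[OF V W] U])
  then show ?thesis by (simp add: KG.mark_sum' fin_biset_tensor V W U)
qed

lemma mark_tensor_sum_right:
  assumes V: "fin_biset K H V" and U: "fin_biset H G U" and W: "fin_biset H G W"
  shows "tmark K H G V (U \<uplus> W) =
    tmark K H G V U + tmark K H G V W"
proof -
  let ?B = "biset_tensor K H G V U \<uplus> biset_tensor K H G V W"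
  let ?f = "\<lambda>v s. case s of Inl u \<Rightarrow> Inl (tensor_cls K H G V U v u) | Inr w \<Rightarrow> Inr (tensor_cls K H G V W v w)"
  have "is_tensor K H G V (U \<uplus> W) ?f ?B"
    unfolding is_tensor_def
  proof (intro conjI ballI)
    fix c assume "c \<in> fst ?B"
    then show "\<exists>v\<in>fst V. \<exists>u\<in>fst (U \<uplus> W). c = ?f v u"
      by (auto elim!: cls_cases[OF V U] cls_cases[OF V W] simp: bex_Plus)
  next
    fix v u v' u' assume "v \<in> fst V" "u \<in> fst (U \<uplus> W)" "v' \<in> fst V" "u' \<in> fst (U \<uplus> W)"
    then show "?f v u = ?f v' u' \<longleftrightarrow>
        (\<exists>h\<in>carrier H. v = ract K V v' h \<and> u' = lact G (U \<uplus> W) h u)"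
      by (auto simp: cls_eq_iff[OF V U] cls_eq_iff[OF V W])
  qed (auto simp: cls_mem[OF V U] cls_mem[OF V W] cls_act[OF V U] cls_act[OF V W])
  then have "tmark K H G V (U \<uplus> W) = mark K G ?B"
    by (rule mark_tensor[OF V HG.fin_biset_sum[OF U W]])
  then show ?thesis by (simp add: KG.mark_sum' fin_biset_tensor V W U)
qed

text \<open>Bringing the negative terms to the other side turns an equation of virtual bisets into
  one of bisets, where congruence applies; additivity then removes the added terms again.\<close>

lemma mark_tensor_diff_left:
  assumes "fin_biset K H V" "fin_biset K H V'" "fin_biset K H W" "fin_biset K H W'" "fin_biset H G U"
    and "mark K H V - mark K H V' = mark K H W - mark K H W'"
  shows "tmark K H G V U - tmark K H G V' U =
    tmark K H G W U - tmark K H G W' U"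
proof -
  have "mark K H (V \<uplus> W') = mark K H (W \<uplus> V')"
    using assms by (simp add: KH.mark_sum' algebra_simps)
  then have "tmark K H G (V \<uplus> W') U = tmark K H G (W \<uplus> V') U"
    by (intro mark_tensor_cong KH.fin_biset_sum assms refl)
  then show ?thesis using assms by (simp add: mark_tensor_sum_left algebra_simps)
qed

lemma mark_tensor_diff_right:
  assumes "fin_biset K H V" "fin_biset H G U" "fin_biset H G U'" "fin_biset H G W" "fin_biset H G W'"
    and "mark H G U - mark H G U' = mark H G W - mark H G W'"
  shows "tmark K H G V U - tmark K H G V U' =
    tmark K H G V W - tmark K H G V W'"
proof -
  have "mark H G (U \<uplus> W') = mark H G (W \<uplus> U')"
    using assms by (simp add: HG.mark_sum' algebra_simps)
  then have "tmark K H G V (U \<uplus> W') = tmark K H G V (W \<uplus> U')"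
    by (intro mark_tensor_cong HG.fin_biset_sum assms refl)
  then show ?thesis using assms by (simp add: mark_tensor_sum_right algebra_simps)
qed

end

lemma id_biset_sel [simp]: "fst (id_biset G) = carrier G"
  "x \<in> carrier G \<Longrightarrow> snd (id_biset G) (a, b) x = a \<otimes>\<^bsub>G\<^esub> x \<otimes>\<^bsub>G\<^esub> b"
  by (simp_all add: id_biset_def)

lemma fin_biset_id: assumes "finite_group G" shows "fin_biset G G (id_biset G)"
proof -
  interpret two_groups G G by unfold_locales fact+
  show ?thesis by (rule fin_bisetI) (auto simp: id_biset_def H.m_assoc)
qed

lemma id_lact_ract:
  fixes G (structure)
  assumes "group G" "x \<in> carrier G" "y \<in> carrier G"
  shows "lact G (id_biset G) x y = x \<otimes> y" "ract G (id_biset G) y x = y \<otimes> x"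
proof -
  interpret group G by fact
  show "lact G (id_biset G) x y = x \<otimes> y" "ract G (id_biset G) y x = y \<otimes> x"
    using assms by (simp_all add: lact_def ract_def)
qed

context two_groups begin

lemma mark_tensor_id_left:
  assumes U: "fin_biset H G U" shows "tmark H H G (id_biset H) U = mark H G U"
proof -
  interpret three_groups H H G by unfold_locales (rule fin_H fin_G)+
  note [simp] = id_lact_ract[OF H.is_group]
  have "is_tensor H H G (id_biset H) U (\<lambda>h u. lact G U h u) U"
    unfolding is_tensor_def
  proof (intro conjI ballI)
    fix u assume "u \<in> fst U"
    then show "\<exists>h\<in>fst (id_biset H). \<exists>u'\<in>fst U. u = lact G U h u'"
      using U by (auto intro!: bexI[of _ "\<one>\<^bsub>H\<^esub>"] bexI[of _ u])
  next
    fix v u v' u' assume *: "v \<in> fst (id_biset H)" "u \<in> fst U" "v' \<in> fst (id_biset H)" "u' \<in> fst U"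
    show "lact G U v u = lact G U v' u' \<longleftrightarrow>
        (\<exists>h\<in>carrier H. v = ract H (id_biset H) v' h \<and> u' = lact G U h u)"
    proof
      assume "lact G U v u = lact G U v' u'"
      then have "u' = lact G U (inv\<^bsub>H\<^esub> v' \<otimes>\<^bsub>H\<^esub> v) u"
        using * U lact_eq_iff[OF U, of u' "lact G U v u" v'] by (simp add: eq_commute[of "lact G U v u"])
      then show "\<exists>h\<in>carrier H. v = ract H (id_biset H) v' h \<and> u' = lact G U h u"
        using * by (intro bexI[of _ "inv\<^bsub>H\<^esub> v' \<otimes>\<^bsub>H\<^esub> v"]) (auto simp: H.m_assoc[symmetric])
    qed (use * U in auto)
  qed (auto simp: U act_lact_ract)
  then show ?thesis by (rule mark_tensor[OF fin_biset_id[OF fin_H] U])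
qed

lemma mark_tensor_id_right:
  assumes U: "fin_biset H G U" shows "tmark H G G U (id_biset G) = mark H G U"
proof -
  interpret three_groups H G G by unfold_locales (rule fin_H fin_G)+
  note [simp] = id_lact_ract[OF G.is_group]
  have "is_tensor H G G U (id_biset G) (\<lambda>u g. ract H U u g) U"
    unfolding is_tensor_def
  proof (intro conjI ballI)
    fix u assume "u \<in> fst U"
    then show "\<exists>u'\<in>fst U. \<exists>h\<in>fst (id_biset G). u = ract H U u' h"
      using U by (auto intro!: bexI[of _ "\<one>"] bexI[of _ u])
  next
    fix u v u' v' assume *: "v \<in> fst (id_biset G)" "u \<in> fst U" "v' \<in> fst (id_biset G)" "u' \<in> fst U"
    show "ract H U u v = ract H U u' v' \<longleftrightarrow>
        (\<exists>h\<in>carrier G. u = ract H U u' h \<and> v' = lact G (id_biset G) h v)"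
    proof
      assume "ract H U u v = ract H U u' v'"
      then have "u = ract H U u' (v' \<otimes> inv v)"
        using * U ract_eq_iff[OF U, of u "ract H U u' v'" v] by simp
      then show "\<exists>h\<in>carrier G. u = ract H U u' h \<and> v' = lact G (id_biset G) h v"
        using * by (intro bexI[of _ "v' \<otimes> inv v"]) (auto simp: G.m_assoc)
    qed (use * U in auto)
  qed (auto simp: U act_lact_ract)
  then show ?thesis by (rule mark_tensor[OF U fin_biset_id[OF fin_G]])
qed

end

text \<open>The right-nested product is a model of the left-nested one: the class of (w, v) together
  with u goes to the class of w together with that of (v, u). Equality on either side comes down to
  the same k and h balancing w, v and u.\<close>

lemma mark_tensor_assoc:
  fixes H (structure)
  assumes "finite_group L" "finite_group K" "finite_group H" "finite_group G"
    and W: "fin_biset L K W" and V: "fin_biset K H V" and U: "fin_biset H G U"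
  shows "tmark L H G (biset_tensor L K H W V) U =
    tmark L K G W (biset_tensor K H G V U)"
proof -
  interpret LKH: three_groups L K H by unfold_locales fact+
  interpret KHG: three_groups K H G by unfold_locales fact+
  interpret LHG: three_groups L H G by unfold_locales fact+
  interpret LKG: three_groups L K G by unfold_locales fact+
  note WV = LKH.fin_biset_tensor[OF W V] and VU = KHG.fin_biset_tensor[OF V U]
  let ?WV = "biset_tensor L K H W V" and ?VU = "biset_tensor K H G V U"
  let ?T = "biset_tensor L K G W ?VU"
  let ?a = "tensor_cls L K H W V" and ?b = "tensor_cls K H G V U" and ?c = "tensor_cls L K G W ?VU"
  note [simp] = LKH.cls_mem[OF W V] KHG.cls_mem[OF V U] LKG.cls_mem[OF W VU]
    LKH.cls_lact_ract[OF W V] KHG.cls_lact_ract[OF V U] LKG.cls_lact_ract[OF W VU]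
    W V U WV VU
  have bal: "?c (ract L W w k) (?b v u) = ?c w (?b (lact H V k v) u)"
    if "w \<in> fst W" "v \<in> fst V" "u \<in> fst U" "k \<in> carrier K" for w v u k
    using that by (simp add: LKG.cls_balanced[OF W VU])
  \<comment> \<open>The value at (w, v) is a function of u restricted to the points of
    \<open>U\<close>, so that equal classes of (w, v) yield equal functions.\<close>
  obtain F where F': "\<And>x. x \<in> fst W \<times> fst V \<Longrightarrow>
      F ((\<lambda>(w, v). ?a w v) x) = (\<lambda>(w, v). \<lambda>u\<in>fst U. ?c w (?b v u)) x"
    by (rule factor_map[of "fst W \<times> fst V" "\<lambda>(w, v). ?a w v" "\<lambda>(w, v). \<lambda>u\<in>fst U. ?c w (?b v u)"])
      (auto simp: LKH.cls_eq_iff bal intro!: restrict_ext)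
  have F: "F (?a w v) u = ?c w (?b v u)" if "w \<in> fst W" "v \<in> fst V" "u \<in> fst U" for w v u
    using F'[of "(w, v)"] that by simp
  have eq: "?c w (?b v u) = ?c w' (?b v' u') \<longleftrightarrow> (\<exists>h\<in>carrier H. ?a w v = ract L ?WV (?a w' v') h \<and> u' = lact G U h u)"
    if w: "w \<in> fst W" "w' \<in> fst W" and v: "v \<in> fst V" "v' \<in> fst V" and u: "u \<in> fst U" "u' \<in> fst U" for w v u w' v' u'
  proof -
    have "?c w (?b v u) = ?c w' (?b v' u') \<longleftrightarrow> (\<exists>k\<in>carrier K. w = ract L W w' k \<and> ?b v' u' = ?b (lact H V k v) u)"
      by (subst LKG.cls_eq_iff[OF W VU]) (use that in \<open>auto intro!: bex_cong conj_cong\<close>)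
    also have "\<dots> \<longleftrightarrow> (\<exists>k\<in>carrier K. w = ract L W w' k \<and>
        (\<exists>h\<in>carrier H. v' = ract K V (lact H V k v) h \<and> u = lact G U h u'))"
      by (intro bex_cong[OF refl] conj_cong[OF refl] KHG.cls_eq_iff[OF V U]) (use that in auto)
    also have "\<dots> \<longleftrightarrow> (\<exists>k\<in>carrier K. w = ract L W w' k \<and>
        (\<exists>h\<in>carrier H. ract K V v' h = lact H V k v \<and> u' = lact G U h u))"
    proof (rule bex_cong[OF refl], rule conj_cong[OF refl], rule iffI)
      fix k assume k: "k \<in> carrier K"
      show "\<exists>h\<in>carrier H. ract K V v' h = lact H V k v \<and> u' = lact G U h u"
        if "\<exists>h\<in>carrier H. v' = ract K V (lact H V k v) h \<and> u = lact G U h u'"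
      proof -
        from that obtain h where h: "h \<in> carrier H" "v' = ract K V (lact H V k v) h" "u = lact G U h u'" by blast
        have "ract K V v' (inv h) = lact H V k v" "u' = lact G U (inv h) u"
          unfolding h(2,3) using h(1) k v u by simp_all
        then show ?thesis using h(1) by (intro bexI[of _ "inv h"]) simp_all
      qed
      show "\<exists>h\<in>carrier H. v' = ract K V (lact H V k v) h \<and> u = lact G U h u'"
        if "\<exists>h\<in>carrier H. ract K V v' h = lact H V k v \<and> u' = lact G U h u"
      proof -
        from that obtain h where h: "h \<in> carrier H" "ract K V v' h = lact H V k v" "u' = lact G U h u" by blast
        have "v' = ract K V (lact H V k v) (inv h)"
          by (rule LKH.HG.ract_eq_iff[OF V _ _ h(1), THEN iffD1, OF _ _ h(2)]) (use k v in simp_all)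
        moreover have "u = lact G U (inv h) u'"
          unfolding h(3) using h(1) u by simp
        ultimately show ?thesis using h(1) by (intro bexI[of _ "inv h"]) simp_all
      qed
    qed
    also have "\<dots> \<longleftrightarrow> (\<exists>h\<in>carrier H. (\<exists>k\<in>carrier K. w = ract L W w' k \<and> ract K V v' h = lact H V k v) \<and> u' = lact G U h u)"
      by blast
    also have "\<dots> \<longleftrightarrow> (\<exists>h\<in>carrier H. ?a w v = ract L ?WV (?a w' v') h \<and> u' = lact G U h u)"
    proof (rule bex_cong[OF refl], rule conj_cong[OF _ refl])
      fix h assume h: "h \<in> carrier H"
      have "?a w v = ?a w' (ract K V v' h) \<longleftrightarrow> (\<exists>k\<in>carrier K. w = ract L W w' k \<and> ract K V v' h = lact H V k v)"
        by (rule LKH.cls_eq_iff[OF W V]) (use that h in auto)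
      then show "(\<exists>k\<in>carrier K. w = ract L W w' k \<and> ract K V v' h = lact H V k v) \<longleftrightarrow> ?a w v = ract L ?WV (?a w' v') h"
        using that h by simp
    qed
    finally show ?thesis .
  qed
  have "is_tensor L H G ?WV U F ?T"
    unfolding is_tensor_def
  proof (intro conjI ballI)
    fix t assume "t \<in> fst ?T"
    then obtain w y where "w \<in> fst W" "y \<in> fst ?VU" "t = ?c w y" by (rule LKG.cls_cases[OF W VU])
    moreover from \<open>y \<in> fst ?VU\<close> obtain v u where "v \<in> fst V" "u \<in> fst U" "y = ?b v u"
      by (rule KHG.cls_cases[OF V U])
    ultimately show "\<exists>x\<in>fst ?WV. \<exists>u\<in>fst U. t = F x u"
      by (intro bexI[of _ "?a w v"] bexI[of _ u]) (simp_all add: F)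
  next
    fix x u x' u' assume *: "x \<in> fst ?WV" "u \<in> fst U" "x' \<in> fst ?WV" "u' \<in> fst U"
    from *(1) obtain w v where wv: "w \<in> fst W" "v \<in> fst V" "x = ?a w v" by (rule LKH.cls_cases[OF W V])
    from *(3) obtain w' v' where wv': "w' \<in> fst W" "v' \<in> fst V" "x' = ?a w' v'" by (rule LKH.cls_cases[OF W V])
    show "F x u = F x' u' \<longleftrightarrow> (\<exists>h\<in>carrier H. x = ract L ?WV x' h \<and> u' = lact G U h u)"
      using eq[OF wv(1) wv'(1) wv(2) wv'(2) *(2,4)] * wv wv' by (simp add: F)
  qed (auto elim!: LKH.cls_cases[OF W V] simp: F LKG.cls_act[OF W VU])
  then show ?thesis by (rule LHG.mark_tensor[OF WV U])
qed

text \<open>The bilinear extension of the tensor product to marks of virtual bisets. The choice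
  operator picks representatives; by \<open>tensor_diff_welldef\<close> the result is the same for
  all of them, and \<open>vcomp_diff\<close> computes it for bisets on any types.\<close>

definition vcomp :: "'k monoid \<Rightarrow> 'h monoid \<Rightarrow> 'g monoid \<Rightarrow>
    ('k, 'h) vmark \<Rightarrow> ('h, 'g) vmark \<Rightarrow> ('k, 'g) vmark" where
  "vcomp K H G y x = (SOME z. \<exists>(V :: ('k, 'h, nat) biset) (V' :: ('k, 'h, nat) biset)
       (U :: ('h, 'g, nat) biset) (U' :: ('h, 'g, nat) biset).
     fin_biset K H V \<and> fin_biset K H V' \<and> fin_biset H G U \<and> fin_biset H G U' \<and>
     y = mark K H V - mark K H V' \<and> x = mark H G U - mark H G U' \<and>
     z = dmark K H G V V' U U')"

lemma mark_no_points: "fst U = {} \<Longrightarrow> mark H G U = 0"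
  by (simp add: mark_def fun_eq_iff)

context three_groups begin

text \<open>The representatives on the left are exchanged while those on the right stay fixed, then
  conversely; each exchange is one of the two difference lemmas.\<close>

lemma tensor_diff_welldef:
  assumes V: "fin_biset K H V" "fin_biset K H V'" "fin_biset K H W" "fin_biset K H W'"
    and U: "fin_biset H G U" "fin_biset H G U'" "fin_biset H G T" "fin_biset H G T'"
    and v: "mark K H V - mark K H V' = mark K H W - mark K H W'"
    and u: "mark H G U - mark H G U' = mark H G T - mark H G T'"
  shows "dmark K H G V V' U U' = dmark K H G W W' T T'"
proof -
  have "dmark K H G W W' U U' = (tmark K H G W U - tmark K H G W U') - (tmark K H G W' U - tmark K H G W' U')"
    by simp
  then show ?thesis
    using mark_tensor_diff_left[OF V U(1) v] mark_tensor_diff_left[OF V U(2) v]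
      mark_tensor_diff_right[OF V(3) U u] mark_tensor_diff_right[OF V(4) U u] by simp
qed

lemma vcomp_diff:
  assumes V: "fin_biset K H V" "fin_biset K H V'" and U: "fin_biset H G U" "fin_biset H G U'"
  shows "vcomp K H G (mark K H V - mark K H V') (mark H G U - mark H G U') =
    dmark K H G V V' U U'"
proof -
  obtain W W' :: "('k, 'h, nat) biset" where W: "fin_biset K H W" "fin_biset K H W'"
    "mark K H V - mark K H V' = mark K H W - mark K H W'"
    using KH.vmarksE[OF KH.mark_diff_vmarks[OF V]] .
  obtain T T' :: "('h, 'g, nat) biset" where T: "fin_biset H G T" "fin_biset H G T'"
    "mark H G U - mark H G U' = mark H G T - mark H G T'"
    using HG.vmarksE[OF HG.mark_diff_vmarks[OF U]] .
  show ?thesis unfolding vcomp_def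
    by (rule some_equality, intro exI conjI, (rule W T tensor_diff_welldef[OF V W(1,2) U T(1,2) W(3) T(3)])+)
      (elim exE conjE, erule ssubst, rule tensor_diff_welldef[OF _ _ V _ _ U], (assumption | erule sym)+)
qed

lemma vcomp_mark:
  assumes V: "fin_biset K H V" and U: "fin_biset H G U"
  shows "vcomp K H G (mark K H V) (mark H G U) = tmark K H G V U"
proof -
  have z: "fst (biset_tensor K H G empty_biset U) = {}"
    "fst (biset_tensor K H G V empty_biset) = {}"
    "fst (biset_tensor K H G empty_biset empty_biset) = {}"
    by (simp_all add: biset_tensor_def empty_biset_def)
  show ?thesis
    using vcomp_diff[OF V KH.fin_biset_empty U HG.fin_biset_empty]
    by (simp add: KH.mark_empty' HG.mark_empty' z mark_no_points)
qed

lemma vcomp_closed: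
  assumes y: "y \<in> vmarks K H" and x: "x \<in> vmarks H G" shows "vcomp K H G y x \<in> vmarks K G"
proof -
  obtain V V' :: "('k, 'h, nat) biset" where V: "fin_biset K H V" "fin_biset K H V'" "y = mark K H V - mark K H V'"
    using y by (rule KH.vmarksE)
  obtain U U' :: "('h, 'g, nat) biset" where U: "fin_biset H G U" "fin_biset H G U'" "x = mark H G U - mark H G U'"
    using x by (rule HG.vmarksE)
  show ?thesis
    unfolding V(3) U(3) vcomp_diff[OF V(1,2) U(1,2)]
    by (intro KG.vmarks_diff KG.mark_diff_vmarks fin_biset_tensor V U)
qed

lemma vcomp_add_left:
  assumes y: "y \<in> vmarks K H" and y': "y' \<in> vmarks K H" and x: "x \<in> vmarks H G"
  shows "vcomp K H G (y + y') x = vcomp K H G y x + vcomp K H G y' x"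
proof -
  obtain V V' :: "('k, 'h, nat) biset" where V: "fin_biset K H V" "fin_biset K H V'" "y = mark K H V - mark K H V'"
    using y by (rule KH.vmarksE)
  obtain W W' :: "('k, 'h, nat) biset" where W: "fin_biset K H W" "fin_biset K H W'" "y' = mark K H W - mark K H W'"
    using y' by (rule KH.vmarksE)
  obtain U U' :: "('h, 'g, nat) biset" where U: "fin_biset H G U" "fin_biset H G U'" "x = mark H G U - mark H G U'"
    using x by (rule HG.vmarksE)
  have s: "y + y' = mark K H (V \<uplus> W) - mark K H (V' \<uplus> W')"
    using V W by (simp add: KH.mark_sum')
  show ?thesis
    unfolding s vcomp_diff[OF KH.fin_biset_sum[OF V(1) W(1)] KH.fin_biset_sum[OF V(2) W(2)] U(1,2), folded U(3)]
    unfolding V(3) W(3) U(3) vcomp_diff[OF V(1,2) U(1,2)] vcomp_diff[OF W(1,2) U(1,2)]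
    using V(1,2) W(1,2) U(1,2) by (simp add: mark_tensor_sum_left)
qed

lemma vcomp_add_right:
  assumes y: "y \<in> vmarks K H" and x: "x \<in> vmarks H G" and x': "x' \<in> vmarks H G"
  shows "vcomp K H G y (x + x') = vcomp K H G y x + vcomp K H G y x'"
proof -
  obtain V V' :: "('k, 'h, nat) biset" where V: "fin_biset K H V" "fin_biset K H V'" "y = mark K H V - mark K H V'"
    using y by (rule KH.vmarksE)
  obtain W W' :: "('h, 'g, nat) biset" where W: "fin_biset H G W" "fin_biset H G W'" "x' = mark H G W - mark H G W'"
    using x' by (rule HG.vmarksE)
  obtain U U' :: "('h, 'g, nat) biset" where U: "fin_biset H G U" "fin_biset H G U'" "x = mark H G U - mark H G U'"
    using x by (rule HG.vmarksE)
  have s: "x + x' = mark H G (U \<uplus> W) - mark H G (U' \<uplus> W')"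
    using U W by (simp add: HG.mark_sum')
  show ?thesis
    unfolding s V(3) vcomp_diff[OF V(1,2) HG.fin_biset_sum[OF U(1) W(1)] HG.fin_biset_sum[OF U(2) W(2)]]
    unfolding W(3) U(3) vcomp_diff[OF V(1,2) U(1,2)] vcomp_diff[OF V(1,2) W(1,2)]
    using V(1,2) W(1,2) U(1,2) by (simp add: mark_tensor_sum_right)
qed

lemma vcomp_zero_left:
  assumes x: "x \<in> vmarks H G" shows "vcomp K H G 0 x = 0"
  using vcomp_add_left[OF KH.vmarks_zero KH.vmarks_zero x] by simp

lemma vcomp_diff_left:
  assumes y: "y \<in> vmarks K H" and y': "y' \<in> vmarks K H" and x: "x \<in> vmarks H G"
  shows "vcomp K H G (y - y') x = vcomp K H G y x - vcomp K H G y' x"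
  using vcomp_add_left[OF KH.vmarks_diff[OF y y'] y' x] by simp

lemma vcomp_diff_right:
  assumes y: "y \<in> vmarks K H" and x: "x \<in> vmarks H G" and x': "x' \<in> vmarks H G"
  shows "vcomp K H G y (x - x') = vcomp K H G y x - vcomp K H G y x'"
  using vcomp_add_right[OF y HG.vmarks_diff[OF x x'] x'] by simp

lemma bcomp_of_mark:
  assumes y: "y \<in> vmarks K H" and x: "x \<in> vmarks H G"
  shows "bcomp K H G (of_mark K H y) (of_mark H G x) = of_mark K G (vcomp K H G y x)"
  unfolding bcomp_def
proof (intro KH.UN_of_mark[OF y] HG.UN_of_mark[OF x])
  fix V V' :: "('k, 'h, nat) biset" and U U' :: "('h, 'g, nat) biset"
  assume V: "fin_biset K H V" "fin_biset K H V'" "y = mark K H V - mark K H V'"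
    and U: "fin_biset H G U" "fin_biset H G U'" "x = mark H G U - mark H G U'"
  show "vbiset K G (biset_tensor K H G V U \<uplus> biset_tensor K H G V' U')
                (biset_tensor K H G V U' \<uplus> biset_tensor K H G V' U) = of_mark K G (vcomp K H G y x)"
    unfolding V(3) U(3) vcomp_diff[OF V(1,2) U(1,2)]
    using V(1,2) U(1,2)
    by (subst KG.vbiset_eq) (simp_all add: KG.fin_biset_sum fin_biset_tensor KG.mark_sum' algebra_simps)
qed

end

text \<open>Both sides are additive in each argument, and marks of actual bisets generate
  \<open>vmarks\<close>; what remains is associativity of the tensor product.\<close>

lemma vcomp_assoc:
  assumes g: "finite_group L" "finite_group K" "finite_group H" "finite_group G"
    and z: "z \<in> vmarks L K" and y: "y \<in> vmarks K H" and x: "x \<in> vmarks H G"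
  shows "vcomp L H G (vcomp L K H z y) x = vcomp L K G z (vcomp K H G y x)"
proof -
  interpret LKH: three_groups L K H by unfold_locales fact+
  interpret KHG: three_groups K H G by unfold_locales fact+
  interpret LHG: three_groups L H G by unfold_locales fact+
  interpret LKG: three_groups L K G by unfold_locales fact+
  note c = LKH.KH.mark_vmarks LKH.HG.mark_vmarks KHG.HG.mark_vmarks LKH.vcomp_closed KHG.vcomp_closed
    LKH.vcomp_diff_left LKH.vcomp_diff_right KHG.vcomp_diff_left KHG.vcomp_diff_right
    LHG.vcomp_diff_left LHG.vcomp_diff_right LKG.vcomp_diff_left LKG.vcomp_diff_right
  show ?thesis using z
  proof (induction rule: LKH.KH.vmarks_induct)
    case W: (mark W)
    show ?case using y
    proof (induction rule: LKH.HG.vmarks_induct)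
      case V: (mark V)
      show ?case using x
      proof (induction rule: KHG.HG.vmarks_induct)
        case (mark U)
        with W V show ?case
          by (simp add: LKH.vcomp_mark KHG.vcomp_mark LHG.vcomp_mark LKG.vcomp_mark
            LKH.fin_biset_tensor KHG.fin_biset_tensor mark_tensor_assoc[OF g])
      qed (simp only: c W V)
    qed (simp only: c W x)
  qed (simp only: c x y)
qed

lemma vcomp_id:
  assumes "finite_group H" "finite_group G" and x: "x \<in> vmarks H G"
  shows "vcomp H H G (mark H H (id_biset H)) x = x" "vcomp H G G x (mark G G (id_biset G)) = x"
proof -
  interpret HHG: three_groups H H G by unfold_locales fact+
  interpret HGG: three_groups H G G by unfold_locales fact+
  note i = fin_biset_id[OF assms(1)] fin_biset_id[OF assms(2)]
  show "vcomp H H G (mark H H (id_biset H)) x = x"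
    using x by (induction rule: HHG.HG.vmarks_induct)
      (simp_all only: HHG.vcomp_diff_right HHG.KH.mark_vmarks HHG.vcomp_mark HHG.HG.mark_tensor_id_left i)
  show "vcomp H G G x (mark G G (id_biset G)) = x"
    using x by (induction rule: HHG.HG.vmarks_induct)
      (simp_all only: HGG.vcomp_diff_left HGG.HG.mark_vmarks HGG.vcomp_mark HHG.HG.mark_tensor_id_right i)
qed

section \<open>The subfunctor generated by \<open>\<delta>\<close>\<close>

text \<open>The passage from (Q, P)-bisets to left sets of Q times the opposite of P, on marks. The
  trivial group on the right adds nothing to a subset and is projected away.\<close>

definition lift_mark :: "('q, 'p) vmark \<Rightarrow> ('q \<times> 'p, unit) vmark" where
  "lift_mark x = (\<lambda>L. x (fst ` L))"

lemma lift_mark_linear: "lift_mark (x + y) = lift_mark x + lift_mark y"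
  "lift_mark (x - y) = lift_mark x - lift_mark y" "lift_mark 0 = 0" "lift_mark (- x) = - lift_mark x"
  by (auto simp: lift_mark_def fun_eq_iff)

lemma trivial_grp_sel [simp]: "carrier trivial_grp = {()}"
  by (simp_all add: singleton_group_def)

context two_groups begin

lemma two_groups_opset: "two_groups (H \<bowtie> G) trivial_grp"
  by unfold_locales (intro finite_group_DirProd fin_H finite_group_opp fin_G finite_group_trivial)+

lemma fin_biset_to_opset:
  assumes U: "fin_biset H G U" shows "fin_biset (H \<bowtie> G) trivial_grp (to_opset U)"
proof -
  interpret o: two_groups "H \<bowtie> G" trivial_grp by (rule two_groups_opset)
  show ?thesis
    by (rule o.fin_bisetI) (auto simp: to_opset_def fin_bisetD[OF U])
qed

lemma mark_to_opset: "mark (H \<bowtie> G) trivial_grp (to_opset U) = lift_mark (mark H G U)"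
proof
  fix L :: "(('h \<times> 'g) \<times> unit) set"
  have L: "L = (fst ` L) \<times> {()}" by force
  have "L \<subseteq> carrier (H \<bowtie> G) \<times> carrier trivial_grp \<longleftrightarrow> fst ` L \<subseteq> carrier H \<times> carrier G"
    by (subst L) auto
  moreover have "L \<subseteq> stab_of (H \<bowtie> G) trivial_grp (to_opset U) u \<longleftrightarrow> fst ` L \<subseteq> stab_of H G U u" for u
    by (subst L) (auto simp: stab_of_def to_opset_def)
  ultimately show "mark (H \<bowtie> G) trivial_grp (to_opset U) L = lift_mark (mark H G U) L"
    by (simp add: mark_def lift_mark_def to_opset_def)
qed

lemma lift_mark_vmarks:
  assumes "x \<in> vmarks H G" shows "lift_mark x \<in> vmarks (H \<bowtie> G) trivial_grp"
proof -
  interpret o: two_groups "H \<bowtie> G" trivial_grp by (rule two_groups_opset)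
  show ?thesis using assms
    by (induction rule: vmarks_induct)
      (simp_all only: lift_mark_linear o.vmarks_diff o.mark_vmarks fin_biset_to_opset flip: mark_to_opset)
qed

lemma to_burnside1_of_mark:
  assumes x: "x \<in> vmarks H G"
  shows "to_burnside1 H G (of_mark H G x) = of_mark (H \<bowtie> G) trivial_grp (lift_mark x)"
  unfolding to_burnside1_def
proof (intro UN_of_mark[OF x])
  interpret o: two_groups "H \<bowtie> G" trivial_grp by (rule two_groups_opset)
  fix V W :: "('h, 'g, nat) biset"
  assume "fin_biset H G V" "fin_biset H G W" "x = mark H G V - mark H G W"
  then show "vbiset (H \<bowtie> G) trivial_grp (to_opset V) (to_opset W) =
      of_mark (H \<bowtie> G) trivial_grp (lift_mark x)"
    by (simp add: o.vbiset_eq fin_biset_to_opset mark_to_opset lift_mark_linear)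
qed

end

text \<open>Composing with \<open>V\<close> on the left and with \<open>W\<close> on the right amounts, on
  \<open>Q \<times> P\<^sup>o\<^sup>p\<close>-sets, to composing with the biset \<open>V \<times> W\<close>.\<close>

definition ext_biset :: "('r, 'q, 'x) biset \<Rightarrow> ('p, 's, 'y) biset \<Rightarrow> ('r \<times> 's, 'q \<times> 'p, 'x \<times> 'y) biset" where
  "ext_biset V W = (fst V \<times> fst W,
     (\<lambda>((r, s), (q, p)). \<lambda>(v, w)\<in>fst V \<times> fst W. (snd V (r, q) v, snd W (p, s) w)))"

lemma ext_biset_sel [simp]: "fst (ext_biset V W) = fst V \<times> fst W"
  "v \<in> fst V \<Longrightarrow> w \<in> fst W \<Longrightarrow> snd (ext_biset V W) ((r, s), (q, p)) (v, w) = (snd V (r, q) v, snd W (p, s) w)"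
  by (simp_all add: ext_biset_def)

context
  fixes R :: "'r monoid" and Q :: "'q monoid" and P :: "'p monoid" (structure) and S :: "'s monoid"
  assumes fin: "finite_group R" "finite_group Q" "finite_group P" "finite_group S"
begin

interpretation RQP: three_groups R Q P by unfold_locales (rule fin)+
interpretation RPS: three_groups R P S by unfold_locales (rule fin)+
interpretation E: three_groups "R \<bowtie> S" "Q \<bowtie> P" trivial_grp
  by unfold_locales (intro finite_group_DirProd finite_group_opp fin finite_group_trivial)+

lemma fin_biset_ext:
  assumes V: "fin_biset R Q V" and W: "fin_biset P S W"
  shows "fin_biset (R \<bowtie> S) (Q \<bowtie> P) (ext_biset V W)"
  by (rule E.KH.fin_bisetI)
    (auto simp: RQP.KH.fin_bisetD[OF V] RPS.HG.fin_bisetD[OF W], auto simp: ext_biset_def)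

text \<open>The point ((v, w), u) corresponds to the iterated class of v, u and w. Balancing over Q
  and then over P amounts to balancing over both at once, up to inverting the element of P.\<close>

lemma mark_ext_tensor:
  assumes V: "fin_biset R Q V" and U: "fin_biset Q P U" and W: "fin_biset P S W"
  shows "mark (R \<bowtie> S) trivial_grp
      (biset_tensor (R \<bowtie> S) (Q \<bowtie> P) trivial_grp (ext_biset V W) (to_opset U)) =
    lift_mark (tmark R P S (biset_tensor R Q P V U) W)"
proof -
  let ?Q = "Q \<bowtie> P"
  let ?B = "biset_tensor R P S"
  let ?T = "to_opset U"
  let ?E = "ext_biset V W"
  note VU = RQP.fin_biset_tensor[OF V U]
  let ?VU = "biset_tensor R Q P V U"
  let ?a = "tensor_cls R Q P V U" and ?b = "tensor_cls R P S ?VU W"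
  let ?f = "\<lambda>(v, w) u. ?b (?a v u) w"
  have lr: "ract (R \<bowtie> S) ?E (v, w) (q, p) = (ract R V v q, lact S W p w)"
    "lact ?Q ?E (r, s) (v, w) = (lact Q V r v, ract P W w s)"
    if "v \<in> fst V" "w \<in> fst W" for v w q p r s
    using that by (simp_all add: ract_def lact_def)
  have lo: "lact trivial_grp ?T (q, p) u = snd U (q, p) u"
    "ract ?Q ?T u e = snd U (\<one>\<^bsub>Q\<^esub>, \<one>) u" for q p u e
    by (simp_all add: lact_def ract_def to_opset_def)
  have "is_tensor (R \<bowtie> S) ?Q trivial_grp ?E ?T ?f
      (to_opset (?B ?VU W))"
    unfolding is_tensor_def
  proof (intro conjI ballI)
    fix x u assume "x \<in> fst ?E" "u \<in> fst ?T"
    then show "?f x u \<in> fst (to_opset (?B ?VU W))"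
      by (auto simp: to_opset_def RQP.cls_mem[OF V U] RPS.cls_mem[OF VU W])
  next
    fix t assume "t \<in> fst (to_opset (?B ?VU W))"
    then have "t \<in> fst (?B ?VU W)" by (simp add: to_opset_def)
    then obtain y w where "y \<in> fst ?VU" "w \<in> fst W" "t = ?b y w" by (rule RPS.cls_cases[OF VU W])
    moreover from \<open>y \<in> fst ?VU\<close> obtain v u where "v \<in> fst V" "u \<in> fst U" "y = ?a v u"
      by (rule RQP.cls_cases[OF V U])
    ultimately show "\<exists>x\<in>fst ?E. \<exists>u\<in>fst ?T. t = ?f x u"
      by (intro bexI[of _ "(v, w)"] bexI[of _ u]) (simp_all add: to_opset_def)
  next
    fix x u x' u'
    assume *: "x \<in> fst ?E" "u \<in> fst ?T"
      "x' \<in> fst ?E" "u' \<in> fst ?T"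
    obtain v w v' w' where x: "x = (v, w)" "x' = (v', w')" by (cases x; cases x')
    have m: "v \<in> fst V" "w \<in> fst W" "v' \<in> fst V" "w' \<in> fst W" "u \<in> fst U" "u' \<in> fst U"
      using * by (auto simp: x to_opset_def)
    have "?f x u = ?f x' u' \<longleftrightarrow> (\<exists>p\<in>carrier P. ?a v u = ract R ?VU (?a v' u') p \<and> w' = lact S W p w)"
      unfolding x using m by (simp add: RPS.cls_eq_iff[OF VU W] RQP.cls_mem[OF V U])
    also have "\<dots> \<longleftrightarrow> (\<exists>p\<in>carrier P. \<exists>q\<in>carrier Q. v = ract R V v' q \<and> ract Q U u' p = lact P U q u \<and> w' = lact S W p w)"
    proof (rule bex_cong[OF refl])
      fix p assume p: "p \<in> carrier P"
      have "ract R ?VU (?a v' u') p = ?a v' (ract Q U u' p)"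
        using m p by (intro RQP.cls_lact_ract[OF V U])
      moreover have "?a v u = ?a v' (ract Q U u' p) \<longleftrightarrow> (\<exists>q\<in>carrier Q. v = ract R V v' q \<and> ract Q U u' p = lact P U q u)"
        using m p U by (intro RQP.cls_eq_iff[OF V U]) auto
      ultimately show "(?a v u = ract R ?VU (?a v' u') p \<and> w' = lact S W p w) \<longleftrightarrow>
          (\<exists>q\<in>carrier Q. v = ract R V v' q \<and> ract Q U u' p = lact P U q u \<and> w' = lact S W p w)"
        by auto
    qed
    also have "\<dots> \<longleftrightarrow> (\<exists>p\<in>carrier P. \<exists>q\<in>carrier Q. v = ract R V v' q \<and> w = lact S W p w' \<and> u' = snd U (q, p) u)"
    proof -
      \<comment> \<open>Here the inversion takes place: P acts on \<open>U\<close> from the right,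
        whereas its opposite group acts from the left.\<close>
      have eq: "ract Q U u' p = lact P U q u \<and> w' = lact S W p w \<longleftrightarrow>
          w = lact S W (inv p) w' \<and> u' = snd U (q, inv p) u" if "p \<in> carrier P" "q \<in> carrier Q" for p q
        using RPS.HG.lact_eq_iff[OF W m(2,4) that(1)] RQP.HG.ract_eq_iff[OF U m(6) _ that(1), of "lact P U q u"] that m U
        by (auto simp: RQP.HG.act_lact_ract)
      show ?thesis
      proof
        assume "\<exists>p\<in>carrier P. \<exists>q\<in>carrier Q. v = ract R V v' q \<and> ract Q U u' p = lact P U q u \<and> w' = lact S W p w"
        then show "\<exists>p\<in>carrier P. \<exists>q\<in>carrier Q. v = ract R V v' q \<and> w = lact S W p w' \<and> u' = snd U (q, p) u"
          using eq RQP.HG.G.inv_closed by meson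
      next
        assume "\<exists>p\<in>carrier P. \<exists>q\<in>carrier Q. v = ract R V v' q \<and> w = lact S W p w' \<and> u' = snd U (q, p) u"
        then obtain p q where "p \<in> carrier P" "q \<in> carrier Q" "v = ract R V v' q" "w = lact S W p w' \<and> u' = snd U (q, p) u"
          by blast
        then show "\<exists>p\<in>carrier P. \<exists>q\<in>carrier Q. v = ract R V v' q \<and> ract Q U u' p = lact P U q u \<and> w' = lact S W p w"
          using eq[of "inv p" q] by (intro bexI[of _ "inv p"] bexI[of _ q]) auto
      qed
    qed
    also have "\<dots> \<longleftrightarrow> (\<exists>h\<in>carrier ?Q.
        x = ract (R \<bowtie> S) ?E x' h \<and> u' = lact trivial_grp ?T h u)"
      using m by (auto simp: x lr lo)
    finally show "?f x u = ?f x' u' \<longleftrightarrow> (\<exists>h\<in>carrier ?Q.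
        x = ract (R \<bowtie> S) ?E x' h \<and> u' = lact trivial_grp ?T h u)" .
  next
    fix k e x u assume *: "k \<in> carrier (R \<bowtie> S)" "x \<in> fst ?E" "u \<in> fst ?T"
    obtain v w r s where x: "x = (v, w)" "k = (r, s)" by (cases x; cases k)
    have "snd (?B ?VU W) (r, s) (?b (?a v u) w) = ?b (?a (lact Q V r v) u) (ract P W w s)"
      using * by (simp add: x to_opset_def RPS.cls_act[OF VU W] RQP.cls_mem[OF V U] RQP.cls_lact_ract[OF V U])
    moreover have "ract ?Q ?T u e = u"
      using * unfolding lo by (simp add: to_opset_def RQP.HG.fin_bisetD[OF U])
    ultimately show "snd (to_opset (?B ?VU W)) (k, e) (?f x u) =
        ?f (lact ?Q ?E k x) (ract ?Q ?T u e)"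
      using * by (simp add: x lr to_opset_def[of "?B ?VU W"])
  qed
  from E.mark_tensor[OF fin_biset_ext[OF V W] RQP.HG.fin_biset_to_opset[OF U] this]
  show ?thesis by (simp add: RPS.KG.mark_to_opset)
qed

lemma lift_mark_vcomp:
  assumes V: "fin_biset R Q V" and x: "x \<in> vmarks Q P" and W: "fin_biset P S W"
  shows "lift_mark (vcomp R P S (vcomp R Q P (mark R Q V) x) (mark P S W)) =
    vcomp (R \<bowtie> S) (Q \<bowtie> P) trivial_grp
      (mark (R \<bowtie> S) (Q \<bowtie> P) (ext_biset V W)) (lift_mark x)"
  using x
proof (induction rule: RQP.HG.vmarks_induct)
  case (mark U)
  then show ?case unfolding RQP.HG.mark_to_opset[symmetric] using V W
    by (simp add: RQP.vcomp_mark RPS.vcomp_mark E.vcomp_mark RQP.fin_biset_tensor fin_biset_ext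
      RQP.HG.fin_biset_to_opset mark_ext_tensor)
next
  case (diff x y)
  then show ?case using V W
    by (simp only: lift_mark_linear RQP.vcomp_diff_right RPS.vcomp_diff_left E.vcomp_diff_right RQP.KH.mark_vmarks
      RPS.HG.mark_vmarks RQP.vcomp_closed E.KH.mark_vmarks fin_biset_ext RQP.HG.lift_mark_vmarks)
qed
end

section \<open>Transitive bisets\<close>

text \<open>The stabilizer with its second component inverted, which makes it a subgroup of the
  plain product. In this form the identity biset gives the diagonal, and composition of bisets turns
  into composition of relations.\<close>

definition pt_rel :: "'h monoid \<Rightarrow> 'g monoid \<Rightarrow> ('h, 'g, 'x) biset \<Rightarrow> 'x \<Rightarrow> ('h \<times> 'g) set" where
  "pt_rel H G U u = {(h, g). h \<in> carrier H \<and> g \<in> carrier G \<and> lact G U h u = ract H U u g}"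

text \<open>The coset space of L, with g acting through its inverse to obtain a right action. By
  \<open>mark_orbit\<close> every transitive biset has the mark of one of these.\<close>

definition rel_biset :: "'h monoid \<Rightarrow> 'g monoid \<Rightarrow> ('h \<times> 'g) set \<Rightarrow> ('h, 'g, ('h \<times> 'g) set) biset" where
  "rel_biset H G L = ((\<lambda>z. z <#\<^bsub>H \<times>\<times> G\<^esub> L) ` carrier (H \<times>\<times> G),
     (\<lambda>(h, g). \<lambda>c\<in>(\<lambda>z. z <#\<^bsub>H \<times>\<times> G\<^esub> L) ` carrier (H \<times>\<times> G). (h, inv\<^bsub>G\<^esub> g) <#\<^bsub>H \<times>\<times> G\<^esub> c))"

definition tau :: "'h monoid \<Rightarrow> 'g monoid \<Rightarrow> ('h \<times> 'g) set \<Rightarrow> ('h, 'g) vmark" where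
  "tau H G L = mark H G (rel_biset H G L)"

lemma sum_fun_apply: "(sum f A) x = (\<Sum>a\<in>A. f a x)"
  by (induction A rule: infinite_finite_induct) auto

lemma (in group) l_coset_eq_iff:
  assumes "subgroup L G" "x \<in> carrier G" "y \<in> carrier G"
  shows "x <# L = y <# L \<longleftrightarrow> inv x \<otimes> y \<in> L"
proof
  interpret subgroup L G by fact
  assume "x <# L = y <# L"
  moreover have "y \<in> y <# L" using assms by (auto simp: l_coset_def intro!: bexI[of _ \<one>])
  ultimately obtain l where "l \<in> L" "y = x \<otimes> l" by (auto simp: l_coset_def)
  then show "inv x \<otimes> y \<in> L" using assms by (simp add: inv_solve_left' m_assoc[symmetric])
next
  interpret subgroup L G by fact
  assume *: "inv x \<otimes> y \<in> L"
  have "y <# L = x <# ((inv x \<otimes> y) <# L)"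
    using assms * by (simp add: lcos_m_assoc subset m_assoc[symmetric])
  also have "(inv x \<otimes> y) <# L = L"
    using * assms coset_join3[of "inv x \<otimes> y" L] by auto
  finally show "x <# L = y <# L" by simp
qed

context two_groups begin

lemma group_DP: "group (H \<times>\<times> G)" by (intro DirProd_group H.is_group G.is_group)

lemma inv_DP: "h \<in> carrier H \<Longrightarrow> g \<in> carrier G \<Longrightarrow> inv\<^bsub>H \<times>\<times> G\<^esub> (h, g) = (inv\<^bsub>H\<^esub> h, inv g)"
  by (simp add: inv_DirProd H.is_group G.is_group)

lemma rel_sub: "subgroup L (H \<times>\<times> G) \<Longrightarrow> (a, b) \<in> L \<Longrightarrow> a \<in> carrier H \<and> b \<in> carrier G"
  using subgroup.subset by fastforce

context
  fixes L assumes L: "subgroup L (H \<times>\<times> G)"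
begin

interpretation DP: group "H \<times>\<times> G" by (rule group_DP)

lemma rel_biset_act:
  assumes "h \<in> carrier H" "g \<in> carrier G" "x \<in> carrier H" "y \<in> carrier G"
  shows "snd (rel_biset H G L) (h, g) ((x, y) <#\<^bsub>H \<times>\<times> G\<^esub> L) = (h \<otimes>\<^bsub>H\<^esub> x, inv g \<otimes> y) <#\<^bsub>H \<times>\<times> G\<^esub> L"
  using assms subgroup.subset[OF L]
  by (simp add: rel_biset_def DP.lcos_m_assoc)

lemma rel_biset_cases:
  assumes "c \<in> fst (rel_biset H G L)"
  obtains x y where "x \<in> carrier H" "y \<in> carrier G" "c = (x, y) <#\<^bsub>H \<times>\<times> G\<^esub> L"
  using assms by (auto simp: rel_biset_def)

lemma rel_biset_mem: "x \<in> carrier H \<Longrightarrow> y \<in> carrier G \<Longrightarrow> (x, y) <#\<^bsub>H \<times>\<times> G\<^esub> L \<in> fst (rel_biset H G L)"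
  by (auto simp: rel_biset_def)

lemma fin_biset_rel: "fin_biset H G (rel_biset H G L)"
proof (rule fin_bisetI)
  show "finite (fst (rel_biset H G L))" by (simp add: rel_biset_def)
  show "snd (rel_biset H G L) (h, g) \<in> extensional (fst (rel_biset H G L))" for h g
    by (simp add: rel_biset_def)
qed (auto elim!: rel_biset_cases simp: rel_biset_act rel_biset_mem G.inv_mult_group H.m_assoc G.m_assoc)

lemma rel_biset_base: "L \<in> fst (rel_biset H G L)"
  using rel_biset_mem[of "\<one>\<^bsub>H\<^esub>" "\<one>"] DP.coset_join3[OF DP.one_closed L subgroup.one_closed[OF L]] by simp

lemma rel_biset_act_base:
  assumes "h \<in> carrier H" "g \<in> carrier G"
  shows "snd (rel_biset H G L) (h, g) L = (h, inv g) <#\<^bsub>H \<times>\<times> G\<^esub> L"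
  using rel_biset_act[OF assms H.one_closed G.one_closed] assms
    DP.coset_join3[OF DP.one_closed L subgroup.one_closed[OF L]] by simp

lemma rel_biset_orbit: "fst (rel_biset H G L) = orbit_of H G (rel_biset H G L) L"
proof (intro equalityI subsetI)
  fix c assume "c \<in> fst (rel_biset H G L)"
  then obtain x y where "x \<in> carrier H" "y \<in> carrier G" "c = (x, y) <#\<^bsub>H \<times>\<times> G\<^esub> L" by (rule rel_biset_cases)
  then have "c = snd (rel_biset H G L) (x, inv y) L" "inv y \<in> carrier G" by (simp_all add: rel_biset_act_base)
  then show "c \<in> orbit_of H G (rel_biset H G L) L" using \<open>x \<in> carrier H\<close> by (auto simp: orbit_of_def)
qed (auto simp: orbit_of_def fin_bisetD(3)[OF fin_biset_rel] rel_biset_base)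

lemma rel_biset_pt_rel: "pt_rel H G (rel_biset H G L) L = L"
proof -
  have "lact G (rel_biset H G L) h L = ract H (rel_biset H G L) L g \<longleftrightarrow> (h, g) \<in> L"
    if "h \<in> carrier H" "g \<in> carrier G" for h g
  proof -
    have "lact G (rel_biset H G L) h L = ract H (rel_biset H G L) L g \<longleftrightarrow>
       inv\<^bsub>H \<times>\<times> G\<^esub> (h, g) \<in> L"
      using that by (simp add: lact_def ract_def rel_biset_act_base DP.l_coset_eq_iff[OF L] inv_DP)
    also have "\<dots> \<longleftrightarrow> (h, g) \<in> L"
      using subgroup.m_inv_closed[OF L] DP.inv_inv[of "(h, g)"] that by (metis DirProd_sel(1) SigmaI)
    finally show ?thesis .
  qed
  then show ?thesis using rel_sub[OF L] by (auto simp: pt_rel_def)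
qed

lemma tau_vmarks: "tau H G L \<in> vmarks H G"
  unfolding tau_def by (rule mark_vmarks[OF fin_biset_rel])

end

lemma stab_of_pt_rel:
  assumes U: "fin_biset H G U" and u: "u \<in> fst U"
  shows "stab_of H G U u = {(h, g). h \<in> carrier H \<and> g \<in> carrier G \<and> (h, inv g) \<in> pt_rel H G U u}"
proof -
  have "snd U (h, g) u = u \<longleftrightarrow> lact G U h u = ract H U u (inv g)" if "h \<in> carrier H" "g \<in> carrier G" for h g
    using ract_eq_iff[OF U, of "lact G U h u" u g] that u U by (simp add: act_lact_ract)
  then show ?thesis using u by (auto simp: stab_of_def pt_rel_def)
qed

lemma pt_rel_subgroup:
  assumes U: "fin_biset H G U" and u: "u \<in> fst U" shows "subgroup (pt_rel H G U u) (H \<times>\<times> G)"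
proof -
  interpret DP: group "H \<times>\<times> G" by (rule group_DP)
  show ?thesis
  proof (rule DP.subgroupI)
    show "pt_rel H G U u \<noteq> {}" using u U by (auto simp: pt_rel_def intro!: exI[of _ "\<one>\<^bsub>H\<^esub>"] exI[of _ "\<one>"])
    fix a assume "a \<in> pt_rel H G U u"
    then obtain h g where a: "a = (h, g)" "h \<in> carrier H" "g \<in> carrier G" "lact G U h u = ract H U u g"
      by (auto simp: pt_rel_def)
    have "u = ract H U (lact G U (inv\<^bsub>H\<^esub> h) u) g"
      using a u U lact_eq_iff[OF U, of u "ract H U u g" h] by simp
    then have "lact G U (inv\<^bsub>H\<^esub> h) u = ract H U u (inv g)"
      using a u U ract_eq_iff[OF U, of "lact G U (inv\<^bsub>H\<^esub> h) u" u g] by simp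
    then show "inv\<^bsub>H \<times>\<times> G\<^esub> a \<in> pt_rel H G U u" using a by (simp add: pt_rel_def inv_DP)
    fix b assume "b \<in> pt_rel H G U u"
    then obtain h' g' where b: "b = (h', g')" "h' \<in> carrier H" "g' \<in> carrier G" "lact G U h' u = ract H U u g'"
      by (auto simp: pt_rel_def)
    have "lact G U (h \<otimes>\<^bsub>H\<^esub> h') u = lact G U h (lact G U h' u)"
      by (rule lact_ract(5)[OF U u a(2) b(2), symmetric])
    also have "\<dots> = ract H U (lact G U h u) g'"
      unfolding b(4) by (rule lact_ract(7)[OF U u a(2) b(3), symmetric])
    also have "\<dots> = ract H U u (g \<otimes> g')"
      unfolding a(4) by (rule lact_ract(6)[OF U u a(3) b(3)])
    finally show "a \<otimes>\<^bsub>H \<times>\<times> G\<^esub> b \<in> pt_rel H G U u" using a b by (simp add: pt_rel_def)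
  qed (auto simp: pt_rel_def)
qed

text \<open>The base coset of \<open>rel_biset\<close> at \<open>pt_rel H G U u\<close> has the same
  stabilizer as u, so the two orbits are isomorphic.\<close>

lemma mark_orbit:
  assumes U: "fin_biset H G U" and u: "u \<in> fst U"
  shows "mark H G (part_of U (orbit_of H G U u)) = tau H G (pt_rel H G U u)"
proof -
  let ?L = "pt_rel H G U u"
  note L = pt_rel_subgroup[OF U u]
  have "stab_of H G U u = stab_of H G (rel_biset H G ?L) ?L"
    by (simp add: stab_of_pt_rel[OF U u] stab_of_pt_rel[OF fin_biset_rel[OF L] rel_biset_base[OF L]] rel_biset_pt_rel[OF L])
  then have iso: "biset_iso H G (part_of U (orbit_of H G U u)) (part_of (rel_biset H G ?L) (orbit_of H G (rel_biset H G ?L) ?L))"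
    by (rule orbit_iso[OF U fin_biset_rel[OF L] u rel_biset_base[OF L]])
  have "mark H G (part_of (rel_biset H G ?L) (fst (rel_biset H G ?L))) = mark H G (rel_biset H G ?L)"
    by (rule ext) (simp add: mark_def part_of_def stab_of_def cong: conj_cong)
  then show ?thesis
    using mark_iso[OF fin_biset_part_of[OF U orbit_stable[OF U u]] iso]
    by (simp add: tau_def flip: rel_biset_orbit[OF L])
qed

lemma mark_orbits:
  assumes U: "fin_biset H G U" and R: "finite R" "R \<subseteq> fst U"
    and cover: "fst U \<subseteq> (\<Union>u\<in>R. orbit_of H G U u)"
    and disj: "\<And>u v. u \<in> R \<Longrightarrow> v \<in> R \<Longrightarrow> v \<in> orbit_of H G U u \<Longrightarrow> u = v"
  shows "mark H G U = (\<Sum>u\<in>R. tau H G (pt_rel H G U u))"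
proof
  let ?S = "stab_of H G U"
  let ?O = "orbit_of H G U"
  fix L
  have disj': "?O u \<inter> ?O v = {}" if uv: "u \<in> R" "v \<in> R" "u \<noteq> v" for u v
  proof (rule ccontr)
    assume "?O u \<inter> ?O v \<noteq> {}"
    then obtain h g h' g' where *: "h \<in> carrier H" "g \<in> carrier G" "h' \<in> carrier H" "g' \<in> carrier G"
      "snd U (h, g) u = snd U (h', g') v" by (auto simp: orbit_of_def)
    have "v = snd U (inv\<^bsub>H\<^esub> h', inv g') (snd U (h, g) u)"
      using act_eq_iff[OF U *(3,4), of v "snd U (h, g) u"] * R uv fin_bisetD(3)[OF U] by auto
    then have "v \<in> ?O u"
      using * R(2) uv fin_bisetD(5)[OF U, of "inv\<^bsub>H\<^esub> h'" "inv g'" h g u]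
      by (auto simp: orbit_of_def)
    then show False using disj uv by blast
  qed
  have sub: "?O u \<subseteq> fst U" if "u \<in> R" for u
    using orbit_stable[OF U, of u] R that by (auto simp: stable_def)
  show "mark H G U L = (\<Sum>u\<in>R. tau H G (pt_rel H G U u)) L"
  proof (cases "L \<subseteq> carrier H \<times> carrier G")
    case True
    have "{w \<in> fst U. L \<subseteq> ?S w} = (\<Union>u\<in>R. {w \<in> ?O u. L \<subseteq> ?S w})"
      using cover sub by blast
    also have "card \<dots> = (\<Sum>u\<in>R. card {w \<in> ?O u. L \<subseteq> ?S w})"
    proof (rule card_UN_disjoint)
      show "\<forall>u\<in>R. finite {w \<in> ?O u. L \<subseteq> ?S w}"
        using sub fin_bisetD(1)[OF U] by (auto intro: finite_subset)
    qed (use R(1) disj' in auto)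
    finally have "mark H G U L = (\<Sum>u\<in>R. int (card {w \<in> ?O u. L \<subseteq> ?S w}))"
      using True by (simp add: mark_def)
    also have "\<dots> = (\<Sum>u\<in>R. mark H G (part_of U (?O u)) L)"
    proof (rule sum.cong[OF refl])
      fix u assume "u \<in> R"
      then have "{w \<in> ?O u. L \<subseteq> ?S w} =
          {w \<in> fst (part_of U (?O u)). L \<subseteq> stab_of H G (part_of U (?O u)) w}"
        using sub by (auto simp: part_of_def stab_of_def)
      then show "int (card {w \<in> ?O u. L \<subseteq> ?S w}) = mark H G (part_of U (?O u)) L"
        using True by (simp add: mark_def)
    qed
    also have "\<dots> = (\<Sum>u\<in>R. tau H G (pt_rel H G U u) L)"
      by (rule sum.cong[OF refl]) (use R mark_orbit[OF U] in auto)
    finally show ?thesis by (simp add: sum_fun_apply)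
  qed (simp add: mark_def tau_def sum_fun_apply)
qed

end

lemma (in two_groups) mark_transitive:
  assumes U: "fin_biset H G U" and u: "u \<in> fst U" and "fst U \<subseteq> orbit_of H G U u"
  shows "mark H G U = tau H G (pt_rel H G U u)"
  using mark_orbits[OF U, of "{u}"] assms by simp

context three_groups begin

abbreviation mac where
  "mac L M x \<equiv> {(k, g). \<exists>h\<in>carrier H. (k, x \<otimes> h \<otimes> inv x) \<in> L \<and> (h, g) \<in> M}"

text \<open>The Mackey formula for transitive bisets; \<open>X\<close> is a set of representatives of the double
  cosets of the projections of \<open>L\<close> and \<open>M\<close> to \<open>H\<close>.\<close>

lemma vcomp_tau:
  assumes L: "subgroup L (K \<times>\<times> H)" and M: "subgroup M (H \<times>\<times> G)" and X: "X \<subseteq> carrier H"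
    and cover: "\<And>h. h \<in> carrier H \<Longrightarrow> \<exists>a\<in>Range L. \<exists>x\<in>X. \<exists>b\<in>Domain M. h = a \<otimes> x \<otimes> b"
    and inj: "\<And>a x b y. a \<in> Range L \<Longrightarrow> b \<in> Domain M \<Longrightarrow> x \<in> X \<Longrightarrow> y \<in> X \<Longrightarrow> y = a \<otimes> x \<otimes> b \<Longrightarrow> x = y"
  shows "vcomp K H G (tau K H L) (tau H G M) =
    (\<Sum>x\<in>X. tau K G (mac L M x))"
proof -
  let ?V = "rel_biset K H L" and ?U = "rel_biset H G M"
  note V = KH.fin_biset_rel[OF L] and U = HG.fin_biset_rel[OF M]
  note v0 = KH.rel_biset_base[OF L] and u0 = HG.rel_biset_base[OF M]
  let ?W = "biset_tensor K H G ?V ?U"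
  note W = fin_biset_tensor[OF V U]
  let ?c = "tensor_cls K H G ?V ?U"
  \<comment> \<open>The representative for x: the base point of the first biset is translated by x
    before it is paired with the base point of the second.\<close>
  define w where "w x = ?c (ract K ?V L x) M" for x
  note Hs = KH.rel_sub[OF L] HG.rel_sub[OF M]
  have Leq: "(k, h) \<in> L \<longleftrightarrow> lact H ?V k L = ract K ?V L h" if "k \<in> carrier K" "h \<in> carrier H" for k h
    using KH.rel_biset_pt_rel[OF L] that by (auto simp: pt_rel_def)
  have Meq: "(h, g) \<in> M \<longleftrightarrow> lact G ?U h M = ract H ?U M g" if "h \<in> carrier H" "g \<in> carrier G" for h g
    using HG.rel_biset_pt_rel[OF M] that by (auto simp: pt_rel_def)
  have wW: "w x \<in> fst ?W" if "x \<in> carrier H" for x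
    using that v0 u0 V by (simp add: w_def cls_mem[OF V U])
  have shift: "snd ?W (k, g) (w x) = ?c (lact H ?V k (ract K ?V L x)) (ract H ?U M g)"
    if "x \<in> carrier H" "k \<in> carrier K" "g \<in> carrier G" for x k g
    using that v0 u0 V by (simp add: w_def cls_act[OF V U])
  \<comment> \<open>The balancing element h is what survives in \<open>mac\<close>. For y = x the
    equivalence computes the stabilizer of a representative; for general y it decides whether two
    representatives lie in one orbit.\<close>
  have rel: "?c (lact H ?V k (ract K ?V L x)) (ract H ?U M g) = w y \<longleftrightarrow>
      (\<exists>h\<in>carrier H. (k, y \<otimes> h \<otimes> inv x) \<in> L \<and> (h, inv\<^bsub>G\<^esub> g) \<in> M)"
    if [simp]: "x \<in> carrier H" "y \<in> carrier H" "k \<in> carrier K" "g \<in> carrier G" for x y k g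
  proof -
    have "?c (lact H ?V k (ract K ?V L x)) (ract H ?U M g) = w y \<longleftrightarrow>
      (\<exists>h\<in>carrier H. lact H ?V k (ract K ?V L x) = ract K ?V (ract K ?V L y) h \<and> M = lact G ?U h (ract H ?U M g))"
      unfolding w_def by (rule cls_eq_iff[OF V U]) (simp_all add: V U v0 u0)
    also have "\<dots> \<longleftrightarrow> (\<exists>h\<in>carrier H. (k, y \<otimes> h \<otimes> inv x) \<in> L \<and> (h, inv\<^bsub>G\<^esub> g) \<in> M)"
    proof (rule bex_cong[OF refl])
      fix h assume [simp]: "h \<in> carrier H"
      have "lact H ?V k (ract K ?V L x) = ract K ?V (ract K ?V L y) h \<longleftrightarrow>
          ract K ?V (lact H ?V k L) x = ract K ?V L (y \<otimes> h)"
        by (simp add: V v0)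
      also have "\<dots> \<longleftrightarrow> lact H ?V k L = ract K ?V L (y \<otimes> h \<otimes> inv x)"
        using KH.ract_eq_iff[OF V, of "lact H ?V k L" "ract K ?V L (y \<otimes> h)" x] by (simp add: V v0 KH.G.m_assoc)
      also have "\<dots> \<longleftrightarrow> (k, y \<otimes> h \<otimes> inv x) \<in> L" by (simp add: Leq)
      finally have 1: "lact H ?V k (ract K ?V L x) = ract K ?V (ract K ?V L y) h \<longleftrightarrow> (k, y \<otimes> h \<otimes> inv x) \<in> L" .
      have "M = lact G ?U h (ract H ?U M g) \<longleftrightarrow> ract H ?U (lact G ?U h M) g = M"
        by (auto simp: U u0)
      also have "\<dots> \<longleftrightarrow> (h, inv\<^bsub>G\<^esub> g) \<in> M"
        using HG.ract_eq_iff[OF U, of "lact G ?U h M" M g] by (simp add: U u0 Meq)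
      finally show "(lact H ?V k (ract K ?V L x) = ract K ?V (ract K ?V L y) h \<and> M = lact G ?U h (ract H ?U M g)) \<longleftrightarrow>
          (k, y \<otimes> h \<otimes> inv x) \<in> L \<and> (h, inv\<^bsub>G\<^esub> g) \<in> M" using 1 by simp
    qed
    finally show ?thesis .
  qed
  have orb: "w y \<in> orbit_of K G ?W (w x) \<Longrightarrow> x = y" if xy: "x \<in> X" "y \<in> X" for x y
  proof -
    assume "w y \<in> orbit_of K G ?W (w x)"
    then obtain k g where kg: "k \<in> carrier K" "g \<in> carrier G" "snd ?W (k, g) (w x) = w y"
      by (auto simp: orbit_of_def)
    have [simp]: "x \<in> carrier H" "y \<in> carrier H" using X xy by auto
    obtain h where h: "h \<in> carrier H" "(k, y \<otimes> h \<otimes> inv x) \<in> L" "(h, inv\<^bsub>G\<^esub> g) \<in> M"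
      using kg shift[of x k g] rel[of x y k g] by auto
    have "(inv h, g) \<in> M"
      using subgroup.m_inv_closed[OF M h(3)] h(1) kg by (simp add: HG.inv_DP)
    moreover have "y = (y \<otimes> h \<otimes> inv x) \<otimes> x \<otimes> inv h"
      using h(1) by (simp add: KH.G.m_assoc)
    ultimately show "x = y" using inj h(2) xy by blast
  qed
  have winj: "inj_on w X"
  proof (rule inj_onI)
    fix x y assume "x \<in> X" "y \<in> X" "w x = w y"
    then show "x = y" using orb[of x y] KG.orbit_self[OF W wW[of x]] X by auto
  qed
  have "mark K G ?W = (\<Sum>u\<in>w ` X. tau K G (pt_rel K G ?W u))"
  proof (rule KG.mark_orbits[OF W])
    show "finite (w ` X)" using finite_subset[OF X] by simp
    show "w ` X \<subseteq> fst ?W" using wW X by auto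
    show "fst ?W \<subseteq> (\<Union>u\<in>w ` X. orbit_of K G ?W u)"
    proof
      fix t assume "t \<in> fst ?W"
      then obtain v u where vu: "v \<in> fst ?V" "u \<in> fst ?U" "t = ?c v u" by (rule cls_cases[OF V U])
      obtain k h1 where k: "k \<in> carrier K" "h1 \<in> carrier H" "v = lact H ?V k (ract K ?V L h1)"
        using vu(1) unfolding KH.rel_biset_orbit[OF L] by (auto simp: orbit_of_def KH.act_lact_ract[OF V v0])
      obtain h2 g where g: "h2 \<in> carrier H" "g \<in> carrier G" "u = lact G ?U h2 (ract H ?U M g)"
        using vu(2) unfolding HG.rel_biset_orbit[OF M] by (auto simp: orbit_of_def HG.act_lact_ract[OF U u0])
      \<comment> \<open>Up to the outer actions a class depends only on the product of h1 and h2. In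
        the factorization of that product a is absorbed by L on the left and b by M on the
        right.\<close>
      obtain a x b where axb: "a \<in> Range L" "x \<in> X" "b \<in> Domain M" "h1 \<otimes> h2 = a \<otimes> x \<otimes> b"
        using cover[of "h1 \<otimes> h2"] k g by auto
      obtain k' g' where kg': "(k', a) \<in> L" "(b, g') \<in> M" using axb by auto
      have [simp]: "x \<in> carrier H" "a \<in> carrier H" "b \<in> carrier H" "k' \<in> carrier K" "g' \<in> carrier G"
        "h1 \<in> carrier H" "h2 \<in> carrier H" "k \<in> carrier K" "g \<in> carrier G"
        using X axb Hs kg' k g by auto
      have La: "ract K ?V L a = lact H ?V k' L" and Mb: "lact G ?U b M = ract H ?U M g'"
        using Leq[of k' a] Meq[of b g'] kg' by simp_all
      have "ract K ?V v h2 = lact H ?V k (ract K ?V L (a \<otimes> x \<otimes> b))"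
        unfolding k(3) by (simp add: V v0 axb(4))
      also have "ract K ?V L (a \<otimes> x \<otimes> b) = ract K ?V (ract K ?V L a) (x \<otimes> b)"
        by (simp add: V v0 KH.G.m_assoc)
      finally have vh: "ract K ?V v h2 = ract K ?V (lact H ?V (k \<otimes>\<^bsub>K\<^esub> k') (ract K ?V L x)) b"
        unfolding La by (simp add: V v0)
      have "t = ?c (ract K ?V v h2) (ract H ?U M g)"
        unfolding vu(3) g(3) by (subst cls_balanced[OF V U]) (simp_all add: vu(1) U u0)
      also have "\<dots> = ?c (lact H ?V (k \<otimes>\<^bsub>K\<^esub> k') (ract K ?V L x)) (lact G ?U b (ract H ?U M g))"
        unfolding vh by (rule cls_balanced[OF V U]) (simp_all add: V v0 U u0)
      also have "lact G ?U b (ract H ?U M g) = ract H ?U (lact G ?U b M) g"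
        by (simp add: U u0)
      also have "\<dots> = ract H ?U M (g' \<otimes>\<^bsub>G\<^esub> g)" unfolding Mb by (simp add: U u0)
      also have "?c (lact H ?V (k \<otimes>\<^bsub>K\<^esub> k') (ract K ?V L x)) (ract H ?U M (g' \<otimes>\<^bsub>G\<^esub> g)) =
          snd ?W (k \<otimes>\<^bsub>K\<^esub> k', g' \<otimes>\<^bsub>G\<^esub> g) (w x)" by (simp add: shift)
      finally have "t \<in> orbit_of K G ?W (w x)" unfolding orbit_of_def
        by (intro CollectI exI[of _ "k \<otimes>\<^bsub>K\<^esub> k'"] exI[of _ "g' \<otimes>\<^bsub>G\<^esub> g"]) simp
      then show "t \<in> (\<Union>u\<in>w ` X. orbit_of K G ?W u)" using axb by blast
    qed
  qed (use orb in blast)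
  also have "\<dots> = (\<Sum>x\<in>X. tau K G (pt_rel K G ?W (w x)))"
    using winj by (simp add: sum.reindex)
  also have "\<dots> = (\<Sum>x\<in>X. tau K G (mac L M x))"
  proof (rule sum.cong[OF refl])
    fix x assume "x \<in> X"
    then have [simp]: "x \<in> carrier H" using X by auto
    have "(k, g) \<in> pt_rel K G ?W (w x) \<longleftrightarrow> (\<exists>h\<in>carrier H. (k, x \<otimes> h \<otimes> inv x) \<in> L \<and> (h, g) \<in> M)" for k g
    proof (cases "k \<in> carrier K \<and> g \<in> carrier G")
      case True
      have "(k, g) \<in> pt_rel K G ?W (w x) \<longleftrightarrow> snd ?W (k, inv\<^bsub>G\<^esub> g) (w x) = w x"
      proof -
        have "(k, g) \<in> pt_rel K G ?W (w x) \<longleftrightarrow> (k, inv\<^bsub>G\<^esub> g) \<in> stab_of K G ?W (w x)"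
          by (subst KG.stab_of_pt_rel[OF W wW]) (use True in simp_all)
        then show ?thesis using True by (simp add: stab_of_def)
      qed
      also have "\<dots> \<longleftrightarrow> (\<exists>h\<in>carrier H. (k, x \<otimes> h \<otimes> inv x) \<in> L \<and> (h, g) \<in> M)"
        using True by (simp add: shift rel)
      finally show ?thesis .
    qed (use Hs in \<open>auto simp: pt_rel_def\<close>)
    then have "pt_rel K G ?W (w x) = mac L M x"
      by auto
    then show "tau K G (pt_rel K G ?W (w x)) = tau K G (mac L M x)"
      by simp
  qed
  finally show ?thesis unfolding tau_def[of K H L] tau_def[of H G M] vcomp_mark[OF V U] .
qed

text \<open>There is a single double coset, represented by 1, and at 1 the relation of the Mackey
  formula is the composite of L and M.\<close>

lemma vcomp_tau_single:
  assumes L: "subgroup L (K \<times>\<times> H)" and M: "subgroup M (H \<times>\<times> G)"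
    and cover: "\<And>h. h \<in> carrier H \<Longrightarrow> \<exists>a\<in>Range L. \<exists>b\<in>Domain M. h = a \<otimes> b"
  shows "vcomp K H G (tau K H L) (tau H G M) = tau K G (L O M)"
proof -
  have [simp]: "a \<in> carrier H" if "a \<in> Range L" for a using that KH.rel_sub[OF L] by auto
  have "vcomp K H G (tau K H L) (tau H G M) = (\<Sum>x\<in>{\<one>}. tau K G (mac L M x))"
    by (rule vcomp_tau[OF L M]) (use cover in \<open>auto cong: bex_cong\<close>)
  moreover have "mac L M \<one> = L O M"
    using KH.rel_sub[OF L] by fastforce
  ultimately show ?thesis by simp
qed

lemma vcomp_tau_Domain:
  assumes L: "subgroup L (K \<times>\<times> H)" and M: "subgroup M (H \<times>\<times> G)" and "Domain M = carrier H"
  shows "vcomp K H G (tau K H L) (tau H G M) = tau K G (L O M)"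
proof (rule vcomp_tau_single[OF L M])
  fix h assume "h \<in> carrier H"
  moreover have "\<one> \<in> Range L" using subgroup.one_closed[OF L] by auto
  ultimately show "\<exists>a\<in>Range L. \<exists>b\<in>Domain M. h = a \<otimes> b" using assms(3) by force
qed

lemma vcomp_tau_Range:
  assumes L: "subgroup L (K \<times>\<times> H)" and M: "subgroup M (H \<times>\<times> G)" and "Range L = carrier H"
  shows "vcomp K H G (tau K H L) (tau H G M) = tau K G (L O M)"
proof (rule vcomp_tau_single[OF L M])
  fix h assume "h \<in> carrier H"
  moreover have "\<one> \<in> Domain M" using subgroup.one_closed[OF M] by auto
  ultimately show "\<exists>a\<in>Range L. \<exists>b\<in>Domain M. h = a \<otimes> b" using assms(3) by force
qed

text \<open>C has index two and contains both projections, so its two cosets are the double cosets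
  and 1 and x represent them.\<close>

lemma vcomp_tau_two:
  assumes L: "subgroup L (K \<times>\<times> H)" and M: "subgroup M (H \<times>\<times> G)"
    and C: "Range L = C" "Domain M \<subseteq> C" "subgroup C H" and x: "x \<in> carrier H" "x \<notin> C"
    and two: "\<And>h. h \<in> carrier H \<Longrightarrow> h \<notin> C \<Longrightarrow> h \<otimes> inv x \<in> C"
  shows "vcomp K H G (tau K H L) (tau H G M) = tau K G (L O M) +
    tau K G (mac L M x)"
proof -
  have [simp]: "a \<in> carrier H" if "a \<in> C" for a using that C(3) subgroup.subset by blast
  have 1: "\<one> \<in> Domain M" using subgroup.one_closed[OF M] by auto
  have ne: "x \<noteq> \<one>" using x subgroup.one_closed[OF C(3)] by auto
  note Cc = subgroup.m_closed[OF C(3)] subgroup.m_inv_closed[OF C(3)]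
  have "vcomp K H G (tau K H L) (tau H G M) = (\<Sum>x\<in>{\<one>, x}. tau K G (mac L M x))"
  proof (rule vcomp_tau[OF L M])
    fix h assume h: "h \<in> carrier H"
    show "\<exists>a\<in>Range L. \<exists>y\<in>{\<one>, x}. \<exists>b\<in>Domain M. h = a \<otimes> y \<otimes> b"
    proof (cases "h \<in> C")
      case True
      then show ?thesis using 1 C(1) by (intro bexI[of _ h] bexI[of _ "\<one>"]) auto
    next
      case False
      then show ?thesis using 1 C(1) two[OF h False] h x(1)
        by (intro bexI[of _ "h \<otimes> inv x"] bexI[of _ x] bexI[of _ "\<one>"]) (auto simp: KH.G.m_assoc)
    qed
  next
    fix a y b z assume *: "a \<in> Range L" "b \<in> Domain M" "y \<in> {\<one>, x}" "z \<in> {\<one>, x}" "z = a \<otimes> y \<otimes> b"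
    have ab: "a \<in> C" "b \<in> C" using * C by auto
    have False if "y = x" "z = \<one>"
    proof -
      have "x = inv a \<otimes> (a \<otimes> x \<otimes> b) \<otimes> inv b"
        using ab x(1) by (simp add: KH.G.m_assoc) (simp flip: KH.G.m_assoc)
      then show False using ab Cc x that *(5) by auto
    qed
    moreover have False if "y = \<one>" "z = x" using that * ab Cc x by auto
    ultimately show "y = z" using * by auto
  qed (use x in auto)
  moreover have "mac L M \<one> = L O M"
    using KH.rel_sub[OF L] by fastforce
  ultimately show ?thesis using ne by simp
qed

end

section \<open>The Sylow subgroup as a group of unitriangular matrices\<close>

definition utmat :: "bit \<Rightarrow> bit \<Rightarrow> bit \<Rightarrow> bit ^ 3 ^ 3" where
  "utmat c a b = vector [vector [1, c, b], vector [0, 1, a], vector [0, 0, 1]]"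

text \<open>Over the field with two elements the only nonzero scalar is 1, so the coset of a matrix
  in the projective group contains just that matrix.\<close>

definition ut :: "bit \<Rightarrow> bit \<Rightarrow> bit \<Rightarrow> (bit ^ 3 ^ 3) set" where
  "ut c a b = {utmat c a b}"

abbreviation v3 :: "bit \<Rightarrow> bit \<Rightarrow> bit \<Rightarrow> bit ^ 3" where "v3 x y z \<equiv> vector [x, y, z]"

lemma v3_simps [simp]:
  "v3 x y z = v3 x' y' z' \<longleftrightarrow> x = x' \<and> y = y' \<and> z = z'"
  "v3 x y z + v3 x' y' z' = v3 (x + x') (y + y') (z + z')"
  "utmat c a b *v v3 x y z = v3 (x + c * y + b * z) (y + a * z) z"
  "v3 x y z = 0 \<longleftrightarrow> x = 0 \<and> y = 0 \<and> z = 0"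
  by (simp_all add: vec_eq_iff forall_3 utmat_def matrix_vector_mult_def sum_3 add.assoc)

lemma v3_zero: "0 = v3 0 0 0" by (simp add: vec_eq_iff forall_3)

lemma v3_cases: obtains x y z where "v = v3 x y z"
proof
  show "v = v3 (v $ 1) (v $ 2) (v $ 3)" by (simp add: vec_eq_iff forall_3)
qed

lemma utmat_mult: "utmat c a b ** utmat c' a' b' = utmat (c + c') (a + a') (b + b' + c * a')"
  by (simp only: vec_eq_iff forall_3 utmat_def matrix_matrix_mult_def sum_3 vec_lambda_beta vector_3
    mult_1_left mult_1_right mult_zero_left mult_zero_right add_0_left add_0_right ac_simps)

lemma utmat_inj: "utmat c a b = utmat c' a' b' \<longleftrightarrow> c = c' \<and> a = a' \<and> b = b'"
  by (auto simp: vec_eq_iff forall_3 utmat_def)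

lemma utmat_one: "mat 1 = utmat 0 0 0"
  by (simp add: vec_eq_iff forall_3 utmat_def mat_def)

lemma scalars3_eq: "scalars3 = {mat 1}" by (auto simp: scalars3_def)

lemma unitriangular3_eq: "unitriangular3 = {utmat c a b | c a b. True}"
proof (intro equalityI subsetI)
  fix A assume "A \<in> unitriangular3"
  then have "A = utmat (A $ 1 $ 2) (A $ 2 $ 3) (A $ 1 $ 3)"
    by (simp add: unitriangular3_def utmat_def vec_eq_iff forall_3)
  then show "A \<in> {utmat c a b | c a b. True}" by blast
qed (auto simp: unitriangular3_def utmat_def forall_3)

lemma ut_inj [simp]: "ut c a b = ut c' a' b' \<longleftrightarrow> c = c' \<and> a = a' \<and> b = b'"
  by (simp add: ut_def utmat_inj)

lemma sylow3_carrier: "carrier sylow3 = {ut c a b | c a b. True}"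
  by (auto simp: sylow3_def scalars3_eq r_coset_def GL3_def unitriangular3_eq ut_def image_def)

lemma sylow3_mult [simp]: "ut c a b \<otimes>\<^bsub>sylow3\<^esub> ut c' a' b' = ut (c + c') (a + a') (b + b' + c * a')"
  by (simp add: sylow3_def PGL3_def FactGroup_def set_mult_def ut_def GL3_def utmat_mult)

lemma sylow3_one: "\<one>\<^bsub>sylow3\<^esub> = ut 0 0 0"
  by (simp add: sylow3_def PGL3_def FactGroup_def scalars3_eq ut_def utmat_one)

lemma ut_mem [simp]: "ut c a b \<in> carrier sylow3" by (auto simp: sylow3_carrier)

lemma sylow3_cases: assumes "x \<in> carrier sylow3" obtains c a b where "x = ut c a b"
  using assms by (auto simp: sylow3_carrier)

lemma finite_bit: "finite (UNIV :: bit set)"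
proof -
  have "(UNIV :: bit set) = {0, 1}" using bit_not_one_iff by blast
  then show ?thesis by (metis finite.emptyI finite.insertI)
qed

lemma group_sylow3: "group sylow3"
proof (rule groupI)
  fix x y assume x: "x \<in> carrier sylow3" and y: "y \<in> carrier sylow3"
  obtain c a b where x: "x = ut c a b" using x by (rule sylow3_cases)
  obtain c' a' b' where y: "y = ut c' a' b'" using y by (rule sylow3_cases)
  show "x \<otimes>\<^bsub>sylow3\<^esub> y \<in> carrier sylow3" unfolding x y sylow3_mult by (rule ut_mem)
  fix z assume "z \<in> carrier sylow3"
  then obtain c'' a'' b'' where z: "z = ut c'' a'' b''" by (rule sylow3_cases)
  show "x \<otimes>\<^bsub>sylow3\<^esub> y \<otimes>\<^bsub>sylow3\<^esub> z = x \<otimes>\<^bsub>sylow3\<^esub> (y \<otimes>\<^bsub>sylow3\<^esub> z)"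
    unfolding x y z sylow3_mult ut_inj by (simp only: distrib_left distrib_right ac_simps)
next
  fix x assume "x \<in> carrier sylow3"
  then obtain c a b where x: "x = ut c a b" by (rule sylow3_cases)
  show "\<one>\<^bsub>sylow3\<^esub> \<otimes>\<^bsub>sylow3\<^esub> x = x" by (simp add: x sylow3_one)
  have "ut c a (b + c * a) \<otimes>\<^bsub>sylow3\<^esub> x = \<one>\<^bsub>sylow3\<^esub>"
    unfolding x sylow3_one sylow3_mult ut_inj by (cases a; cases b; cases c; simp)
  then show "\<exists>y\<in>carrier sylow3. y \<otimes>\<^bsub>sylow3\<^esub> x = \<one>\<^bsub>sylow3\<^esub>" using ut_mem by blast
qed (simp add: sylow3_one)

lemma finite_group_sylow3: "finite_group sylow3"
proof -
  have "carrier sylow3 = (\<Union>c. \<Union>a. \<Union>b. {ut c a b})" unfolding sylow3_carrier by blast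
  then show ?thesis using finite_bit group_sylow3 by (simp add: finite_group_def)
qed

interpretation X: two_groups sylow3 trivial_grp
  by unfold_locales (rule finite_group_sylow3 finite_group_trivial)+

lemma inv_ut: "inv\<^bsub>sylow3\<^esub> (ut c a b) = ut c a (b + c * a)"
  by (rule X.H.inv_equality) (cases a; cases b; cases c; simp add: sylow3_one)+

section \<open>Orbits on the points and lines of the projective plane\<close>

abbreviation ut_im where "ut_im c a b S \<equiv> (*v) (utmat c a b) ` S"

lemma proj_act_ut: "proj_act (ut c a b) S = ut_im c a b S"
  by (simp add: proj_act_def ut_def)

lemma bit_scale: "(c :: bit) *s v = (if c = 0 then 0 else v)"
  by (cases c) auto

lemma span1: "vec.span {v :: bit ^ 3} = {0, v}"
proof -
  have "range (\<lambda>c :: bit. c *s v) = {0, v}"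
    by (auto simp: bit_scale image_iff)
  then show ?thesis by (simp add: vec.span_singleton)
qed

lemma span2: "vec.span {v :: bit ^ 3, w} = {0, v, w, v + w}"
proof -
  have "x \<in> vec.span {v, w} \<longleftrightarrow> (\<exists>k :: bit. x - k *s v \<in> {0, w})" for x
    using vec.span_breakdown_eq[of x v "{w}"] by (simp add: span1)
  also have "\<dots> x \<longleftrightarrow> x \<in> {0, v, w, v + w}" for x
  proof -
    have "(\<exists>k :: bit. x - k *s v \<in> {0, w}) \<longleftrightarrow> x \<in> {0, w} \<or> x - v \<in> {0, w}"
      by (auto simp: bit_scale split: if_splits)
    also have "\<dots> \<longleftrightarrow> x \<in> {0, v, w, v + w}" by (auto simp: diff_eq_eq add.commute)
    finally show ?thesis .
  qed
  finally show ?thesis by blast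
qed

text \<open>Over the field with two elements a one-dimensional space has a single nonzero vector. A
  two-dimensional one has three, each of them the sum of the other two.\<close>

lemma proj_points_eq: "proj_points = {{0, v} | v. v \<noteq> 0}"
proof (intro equalityI subsetI)
  fix S assume "S \<in> proj_points"
  then have S: "vec.subspace S" "vec.dim S = 1" by (auto simp: proj_points_def)
  obtain B where B: "B \<subseteq> S" "vec.independent B" "S \<subseteq> vec.span B" "card B = vec.dim S"
    using vec.basis_exists by blast
  then obtain v where v: "B = {v}" using S by (auto simp: card_1_singleton_iff)
  have "S = vec.span {v}" using B v S by (metis vec.span_minimal subset_antisym)
  moreover have "v \<noteq> 0" using B v vec.dependent_zero by blast
  ultimately show "S \<in> {{0, v} | v. v \<noteq> 0}" by (auto simp: span1)
next
  fix S assume "S \<in> {{0, v :: bit ^ 3} | v. v \<noteq> 0}"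
  then obtain v where v: "S = vec.span {v}" "v \<noteq> 0" by (auto simp: span1)
  then have "vec.independent {v}" by simp
  then have "vec.dim S = 1" using v by (simp add: vec.dim_span_eq_card_independent)
  then show "S \<in> proj_points" using v by (simp add: proj_points_def)
qed

lemma proj_lines_eq: "proj_lines = {{0, v, w, v + w} | v w. v \<noteq> 0 \<and> w \<noteq> 0 \<and> v \<noteq> w}"
proof (intro equalityI subsetI)
  fix S assume "S \<in> proj_lines"
  then have S: "vec.subspace S" "vec.dim S = 2" by (auto simp: proj_lines_def)
  obtain B where B: "B \<subseteq> S" "vec.independent B" "S \<subseteq> vec.span B" "card B = vec.dim S"
    using vec.basis_exists by blast
  then obtain v w where v: "B = {v, w}" "v \<noteq> w" using S by (auto simp: card_2_iff)
  have "S = vec.span {v, w}" using B v S by (metis vec.span_minimal subset_antisym)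
  moreover have "0 \<notin> B" using B vec.dependent_zero by blast
  ultimately show "S \<in> {{0, v, w, v + w} | v w. v \<noteq> 0 \<and> w \<noteq> 0 \<and> v \<noteq> w}"
    using v by (auto simp: span2)
next
  fix S assume "S \<in> {{0, v, w, v + w :: bit ^ 3} | v w. v \<noteq> 0 \<and> w \<noteq> 0 \<and> v \<noteq> w}"
  then obtain v w where v: "S = vec.span {v, w}" "v \<noteq> 0" "w \<noteq> 0" "v \<noteq> w" by (auto simp: span2)
  then have "vec.independent {v, w}" by (simp add: vec.independent_insert span1)
  then have "vec.dim S = 2" using v vec.dim_span_eq_card_independent[of "{v, w}"] by (simp del: vec.dim_span)
  then show "S \<in> proj_lines" using v by (simp add: proj_lines_def)
qed

lemma finite_bit3: "finite (UNIV :: (bit ^ 3) set)"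
proof (rule finite_subset)
  let ?U = "UNIV \<times> UNIV \<times> UNIV"
  show "UNIV \<subseteq> (\<lambda>(x, y, z). v3 x y z) ` ?U"
  proof
    fix v :: "bit ^ 3"
    obtain x y z where "v = v3 x y z" by (rule v3_cases)
    then have "v = (\<lambda>(x, y, z). v3 x y z) (x, y, z)" by simp
    then show "v \<in> (\<lambda>(x, y, z). v3 x y z) ` ?U" by (rule image_eqI) simp
  qed
  show "finite ((\<lambda>(x, y, z). v3 x y z) ` ?U)"
    by (intro finite_imageI finite_cartesian_product finite_bit)
qed

lemma trivial_grp_simps [simp]: "\<one>\<^bsub>trivial_grp\<^esub> = ()" "x \<otimes>\<^bsub>trivial_grp\<^esub> y = ()"
  by (simp_all add: singleton_group_def)

lemma fin_biset_proj_set: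
  assumes F: "\<And>c a b S. S \<in> F \<Longrightarrow> ut_im c a b S \<in> F"
  shows "fin_biset sylow3 trivial_grp (proj_set F)"
proof (rule X.fin_bisetI)
  have "finite (UNIV :: (bit ^ 3) set set)" using finite_bit3 by (simp add: Finite_Set.finite_set)
  then show "finite (fst (proj_set F))" by (metis finite_subset top_greatest)
  show "snd (proj_set F) (\<one>\<^bsub>sylow3\<^esub>, \<one>\<^bsub>trivial_grp\<^esub>) S = S" if "S \<in> fst (proj_set F)" for S
    using that by (simp add: proj_set_def sylow3_one proj_act_ut flip: utmat_one)
next
  fix h g h' g' S
  assume h: "h \<in> carrier sylow3" and h': "h' \<in> carrier sylow3" and S: "S \<in> fst (proj_set F)"
  obtain c a b where h: "h = ut c a b" using h by (rule sylow3_cases)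
  obtain c' a' b' where h': "h' = ut c' a' b'" using h' by (rule sylow3_cases)
  have "ut_im c a b (ut_im c' a' b' S) = ut_im (c + c') (a + a') (b + b' + c * a') S"
    unfolding image_image matrix_vector_mul_assoc utmat_mult ..
  then show "snd (proj_set F) (h, g) (snd (proj_set F) (h', g') S) =
      snd (proj_set F) (h \<otimes>\<^bsub>sylow3\<^esub> h', g' \<otimes>\<^bsub>trivial_grp\<^esub> g) S"
    using S F by (simp add: proj_set_def h h' proj_act_ut)
qed (use F in \<open>auto simp: proj_set_def proj_act_ut elim!: sylow3_cases\<close>)

lemma proj_set_pt_rel:
  assumes F: "\<And>c a b S. S \<in> F \<Longrightarrow> ut_im c a b S \<in> F" and S: "S \<in> F"
  shows "pt_rel sylow3 trivial_grp (proj_set F) S = {(ut c a b, ()) | c a b. ut_im c a b S = S}"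
proof -
  have "ract sylow3 (proj_set F) S () = S"
    using X.lact_ract(4)[OF fin_biset_proj_set[OF F], of S] S by (simp add: proj_set_def)
  moreover have "lact trivial_grp (proj_set F) (ut c a b) S = ut_im c a b S" for c a b
    using S by (simp add: lact_def proj_set_def proj_act_ut)
  ultimately show ?thesis by (auto simp: pt_rel_def sylow3_carrier)
qed

lemma proj_set_orbit:
  assumes "S \<in> F"
  shows "T \<in> orbit_of sylow3 trivial_grp (proj_set F) S \<longleftrightarrow> (\<exists>c a b. T = ut_im c a b S)"
proof -
  have "T \<in> orbit_of sylow3 trivial_grp (proj_set F) S \<longleftrightarrow> (\<exists>x\<in>carrier sylow3. T = proj_act x S)"
    using assms by (auto simp: orbit_of_def proj_set_def)
  also have "\<dots> \<longleftrightarrow> (\<exists>c a b. T = proj_act (ut c a b) S)"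
    by (metis sylow3_cases ut_mem)
  finally show ?thesis unfolding proj_act_ut .
qed

definition ut_rel :: "(bit \<Rightarrow> bit \<Rightarrow> bit \<Rightarrow> bool) \<Rightarrow> ((bit ^ 3 ^ 3) set \<times> unit) set" where
  "ut_rel P = {(ut c a b, ()) | c a b. P c a b}"

abbreviation ut_tau where "ut_tau P \<equiv> tau sylow3 trivial_grp (ut_rel P)"

text \<open>The seven points as well as the seven lines fall into three orbits, of sizes 1, 2 and 4.
  The lemma is fed with representatives and with the conditions on matrix entries that cut out their
  stabilizers.\<close>

lemma proj_set_mark:
  assumes F: "\<And>c a b S. S \<in> F \<Longrightarrow> ut_im c a b S \<in> F"
    and T: "T1 \<in> F" "T2 \<in> F" "T3 \<in> F"
    and cover: "\<And>S. S \<in> F \<Longrightarrow> \<exists>c a b. S = ut_im c a b T1 \<or>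
      S = ut_im c a b T2 \<or> S = ut_im c a b T3"
    and disj: "\<And>c a b. ut_im c a b T1 \<notin> {T2, T3}" "\<And>c a b. ut_im c a b T2 \<notin> {T1, T3}"
      "\<And>c a b. ut_im c a b T3 \<notin> {T1, T2}"
    and ne: "T1 \<noteq> T2" "T1 \<noteq> T3" "T2 \<noteq> T3"
    and stab: "\<And>c a b. ut_im c a b T1 = T1 \<longleftrightarrow> P1 c a b" "\<And>c a b. ut_im c a b T2 = T2 \<longleftrightarrow> P2 c a b"
      "\<And>c a b. ut_im c a b T3 = T3 \<longleftrightarrow> P3 c a b"
  shows "mark sylow3 trivial_grp (proj_set F) = ut_tau P1 +
    ut_tau P2 + ut_tau P3"
proof -
  let ?p = "pt_rel sylow3 trivial_grp"
  let ?O = "orbit_of sylow3 trivial_grp"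
  let ?P = "proj_set F"
  have 1: "fst ?P = F" by (simp add: proj_set_def)
  have "mark sylow3 trivial_grp ?P =
      (\<Sum>S\<in>{T1, T2, T3}. tau sylow3 trivial_grp (?p ?P S))"
  proof (rule X.mark_orbits[OF fin_biset_proj_set[OF F]])
    show "fst ?P \<subseteq> (\<Union>u\<in>{T1, T2, T3}. ?O ?P u)"
    proof
      fix S assume "S \<in> fst ?P"
      then obtain c a b where "S = ut_im c a b T1 \<or> S = ut_im c a b T2 \<or>
          S = ut_im c a b T3" unfolding 1 using cover by meson
      then have "S \<in> ?O ?P T1 \<or>
          S \<in> ?O ?P T2 \<or> S \<in> ?O ?P T3"
        using T by (simp only: proj_set_orbit) iprover
      then show "S \<in> (\<Union>u\<in>{T1, T2, T3}. ?O ?P u)" by simp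
    qed
    fix S S' assume S: "S \<in> {T1, T2, T3}" "S' \<in> {T1, T2, T3}" "S' \<in> ?O ?P S"
    then obtain c a b where "S' = ut_im c a b S" using T proj_set_orbit[of S F S'] by blast
    then show "S = S'" using S(1,2) disj[of c a b] by (elim insertE emptyE) simp_all
  qed (simp_all add: 1 T)
  moreover have "?p ?P T1 = ut_rel P1"
    "?p ?P T2 = ut_rel P2"
    "?p ?P T3 = ut_rel P3"
    using T by (simp_all only: proj_set_pt_rel[OF F] ut_rel_def stab)
  ultimately show ?thesis using ne by (simp add: add.assoc)
qed

lemma image_line: "ut_im c a b {0, v, w, v + w} =
    {0, utmat c a b *v v, utmat c a b *v w, utmat c a b *v v + utmat c a b *v w}"
  by (simp add: matrix_vector_right_distrib)

lemma utmat_mult_inj: "utmat c a b *v v = utmat c a b *v w \<longleftrightarrow> v = w"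
proof
  obtain x y z where v: "v = v3 x y z" by (rule v3_cases)
  obtain x' y' z' where w: "w = v3 x' y' z'" by (rule v3_cases)
  assume "utmat c a b *v v = utmat c a b *v w"
  then have *: "x + c * y + b * z = x' + c * y' + b * z'" "y + a * z = y' + a * z'" "z = z'"
    unfolding v w v3_simps by blast+
  from *(2,3) have "y = y'" by (simp only: add_right_cancel)
  with * have "x = x'" by (simp only: add_right_cancel)
  then show "v = w" unfolding v w \<open>y = y'\<close> \<open>z = z'\<close> by simp
qed simp

lemma points_closed: "S \<in> proj_points \<Longrightarrow> ut_im c a b S \<in> proj_points"
  using utmat_mult_inj[of c a b _ 0] by (force simp: proj_points_eq)

lemma lines_closed: "S \<in> proj_lines \<Longrightarrow> ut_im c a b S \<in> proj_lines"
proof -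
  assume "S \<in> proj_lines"
  then obtain v w where "v \<noteq> 0" "w \<noteq> 0" "v \<noteq> w" "S = {0, v, w, v + w}" by (auto simp: proj_lines_eq)
  then have "ut_im c a b S =
      {0, utmat c a b *v v, utmat c a b *v w, utmat c a b *v v + utmat c a b *v w} \<and>
      utmat c a b *v v \<noteq> 0 \<and> utmat c a b *v w \<noteq> 0 \<and> utmat c a b *v v \<noteq> utmat c a b *v w"
    using utmat_mult_inj[of c a b v 0] utmat_mult_inj[of c a b w 0] utmat_mult_inj[of c a b v w]
    by (simp only: image_line) simp
  then show ?thesis unfolding proj_lines_eq by blast
qed

text \<open>The group fixes a flag, the point of \<open>v3 1 0 0\<close> on the line where the third
  coordinate vanishes. The orbits are this point, the other points of the line, and the points off
  the line.\<close>

lemma mark_points: "mark sylow3 trivial_grp (proj_set proj_points) =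
  ut_tau (\<lambda>c a b. True) + ut_tau (\<lambda>c a b. c = 0) +
  ut_tau (\<lambda>c a b. a = 0 \<and> b = 0)"
proof -
  let ?p = "\<lambda>x y z. {0, v3 x y z}"
  have eq: "?p x y z = ?p x' y' z' \<longleftrightarrow> x = x' \<and> y = y' \<and> z = z'" for x y z x' y' z'
    unfolding doubleton_eq_iff by (simp only: v3_zero v3_simps(1)) blast
  have im: "ut_im c a b (?p x y z) = ?p (x + c * y + b * z) (y + a * z) z" for c a b x y z
    by (simp only: image_insert image_empty v3_simps matrix_vector_mult_0_right)
  have p: "?p x y z \<in> proj_points" if "v3 x y z \<noteq> 0" for x y z
    using that unfolding proj_points_eq by blast
  show ?thesis
  proof (rule proj_set_mark[OF points_closed, of "?p 1 0 0" "?p 0 1 0" "?p 0 0 1"])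
    fix S assume "S \<in> proj_points"
    then obtain v where v: "v \<noteq> 0" "S = {0, v}" unfolding proj_points_eq by blast
    obtain x y z where vv: "v = v3 x y z" by (rule v3_cases)
    consider "z = 1" | "z = 0" "y = 1" | "z = 0" "y = 0" by (cases z; cases y) simp_all
    then show "\<exists>c a b. S = ut_im c a b (?p 1 0 0) \<or> S = ut_im c a b (?p 0 1 0) \<or>
        S = ut_im c a b (?p 0 0 1)"
    proof cases
      case 1
      show ?thesis unfolding v(2) vv im by (rule exI[of _ 0], rule exI[of _ y], rule exI[of _ x]) (simp add: 1)
    next
      case 2
      show ?thesis unfolding v(2) vv im by (rule exI[of _ x], rule exI[of _ 0], rule exI[of _ 0]) (simp add: 2)
    next
      case 3
      show ?thesis unfolding v(2) vv im using v(1) by (simp add: 3 vv)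
    qed
  qed (simp_all only: im eq insert_iff empty_iff v3_simps, auto intro!: p)
qed

text \<open>Dually to the points, the orbits are the line of the flag, the other lines through its
  point, and the lines that avoid this point; the three coordinate lines represent them.\<close>

lemma mark_lines: "mark sylow3 trivial_grp (proj_set proj_lines) =
  ut_tau (\<lambda>c a b. True) + ut_tau (\<lambda>c a b. a = 0) +
  ut_tau (\<lambda>c a b. c = 0 \<and> b = 0)"
proof -
  let ?l = "\<lambda>v w. {0, v, w, v + w}"
  let ?e1 = "v3 1 0 0" and ?e2 = "v3 0 1 0" and ?e3 = "v3 0 0 1"
  have e1: "ut_im c a b (?l ?e1 ?e2) = ?l ?e1 ?e2" for c a b
    unfolding image_line by (cases c) (simp_all add: insert_commute)
  have e2: "ut_im c a b (?l ?e1 ?e3) = {0, v3 1 0 0, v3 0 a 1, v3 1 a 1}" for c a b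
    unfolding image_line by (cases b) (simp_all add: insert_commute)
  have e3: "ut_im c a b (?l ?e2 ?e3) = {0, v3 c 1 0, v3 b a 1, v3 (c + b) (1 + a) 1}" for c a b
    unfolding image_line by simp
  have neI: "A \<noteq> B" if "x \<in> A" "x \<notin> B" for A B and x :: "bit ^ 3" using that by blast
  have n1: "{0, v3 1 0 0, v3 0 a 1, v3 1 a 1} \<noteq> ?l ?e1 ?e2" for a by (rule neI[of "v3 0 a 1"]) simp_all
  have n2: "{0, v3 c 1 0, v3 b a 1, v3 (c + b) (1 + a) 1} \<noteq> ?l ?e1 ?e2" for a b c
    by (rule neI[of "v3 b a 1"]) simp_all
  have n3: "?l ?e2 ?e3 \<noteq> {0, v3 1 0 0, v3 0 a 1, v3 1 a 1}" for a by (rule neI[of "v3 1 0 0", symmetric]) simp_all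
  have n4: "?l ?e1 ?e3 \<noteq> {0, v3 c 1 0, v3 b a 1, v3 (c + b) (1 + a) 1}" for a b c
    by (rule neI[of "v3 1 0 0"]) simp_all
  have n5: "?l ?e1 ?e2 \<noteq> ?l ?e1 ?e3" by (rule neI[of "v3 0 1 0"]) simp_all
  have n6: "?l ?e1 ?e2 \<noteq> ?l ?e2 ?e3" by (rule neI[of "v3 1 0 0"]) simp_all
  have n7: "?l ?e1 ?e3 \<noteq> ?l ?e2 ?e3" by (rule neI[of "v3 1 0 0"]) simp_all
  have s2: "{0, v3 1 0 0, v3 0 a 1, v3 1 a 1} = ?l ?e1 ?e3 \<longleftrightarrow> a = 0" for a
    using neI[of "v3 0 a 1" "{0, v3 1 0 0, v3 0 a 1, v3 1 a 1}" "?l ?e1 ?e3"] by (cases a) simp_all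
  have s3: "{0, v3 c 1 0, v3 b a 1, v3 (c + b) (1 + a) 1} = ?l ?e2 ?e3 \<longleftrightarrow> c = 0 \<and> b = 0" for a b c
    using neI[of "v3 c 1 0" "{0, v3 c 1 0, v3 b a 1, v3 (c + b) (1 + a) 1}" "?l ?e2 ?e3"]
      neI[of "v3 b a 1" "{0, v3 c 1 0, v3 b a 1, v3 (c + b) (1 + a) 1}" "?l ?e2 ?e3"]
    by (cases a; cases b; cases c) (simp_all add: insert_commute)
  have l: "?l v w \<in> proj_lines" if "v \<noteq> 0" "w \<noteq> 0" "v \<noteq> w" for v w
    using that unfolding proj_lines_eq by blast
  \<comment> \<open>A line other than the fixed one contains a point p off it and meets it in a
    single point q. Whether q is the fixed point distinguishes the two remaining orbits.\<close>
  have cov: "\<exists>c a b. ?l p q = ut_im c a b (?l ?e1 ?e3) \<or> ?l p q = ut_im c a b (?l ?e2 ?e3)"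
    if "p $ 3 = 1" "q $ 3 = 0" "q \<noteq> 0" for p q :: "bit ^ 3"
  proof -
    obtain x y z where p: "p = v3 x y z" by (rule v3_cases)
    obtain x' y' z' where q: "q = v3 x' y' z'" by (rule v3_cases)
    have z: "z = 1" "z' = 0" using that(1,2) unfolding p q by simp_all
    show ?thesis
    proof (cases "y' = 1")
      case True
      have "?l p q = ut_im x' y x (?l ?e2 ?e3)"
        unfolding e3 p q z True by (cases x; cases y; cases x') (simp_all add: insert_commute)
      then show ?thesis by iprover
    next
      case False
      then have y': "y' = 0" by simp
      then have x': "x' = 1" using that(3) unfolding q z by simp
      have "?l p q = ut_im 0 y 0 (?l ?e1 ?e3)"
        unfolding e2 p q z x' y' by (cases x) (simp_all add: insert_commute)
      then show ?thesis by iprover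
    qed
  qed
  have cov': "\<exists>c a b. S = ut_im c a b (?l ?e1 ?e2) \<or> S = ut_im c a b (?l ?e1 ?e3) \<or> S = ut_im c a b (?l ?e2 ?e3)"
    if "p $ 3 = 1" "q $ 3 = 0" "q \<noteq> 0" "S = ?l p q" for p q :: "bit ^ 3" and S
    using cov[OF that(1-3)] unfolding that(4) by iprover
  show ?thesis
  proof (rule proj_set_mark[OF lines_closed, of "?l ?e1 ?e2" "?l ?e1 ?e3" "?l ?e2 ?e3"])
    show "?l ?e1 ?e2 \<in> proj_lines" "?l ?e1 ?e3 \<in> proj_lines" "?l ?e2 ?e3 \<in> proj_lines" by (rule l; simp)+
    fix S assume "S \<in> proj_lines"
    then obtain v w where v: "v \<noteq> 0" "w \<noteq> 0" "v \<noteq> w" "S = ?l v w" unfolding proj_lines_eq by blast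
    obtain x y z where p: "v = v3 x y z" by (rule v3_cases)
    obtain x' y' z' where q: "w = v3 x' y' z'" by (rule v3_cases)
    consider "z = 0" "z' = 0" | "z = 1" "z' = 0" | "z = 0" "z' = 1" | "z = 1" "z' = 1"
      by (cases z; cases z') simp_all
    then show "\<exists>c a b. S = ut_im c a b (?l ?e1 ?e2) \<or> S = ut_im c a b (?l ?e1 ?e3) \<or> S = ut_im c a b (?l ?e2 ?e3)"
    proof cases
      case z: 1
      have "S = ?l ?e1 ?e2"
        using v unfolding p q z by (cases x; cases y; cases x'; cases y'; simp add: insert_commute)
      then show ?thesis unfolding e1 by iprover
    next
      case z: 2
      show ?thesis by (rule cov'[of v w]) (use v(2,4) in \<open>simp_all add: p q z\<close>)
    next
      case z: 3
      have "S = ?l w v" unfolding v(4) by (simp add: insert_commute add.commute)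
      then show ?thesis by (intro cov'[of w v]) (use v(1) in \<open>simp_all add: p q z\<close>)
    next
      case z: 4
      \<comment> \<open>Both chosen points lie off the fixed line; the third point of the line,
        their sum, lies on it.\<close>
      have "v + w \<noteq> 0" using v(3) unfolding p q z by (cases x; cases y; cases x'; cases y'; simp)
      moreover have "v + (v + w) = w" by (simp add: vec_eq_iff)
      then have "S = ?l v (v + w)" unfolding v(4) by (simp add: insert_commute)
      ultimately show ?thesis by (intro cov'[of v "v + w"]) (simp_all add: p q z)
    qed
  qed (use n1 n2 n3 n3[symmetric] n4 n4[symmetric] n5 n6 n7 s2 s3 in \<open>simp_all only: e1 e2 e3 insert_iff empty_iff simp_thms\<close>)
qed

text \<open>The fixed point and the fixed line cancel in \<delta>. Let I be given by c = b = 0, J by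
  a = b = 0 and the centre Z by c = a = 0. Then the four terms are X/JZ + X/I - X/IZ - X/J, in this
  order.\<close>

definition delta_mark :: "((bit ^ 3 ^ 3) set, unit) vmark" where
  "delta_mark = ut_tau (\<lambda>c a b. a = 0) + ut_tau (\<lambda>c a b. c = 0 \<and> b = 0) -
    ut_tau (\<lambda>c a b. c = 0) - ut_tau (\<lambda>c a b. a = 0 \<and> b = 0)"

lemma delta_eq: "delta = of_mark sylow3 trivial_grp delta_mark"
proof -
  note fin = fin_biset_proj_set[OF lines_closed] fin_biset_proj_set[OF points_closed]
  have "delta = of_mark sylow3 trivial_grp (mark sylow3 trivial_grp (proj_set proj_lines) - mark sylow3 trivial_grp (proj_set proj_points))"
    unfolding delta_def by (rule X.vbiset_eq[OF fin])
  then show ?thesis unfolding mark_lines mark_points delta_mark_def by (simp add: algebra_simps)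
qed

lemma delta_mark_vmarks: "delta_mark \<in> vmarks sylow3 trivial_grp"
proof -
  note fin = fin_biset_proj_set[OF lines_closed] fin_biset_proj_set[OF points_closed]
  show ?thesis
    using X.mark_diff_vmarks[OF fin] unfolding mark_lines mark_points delta_mark_def by (simp add: algebra_simps)
qed

section \<open>The two-sided ideal of the subfunctor, on marks\<close>

definition delta_ideal :: "'q monoid \<Rightarrow> 'p monoid \<Rightarrow> ('q, 'p) vmark set" where
  "delta_ideal Q P = {x \<in> vmarks Q P. \<exists>\<phi>\<in>vmarks (Q \<bowtie> P) sylow3.
     lift_mark x = vcomp (Q \<bowtie> P) sylow3 trivial_grp \<phi> delta_mark}"

context two_groups begin

interpretation D: three_groups "H \<bowtie> G" sylow3 trivial_grp
  by unfold_locales (intro finite_group_DirProd fin_H finite_group_opp fin_G finite_group_sylow3 finite_group_trivial)+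

abbreviation dcomp where "dcomp \<phi> \<equiv> vcomp (H \<bowtie> G) sylow3 trivial_grp \<phi> delta_mark"

text \<open>Membership means on either side that the lifted element is some \<phi> composed with
  \<delta>; injectivity of \<open>of_mark\<close> on \<open>vmarks\<close> translates one condition
  into the other.\<close>

lemma burnside_delta_eq: "burnside_delta H G = of_mark H G ` delta_ideal H G"
proof -
  let ?H = "H \<bowtie> G"
  have b1: "burnside1_delta ?H = (\<lambda>\<phi>. of_mark ?H trivial_grp (dcomp \<phi>)) ` vmarks ?H sylow3"
    unfolding burnside1_delta_def D.KH.burnside_carrier delta_eq
    using D.bcomp_of_mark[OF _ delta_mark_vmarks] by (fastforce simp: image_iff)
  have *: "of_mark H G x \<in> burnside_delta H G \<longleftrightarrow> x \<in> delta_ideal H G" if x: "x \<in> vmarks H G" for x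
  proof -
    have "of_mark H G x \<in> burnside_delta H G \<longleftrightarrow> to_burnside1 H G (of_mark H G x) \<in> burnside1_delta ?H"
      using x by (simp add: burnside_delta_def burnside_carrier)
    also have "\<dots> \<longleftrightarrow> (\<exists>\<phi>\<in>vmarks ?H sylow3. of_mark ?H trivial_grp (lift_mark x) =
        of_mark ?H trivial_grp (dcomp \<phi>))"
      unfolding to_burnside1_of_mark[OF x] b1 image_iff ..
    also have "\<dots> \<longleftrightarrow> x \<in> delta_ideal H G"
      using x by (simp add: delta_ideal_def D.KG.of_mark_eq_iff[OF lift_mark_vmarks])
    finally show ?thesis .
  qed
  show ?thesis
  proof (intro equalityI subsetI)
    fix z assume z: "z \<in> burnside_delta H G"
    then have "z \<in> carrier (burnside H G)" by (simp add: burnside_delta_def)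
    then obtain x where "x \<in> vmarks H G" "z = of_mark H G x" unfolding burnside_carrier by (rule imageE)
    then show "z \<in> of_mark H G ` delta_ideal H G" using z * by simp
  next
    fix z assume "z \<in> of_mark H G ` delta_ideal H G"
    then obtain x where "x \<in> delta_ideal H G" "z = of_mark H G x" by (rule imageE)
    then show "z \<in> burnside_delta H G" using * by (simp add: delta_ideal_def)
  qed
qed

lemma delta_ideal_vmarks: "x \<in> delta_ideal H G \<Longrightarrow> x \<in> vmarks H G"
  by (simp add: delta_ideal_def)

lemma delta_ideal_zero: "0 \<in> delta_ideal H G"
proof -
  have "lift_mark 0 = dcomp 0"
    by (simp only: lift_mark_linear D.vcomp_zero_left[OF delta_mark_vmarks])
  then show ?thesis using D.KH.vmarks_zero vmarks_zero unfolding delta_ideal_def by blast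
qed

lemma delta_ideal_diff: assumes "x \<in> delta_ideal H G" "y \<in> delta_ideal H G" shows "x - y \<in> delta_ideal H G"
proof -
  obtain \<phi> \<psi> where "\<phi> \<in> vmarks (H \<bowtie> G) sylow3" "\<psi> \<in> vmarks (H \<bowtie> G) sylow3"
    "lift_mark x = dcomp \<phi>" "lift_mark y = dcomp \<psi>"
    using assms by (auto simp: delta_ideal_def)
  moreover from this have "lift_mark (x - y) = dcomp (\<phi> - \<psi>)"
    by (simp add: lift_mark_linear D.vcomp_diff_left delta_mark_vmarks)
  ultimately show ?thesis using assms D.KH.vmarks_diff vmarks_diff unfolding delta_ideal_def by blast
qed

lemma delta_ideal_minus: "x \<in> delta_ideal H G \<Longrightarrow> - x \<in> delta_ideal H G"
  using delta_ideal_diff[OF delta_ideal_zero, of x] by simp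

lemma delta_ideal_add: "x \<in> delta_ideal H G \<Longrightarrow> y \<in> delta_ideal H G \<Longrightarrow> x + y \<in> delta_ideal H G"
  using delta_ideal_diff[OF _ delta_ideal_minus, of x y] by simp

end

text \<open>After lifting, composition on both sides becomes one composition with
  \<open>ext_biset V W\<close> on the left, which associativity moves into \<phi>. This makes the
  subfunctor a two-sided ideal of morphisms.\<close>

lemma delta_ideal_sandwich:
  assumes fin: "finite_group R" "finite_group Q" "finite_group P" "finite_group S"
    and V: "fin_biset R Q V" and x: "x \<in> delta_ideal Q P" and W: "fin_biset P S W"
  shows "vcomp R P S (vcomp R Q P (mark R Q V) x) (mark P S W) \<in> delta_ideal R S"
proof -
  let ?Q = "Q \<bowtie> P"
  let ?V = "vcomp R P S (vcomp R Q P (mark R Q V) x) (mark P S W)"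
  interpret RQP: three_groups R Q P by unfold_locales (rule fin)+
  interpret RPS: three_groups R P S by unfold_locales (rule fin)+
  note fo = finite_group_DirProd[OF fin(1) finite_group_opp[OF fin(4)]] finite_group_DirProd[OF fin(2) finite_group_opp[OF fin(3)]]
  interpret E: three_groups "R \<bowtie> S" "Q \<bowtie> P" sylow3
    by unfold_locales (rule fo finite_group_sylow3)+
  let ?E = "mark (R \<bowtie> S) ?Q (ext_biset V W)"
  have E: "?E \<in> vmarks (R \<bowtie> S) ?Q"
    by (rule E.KH.mark_vmarks[OF fin_biset_ext[OF fin V W]])
  obtain \<phi> where \<phi>: "\<phi> \<in> vmarks ?Q sylow3" "x \<in> vmarks Q P"
    "lift_mark x = vcomp ?Q sylow3 trivial_grp \<phi> delta_mark"
    using x by (auto simp: delta_ideal_def)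
  have "lift_mark ?V =
      vcomp (R \<bowtie> S) ?Q trivial_grp ?E (vcomp ?Q sylow3 trivial_grp \<phi> delta_mark)"
    using lift_mark_vcomp[OF fin V \<phi>(2) W] by (simp only: \<phi>(3))
  also have "\<dots> = vcomp (R \<bowtie> S) sylow3 trivial_grp (vcomp (R \<bowtie> S) ?Q sylow3 ?E \<phi>) delta_mark"
    by (rule vcomp_assoc[OF fo finite_group_sylow3 finite_group_trivial E \<phi>(1) delta_mark_vmarks, symmetric])
  finally have "lift_mark ?V = \<dots>" .
  moreover have "?V \<in> vmarks R S"
    by (intro RPS.vcomp_closed RQP.vcomp_closed RQP.KH.mark_vmarks V \<phi>(2) RPS.HG.mark_vmarks W)
  ultimately show ?thesis using E.vcomp_closed[OF E \<phi>(1)] unfolding delta_ideal_def by blast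
qed

context three_groups begin

lemma delta_ideal_left:
  assumes y: "y \<in> vmarks K H" and x: "x \<in> delta_ideal H G" shows "vcomp K H G y x \<in> delta_ideal K G"
  using y
proof (induction rule: KH.vmarks_induct)
  case (mark T)
  have "vcomp K H G (mark K H T) x \<in> vmarks K G"
    by (intro vcomp_closed KH.mark_vmarks mark HG.delta_ideal_vmarks x)
  then show ?case
    using delta_ideal_sandwich[OF KH.fin_H KH.fin_G HG.fin_G HG.fin_G mark x fin_biset_id[OF HG.fin_G]]
    by (simp only: vcomp_id[OF KH.fin_H HG.fin_G])
qed (simp only: vcomp_diff_left HG.delta_ideal_vmarks[OF x] KG.delta_ideal_diff)

lemma delta_ideal_right:
  assumes y: "y \<in> delta_ideal K H" and x: "x \<in> vmarks H G" shows "vcomp K H G y x \<in> delta_ideal K G"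
  using x
proof (induction rule: HG.vmarks_induct)
  case (mark T)
  show ?case
    using delta_ideal_sandwich[OF KH.fin_H KH.fin_H KH.fin_G HG.fin_G fin_biset_id[OF KH.fin_H] y mark]
    by (simp only: vcomp_id[OF KH.fin_H KH.fin_G KH.delta_ideal_vmarks[OF y]])
qed (simp only: vcomp_diff_right KH.delta_ideal_vmarks[OF y] KG.delta_ideal_diff)

end

declare add_bit_eq_xor [simp del] mult_bit_eq_and [simp del]

section \<open>Elements of the ideal from homomorphisms to the unitriangular group\<close>

lemma delta_idealI:
  assumes "\<phi> \<in> vmarks (Q \<bowtie> P) sylow3"
    and "vcomp (Q \<bowtie> P) sylow3 trivial_grp \<phi> delta_mark = lift_mark x" and "x \<in> vmarks Q P"
  shows "x \<in> delta_ideal Q P"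
  unfolding delta_ideal_def using assms(1,3) assms(2)[symmetric] by blast

definition ut_pred :: "(bit \<Rightarrow> bit \<Rightarrow> bit \<Rightarrow> bool) \<Rightarrow> bool" where
  "ut_pred P \<longleftrightarrow> P 0 0 0 \<and> (\<forall>c a b. P c a b \<longrightarrow> P c a (b + c * a)) \<and>
    (\<forall>c a b c' a' b'. P c a b \<longrightarrow> P c' a' b' \<longrightarrow> P (c + c') (a + a') (b + b' + c * a'))"

text \<open>The first four subgroups are those in \<delta>. The last one is the conjugate of the
  second by \<open>ut 1 0 0\<close>; it arises from the second double coset when the homomorphism
  has abelian image.\<close>

lemma ut_preds: "ut_pred (\<lambda>c a b. a = 0)" "ut_pred (\<lambda>c a b. c = 0 \<and> b = 0)" "ut_pred (\<lambda>c a b. c = 0)"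
  "ut_pred (\<lambda>c a b. a = 0 \<and> b = 0)" "ut_pred (\<lambda>c a b. c = 0 \<and> a + b = 0)"
proof -
  have "a + b = 0 \<Longrightarrow> a' + b' = 0 \<Longrightarrow> a + a' + (b + b') = 0" for a b a' b' :: bit
    by (cases a; cases b; cases a'; cases b'; simp)
  then show "ut_pred (\<lambda>c a b. c = 0 \<and> a + b = 0)" by (simp add: ut_pred_def)
qed (simp_all add: ut_pred_def)

lemma ut_rel_subgroup: assumes P: "ut_pred P" shows "subgroup (ut_rel P) (sylow3 \<times>\<times> trivial_grp)"
proof -
  note P = P[unfolded ut_pred_def]
  interpret DP: group "sylow3 \<times>\<times> trivial_grp" by (rule X.group_DP)
  show ?thesis
  proof (rule DP.subgroupI)
    have "(ut 0 0 0, ()) \<in> ut_rel P" using P by (auto simp: ut_rel_def)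
    then show "ut_rel P \<noteq> {}" by blast
    show "ut_rel P \<subseteq> carrier (sylow3 \<times>\<times> trivial_grp)" by (auto simp: ut_rel_def)
    fix x assume "x \<in> ut_rel P"
    then obtain p q r where x: "x = (ut p q r, ())" "P p q r" unfolding ut_rel_def by blast
    show "inv\<^bsub>sylow3 \<times>\<times> trivial_grp\<^esub> x \<in> ut_rel P"
      using P x(2) unfolding x(1) by (auto simp: ut_rel_def inv_DirProd X.H.is_group X.G.is_group inv_ut)
    fix y assume "y \<in> ut_rel P"
    then obtain p' q' r' where y: "y = (ut p' q' r', ())" "P p' q' r'" unfolding ut_rel_def by blast
    show "x \<otimes>\<^bsub>sylow3 \<times>\<times> trivial_grp\<^esub> y \<in> ut_rel P"
      using P x(2) y(2) unfolding x(1) y(1) by (auto simp: ut_rel_def)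
  qed
qed

text \<open>The stabilizer of the base coset, seen in the product with the opposite group. The
  inverse undoes the one by which g acts on cosets.\<close>

definition op_rel :: "'h monoid \<Rightarrow> 'g monoid \<Rightarrow> ('h \<times> 'g) set \<Rightarrow> (('h \<times> 'g) \<times> unit) set" where
  "op_rel H G N = {((h, g), ()) | h g. g \<in> carrier G \<and> (h, inv\<^bsub>G\<^esub> g) \<in> N}"

context two_groups begin

interpretation o: two_groups "H \<bowtie> G" trivial_grp by (rule two_groups_opset)

lemma lift_mark_tau:
  assumes N: "subgroup N (H \<times>\<times> G)"
  shows "lift_mark (tau H G N) = tau (H \<bowtie> G) trivial_grp (op_rel H G N)"
proof -
  let ?H = "H \<bowtie> G"
  let ?U = "rel_biset H G N" and ?O = "to_opset (rel_biset H G N)"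
  note U = fin_biset_rel[OF N] and u = rel_biset_base[OF N]
  note O = fin_biset_to_opset[OF U]
  have u': "N \<in> fst ?O" using u by (simp add: to_opset_def)
  have "fst ?O \<subseteq> orbit_of ?H trivial_grp ?O N"
  proof
    fix c assume "c \<in> fst ?O"
    then have "c \<in> orbit_of H G ?U N" using rel_biset_orbit[OF N] by (simp add: to_opset_def)
    then show "c \<in> orbit_of ?H trivial_grp ?O N"
      by (auto simp: orbit_of_def to_opset_def)
  qed
  then have "mark ?H trivial_grp ?O = tau ?H trivial_grp (pt_rel ?H trivial_grp ?O N)"
    by (rule o.mark_transitive[OF O u'])
  also have "pt_rel ?H trivial_grp ?O N = op_rel H G N"
  proof -
    have "lact trivial_grp ?O (h, g) N = ract ?H ?O N e \<longleftrightarrow> (h, inv g) \<in> N"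
      if "h \<in> carrier H" "g \<in> carrier G" for h g e
    proof -
      have "lact trivial_grp ?O (h, g) N = snd ?U (h, g) N" "ract ?H ?O N e = N"
        using fin_bisetD(4)[OF U u] by (simp_all add: lact_def ract_def to_opset_def)
      moreover have "snd ?U (h, g) N = N \<longleftrightarrow> (h, g) \<in> stab_of H G ?U N" using that by (simp add: stab_of_def)
      ultimately show ?thesis using that by (simp add: stab_of_pt_rel[OF U u] rel_biset_pt_rel[OF N])
    qed
    moreover have "h \<in> carrier H" if "(h, g) \<in> N" for h g using rel_sub[OF N that] by simp
    ultimately show ?thesis by (auto simp: pt_rel_def op_rel_def)
  qed
  finally show ?thesis by (simp add: mark_to_opset tau_def[of H G])
qed

text \<open>A homomorphism from \<open>N \<le> H \<times> G\<close> to the unitriangular group, given by its three matrix entries.\<close>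

definition ut_hom :: "('h \<times> 'g) set \<Rightarrow> ('h \<times> 'g \<Rightarrow> bit) \<Rightarrow> ('h \<times> 'g \<Rightarrow> bit) \<Rightarrow> ('h \<times> 'g \<Rightarrow> bit) \<Rightarrow> bool" where
  "ut_hom N c a b \<longleftrightarrow> (\<forall>x\<in>N. \<forall>y\<in>N. c (x \<otimes>\<^bsub>H \<times>\<times> G\<^esub> y) = c x + c y \<and>
     a (x \<otimes>\<^bsub>H \<times>\<times> G\<^esub> y) = a x + a y \<and> b (x \<otimes>\<^bsub>H \<times>\<times> G\<^esub> y) = b x + b y + c x * a y)"

definition ut_graph :: "('h \<times> 'g) set \<Rightarrow> ('h \<times> 'g \<Rightarrow> bit) \<Rightarrow> ('h \<times> 'g \<Rightarrow> bit) \<Rightarrow> ('h \<times> 'g \<Rightarrow> bit) \<Rightarrow>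
    (('h \<times> 'g) \<times> (bit ^ 3 ^ 3) set) set" where
  "ut_graph N c a b = {((h, g), ut (c (h, inv g)) (a (h, inv g)) (b (h, inv g))) | h g.
     g \<in> carrier G \<and> (h, inv g) \<in> N}"

context
  fixes N c a b assumes N: "subgroup N (H \<times>\<times> G)" and hom: "ut_hom N c a b"
begin

interpretation D: three_groups "H \<bowtie> G" sylow3 trivial_grp
  by unfold_locales (intro finite_group_DirProd fin_H finite_group_opp fin_G finite_group_sylow3 finite_group_trivial)+

interpretation HG: group "H \<times>\<times> G" by (rule group_DP)

abbreviation utg where "utg \<equiv> ut_graph N c a b"
abbreviation utv where "utv \<equiv> vcomp (H \<bowtie> G) sylow3 trivial_grp (tau (H \<bowtie> G) sylow3 utg)"
abbreviation utpart where "utpart P \<equiv> {n \<in> N. P (c n) (a n) (b n)}"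

lemma ut_graph_iff: "((h, g), x) \<in> utg \<longleftrightarrow> g \<in> carrier G \<and> (h, inv g) \<in> N \<and>
    x = ut (c (h, inv g)) (a (h, inv g)) (b (h, inv g))"
  unfolding ut_graph_def by auto

lemma ut_graph_Range: assumes "n \<in> N" shows "ut (c n) (a n) (b n) \<in> Range utg"
proof -
  obtain h g where n: "n = (h, g)" by (cases n)
  have "g \<in> carrier G" using rel_sub[OF N] assms n by simp
  then have "((h, inv g), ut (c n) (a n) (b n)) \<in> utg" using assms n by (simp add: ut_graph_iff)
  then show ?thesis by blast
qed

lemma ut_hom_mult:
  assumes "x \<in> N" "y \<in> N"
  shows "c (x \<otimes>\<^bsub>H \<times>\<times> G\<^esub> y) = c x + c y" "a (x \<otimes>\<^bsub>H \<times>\<times> G\<^esub> y) = a x + a y"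
    "b (x \<otimes>\<^bsub>H \<times>\<times> G\<^esub> y) = b x + b y + c x * a y"
  using hom assms unfolding ut_hom_def by blast+

lemma one_mem: "(\<one>\<^bsub>H\<^esub>, \<one>) \<in> N" using subgroup.one_closed[OF N] by simp

lemma ut_hom_one: "c (\<one>\<^bsub>H\<^esub>, \<one>) = 0 \<and> a (\<one>\<^bsub>H\<^esub>, \<one>) = 0 \<and> b (\<one>\<^bsub>H\<^esub>, \<one>) = 0"
  using ut_hom_mult[OF one_mem one_mem] by simp

lemma ut_hom_inv: assumes "x \<in> N"
  shows "c (inv\<^bsub>H \<times>\<times> G\<^esub> x) = c x \<and> a (inv\<^bsub>H \<times>\<times> G\<^esub> x) = a x \<and> b (inv\<^bsub>H \<times>\<times> G\<^esub> x) = b x + c x * a x"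
proof -
  let ?y = "inv\<^bsub>H \<times>\<times> G\<^esub> x"
  have "x \<otimes>\<^bsub>H \<times>\<times> G\<^esub> ?y = (\<one>\<^bsub>H\<^esub>, \<one>)" using assms subgroup.subset[OF N] HG.r_inv[of x] by auto
  then show ?thesis using ut_hom_mult[OF assms subgroup.m_inv_closed[OF N assms]] ut_hom_one
    by (cases "c x"; cases "a x"; cases "b x"; cases "c ?y"; cases "a ?y"; cases "b ?y"; simp)
qed

lemma ut_graph_subgroup: "subgroup utg ((H \<bowtie> G) \<times>\<times> sylow3)"
proof -
  let ?P = "(H \<bowtie> G) \<times>\<times> sylow3"
  interpret DP: group ?P by (rule D.KH.group_DP)
  show ?thesis
  proof (rule DP.subgroupI)
    show "utg \<subseteq> carrier ?P" using rel_sub[OF N] by (auto simp: ut_graph_def)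
    have "((\<one>\<^bsub>H\<^esub>, \<one>), ut 0 0 0) \<in> utg" using one_mem ut_hom_one by (simp add: ut_graph_iff)
    then show "utg \<noteq> {}" by blast
    fix x assume "x \<in> utg"
    then obtain h g where x: "x = ((h, g), ut (c (h, inv g)) (a (h, inv g)) (b (h, inv g)))"
      "g \<in> carrier G" "(h, inv g) \<in> N" by (auto simp: ut_graph_def)
    have h: "h \<in> carrier H" using rel_sub[OF N x(3)] by simp
    have i: "inv\<^bsub>H \<times>\<times> G\<^esub> (h, inv g) = (inv\<^bsub>H\<^esub> h, g)" using h x(2) by (simp add: inv_DP)
    have "(inv\<^bsub>H\<^esub> h, g) \<in> N" using subgroup.m_inv_closed[OF N x(3)] unfolding i .
    then show "inv\<^bsub>?P\<^esub> x \<in> utg"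
      using x h ut_hom_inv[OF x(3), unfolded i]
      by (simp add: ut_graph_iff inv_DirProd group_opp_group DirProd_group X.H.is_group inv_opp_group inv_ut)
    fix y assume "y \<in> utg"
    then obtain h' g' where y: "y = ((h', g'), ut (c (h', inv g')) (a (h', inv g')) (b (h', inv g')))"
      "g' \<in> carrier G" "(h', inv g') \<in> N" by (auto simp: ut_graph_def)
    have xy: "(h \<otimes>\<^bsub>H\<^esub> h', inv (g' \<otimes> g)) = (h, inv g) \<otimes>\<^bsub>H \<times>\<times> G\<^esub> (h', inv g')"
      using x(2) y(2) by (simp add: G.inv_mult_group)
    have p: "x \<otimes>\<^bsub>?P\<^esub> y = ((h \<otimes>\<^bsub>H\<^esub> h', g' \<otimes> g),
        ut (c (h, inv g) + c (h', inv g')) (a (h, inv g) + a (h', inv g'))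
         (b (h, inv g) + b (h', inv g') + c (h, inv g) * a (h', inv g')))"
      unfolding x(1) y(1) by simp
    show "x \<otimes>\<^bsub>?P\<^esub> y \<in> utg"
      unfolding p ut_graph_iff xy ut_hom_mult[OF x(3) y(3)] using subgroup.m_closed[OF N x(3) y(3)] x(2) y(2) by simp
  qed
qed

lemma ut_graph_comp: "utg O ut_rel P = op_rel H G (utpart P)"
  by (auto simp: ut_graph_def ut_rel_def op_rel_def)

lemma utpart_subgroup:
  assumes P: "ut_pred P" shows "subgroup (utpart P) (H \<times>\<times> G)"
proof (rule HG.subgroupI)
  note P = P[unfolded ut_pred_def]
  show "utpart P \<subseteq> carrier (H \<times>\<times> G)" using subgroup.subset[OF N] by blast
  have "(\<one>\<^bsub>H\<^esub>, \<one>) \<in> utpart P" using one_mem ut_hom_one P by simp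
  then show "utpart P \<noteq> {}" by blast
  fix x assume x: "x \<in> utpart P"
  then show "inv\<^bsub>H \<times>\<times> G\<^esub> x \<in> utpart P"
    using ut_hom_inv[of x] P subgroup.m_inv_closed[OF N] by simp
  fix y assume y: "y \<in> utpart P"
  show "x \<otimes>\<^bsub>H \<times>\<times> G\<^esub> y \<in> utpart P"
    using x y P ut_hom_mult[of x y] subgroup.m_closed[OF N] by simp
qed

lemma ut_single:
  assumes P: "ut_pred P"
    and "\<And>h. h \<in> carrier sylow3 \<Longrightarrow> \<exists>x\<in>Range utg. \<exists>y\<in>Domain (ut_rel P). h = x \<otimes>\<^bsub>sylow3\<^esub> y"
  shows "utv (ut_tau P) = lift_mark (tau H G (utpart P))"
  by (simp only: D.vcomp_tau_single[OF ut_graph_subgroup ut_rel_subgroup[OF P] assms(2)] ut_graph_comp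
    lift_mark_tau[OF utpart_subgroup[OF P]])

lemma utv_delta: "utv delta_mark = utv (ut_tau (\<lambda>c a b. a = 0)) + utv (ut_tau (\<lambda>c a b. c = 0 \<and> b = 0)) -
    utv (ut_tau (\<lambda>c a b. c = 0)) - utv (ut_tau (\<lambda>c a b. a = 0 \<and> b = 0))"
  unfolding delta_mark_def
  by (simp only: D.vcomp_diff_right D.vcomp_add_right D.KH.tau_vmarks[OF ut_graph_subgroup] X.vmarks_add X.vmarks_diff
    ut_preds[THEN ut_rel_subgroup, THEN X.tau_vmarks])

lemma ut_delta_idealI: "utv delta_mark = lift_mark x \<Longrightarrow> x \<in> vmarks H G \<Longrightarrow> x \<in> delta_ideal H G"
  by (rule delta_idealI[OF D.KH.tau_vmarks[OF ut_graph_subgroup]])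

text \<open>For a surjective homomorphism each Mackey sum has one term, so composing its graph with
  \<delta> takes the preimages of the four subgroups in \<delta>.\<close>

lemma delta_relation:
  assumes surj: "\<And>x y z. \<exists>n\<in>N. c n = x \<and> a n = y \<and> b n = z"
  shows "tau H G {n \<in> N. a n = 0} + tau H G {n \<in> N. c n = 0 \<and> b n = 0} -
    tau H G {n \<in> N. c n = 0} - tau H G {n \<in> N. a n = 0 \<and> b n = 0} \<in> delta_ideal H G"
proof (rule ut_delta_idealI)
  have "utv (ut_tau P) = lift_mark (tau H G (utpart P))" if P: "ut_pred P" for P
  proof (rule ut_single[OF P])
    fix h assume "h \<in> carrier sylow3"
    then obtain p q r where h: "h = ut p q r" by (rule sylow3_cases)
    obtain n where "n \<in> N" "c n = p" "a n = q" "b n = r" using surj by blast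
    then have "h \<in> Range utg" using ut_graph_Range[of n] h by simp
    moreover have "ut 0 0 0 \<in> Domain (ut_rel P)" using P by (auto simp: ut_rel_def ut_pred_def)
    moreover have "h = h \<otimes>\<^bsub>sylow3\<^esub> ut 0 0 0" by (simp add: h)
    ultimately show "\<exists>x\<in>Range utg. \<exists>y\<in>Domain (ut_rel P). h = x \<otimes>\<^bsub>sylow3\<^esub> y" by blast
  qed
  then show "utv delta_mark = lift_mark (tau H G {n \<in> N. a n = 0} + tau H G {n \<in> N. c n = 0 \<and> b n = 0} -
    tau H G {n \<in> N. c n = 0} - tau H G {n \<in> N. a n = 0 \<and> b n = 0})"
    by (simp only: utv_delta lift_mark_linear ut_preds)
qed (intro vmarks_add vmarks_diff tau_vmarks ut_preds[THEN utpart_subgroup])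

text \<open>The image is C = IZ, the subgroup c = 0 of index two. J and JZ each generate X together
  with C and contribute one term. I and IZ lie inside C and contribute two: a = b is the preimage of
  the conjugate of I, and the term of N is doubled.\<close>

lemma delta_relation_abelian:
  assumes c: "\<And>n. n \<in> N \<Longrightarrow> c n = 0" and surj: "\<And>y z. \<exists>n\<in>N. a n = y \<and> b n = z"
  shows "tau H G {n \<in> N. a n = 0} + (tau H G {n \<in> N. b n = 0} + tau H G {n \<in> N. a n = b n}) -
    (tau H G N + tau H G N) - tau H G {n \<in> N. a n = 0 \<and> b n = 0} \<in> delta_ideal H G"
proof -
  let ?C = "{ut 0 y z | y z. True}" and ?x = "ut 1 0 0"
  have R: "Range utg = ?C"
  proof (intro equalityI subsetI)
    fix x assume "x \<in> ?C"
    then obtain q r where x: "x = ut 0 q r" by blast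
    obtain n where "n \<in> N" "a n = q" "b n = r" using surj by blast
    then show "x \<in> Range utg" using ut_graph_Range[of n] x c by simp
  qed (use c in \<open>auto simp: ut_graph_def\<close>)
  have single: "utv (ut_tau P) = lift_mark (tau H G (utpart P))" if P: "ut_pred P" "\<And>x. P x 0 0" for P
  proof (rule ut_single[OF P(1)])
    fix h assume "h \<in> carrier sylow3"
    then obtain p q r where h: "h = ut p q r" by (rule sylow3_cases)
    have "h = ut 0 q r \<otimes>\<^bsub>sylow3\<^esub> ut p 0 0" by (simp add: h)
    moreover have "ut 0 q r \<in> Range utg" unfolding R by blast
    moreover have "ut p 0 0 \<in> Domain (ut_rel P)" using P(2) by (auto simp: ut_rel_def)
    ultimately show "\<exists>x\<in>Range utg. \<exists>y\<in>Domain (ut_rel P). h = x \<otimes>\<^bsub>sylow3\<^esub> y" by blast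
  qed
  have C: "subgroup ?C sylow3"
  proof (rule X.H.subgroupI)
    fix x assume "x \<in> ?C"
    then obtain q r where x: "x = ut 0 q r" by blast
    show "inv\<^bsub>sylow3\<^esub> x \<in> ?C" unfolding x inv_ut by blast
    fix y assume "y \<in> ?C"
    then obtain q' r' where y: "y = ut 0 q' r'" by blast
    show "x \<otimes>\<^bsub>sylow3\<^esub> y \<in> ?C" unfolding x y sylow3_mult by (simp del: ut_inj) blast
  qed (auto simp del: ut_inj)
  have two: "utv (ut_tau P) = lift_mark (tau H G (utpart P)) + lift_mark (tau H G (utpart (\<lambda>c a b. P c a (a + b))))"
    if P: "ut_pred P" "ut_pred (\<lambda>c a b. P c a (a + b))" "\<And>x y z. P x y z \<Longrightarrow> x = 0" for P
  proof -
    have conj: "?x \<otimes>\<^bsub>sylow3\<^esub> ut p q r \<otimes>\<^bsub>sylow3\<^esub> inv\<^bsub>sylow3\<^esub> ?x = ut p q (q + r)" for p q r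
      by (cases p; cases q; cases r; simp add: inv_ut)
    have e: "q + r = s \<longleftrightarrow> r = q + s" for q r s :: bit by (cases q; cases r; cases s; simp)
    have ex: "(\<exists>h\<in>carrier sylow3. Q h \<and> (h, g) \<in> ut_rel P) \<longleftrightarrow> (\<exists>p q r. Q (ut p q r) \<and> P p q r)" for Q g
      using ut_mem by (auto simp: ut_rel_def)
    have "D.mac utg (ut_rel P) ?x = op_rel H G (utpart (\<lambda>c a b. P c a (a + b)))"
      unfolding ex conj by (auto simp: ut_graph_iff op_rel_def e)
    moreover have "utv (ut_tau P) = tau (H \<bowtie> G) trivial_grp (utg O ut_rel P) +
      tau (H \<bowtie> G) trivial_grp (D.mac utg (ut_rel P) ?x)"
    proof (rule D.vcomp_tau_two[OF ut_graph_subgroup ut_rel_subgroup[OF P(1)] R _ C])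
      show "Domain (ut_rel P) \<subseteq> ?C" using P(3) by (auto simp: ut_rel_def)
      fix h assume h: "h \<in> carrier sylow3" "h \<notin> ?C"
      obtain p q r where h': "h = ut p q r" using h(1) by (rule sylow3_cases)
      have "p = 1" using h(2) unfolding h' by (cases p) auto
      then show "h \<otimes>\<^bsub>sylow3\<^esub> inv\<^bsub>sylow3\<^esub> ?x \<in> ?C" unfolding h' inv_ut sylow3_mult by (simp del: ut_inj) blast
    qed simp_all
    ultimately show ?thesis by (simp only: ut_graph_comp lift_mark_tau[OF utpart_subgroup[OF P(1)]]
      lift_mark_tau[OF utpart_subgroup[OF P(2)]])
  qed
  have N1: "{n \<in> N. c n = 0} = N" using c by blast
  have N2: "{n \<in> N. c n = 0 \<and> b n = 0} = {n \<in> N. b n = 0}" using c by blast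
  have ab: "p + q = 0 \<longleftrightarrow> p = q" for p q :: bit by (cases p; cases q; simp)
  have N3: "{n \<in> N. c n = 0 \<and> a n + b n = 0} = {n \<in> N. a n = b n}" unfolding ab using c by blast
  show ?thesis
  proof (rule ut_delta_idealI)
    show "utv delta_mark =
      lift_mark (tau H G {n \<in> N. a n = 0} + (tau H G {n \<in> N. b n = 0} + tau H G {n \<in> N. a n = b n}) -
      (tau H G N + tau H G N) - tau H G {n \<in> N. a n = 0 \<and> b n = 0})"
      unfolding utv_delta
      by (simp only: single[OF ut_preds(1) refl] two[OF ut_preds(2,5) conjunct1] two[OF ut_preds(3,3)]
        single[OF ut_preds(4) conjI[OF refl refl]] lift_mark_linear N1 N2 N3)
  qed (use N ut_preds[THEN utpart_subgroup, unfolded N2 N3] in \<open>intro vmarks_add vmarks_diff tau_vmarks\<close>)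
qed

end
end

section \<open>Decompositions in an additive quotient category\<close>

text \<open>\<open>M Q P\<close> is the group of morphisms from \<open>P\<close> to \<open>Q\<close>, and \<open>D\<close> is a two-sided ideal.\<close>

locale category_mod_ideal =
  fixes Ob :: "'o \<Rightarrow> bool" and M D :: "'o \<Rightarrow> 'o \<Rightarrow> 'm :: ab_group_add set"
    and cmp :: "'o \<Rightarrow> 'o \<Rightarrow> 'o \<Rightarrow> 'm \<Rightarrow> 'm \<Rightarrow> 'm" and ide :: "'o \<Rightarrow> 'm"
  assumes M_zero: "Ob Q \<Longrightarrow> Ob P \<Longrightarrow> 0 \<in> M Q P"
    and M_diff: "Ob Q \<Longrightarrow> Ob P \<Longrightarrow> x \<in> M Q P \<Longrightarrow> y \<in> M Q P \<Longrightarrow> x - y \<in> M Q P"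
    and D_sub: "Ob Q \<Longrightarrow> Ob P \<Longrightarrow> x \<in> D Q P \<Longrightarrow> x \<in> M Q P"
    and D_zero: "Ob Q \<Longrightarrow> Ob P \<Longrightarrow> 0 \<in> D Q P"
    and D_diff: "Ob Q \<Longrightarrow> Ob P \<Longrightarrow> x \<in> D Q P \<Longrightarrow> y \<in> D Q P \<Longrightarrow> x - y \<in> D Q P"
    and cmp_M: "Ob R \<Longrightarrow> Ob Q \<Longrightarrow> Ob P \<Longrightarrow> g \<in> M R Q \<Longrightarrow> f \<in> M Q P \<Longrightarrow> cmp R Q P g f \<in> M R P"
    and cmp_add_left: "Ob R \<Longrightarrow> Ob Q \<Longrightarrow> Ob P \<Longrightarrow> g \<in> M R Q \<Longrightarrow> g' \<in> M R Q \<Longrightarrow> f \<in> M Q P \<Longrightarrow>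
      cmp R Q P (g + g') f = cmp R Q P g f + cmp R Q P g' f"
    and cmp_add_right: "Ob R \<Longrightarrow> Ob Q \<Longrightarrow> Ob P \<Longrightarrow> g \<in> M R Q \<Longrightarrow> f \<in> M Q P \<Longrightarrow> f' \<in> M Q P \<Longrightarrow>
      cmp R Q P g (f + f') = cmp R Q P g f + cmp R Q P g f'"
    and cmp_assoc: "Ob S \<Longrightarrow> Ob R \<Longrightarrow> Ob Q \<Longrightarrow> Ob P \<Longrightarrow> h \<in> M S R \<Longrightarrow> g \<in> M R Q \<Longrightarrow> f \<in> M Q P \<Longrightarrow>
      cmp S Q P (cmp S R Q h g) f = cmp S R P h (cmp R Q P g f)"
    and cmp_D_left: "Ob R \<Longrightarrow> Ob Q \<Longrightarrow> Ob P \<Longrightarrow> g \<in> D R Q \<Longrightarrow> f \<in> M Q P \<Longrightarrow> cmp R Q P g f \<in> D R P"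
    and cmp_D_right: "Ob R \<Longrightarrow> Ob Q \<Longrightarrow> Ob P \<Longrightarrow> g \<in> M R Q \<Longrightarrow> f \<in> D Q P \<Longrightarrow> cmp R Q P g f \<in> D R P"
    and ide_M: "Ob P \<Longrightarrow> ide P \<in> M P P"
    and cmp_ide: "Ob Q \<Longrightarrow> Ob P \<Longrightarrow> f \<in> M Q P \<Longrightarrow> cmp Q Q P (ide Q) f = f"
      "Ob Q \<Longrightarrow> Ob P \<Longrightarrow> f \<in> M Q P \<Longrightarrow> cmp Q P P f (ide P) = f"
begin

lemma M_minus: "Ob Q \<Longrightarrow> Ob P \<Longrightarrow> x \<in> M Q P \<Longrightarrow> - x \<in> M Q P"
  using M_diff[OF _ _ M_zero, of Q P x] by simp

lemma M_add: "Ob Q \<Longrightarrow> Ob P \<Longrightarrow> x \<in> M Q P \<Longrightarrow> y \<in> M Q P \<Longrightarrow> x + y \<in> M Q P"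
  using M_diff[OF _ _ _ M_minus, of Q P x y] by simp

lemma D_minus: "Ob Q \<Longrightarrow> Ob P \<Longrightarrow> x \<in> D Q P \<Longrightarrow> - x \<in> D Q P"
  using D_diff[OF _ _ D_zero, of Q P x] by simp

lemma D_add: "Ob Q \<Longrightarrow> Ob P \<Longrightarrow> x \<in> D Q P \<Longrightarrow> y \<in> D Q P \<Longrightarrow> x + y \<in> D Q P"
  using D_diff[OF _ _ _ D_minus, of Q P x y] by simp

lemma cmp_diff_left:
  assumes "Ob R" "Ob Q" "Ob P" "g \<in> M R Q" "g' \<in> M R Q" "f \<in> M Q P"
  shows "cmp R Q P (g - g') f = cmp R Q P g f - cmp R Q P g' f"
  using cmp_add_left[OF assms(1-3) M_diff[OF assms(1,2,4,5)] assms(5,6)] by (simp add: eq_diff_eq)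

lemma cmp_diff_right:
  assumes "Ob R" "Ob Q" "Ob P" "g \<in> M R Q" "f \<in> M Q P" "f' \<in> M Q P"
  shows "cmp R Q P g (f - f') = cmp R Q P g f - cmp R Q P g f'"
  using cmp_add_right[OF assms(1-4) M_diff[OF assms(2,3,5,6)] assms(6)] by (simp add: eq_diff_eq)

lemma cmp_zero_left: "Ob R \<Longrightarrow> Ob Q \<Longrightarrow> Ob P \<Longrightarrow> f \<in> M Q P \<Longrightarrow> cmp R Q P 0 f = 0"
  using cmp_diff_left[OF _ _ _ M_zero M_zero, of R Q P f] by simp

lemma cmp_zero_right: "Ob R \<Longrightarrow> Ob Q \<Longrightarrow> Ob P \<Longrightarrow> g \<in> M R Q \<Longrightarrow> cmp R Q P g 0 = 0"
  using cmp_diff_right[OF _ _ _ _ M_zero M_zero, of R Q P g] by simp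

definition eqv :: "'o \<Rightarrow> 'o \<Rightarrow> 'm \<Rightarrow> 'm \<Rightarrow> bool" where
  "eqv Q P x y \<longleftrightarrow> x - y \<in> D Q P"

lemma eqv_refl: "Ob Q \<Longrightarrow> Ob P \<Longrightarrow> eqv Q P x x"
  by (simp add: eqv_def D_zero)

lemma eqv_sym: "Ob Q \<Longrightarrow> Ob P \<Longrightarrow> eqv Q P x y \<Longrightarrow> eqv Q P y x"
  unfolding eqv_def using D_minus[of Q P "x - y"] by simp

lemma eqv_trans: "Ob Q \<Longrightarrow> Ob P \<Longrightarrow> eqv Q P x y \<Longrightarrow> eqv Q P y z \<Longrightarrow> eqv Q P x z"
  unfolding eqv_def using D_add[of Q P "x - y" "y - z"] by simp

lemma eqv_add: "Ob Q \<Longrightarrow> Ob P \<Longrightarrow> eqv Q P x y \<Longrightarrow> eqv Q P x' y' \<Longrightarrow> eqv Q P (x + x') (y + y')"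
  unfolding eqv_def using D_add[of Q P "x - y" "x' - y'"] by (simp add: algebra_simps)

lemma eqv_cmp_left:
  assumes "Ob R" "Ob Q" "Ob P" "g \<in> M R Q" "g' \<in> M R Q" "f \<in> M Q P" "eqv R Q g g'"
  shows "eqv R P (cmp R Q P g f) (cmp R Q P g' f)"
  using cmp_D_left[OF assms(1-3), of "g - g'" f] assms(6,7) by (simp add: eqv_def cmp_diff_left[OF assms(1-6)])

lemma eqv_cmp_right:
  assumes "Ob R" "Ob Q" "Ob P" "g \<in> M R Q" "f \<in> M Q P" "f' \<in> M Q P" "eqv Q P f f'"
  shows "eqv R P (cmp R Q P g f) (cmp R Q P g f')"
  using cmp_D_right[OF assms(1-4), of "f - f'"] assms(7) by (simp add: eqv_def cmp_diff_right[OF assms(1-6)])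

text \<open>A part \<open>(Q, f, a, b)\<close> of \<open>P\<close> consists of \<open>a : (Q, f) \<rightarrow> P\<close> and \<open>b : P \<rightarrow> (Q, f)\<close> with \<open>b a = f\<close>.\<close>

definition part :: "'o \<Rightarrow> 'o \<times> 'm \<times> 'm \<times> 'm \<Rightarrow> bool" where
  "part P = (\<lambda>(Q, f, a, b). Ob Q \<and> f \<in> M Q Q \<and> a \<in> M P Q \<and> b \<in> M Q P \<and>
     eqv Q Q (cmp Q P Q b a) f \<and> eqv P Q (cmp P Q Q a f) a \<and> eqv Q P (cmp Q Q P f b) b)"

definition orth :: "'o \<Rightarrow> 'o \<times> 'm \<times> 'm \<times> 'm \<Rightarrow> 'o \<times> 'm \<times> 'm \<times> 'm \<Rightarrow> bool" where
  "orth P = (\<lambda>(Q, f, a, b) (Q', f', a', b').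
     eqv Q Q' (cmp Q P Q' b a') 0 \<and> eqv Q' Q (cmp Q' P Q b' a) 0)"

definition part_sum :: "'o \<Rightarrow> ('o \<times> 'm \<times> 'm \<times> 'm) list \<Rightarrow> 'm" where
  "part_sum P T = sum_list (map (\<lambda>(Q, f, a, b). cmp P Q P a b) T)"

abbreviation part_ob :: "'o \<times> 'm \<times> 'm \<times> 'm \<Rightarrow> 'o \<times> 'm" where
  "part_ob \<equiv> \<lambda>(Q, f, a, b). (Q, f)"

definition splits :: "'o \<times> 'm \<Rightarrow> ('o \<times> 'm \<times> 'm \<times> 'm) list \<Rightarrow> bool" where
  "splits = (\<lambda>(P, e) T. Ob P \<and> e \<in> M P P \<and> (\<forall>t\<in>set T. part P t) \<and> sorted_wrt (orth P) T \<and>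
     eqv P P (part_sum P T) e)"

text \<open>Only the summands are recorded, as a multiset, so that multiplicities can be added and
  summands replaced without following positions; the maps stay under the existential
  quantifier.\<close>

definition dec :: "'o \<times> 'm \<Rightarrow> ('o \<times> 'm) multiset \<Rightarrow> bool" where
  "dec X N \<longleftrightarrow> (\<exists>T. splits X T \<and> mset (map part_ob T) = N)"

lemma orth_sym: "orth P s t \<Longrightarrow> orth P t s"
  by (auto simp: orth_def split: prod.splits)

lemma sorted_wrt_perm:
  assumes "mset S = mset T" "sorted_wrt (orth P) S" shows "sorted_wrt (orth P) T"
  using assms
proof (induction S arbitrary: T)
  case (Cons s S)
  then have "s \<in> set T" by (metis list.set_intros(1) set_mset_mset)
  then obtain T1 T2 where T: "T = T1 @ s # T2" by (meson split_list)
  have "mset S = mset (T1 @ T2)" using Cons.prems(1) unfolding T by simp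
  then have "sorted_wrt (orth P) (T1 @ T2)" "set S = set (T1 @ T2)"
    using Cons.IH[of "T1 @ T2"] Cons.prems(2) mset_eq_setD[of S "T1 @ T2"] by simp_all
  then show ?case using Cons.prems(2) orth_sym unfolding T by (auto simp: sorted_wrt_append)
qed simp

lemma splits_perm:
  assumes "mset S = mset T" "splits X S" shows "splits X T"
proof -
  have "part_sum P S = part_sum P T" for P
    using arg_cong[OF assms(1), of "\<lambda>N. \<Sum>(Q, f, a, b)\<in>#N. cmp P Q P a b"] by (simp add: part_sum_def sum_mset_sum_list flip: mset_map)
  then show ?thesis using assms sorted_wrt_perm[OF assms(1)] mset_eq_setD[OF assms(1)]
    by (auto simp: splits_def)
qed

text \<open>Orthogonality is symmetric and the sum of the parts is commutative, so the parts may be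
  arranged in any prescribed order.\<close>

lemma dec_list:
  assumes "dec X (mset L)" shows "\<exists>T. splits X T \<and> map part_ob T = L"
proof -
  obtain S where S: "splits X S" "mset (map part_ob S) = mset L" using assms by (auto simp: dec_def)
  then obtain p where p: "p permutes {..<length (map part_ob S)}" "permute_list p (map part_ob S) = L"
    using mset_eq_permutation[of L "map part_ob S"] by metis
  have "mset (permute_list p S) = mset S" using p(1) by simp
  then have "splits X (permute_list p S)" using splits_perm[OF _ S(1)] by simp
  moreover have "map part_ob (permute_list p S) = L" using p by (simp add: permute_list_map)
  ultimately show ?thesis by blast
qed

lemma part_sum_append: "part_sum P (S @ T) = part_sum P S + part_sum P T"
  by (simp add: part_sum_def)

lemma part_sum_M: "Ob P \<Longrightarrow> \<forall>t\<in>set T. part P t \<Longrightarrow> part_sum P T \<in> M P P"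
  by (induction T) (auto simp: part_sum_def part_def M_zero M_add cmp_M split: prod.splits)

lemma part_sum_absorb:
  assumes P: "Ob P" and T: "\<forall>t\<in>set T. part P t" and o: "\<forall>t\<in>set T. orth P (Q, f, a, b) t" and Q: "part P (Q, f, a, b)"
  shows "eqv P Q (cmp P P Q (part_sum P T) a) 0" "eqv Q P (cmp Q P P b (part_sum P T)) 0"
proof -
  have Q': "Ob Q" "a \<in> M P Q" "b \<in> M Q P" using Q by (auto simp: part_def)
  have "eqv P Q (cmp P P Q (part_sum P T) a) 0 \<and> eqv Q P (cmp Q P P b (part_sum P T)) 0"
    using T o
  proof (induction T)
    case Nil
    then show ?case using P Q' by (simp add: part_sum_def cmp_zero_left cmp_zero_right eqv_refl)
  next
    case (Cons t T)
    obtain R g c d where t: "t = (R, g, c, d)" by (metis prod.collapse)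
    have R: "Ob R" "c \<in> M P R" "d \<in> M R P" using Cons.prems(1) by (auto simp: t part_def)
    have IH: "eqv P Q (cmp P P Q (part_sum P T) a) 0" "eqv Q P (cmp Q P P b (part_sum P T)) 0"
      using Cons by auto
    have s: "part_sum P (t # T) = cmp P R P c d + part_sum P T" by (simp add: part_sum_def t)
    have sM: "part_sum P T \<in> M P P" "cmp P R P c d \<in> M P P"
      using Cons.prems(1) P R by (auto intro: part_sum_M cmp_M)
    have o: "eqv Q R (cmp Q P R b c) 0" "eqv R Q (cmp R P Q d a) 0"
      using Cons.prems(2) by (auto simp: orth_def t)
    have "eqv P Q (cmp P R Q c (cmp R P Q d a)) (cmp P R Q c 0)"
      by (rule eqv_cmp_right) (use P Q' R o in \<open>auto intro: cmp_M M_zero\<close>)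
    then have 1: "eqv P Q (cmp P P Q (cmp P R P c d) a) 0"
      using P Q' R by (simp add: cmp_assoc cmp_zero_right)
    have "eqv Q P (cmp Q R P (cmp Q P R b c) d) (cmp Q R P 0 d)"
      by (rule eqv_cmp_left) (use P Q' R o in \<open>auto intro: cmp_M M_zero\<close>)
    then have 2: "eqv Q P (cmp Q P P b (cmp P R P c d)) 0"
      using P Q' R by (simp add: cmp_assoc cmp_zero_left)
    show ?case
      using eqv_add[OF P Q'(1) 1 IH(1)] eqv_add[OF Q'(1) P 2 IH(2)] P Q' sM
      by (simp add: s cmp_add_left cmp_add_right)
  qed
  then show "eqv P Q (cmp P P Q (part_sum P T) a) 0" "eqv Q P (cmp Q P P b (part_sum P T)) 0" by auto
qed

text \<open>A part refers only to its own idempotent f. Compatibility of its maps with e comes from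
  the sum of all parts: the others annihilate a and b by orthogonality, and \<open>a b a\<close>
  equals \<open>a f\<close>, hence a, modulo the ideal.\<close>

lemma splits_absorb:
  assumes "splits (P, e) T" "(Q, f, a, b) \<in> set T"
  shows "eqv P Q (cmp P P Q e a) a" "eqv Q P (cmp Q P P b e) b"
proof -
  let ?C = "cmp P Q P a b"
  obtain T1 T2 where T: "T = T1 @ (Q, f, a, b) # T2" using assms(2) by (meson split_list)
  have "splits (P, e) ((Q, f, a, b) # T1 @ T2)"
    by (rule splits_perm[OF _ assms(1)]) (simp add: T)
  then have P: "Ob P" "e \<in> M P P" "\<forall>t\<in>set (T1 @ T2). part P t" "\<forall>t\<in>set (T1 @ T2). orth P (Q, f, a, b) t"
    "part P (Q, f, a, b)" "eqv P P (?C + part_sum P (T1 @ T2)) e"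
    by (auto simp: splits_def part_sum_def)
  have Q: "Ob Q" "f \<in> M Q Q" "a \<in> M P Q" "b \<in> M Q P" "eqv Q Q (cmp Q P Q b a) f" "eqv P Q (cmp P Q Q a f) a"
    "eqv Q P (cmp Q Q P f b) b" using P(5) by (auto simp: part_def)
  have sM: "part_sum P (T1 @ T2) \<in> M P P" "?C \<in> M P P" using P Q by (auto intro: part_sum_M cmp_M)
  have "eqv P Q (cmp P Q Q a (cmp Q P Q b a)) (cmp P Q Q a f)"
    by (rule eqv_cmp_right) (use P Q in \<open>auto intro: cmp_M\<close>)
  then have "eqv P Q (cmp P P Q ?C a) a"
    using eqv_trans[OF P(1) Q(1) _ Q(6)] P Q by (simp add: cmp_assoc)
  from eqv_add[OF P(1) Q(1) this part_sum_absorb(1)[OF P(1,3,4,5)]]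
  have 1: "eqv P Q (cmp P P Q (?C + part_sum P (T1 @ T2)) a) a"
    using P Q sM by (simp add: cmp_add_left)
  have "eqv P Q (cmp P P Q (?C + part_sum P (T1 @ T2)) a) (cmp P P Q e a)"
    by (rule eqv_cmp_left) (use P Q sM in \<open>auto intro: M_add\<close>)
  then show "eqv P Q (cmp P P Q e a) a" using 1 eqv_trans eqv_sym P(1) Q(1) by blast
  have "eqv Q P (cmp Q Q P (cmp Q P Q b a) b) (cmp Q Q P f b)"
    by (rule eqv_cmp_left) (use P Q in \<open>auto intro: cmp_M\<close>)
  then have "eqv Q P (cmp Q P P b ?C) b"
    using eqv_trans[OF Q(1) P(1) _ Q(7)] P Q by (simp add: cmp_assoc)
  from eqv_add[OF Q(1) P(1) this part_sum_absorb(2)[OF P(1,3,4,5)]]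
  have 1: "eqv Q P (cmp Q P P b (?C + part_sum P (T1 @ T2))) b"
    using P Q sM by (simp add: cmp_add_right)
  have "eqv Q P (cmp Q P P b (?C + part_sum P (T1 @ T2))) (cmp Q P P b e)"
    by (rule eqv_cmp_right) (use P Q sM in \<open>auto intro: M_add\<close>)
  then show "eqv Q P (cmp Q P P b e) b" using 1 eqv_trans eqv_sym P(1) Q(1) by blast
qed

text \<open>The maps of the new parts are composites through the old part. They satisfy the
  conditions because \<open>b a\<close> in the middle acts as f, and by \<open>splits_absorb\<close>
  f acts as the identity on the maps of a splitting of (Q, f).\<close>

lemma splits_subst:
  assumes PT: "splits (P, e) ((Q, f, a, b) # T)" and QS: "splits (Q, f) S"
  shows "splits (P, e) (map (\<lambda>(R, g, c, d). (R, g, cmp P Q R a c, cmp R Q P d b)) S @ T)" (is "splits _ (map ?F S @ T)")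
proof -
  have P: "Ob P" "e \<in> M P P" "\<forall>t\<in>set T. part P t" "\<forall>t\<in>set T. orth P (Q, f, a, b) t" "sorted_wrt (orth P) T"
    "part P (Q, f, a, b)" "eqv P P (cmp P Q P a b + part_sum P T) e"
    using PT by (auto simp: splits_def part_sum_def)
  have Q: "Ob Q" "f \<in> M Q Q" "a \<in> M P Q" "b \<in> M Q P" "eqv Q Q (cmp Q P Q b a) f" "eqv P Q (cmp P Q Q a f) a"
    "eqv Q P (cmp Q Q P f b) b" using P(6) by (auto simp: part_def)
  have S: "\<forall>s\<in>set S. part Q s" "sorted_wrt (orth Q) S" "eqv Q Q (part_sum Q S) f"
    using QS by (auto simp: splits_def)
  have mid: "eqv R R' (cmp R P R' (cmp R Q P d b) (cmp P Q R' a c)) (cmp R Q R' d c)"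
    if R: "Ob R" "Ob R'" and d: "d \<in> M R Q" and c: "c \<in> M Q R'" and fc: "eqv Q R' (cmp Q Q R' f c) c" for R R' c d
  proof -
    have "cmp R P R' (cmp R Q P d b) (cmp P Q R' a c) = cmp R Q R' d (cmp Q P R' b (cmp P Q R' a c))"
      using P(1) Q R d c by (simp add: cmp_assoc cmp_M)
    also have "cmp Q P R' b (cmp P Q R' a c) = cmp Q Q R' (cmp Q P Q b a) c"
      using P(1) Q R d c by (simp add: cmp_assoc)
    finally have 1: "cmp R P R' (cmp R Q P d b) (cmp P Q R' a c) = cmp R Q R' d (cmp Q Q R' (cmp Q P Q b a) c)" .
    have "eqv Q R' (cmp Q Q R' (cmp Q P Q b a) c) (cmp Q Q R' f c)"
      by (rule eqv_cmp_left) (use P(1) Q R c in \<open>auto intro: cmp_M\<close>)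
    then have "eqv Q R' (cmp Q Q R' (cmp Q P Q b a) c) c" by (rule eqv_trans[OF Q(1) R(2) _ fc])
    then show ?thesis unfolding 1
      by (intro eqv_cmp_right) (use P(1) Q R c d in \<open>auto intro: cmp_M\<close>)
  qed
  have Sm: "Ob R" "g \<in> M R R" "c \<in> M Q R" "d \<in> M R Q" "eqv R R (cmp R Q R d c) g" "eqv Q R (cmp Q R R c g) c" "eqv R Q (cmp R R Q g d) d"
      "eqv Q R (cmp Q Q R f c) c" if "(R, g, c, d) \<in> set S" for R g c d
    using S(1) that splits_absorb[OF QS that] by (auto simp: part_def)
  have p1: "part P (?F s)" if s: "s \<in> set S" for s
  proof -
    obtain R g c d where sd: "s = (R, g, c, d)" by (metis prod.collapse)
    note R = Sm[OF s[unfolded sd]]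
    have "eqv R R (cmp R P R (cmp R Q P d b) (cmp P Q R a c)) g"
      by (rule eqv_trans[OF R(1) R(1) mid[OF R(1) R(1) R(4) R(3) R(8)] R(5)])
    moreover have "eqv P R (cmp P Q R a (cmp Q R R c g)) (cmp P Q R a c)"
      by (rule eqv_cmp_right) (use P(1) Q R in \<open>auto intro: cmp_M\<close>)
    moreover have "eqv R P (cmp R Q P (cmp R R Q g d) b) (cmp R Q P d b)"
      by (rule eqv_cmp_left) (use P(1) Q R in \<open>auto intro: cmp_M\<close>)
    ultimately show ?thesis using P(1) Q(1-4) R(1-4) by (simp add: sd part_def cmp_M cmp_assoc)
  qed
  have o1: "orth P (?F s) (?F s')" if s: "s \<in> set S" "s' \<in> set S" "orth Q s s'" for s s'
  proof -
    obtain R g c d where sd: "s = (R, g, c, d)" by (metis prod.collapse)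
    obtain R' g' c' d' where sd': "s' = (R', g', c', d')" by (metis prod.collapse)
    note R = Sm[OF s(1)[unfolded sd]] and R' = Sm[OF s(2)[unfolded sd']]
    have "eqv R R' (cmp R Q R' d c') 0" "eqv R' R (cmp R' Q R d' c) 0"
      using s(3) by (auto simp: sd sd' orth_def)
    then show ?thesis
      using eqv_trans[OF R(1) R'(1) mid[OF R(1) R'(1) R(4) R'(3) R'(8)]]
        eqv_trans[OF R'(1) R(1) mid[OF R'(1) R(1) R'(4) R(3) R(8)]]
      by (auto simp: sd sd' orth_def)
  qed
  have o2: "orth P (?F s) t" if s: "s \<in> set S" and t: "t \<in> set T" for s t
  proof -
    obtain R g c d where sd: "s = (R, g, c, d)" by (metis prod.collapse)
    obtain R' g' a' b' where td: "t = (R', g', a', b')" by (metis prod.collapse)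
    note R = Sm[OF s[unfolded sd]]
    have R': "Ob R'" "a' \<in> M P R'" "b' \<in> M R' P" using P(3) t by (auto simp: td part_def)
    have o: "eqv Q R' (cmp Q P R' b a') 0" "eqv R' Q (cmp R' P Q b' a) 0" using P(4) t by (auto simp: td orth_def)
    have "eqv R R' (cmp R Q R' d (cmp Q P R' b a')) (cmp R Q R' d 0)"
      by (rule eqv_cmp_right) (use P(1) Q R R' o in \<open>auto intro: cmp_M M_zero\<close>)
    moreover have "eqv R' R (cmp R' Q R (cmp R' P Q b' a) c) (cmp R' Q R 0 c)"
      by (rule eqv_cmp_left) (use P(1) Q R R' o in \<open>auto intro: cmp_M M_zero\<close>)
    ultimately show ?thesis using P(1) Q(1-4) R(1-4) R'
      by (simp add: sd td orth_def cmp_assoc cmp_zero_left cmp_zero_right)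
  qed
  have sum: "part_sum P (map ?F S) = cmp P Q P (cmp P Q Q a (part_sum Q S)) b"
    using S(1)
  proof (induction S)
    case Nil
    then show ?case using P(1) Q by (simp add: part_sum_def cmp_zero_left cmp_zero_right)
  next
    case (Cons s S)
    obtain R g c d where sd: "s = (R, g, c, d)" by (metis prod.collapse)
    have R: "Ob R" "c \<in> M Q R" "d \<in> M R Q" using Cons.prems by (auto simp: sd part_def)
    have IH: "part_sum P (map ?F S) = cmp P Q P (cmp P Q Q a (part_sum Q S)) b"
      using Cons by simp
    have sM: "part_sum Q S \<in> M Q Q" "cmp Q R Q c d \<in> M Q Q" using Cons.prems Q(1) R by (auto intro: part_sum_M cmp_M)
    have "part_sum P (map ?F (s # S)) = cmp P R P (cmp P Q R a c) (cmp R Q P d b) + part_sum P (map ?F S)"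
      by (simp add: part_sum_def sd)
    also have "cmp P R P (cmp P Q R a c) (cmp R Q P d b) = cmp P Q P (cmp P Q Q a (cmp Q R Q c d)) b"
      using P(1) Q(1-4) R by (simp add: cmp_assoc cmp_M)
    finally have 1: "part_sum P (map ?F (s # S)) = cmp P Q P (cmp P Q Q a (cmp Q R Q c d)) b + part_sum P (map ?F S)" .
    have 2: "part_sum Q (s # S) = cmp Q R Q c d + part_sum Q S" by (simp add: part_sum_def sd)
    show ?case unfolding 1 2 IH
      using P(1) Q(1-4) R sM by (simp add: cmp_add_left cmp_add_right cmp_M)
  qed
  have sQ: "part_sum Q S \<in> M Q Q" by (rule part_sum_M[OF Q(1) S(1)])
  have "eqv P Q (cmp P Q Q a (part_sum Q S)) (cmp P Q Q a f)"
    by (rule eqv_cmp_right) (use P(1) Q sQ S(3) in auto)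
  then have "eqv P Q (cmp P Q Q a (part_sum Q S)) a" by (rule eqv_trans[OF P(1) Q(1) _ Q(6)])
  then have "eqv P P (cmp P Q P (cmp P Q Q a (part_sum Q S)) b) (cmp P Q P a b)"
    by (intro eqv_cmp_left) (use P(1) Q sQ in \<open>auto intro: cmp_M\<close>)
  from eqv_add[OF P(1) P(1) this eqv_refl[OF P(1) P(1)]]
  have "eqv P P (part_sum P (map ?F S @ T)) (cmp P Q P a b + part_sum P T)"
    unfolding part_sum_append sum .
  then have "eqv P P (part_sum P (map ?F S @ T)) e" by (rule eqv_trans[OF P(1) P(1) _ P(7)])
  moreover have "sorted_wrt (orth P) (map ?F S @ T)"
  proof -
    have "sorted_wrt (\<lambda>s s'. orth P (?F s) (?F s')) S"
      by (rule sorted_wrt_mono_rel[OF _ S(2)]) (rule o1)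
    then show ?thesis using P(5) o2 by (simp only: sorted_wrt_append sorted_wrt_map) auto
  qed
  moreover have "\<forall>t\<in>set (map ?F S @ T). part P t" using p1 P(3) by (auto simp del: split_paired_All)
  ultimately show ?thesis using P(1,2) by (simp add: splits_def)
qed

lemma dec_subst:
  assumes "dec X (add_mset Y N)" "dec Y N'" shows "dec X (N' + N)"
proof -
  obtain L where L: "mset L = N" by (metis ex_mset)
  obtain P e where X: "X = (P, e)" by (cases X)
  have "dec X (mset (Y # L))" using assms(1) L by simp
  then obtain T0 where T0: "splits X T0" "map part_ob T0 = Y # L" using dec_list[of X "Y # L"] by auto
  then obtain Q f a b T where T: "T0 = (Q, f, a, b) # T" "Y = (Q, f)" "map part_ob T = L"
    by (cases T0) auto
  obtain S where S: "splits Y S" "mset (map part_ob S) = N'" using assms(2) by (auto simp: dec_def)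
  have "splits X (map (\<lambda>(R, g, c, d). (R, g, cmp P Q R a c, cmp R Q P d b)) S @ T)"
    using splits_subst T0(1) S(1) unfolding X T by blast
  moreover have "mset (map part_ob (map (\<lambda>(R, g, c, d). (R, g, cmp P Q R a c, cmp R Q P d b)) S @ T)) = N' + N"
  proof -
    have "map part_ob (map (\<lambda>(R, g, c, d). (R, g, cmp P Q R a c, cmp R Q P d b)) S) = map part_ob S"
      by (auto simp: case_prod_beta)
    then show ?thesis using S(2) L T(3) by (simp only: map_append mset_append)
  qed
  ultimately show ?thesis unfolding dec_def by blast
qed

lemma dec_subst_all:
  assumes "dec X (image_mset G N + N')" and "\<And>y. y \<in># N \<Longrightarrow> dec (G y) (F y)"
  shows "dec X ((\<Sum>y\<in>#N. F y) + N')"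
  using assms
proof (induction N arbitrary: N')
  case (add y N)
  have "dec X (F y + (image_mset G N + N'))" using dec_subst[of X "G y"] add.prems by simp
  then have "dec X (image_mset G N + (F y + N'))" by (simp add: ac_simps)
  then have "dec X ((\<Sum>y\<in>#N. F y) + (F y + N'))" by (rule add.IH) (use add.prems in auto)
  then show ?case by (simp add: ac_simps)
qed simp

lemma dec_single:
  assumes P: "Ob P" "e \<in> M P P" and Q: "Ob Q" "f \<in> M Q Q" "a \<in> M P Q" "b \<in> M Q P"
    and "eqv Q Q (cmp Q P Q b a) f" "eqv P P (cmp P Q P a b) e" "eqv P Q (cmp P Q Q a f) a" "eqv Q P (cmp Q Q P f b) b"
  shows "dec (P, e) {#(Q, f)#}"
  unfolding dec_def by (rule exI[of _ "[(Q, f, a, b)]"]) (use assms in \<open>simp add: splits_def part_def part_sum_def\<close>)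

lemma dec_two:
  assumes P: "Ob P" "e \<in> M P P" and Q: "Ob Q" "f \<in> M Q Q" "a \<in> M P Q" "b \<in> M Q P"
    and 1: "eqv Q Q (cmp Q P Q b a) f" "eqv P Q (cmp P Q Q a f) a" "eqv Q P (cmp Q Q P f b) b"
    and R: "Ob R" "g \<in> M R R" "c \<in> M P R" "d \<in> M R P"
    and 2: "eqv R R (cmp R P R d c) g" "eqv P R (cmp P R R c g) c" "eqv R P (cmp R R P g d) d"
    and o: "eqv Q R (cmp Q P R b c) 0" "eqv R Q (cmp R P Q d a) 0"
    and s: "eqv P P (cmp P Q P a b + cmp P R P c d) e"
  shows "dec (P, e) {#(Q, f), (R, g)#}"
  unfolding dec_def by (rule exI[of _ "[(Q, f, a, b), (R, g, c, d)]"])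
    (use assms in \<open>simp add: splits_def part_def part_sum_def orth_def\<close>)

end

interpretation C: category_mod_ideal finite_group "vmarks :: 'g monoid \<Rightarrow> _" delta_ideal vcomp "\<lambda>P. mark P P (id_biset P)"
  by unfold_locales (assumption | rule two_groups.vmarks_zero two_groups.vmarks_diff two_groups.mark_vmarks
    two_groups.delta_ideal_zero two_groups.delta_ideal_diff three_groups.delta_ideal_right three_groups.delta_ideal_left
    three_groups.vcomp_closed three_groups.vcomp_add_left three_groups.vcomp_add_right vcomp_assoc vcomp_id
    two_groups.delta_ideal_vmarks fin_biset_id three_groups.intro two_groups.intro)+

section \<open>The bisets attached to subquotients\<close>

text \<open>Congruence modulo K as a relation. Its transitive biset is the quotient biset of K, and
  composition of quotient bisets becomes composition of congruences.\<close>

definition mod_rel :: "'g monoid \<Rightarrow> 'g set \<Rightarrow> ('g \<times> 'g) set" where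
  "mod_rel P K = {(x, y). x \<in> carrier P \<and> y \<in> carrier P \<and> x \<otimes>\<^bsub>P\<^esub> inv\<^bsub>P\<^esub> y \<in> K}"

definition quot_mark :: "'g monoid \<Rightarrow> 'g set \<Rightarrow> ('g, 'g) vmark" where
  "quot_mark P K = tau P P (mod_rel P K)"

definition hom_graph :: "'p set \<Rightarrow> ('p \<Rightarrow> 'q) \<Rightarrow> ('p \<times> 'q) set" where
  "hom_graph A \<pi> = {(x, \<pi> x) | x. x \<in> A}"

lemma mod_rel_subgroup:
  fixes G (structure)
  assumes "group G" "K \<lhd> G" shows "subgroup (mod_rel G K) (G \<times>\<times> G)"
proof -
  interpret group G by fact
  interpret K: normal K G by fact
  interpret GG: group "G \<times>\<times> G" by (intro DirProd_group is_group)
  show ?thesis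
  proof (rule GG.subgroupI)
    show "mod_rel G K \<subseteq> carrier (G \<times>\<times> G)" by (auto simp: mod_rel_def)
    have "(\<one>, \<one>) \<in> mod_rel G K" by (simp add: mod_rel_def)
    then show "mod_rel G K \<noteq> {}" by blast
    fix p assume "p \<in> mod_rel G K"
    then obtain x y where p: "p = (x, y)" "x \<in> carrier G" "y \<in> carrier G" "x \<otimes> inv y \<in> K"
      by (auto simp: mod_rel_def)
    have "inv x \<otimes> inv (x \<otimes> inv y) \<otimes> x \<in> K"
      using K.inv_op_closed1[OF p(2) K.m_inv_closed[OF p(4)]] .
    moreover have "inv x \<otimes> inv (x \<otimes> inv y) \<otimes> x = inv x \<otimes> y"
      using p by (simp add: inv_mult_group m_assoc)
    ultimately show "inv\<^bsub>G \<times>\<times> G\<^esub> p \<in> mod_rel G K" using p by (simp add: mod_rel_def inv_DirProd is_group)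
    fix q assume "q \<in> mod_rel G K"
    then obtain x' y' where q: "q = (x', y')" "x' \<in> carrier G" "y' \<in> carrier G" "x' \<otimes> inv y' \<in> K"
      by (auto simp: mod_rel_def)
    have "(x \<otimes> (x' \<otimes> inv y') \<otimes> inv x) \<otimes> (x \<otimes> inv y) \<in> K"
      using K.inv_op_closed2[OF p(2) q(4)] p(4) by (rule K.m_closed)
    moreover have "(x \<otimes> (x' \<otimes> inv y') \<otimes> inv x) \<otimes> (x \<otimes> inv y) = x \<otimes> x' \<otimes> inv (y \<otimes> y')"
      using p q by (simp add: inv_mult_group m_assoc) (simp add: m_assoc[symmetric])
    ultimately show "p \<otimes>\<^bsub>G \<times>\<times> G\<^esub> q \<in> mod_rel G K" using p q by (simp add: mod_rel_def)
  qed
qed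

lemma hom_graph_subgroup:
  fixes P (structure)
  assumes "group P" "group Q" "subgroup A P" "\<pi> \<in> hom (P\<lparr>carrier := A\<rparr>) Q"
  shows "subgroup (hom_graph A \<pi>) (P \<times>\<times> Q)" "subgroup ((hom_graph A \<pi>)\<inverse>) (Q \<times>\<times> P)"
proof -
  let ?H = "hom_graph A \<pi>"
  interpret P: group P by fact
  interpret Q: group Q by fact
  interpret A: subgroup A P by fact
  interpret PA: group "P\<lparr>carrier := A\<rparr>" by (rule A.subgroup_is_group) fact
  interpret pi: group_hom "P\<lparr>carrier := A\<rparr>" Q \<pi> by unfold_locales (use assms in auto)
  interpret PQ: group "P \<times>\<times> Q" by (intro DirProd_group P.is_group Q.is_group)
  interpret QP: group "Q \<times>\<times> P" by (intro DirProd_group P.is_group Q.is_group)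
  have m: "\<pi> x \<in> carrier Q" if "x \<in> A" for x using pi.hom_closed[of x] that by simp
  have mult: "\<pi> (x \<otimes> y) = \<pi> x \<otimes>\<^bsub>Q\<^esub> \<pi> y" if "x \<in> A" "y \<in> A" for x y using pi.hom_mult[of x y] that by simp
  have inv: "\<pi> (inv x) = inv\<^bsub>Q\<^esub> \<pi> x" if "x \<in> A" for x
    using pi.hom_inv[of x] that P.m_inv_consistent[OF assms(3)] by simp
  have one: "\<pi> \<one> = \<one>\<^bsub>Q\<^esub>" using pi.hom_one by simp
  show "subgroup ?H (P \<times>\<times> Q)"
  proof (rule PQ.subgroupI)
    have "(\<one>, \<one>\<^bsub>Q\<^esub>) \<in> ?H" using one A.one_closed by (force simp: hom_graph_def)
    then show "?H \<noteq> {}" by blast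
  qed (auto simp: hom_graph_def m mult inv inv_DirProd P.is_group Q.is_group)
  show "subgroup (?H\<inverse>) (Q \<times>\<times> P)"
  proof (rule QP.subgroupI)
    have "(\<one>\<^bsub>Q\<^esub>, \<one>) \<in> ?H\<inverse>" using one A.one_closed by (force simp: hom_graph_def)
    then show "?H\<inverse> \<noteq> {}" by blast
  qed (auto simp: hom_graph_def m mult inv inv_DirProd P.is_group Q.is_group)
qed

text \<open>The relation at the neutral element is the diagonal, which is congruence modulo the
  trivial subgroup.\<close>

lemma id_mark:
  fixes P (structure)
  assumes "finite_group P" shows "mark P P (id_biset P) = quot_mark P {\<one>}"
proof -
  let ?I = "id_biset P"
  interpret two_groups P P by unfold_locales fact+
  note I = fin_biset_id[OF assms]
  have "mark P P ?I = tau P P (pt_rel P P ?I \<one>)"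
  proof (rule mark_transitive[OF I])
    show "fst ?I \<subseteq> orbit_of P P ?I \<one>"
    proof
      fix x assume "x \<in> fst ?I"
      then have "x \<in> carrier P" "x = snd ?I (x, \<one>) \<one>" by simp_all
      then show "x \<in> orbit_of P P ?I \<one>" unfolding orbit_of_def by blast
    qed
  qed simp
  moreover have "pt_rel P P ?I \<one> = mod_rel P {\<one>}"
    by (auto simp: pt_rel_def mod_rel_def id_lact_ract[OF H.is_group] H.inv_solve_right')
  ultimately show ?thesis by (simp add: quot_mark_def)
qed

lemma quot_biset_mark:
  fixes P (structure)
  assumes P: "finite_group P" and K: "K \<lhd> P"
  shows "fin_biset P P (quot_biset P K)" "mark P P (quot_biset P K) = quot_mark P K"
proof -
  let ?Q = "quot_biset P K"
  interpret two_groups P P by unfold_locales fact+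
  interpret K: normal K P by fact
  have act: "(a <# (K #> x)) #> b = K #> (a \<otimes> x \<otimes> b)"
    if "a \<in> carrier P" "x \<in> carrier P" "b \<in> carrier P" for a x b
  proof -
    have "a <# (K #> x) = (a <# K) #> x"
      using that K.subset by (simp add: H.coset_assoc)
    also have "a <# K = K #> a" using K.coset_eq that by simp
    finally show ?thesis using that K.subset by (simp add: H.coset_mult_assoc)
  qed
  have X: "fst ?Q = (\<lambda>x. K #> x) ` carrier P" by (auto simp: quot_biset_def RCOSETS_def)
  have S: "snd ?Q (a, b) (K #> x) = K #> (a \<otimes> x \<otimes> b)"
    if "a \<in> carrier P" "x \<in> carrier P" "b \<in> carrier P" for a x b
    using that by (simp add: quot_biset_def act H.rcosetsI K.subset)
  have S1: "snd ?Q (a, b) K = K #> (a \<otimes> b)"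
    if "a \<in> carrier P" "b \<in> carrier P" for a b
    using S[of a "\<one>" b] that K.subset by simp
  show U: "fin_biset P P ?Q"
  proof (rule fin_bisetI)
    show "finite (fst ?Q)" by (simp add: X)
    show "snd ?Q (h, g) \<in> extensional (fst ?Q)" for h g
      by (simp add: quot_biset_def)
  qed (auto simp: X S H.m_assoc)
  have K1: "K \<in> fst ?Q" using X K.subset by (auto intro!: image_eqI[of _ _ "\<one>"])
  have "mark P P ?Q = tau P P (pt_rel P P ?Q K)"
  proof (rule mark_transitive[OF U K1])
    show "fst ?Q \<subseteq> orbit_of P P ?Q K"
    proof
      fix c assume "c \<in> fst ?Q"
      then obtain x where "x \<in> carrier P" "c = K #> x" unfolding X by blast
      then have "x \<in> carrier P" "c = snd ?Q (x, \<one>) K" by (simp_all add: S1)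
      then show "c \<in> orbit_of P P ?Q K" unfolding orbit_of_def by blast
    qed
  qed
  moreover have "pt_rel P P ?Q K = mod_rel P K"
  proof -
    have "K #> x = K #> y \<longleftrightarrow> x \<otimes> inv y \<in> K" if "x \<in> carrier P" "y \<in> carrier P" for x y
      using that H.rcos_self[OF _ K.is_subgroup] K.rcos_module_imp[OF H.is_group] K.rcos_module_rev[OF H.is_group]
        H.repr_independence[OF _ _ K.is_subgroup] by metis
    then have "lact P ?Q x K = ract P ?Q K y \<longleftrightarrow> x \<otimes> inv y \<in> K"
      if "x \<in> carrier P" "y \<in> carrier P" for x y using that by (simp add: lact_def ract_def S1)
    then show ?thesis by (auto simp: pt_rel_def mod_rel_def)
  qed
  ultimately show "mark P P ?Q = quot_mark P K" by (simp add: quot_mark_def)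
qed

context category_mod_ideal begin

text \<open>\<alpha> and \<beta> are maps for the whole of Q. Cutting them down to
  \<open>\<alpha> f\<close> and \<open>f \<beta>\<close> turns them into maps from and to the
  summand (Q, f).\<close>

lemma dec_sub:
  assumes P: "Ob P" "e \<in> M P P" and Q: "Ob Q" "f \<in> M Q Q" and \<alpha>: "\<alpha> \<in> M P Q" and \<beta>: "\<beta> \<in> M Q P"
    and ff: "eqv Q Q (cmp Q Q Q f f) f" and ba: "eqv Q Q (cmp Q Q Q (cmp Q P Q \<beta> \<alpha>) f) f"
    and ab: "eqv P P (cmp P Q P \<alpha> (cmp Q Q P f \<beta>)) e"
  shows "dec (P, e) {#(Q, f)#}"
proof (rule dec_single[OF P Q])
  let ?c = "cmp Q Q P f \<beta>"
  let ?C = "cmp P Q Q \<alpha>"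
  note m = P Q \<alpha> \<beta>
  show aM: "?C f \<in> M P Q" and bM: "?c \<in> M Q P" using m by (auto intro: cmp_M)
  have "eqv Q Q (cmp Q Q Q f (cmp Q Q Q (cmp Q P Q \<beta> \<alpha>) f)) (cmp Q Q Q f f)"
    by (rule eqv_cmp_right) (use m ba in \<open>auto intro: cmp_M\<close>)
  then have "eqv Q Q (cmp Q Q Q f (cmp Q Q Q (cmp Q P Q \<beta> \<alpha>) f)) f" by (rule eqv_trans[OF Q(1) Q(1) _ ff])
  then show "eqv Q Q (cmp Q P Q ?c (?C f)) f" using m by (simp add: cmp_assoc cmp_M)
  have "eqv P Q (?C (cmp Q Q Q f f)) (?C f)"
    by (rule eqv_cmp_right) (use m ff in \<open>auto intro: cmp_M\<close>)
  then show af: "eqv P Q (cmp P Q Q (?C f) f) (?C f)" using m by (simp add: cmp_assoc cmp_M)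
  have "eqv Q P (cmp Q Q P (cmp Q Q Q f f) \<beta>) ?c"
    by (rule eqv_cmp_left) (use m ff in \<open>auto intro: cmp_M\<close>)
  then show "eqv Q P (cmp Q Q P f ?c) ?c" using m by (simp add: cmp_assoc cmp_M)
  have "eqv P P (cmp P Q P (cmp P Q Q (?C f) f) \<beta>) (cmp P Q P (?C f) \<beta>)"
    by (rule eqv_cmp_left) (use m af in \<open>auto intro: cmp_M\<close>)
  then have "eqv P P (cmp P Q P (?C f) ?c) (cmp P Q P \<alpha> ?c)"
    using m by (simp add: cmp_assoc cmp_M)
  then show "eqv P P (cmp P Q P (?C f) ?c) e" by (rule eqv_trans[OF P(1) P(1) _ ab])
qed

text \<open>Each idempotent is at once the inclusion and the projection of the summand that it
  splits off.\<close>

lemma dec_orthogonal: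
  assumes P: "Ob P" and g: "g \<in> M P P" "g' \<in> M P P" "e \<in> M P P"
    and "eqv P P (cmp P P P g g) g" "eqv P P (cmp P P P g' g') g'" "eqv P P (cmp P P P g g') 0"
      "eqv P P (cmp P P P g' g) 0" "eqv P P (g + g') e"
  shows "dec (P, e) {#(P, g), (P, g')#}"
proof (rule dec_two[OF P g(3) P g(1) g(1,1) assms(5,5,5) P g(2) g(2,2) assms(6,6,6) assms(7,8)])
  show "eqv P P (cmp P P P g g + cmp P P P g' g') e"
    using eqv_trans[OF P P eqv_add[OF P P assms(5,6)] assms(9)] .
qed

end

text \<open>The difference of two quotient idempotents. With K trivial and K' generated by a central
  involution z, it is the complement in P of the summand that comes from P modulo z.\<close>

abbreviation edge_ob :: "'g monoid \<Rightarrow> 'g set \<Rightarrow> 'g set \<Rightarrow> 'g monoid \<times> ('g, 'g) vmark" where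
  "edge_ob P K K' \<equiv> (P, quot_mark P K - quot_mark P K')"

lemma mod_rel_comp:
  fixes P (structure)
  assumes "group P" and K: "K \<lhd> P" and K': "K' \<lhd> P" and "K \<subseteq> K'"
  shows "mod_rel P K O mod_rel P K' = mod_rel P K'" "mod_rel P K' O mod_rel P K = mod_rel P K'"
proof -
  let ?M = "mod_rel P K'"
  interpret group P by fact
  interpret K': normal K' P by fact
  have one: "(x, x) \<in> mod_rel P K" if "x \<in> carrier P" for x
    using that normal_imp_subgroup[OF K] by (simp add: mod_rel_def subgroup.one_closed)
  have mult: "(x, z) \<in> ?M" if "(x, y) \<in> ?M" "(y, z) \<in> ?M" for x y z
  proof -
    have m: "x \<in> carrier P" "y \<in> carrier P" "z \<in> carrier P" using that by (auto simp: mod_rel_def)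
    have "(x \<otimes> inv y) \<otimes> (y \<otimes> inv z) \<in> K'" using that by (auto simp: mod_rel_def)
    moreover have "(x \<otimes> inv y) \<otimes> (y \<otimes> inv z) = x \<otimes> inv z"
      using m by (simp add: m_assoc) (simp add: m_assoc[symmetric])
    ultimately show ?thesis using m by (simp add: mod_rel_def)
  qed
  have sub: "mod_rel P K \<subseteq> ?M" using assms(4) by (auto simp: mod_rel_def)
  have c: "x \<in> carrier P \<and> y \<in> carrier P" if "(x, y) \<in> ?M" for x y using that by (simp add: mod_rel_def)
  show "mod_rel P K O ?M = ?M"
  proof (intro equalityI subrelI)
    fix x z assume "(x, z) \<in> mod_rel P K O ?M"
    then show "(x, z) \<in> ?M" using mult sub by (elim relcompE) auto
  next
    fix x z assume "(x, z) \<in> ?M"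
    then show "(x, z) \<in> mod_rel P K O ?M" using one c by (intro relcompI[of x x]) auto
  qed
  show "?M O mod_rel P K = ?M"
  proof (intro equalityI subrelI)
    fix x z assume "(x, z) \<in> ?M O mod_rel P K"
    then show "(x, z) \<in> ?M" using mult sub by (elim relcompE) auto
  next
    fix x z assume "(x, z) \<in> ?M"
    then show "(x, z) \<in> ?M O mod_rel P K" using one c by (intro relcompI[of x z]) auto
  qed
qed

lemma relcomp_subgroup:
  fixes K (structure)
  assumes "group K" "group H" "group G" and L: "subgroup L (K \<times>\<times> H)" and M: "subgroup M (H \<times>\<times> G)"
  shows "subgroup (L O M) (K \<times>\<times> G)"
proof -
  interpret K: group K by fact
  interpret H: group H by fact
  interpret G: group G by fact
  interpret KG: group "K \<times>\<times> G" by (intro DirProd_group K.is_group G.is_group)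
  have c: "k \<in> carrier K" "h \<in> carrier H" if "(k, h) \<in> L" for k h
    using subgroup.subset[OF L] that by auto
  have c': "h \<in> carrier H" "g \<in> carrier G" if "(h, g) \<in> M" for h g
    using subgroup.subset[OF M] that by auto
  show ?thesis
  proof (rule KG.subgroupI)
    show "L O M \<subseteq> carrier (K \<times>\<times> G)" using c(1) c'(2) by auto
    have "(\<one>, \<one>\<^bsub>G\<^esub>) \<in> L O M"
      using subgroup.one_closed[OF L] subgroup.one_closed[OF M] by auto
    then show "L O M \<noteq> {}" by blast
    fix p assume "p \<in> L O M"
    then obtain k h g where p: "p = (k, g)" "(k, h) \<in> L" "(h, g) \<in> M" by (elim relcompE)
    have "(inv k, inv\<^bsub>H\<^esub> h) \<in> L" "(inv\<^bsub>H\<^esub> h, inv\<^bsub>G\<^esub> g) \<in> M"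
      using subgroup.m_inv_closed[OF L p(2)] subgroup.m_inv_closed[OF M p(3)] c[OF p(2)] c'[OF p(3)]
      by (simp_all add: inv_DirProd K.is_group H.is_group G.is_group)
    then have "(inv k, inv\<^bsub>G\<^esub> g) \<in> L O M" by (rule relcompI)
    then show "inv\<^bsub>K \<times>\<times> G\<^esub> p \<in> L O M" using c[OF p(2)] c'[OF p(3)]
      by (simp add: p(1) inv_DirProd K.is_group G.is_group)
    fix q assume "q \<in> L O M"
    then obtain k' h' g' where q: "q = (k', g')" "(k', h') \<in> L" "(h', g') \<in> M" by (elim relcompE)
    have "(k \<otimes> k', h \<otimes>\<^bsub>H\<^esub> h') \<in> L" "(h \<otimes>\<^bsub>H\<^esub> h', g \<otimes>\<^bsub>G\<^esub> g') \<in> M"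
      using subgroup.m_closed[OF L p(2) q(2)] subgroup.m_closed[OF M p(3) q(3)] by simp_all
    then show "p \<otimes>\<^bsub>K \<times>\<times> G\<^esub> q \<in> L O M" unfolding p(1) q(1) by (simp add: relcompI)
  qed
qed

lemma mod_rel_Domain:
  assumes "group P" "K \<lhd> P" shows "Domain (mod_rel P K) = carrier P" "Range (mod_rel P K) = carrier P"
proof -
  interpret group P by fact
  have "(x, x) \<in> mod_rel P K" if "x \<in> carrier P" for x
    using that normal_imp_subgroup[OF assms(2)] by (simp add: mod_rel_def subgroup.one_closed)
  then show "Domain (mod_rel P K) = carrier P" "Range (mod_rel P K) = carrier P"
    by (auto simp: mod_rel_def)
qed

context
  fixes P :: "'g monoid" assumes P: "finite_group P"
begin

interpretation PP: two_groups P P by unfold_locales (rule P)+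
interpretation PPP: three_groups P P P by unfold_locales (rule P)+

lemma quot_mark_vmarks: "K \<lhd> P \<Longrightarrow> quot_mark P K \<in> vmarks P P"
  unfolding quot_mark_def by (rule PP.tau_vmarks[OF mod_rel_subgroup[OF PP.H.is_group]])

lemma quot_mark_comp:
  assumes "K \<lhd> P" "K' \<lhd> P" "K \<subseteq> K'"
  shows "vcomp P P P (quot_mark P K) (quot_mark P K') = quot_mark P K'"
    "vcomp P P P (quot_mark P K') (quot_mark P K) = quot_mark P K'"
  unfolding quot_mark_def
  using PPP.vcomp_tau_Domain[OF mod_rel_subgroup[OF PP.H.is_group assms(1)] mod_rel_subgroup[OF PP.H.is_group assms(2)]]
    PPP.vcomp_tau_Domain[OF mod_rel_subgroup[OF PP.H.is_group assms(2)] mod_rel_subgroup[OF PP.H.is_group assms(1)]]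
    mod_rel_Domain[OF PP.H.is_group] mod_rel_comp[OF PP.H.is_group assms] assms(1,2) by simp_all

lemma edge_mark_vmarks: "K \<lhd> P \<Longrightarrow> K' \<lhd> P \<Longrightarrow> quot_mark P K - quot_mark P K' \<in> vmarks P P"
  by (intro PP.vmarks_diff quot_mark_vmarks)

lemma edge_mark_idem:
  assumes "K \<lhd> P" "K' \<lhd> P" "K \<subseteq> K'"
  shows "vcomp P P P (quot_mark P K - quot_mark P K') (quot_mark P K - quot_mark P K') = quot_mark P K - quot_mark P K'"
  using assms by (simp add: PPP.vcomp_diff_left PPP.vcomp_diff_right quot_mark_vmarks edge_mark_vmarks quot_mark_comp)

lemma one_normal: "{\<one>\<^bsub>P\<^esub>} \<lhd> P" by (rule PP.H.one_is_normal)

end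

section \<open>Induction and restriction along a subquotient\<close>

locale section_hom =
  fixes P :: "'g monoid" (structure) and Q :: "'g monoid" and A :: "'g set" and \<pi> :: "'g \<Rightarrow> 'g"
  assumes P: "finite_group P" and Q: "finite_group Q" and A: "subgroup A P"
    and hom: "\<pi> \<in> hom (P\<lparr>carrier := A\<rparr>) Q" and surj: "\<pi> ` A = carrier Q"
begin

sublocale P: group P by (rule finite_groupD[OF P])
sublocale Q: group Q by (rule finite_groupD[OF Q])
sublocale PQ: two_groups P Q by unfold_locales (rule P Q)+
sublocale A: subgroup A P by (rule A)

lemma pi_closed: "x \<in> A \<Longrightarrow> \<pi> x \<in> carrier Q" using surj by auto

lemma pi_mult: "x \<in> A \<Longrightarrow> y \<in> A \<Longrightarrow> \<pi> (x \<otimes> y) = \<pi> x \<otimes>\<^bsub>Q\<^esub> \<pi> y"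
  using hom by (simp add: hom_def)

lemma group_hom_pi: "group_hom (P\<lparr>carrier := A\<rparr>) Q \<pi>"
proof -
  interpret PA: group "P\<lparr>carrier := A\<rparr>" by (rule A.subgroup_is_group[OF P.is_group])
  show ?thesis by unfold_locales (rule hom)
qed

lemma pi_one: "\<pi> \<one> = \<one>\<^bsub>Q\<^esub>" using group_hom.hom_one[OF group_hom_pi] by simp

lemma pi_inv: "x \<in> A \<Longrightarrow> \<pi> (inv x) = inv\<^bsub>Q\<^esub> \<pi> x"
  using group_hom.hom_inv[OF group_hom_pi, of x] P.m_inv_consistent[OF A] by simp

text \<open>Inflation from Q to A followed by induction to P; \<open>res\<close> is restriction from
  P to A followed by deflation to Q.\<close>

definition ind :: "('g, 'g) vmark" where "ind = tau P Q (hom_graph A \<pi>)"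
definition res :: "('g, 'g) vmark" where "res = tau Q P ((hom_graph A \<pi>)\<inverse>)"
definition ker where "ker = {x \<in> A. \<pi> x = \<one>\<^bsub>Q\<^esub>}"
definition pre where "pre K = {x \<in> A. \<pi> x \<in> K}"

lemmas graphs = hom_graph_subgroup[OF P.is_group Q.is_group A hom]

lemma ind_vmarks: "ind \<in> vmarks P Q" unfolding ind_def by (rule PQ.tau_vmarks[OF graphs(1)])

lemma res_vmarks: "res \<in> vmarks Q P"
proof -
  interpret QP: two_groups Q P by unfold_locales (rule P Q)+
  show ?thesis unfolding res_def by (rule QP.tau_vmarks[OF graphs(2)])
qed

lemma graph_Range: "Range (hom_graph A \<pi>) = carrier Q" "Domain ((hom_graph A \<pi>)\<inverse>) = carrier Q"
  using surj unfolding hom_graph_def by blast+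

definition fib :: "'g set \<Rightarrow> ('g \<times> 'g) set" where
  "fib K = {(x, y). x \<in> A \<and> y \<in> A \<and> x \<otimes> inv y \<in> K}"

text \<open>No sum over double cosets arises, because \<pi> maps A onto Q. The composite relation is
  congruence inside A modulo the preimage of K.\<close>

lemma ind_quot_res:
  assumes K: "K \<lhd> Q"
  shows "vcomp P Q P ind (vcomp Q Q P (quot_mark Q K) res) = tau P P (fib (pre K))"
proof -
  let ?M = "mod_rel Q K O (hom_graph A \<pi>)\<inverse>"
  interpret QQP: three_groups Q Q P by unfold_locales (rule P Q)+
  interpret PQP: three_groups P Q P by unfold_locales (rule P Q)+
  note m = mod_rel_subgroup[OF Q.is_group K]
  note R = relcomp_subgroup[OF Q.is_group Q.is_group P.is_group m graphs(2)]
  have 1: "vcomp Q Q P (quot_mark Q K) res = tau Q P ?M"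
    unfolding quot_mark_def res_def by (rule QQP.vcomp_tau_Range[OF m graphs(2)]) (rule mod_rel_Domain[OF Q.is_group K])
  have "hom_graph A \<pi> O ?M = fib (pre K)"
  proof (intro equalityI subrelI)
    fix x y assume "(x, y) \<in> hom_graph A \<pi> O ?M"
    then have "x \<in> A" "y \<in> A" "\<pi> x \<otimes>\<^bsub>Q\<^esub> inv\<^bsub>Q\<^esub> \<pi> y \<in> K" by (auto simp: hom_graph_def mod_rel_def)
    then show "(x, y) \<in> fib (pre K)" by (simp add: fib_def pre_def pi_mult pi_inv)
  next
    fix x y assume "(x, y) \<in> fib (pre K)"
    then have xy: "x \<in> A" "y \<in> A" "\<pi> (x \<otimes> inv y) \<in> K" by (simp_all add: fib_def pre_def)
    then have "\<pi> x \<otimes>\<^bsub>Q\<^esub> inv\<^bsub>Q\<^esub> \<pi> y \<in> K" by (simp add: pi_mult[of x "inv y"] pi_inv)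
    then show "(x, y) \<in> hom_graph A \<pi> O ?M"
      using xy(1,2) by (intro relcompI[of x "\<pi> x"] relcompI[of _ "\<pi> y"]) (auto simp: hom_graph_def mod_rel_def pi_closed)
  qed
  then show ?thesis unfolding 1 unfolding ind_def
    using PQP.vcomp_tau_Range[OF graphs(1) R graph_Range(1)] by simp
qed

end

section \<open>The two reduction steps\<close>

text \<open>\<kappa> stands for reduction modulo a normal subgroup, so i and z are involutions
  modulo its kernel. Their images generate a Klein four-group E in which z commutes with the image
  of P, while conjugation moves i at most to iz.\<close>

locale klein_pair =
  fixes P :: "'g monoid" and B :: "'b monoid" (structure) and \<kappa> :: "'g \<Rightarrow> 'b" and i z :: 'g
  assumes P: "finite_group P" and B: "group B" and \<kappa>: "\<kappa> \<in> hom P B"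
    and i: "i \<in> carrier P" "\<kappa> i \<otimes> \<kappa> i = \<one>" "\<kappa> i \<noteq> \<one>"
    and z: "z \<in> carrier P" "\<kappa> z \<otimes> \<kappa> z = \<one>" "\<kappa> z \<noteq> \<one>" and iz: "\<kappa> i \<noteq> \<kappa> z"
    and zc: "\<And>y. y \<in> carrier P \<Longrightarrow> \<kappa> y \<otimes> \<kappa> z = \<kappa> z \<otimes> \<kappa> y"
    and ic: "\<And>y. y \<in> carrier P \<Longrightarrow> \<kappa> y \<otimes> \<kappa> i = \<kappa> i \<otimes> \<kappa> y \<or>
      \<kappa> y \<otimes> \<kappa> i = \<kappa> i \<otimes> \<kappa> z \<otimes> \<kappa> y"
begin

sublocale P: group P by (rule finite_groupD[OF P])
sublocale B: group B by (rule B)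
sublocale K: group_hom P B \<kappa> by unfold_locales (rule \<kappa>)
sublocale PP: two_groups P P by unfold_locales (rule P)+

definition w :: "bit \<Rightarrow> bit \<Rightarrow> 'b" where
  "w p q = (if p = 1 then \<kappa> i else \<one>) \<otimes> (if q = 1 then \<kappa> z else \<one>)"

text \<open>Congruence modulo the preimage of E. Writing the image of x as e times that of y
  exhibits a semidirect product in which y acts on e by conjugation; \<open>ca\<close>,
  \<open>ap\<close> and \<open>aq\<close> are to be the entries c, a and b of a homomorphism to the
  unitriangular group.\<close>

definition N :: "('g \<times> 'g) set" where
  "N = {(x, y). x \<in> carrier P \<and> y \<in> carrier P \<and> (\<exists>p q. \<kappa> x \<otimes> inv \<kappa> y = w p q)}"

definition ca :: "'g \<times> 'g \<Rightarrow> bit" where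
  "ca = (\<lambda>(x, y). of_bool (\<kappa> y \<otimes> \<kappa> i \<noteq> \<kappa> i \<otimes> \<kappa> y))"

definition ap :: "'g \<times> 'g \<Rightarrow> bit" where
  "ap = (\<lambda>(x, y). THE p. \<exists>q. \<kappa> x \<otimes> inv \<kappa> y = w p q)"

definition aq :: "'g \<times> 'g \<Rightarrow> bit" where
  "aq = (\<lambda>(x, y). THE q. \<exists>p. \<kappa> x \<otimes> inv \<kappa> y = w p q)"

lemma ki [simp]: "\<kappa> i \<in> carrier B" "\<kappa> z \<in> carrier B" using i z by auto

lemma sq: "\<kappa> i \<otimes> (\<kappa> i \<otimes> x) = x" "\<kappa> z \<otimes> (\<kappa> z \<otimes> x) = x" if "x \<in> carrier B" for x
  using that i z by (simp_all add: B.m_assoc[symmetric])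

lemma zi1: "\<kappa> z \<otimes> \<kappa> i = \<kappa> i \<otimes> \<kappa> z"
  using zc[OF i(1)] by simp

lemma zi2: "\<kappa> z \<otimes> (\<kappa> i \<otimes> x) = \<kappa> i \<otimes> (\<kappa> z \<otimes> x)" if "x \<in> carrier B" for x
  using that zi1 by (simp add: B.m_assoc[symmetric])

lemma w_closed [simp]: "w p q \<in> carrier B" by (simp add: w_def)

lemma w_values: "w 0 0 = \<one>" "w 0 1 = \<kappa> z" "w 1 0 = \<kappa> i" "w 1 1 = \<kappa> i \<otimes> \<kappa> z"
  by (simp_all add: w_def)

lemma w_mult: "w p q \<otimes> w p' q' = w (p + p') (q + q')"
  by (cases p; cases q; cases p'; cases q'; simp add: w_values B.m_assoc sq zi1 zi2 i(2) z(2))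

lemma w_inv: "inv (w p q) = w p q"
  by (rule B.inv_equality) (simp_all add: w_mult w_values)

lemma w_eq_one: "w p q = \<one> \<Longrightarrow> p = 0 \<and> q = 0"
proof -
  assume *: "w p q = \<one>"
  have "\<kappa> i \<otimes> \<kappa> z \<noteq> \<one>"
  proof
    assume "\<kappa> i \<otimes> \<kappa> z = \<one>"
    then have "\<kappa> z = \<kappa> i" using sq(1)[of "\<kappa> z"] by simp
    then show False using iz by simp
  qed
  then show ?thesis using * i(3) z(3) by (cases p; cases q) (simp_all add: w_values)
qed

lemma w_inj: "w p q = w p' q' \<longleftrightarrow> p = p' \<and> q = q'"
proof
  assume "w p q = w p' q'"
  then have "w p q \<otimes> w p' q' = \<one>" by (simp add: w_mult w_values)
  then have "p + p' = 0 \<and> q + q' = 0" by (intro w_eq_one) (simp add: w_mult)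
  then show "p = p' \<and> q = q'" by (cases p; cases p'; cases q; cases q'; simp)
qed simp

lemma coords: "\<kappa> x \<otimes> inv \<kappa> y = w p q \<Longrightarrow> ap (x, y) = p \<and> aq (x, y) = q"
  unfolding ap_def aq_def by (auto simp: w_inj)

text \<open>Conjugation by y fixes z and multiplies i by z exactly when y does not commute with i.
  The resulting shift of the z-coordinate is the mixed term in the product of unitriangular
  matrices.\<close>

lemma conj_w:
  assumes y: "y \<in> carrier P"
  shows "\<kappa> y \<otimes> w p q \<otimes> inv \<kappa> y = w p (q + ca (x, y) * p)"
proof -
  let ?I = "\<kappa> i \<otimes> \<kappa> z"
  have ky: "\<kappa> y \<in> carrier B" using y by simp
  have "\<kappa> y \<otimes> w p q = w p (q + ca (x, y) * p) \<otimes> \<kappa> y"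
  proof (cases "\<kappa> y \<otimes> \<kappa> i = \<kappa> i \<otimes> \<kappa> y")
    case True
    then have "ca (x, y) = 0" by (simp add: ca_def)
    have "\<kappa> y \<otimes> ?I = \<kappa> i \<otimes> (\<kappa> y \<otimes> \<kappa> z)"
      using True ky by (simp add: B.m_assoc[symmetric])
    also have "\<dots> = \<kappa> i \<otimes> \<kappa> z \<otimes> \<kappa> y" unfolding zc[OF y] using ky by (simp add: B.m_assoc)
    finally show ?thesis using True zc[OF y] ky \<open>ca (x, y) = 0\<close>
      by (cases p; cases q) (simp_all add: w_values)
  next
    case False
    then have c: "ca (x, y) = 1" by (simp add: ca_def)
    have h: "\<kappa> y \<otimes> \<kappa> i = \<kappa> i \<otimes> \<kappa> z \<otimes> \<kappa> y" using ic[OF y] False by simp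
    have h2: "\<kappa> y \<otimes> ?I = \<kappa> i \<otimes> \<kappa> y"
    proof -
      have "\<kappa> y \<otimes> ?I = \<kappa> i \<otimes> \<kappa> z \<otimes> (\<kappa> y \<otimes> \<kappa> z)"
        using h ky by (simp add: B.m_assoc[symmetric])
      also have "\<dots> = \<kappa> i \<otimes> \<kappa> y" unfolding zc[OF y] using ky by (simp add: B.m_assoc sq)
      finally show ?thesis .
    qed
    show ?thesis using h h2 zc[OF y] ky c by (cases p; cases q) (simp_all add: w_values)
  qed
  then show ?thesis using ky by (simp add: B.inv_solve_right')
qed

lemma N_one: "(\<one>\<^bsub>P\<^esub>, \<one>\<^bsub>P\<^esub>) \<in> N" by (auto simp: N_def intro!: exI[of _ 0] simp: w_values)

lemma N_mult:
  assumes "(x, y) \<in> N" "(x', y') \<in> N"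
  shows "(x \<otimes>\<^bsub>P\<^esub> x', y \<otimes>\<^bsub>P\<^esub> y') \<in> N" "ca (x \<otimes>\<^bsub>P\<^esub> x', y \<otimes>\<^bsub>P\<^esub> y') = ca (x, y) + ca (x', y')"
    "ap (x \<otimes>\<^bsub>P\<^esub> x', y \<otimes>\<^bsub>P\<^esub> y') = ap (x, y) + ap (x', y')"
    "aq (x \<otimes>\<^bsub>P\<^esub> x', y \<otimes>\<^bsub>P\<^esub> y') = aq (x, y) + aq (x', y') + ca (x, y) * ap (x', y')"
proof -
  let ?Y = "y \<otimes>\<^bsub>P\<^esub> y'"
  let ?X = "(x \<otimes>\<^bsub>P\<^esub> x', y \<otimes>\<^bsub>P\<^esub> y')"
  obtain p q where 1: "x \<in> carrier P" "y \<in> carrier P" "\<kappa> x \<otimes> inv \<kappa> y = w p q" using assms(1) by (auto simp: N_def)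
  obtain p' q' where 2: "x' \<in> carrier P" "y' \<in> carrier P" "\<kappa> x' \<otimes> inv \<kappa> y' = w p' q'" using assms(2) by (auto simp: N_def)
  note c = coords[OF 1(3)] coords[OF 2(3)]
  \<comment> \<open>The quotient for the products is the first quotient times the conjugate by y of
    the second, the multiplication rule of a semidirect product.\<close>
  have "\<kappa> (x \<otimes>\<^bsub>P\<^esub> x') \<otimes> inv \<kappa> ?Y =
     (\<kappa> x \<otimes> inv \<kappa> y) \<otimes> (\<kappa> y \<otimes> (\<kappa> x' \<otimes> inv \<kappa> y') \<otimes> inv \<kappa> y)"
    using 1(1,2) 2(1,2) by (simp add: B.m_assoc B.inv_mult_group) (simp add: B.m_assoc[symmetric])
  also have "\<dots> = w (p + p') (q + (q' + ca (x, y) * p'))"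
    unfolding 1(3) 2(3) conj_w[OF 1(2), of p' q' x] w_mult ..
  finally have e: "\<kappa> (x \<otimes>\<^bsub>P\<^esub> x') \<otimes> inv \<kappa> ?Y = w (p + p') (q + (q' + ca (x, y) * p'))" .
  show "?X \<in> N" using 1 2 e by (auto simp: N_def)
  show "ap ?X = ap (x, y) + ap (x', y')"
    "aq ?X = aq (x, y) + aq (x', y') + ca (x, y) * ap (x', y')"
    using coords[OF e] c by (simp_all add: add.assoc)
  \<comment> \<open>The character is read off from the conjugate of i, which makes it
    multiplicative.\<close>
  have "w 1 (ca (x, y \<otimes>\<^bsub>P\<^esub> y')) = \<kappa> ?Y \<otimes> w 1 0 \<otimes> inv \<kappa> ?Y"
    using conj_w[of "y \<otimes>\<^bsub>P\<^esub> y'" 1 0 x] 1 2 by simp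
  also have "\<dots> = \<kappa> y \<otimes> (\<kappa> y' \<otimes> w 1 0 \<otimes> inv \<kappa> y') \<otimes> inv \<kappa> y"
    using 1(1,2) 2(1,2) by (simp add: B.m_assoc B.inv_mult_group)
  also have "\<dots> = w 1 (ca (x', y') + ca (x, y))"
    unfolding conj_w[OF 2(2), of 1 0 x'] conj_w[OF 1(2), of 1 _ x] by simp
  finally have "ca (x, y \<otimes>\<^bsub>P\<^esub> y') = ca (x', y') + ca (x, y)" by (simp only: w_inj)
  then show "ca ?X = ca (x, y) + ca (x', y')" by (simp add: ca_def add.commute)
qed

lemma N_subgroup: "subgroup N (P \<times>\<times> P)"
proof -
  interpret PP: group "P \<times>\<times> P" by (intro DirProd_group P.is_group)
  show ?thesis
  proof (rule PP.subgroupI)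
    show "N \<subseteq> carrier (P \<times>\<times> P)" by (auto simp: N_def)
    show "N \<noteq> {}" using N_one by blast
    fix n assume "n \<in> N"
    then obtain x y p q where 1: "n = (x, y)" "x \<in> carrier P" "y \<in> carrier P" "\<kappa> x \<otimes> inv \<kappa> y = w p q"
      by (auto simp: N_def)
    have "\<kappa> (inv\<^bsub>P\<^esub> x) \<otimes> inv \<kappa> (inv\<^bsub>P\<^esub> y) = \<kappa> (inv\<^bsub>P\<^esub> y) \<otimes> inv (\<kappa> x \<otimes> inv \<kappa> y) \<otimes> inv \<kappa> (inv\<^bsub>P\<^esub> y)"
      using 1(2,3) by (simp add: B.inv_mult_group) (simp add: B.m_assoc[symmetric])
    also have "\<dots> = w p (q + ca (x, inv\<^bsub>P\<^esub> y) * p)"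
      unfolding 1(4) w_inv using 1(3) by (intro conj_w) simp
    finally show "inv\<^bsub>P \<times>\<times> P\<^esub> n \<in> N" using 1 by (auto simp: N_def inv_DirProd P.is_group)
    fix m assume "m \<in> N"
    then show "n \<otimes>\<^bsub>P \<times>\<times> P\<^esub> m \<in> N" using N_mult(1)[of x y] \<open>n \<in> N\<close> 1(1) by (cases m) auto
  qed
qed

lemma N_hom: "PP.ut_hom N ca ap aq"
  unfolding PP.ut_hom_def
proof (intro ballI)
  fix n m assume nm: "n \<in> N" "m \<in> N"
  obtain x y where n: "n = (x, y)" by (cases n)
  obtain x' y' where m: "m = (x', y')" by (cases m)
  show "ca (n \<otimes>\<^bsub>P \<times>\<times> P\<^esub> m) = ca n + ca m \<and> ap (n \<otimes>\<^bsub>P \<times>\<times> P\<^esub> m) = ap n + ap m \<and>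
      aq (n \<otimes>\<^bsub>P \<times>\<times> P\<^esub> m) = aq n + aq m + ca n * ap m"
    using N_mult[OF nm[unfolded n m]] unfolding n m by simp
qed

lemma N_elt:
  assumes y: "y \<in> carrier P"
  shows "\<exists>x. (x, y) \<in> N \<and> ap (x, y) = p \<and> aq (x, y) = q"
proof -
  let ?e = "(if p = 1 then i else \<one>\<^bsub>P\<^esub>) \<otimes>\<^bsub>P\<^esub> (if q = 1 then z else \<one>\<^bsub>P\<^esub>)"
  have e: "?e \<in> carrier P" "\<kappa> ?e = w p q" using i z by (simp_all add: w_def)
  have "\<kappa> (?e \<otimes>\<^bsub>P\<^esub> y) \<otimes> inv \<kappa> y = w p q"
    using e y by (simp add: K.hom_mult B.m_assoc del: P.m_closed)
  then show ?thesis using coords e y by (intro exI[of _ "?e \<otimes>\<^bsub>P\<^esub> y"]) (auto simp: N_def)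
qed

text \<open>Level sets of the two coordinates are congruences modulo subgroups of E; in this way
  terms of \<delta> turn into quotient bisets of P.\<close>

lemma N_sets:
  shows "{n \<in> N. ap n = 0} = {(x, y). x \<in> carrier P \<and> y \<in> carrier P \<and> \<kappa> (x \<otimes>\<^bsub>P\<^esub> inv\<^bsub>P\<^esub> y) \<in> {\<one>, \<kappa> z}}"
    "{n \<in> N. aq n = 0} = {(x, y). x \<in> carrier P \<and> y \<in> carrier P \<and> \<kappa> (x \<otimes>\<^bsub>P\<^esub> inv\<^bsub>P\<^esub> y) \<in> {\<one>, \<kappa> i}}"
    "{n \<in> N. ap n = aq n} = {(x, y). x \<in> carrier P \<and> y \<in> carrier P \<and> \<kappa> (x \<otimes>\<^bsub>P\<^esub> inv\<^bsub>P\<^esub> y) \<in> {\<one>, \<kappa> i \<otimes> \<kappa> z}}"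
    "{n \<in> N. ap n = 0 \<and> aq n = 0} = {(x, y). x \<in> carrier P \<and> y \<in> carrier P \<and> \<kappa> (x \<otimes>\<^bsub>P\<^esub> inv\<^bsub>P\<^esub> y) \<in> {\<one>}}"
    "N = {(x, y). x \<in> carrier P \<and> y \<in> carrier P \<and> \<kappa> (x \<otimes>\<^bsub>P\<^esub> inv\<^bsub>P\<^esub> y) \<in> {\<one>, \<kappa> i, \<kappa> z, \<kappa> i \<otimes> \<kappa> z}}"
proof -
  have *: "(x, y) \<in> N \<and> R (ap (x, y)) (aq (x, y)) \<longleftrightarrow> x \<in> carrier P \<and> y \<in> carrier P \<and> (\<exists>p q. R p q \<and> \<kappa> (x \<otimes>\<^bsub>P\<^esub> inv\<^bsub>P\<^esub> y) = w p q)"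
    for x y R
  proof (cases "x \<in> carrier P \<and> y \<in> carrier P")
    case True
    then have k: "\<kappa> (x \<otimes>\<^bsub>P\<^esub> inv\<^bsub>P\<^esub> y) = \<kappa> x \<otimes> inv \<kappa> y" by simp
    have "(\<exists>p q. \<kappa> x \<otimes> inv \<kappa> y = w p q) \<and> R (ap (x, y)) (aq (x, y)) \<longleftrightarrow>
        (\<exists>p q. R p q \<and> \<kappa> x \<otimes> inv \<kappa> y = w p q)" using coords[of x y] by metis
    then show ?thesis using True unfolding k by (simp add: N_def)
  qed (auto simp: N_def)
  have bit2: "(\<exists>p. S p) \<longleftrightarrow> S 0 \<or> S 1" for S :: "bit \<Rightarrow> bool"
    using bit.exhaust by metis
  have ex: "(\<exists>p q. R p q \<and> e = w p q) \<longleftrightarrow> R 0 0 \<and> e = \<one> \<or> R 0 1 \<and> e = \<kappa> z \<or> R 1 0 \<and> e = \<kappa> i \<or> R 1 1 \<and> e = \<kappa> i \<otimes> \<kappa> z" for R e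
    unfolding bit2 w_values by blast
  show "{n \<in> N. ap n = 0} = {(x, y). x \<in> carrier P \<and> y \<in> carrier P \<and> \<kappa> (x \<otimes>\<^bsub>P\<^esub> inv\<^bsub>P\<^esub> y) \<in> {\<one>, \<kappa> z}}"
    using *[of _ _ "\<lambda>p q. p = 0"] unfolding ex by auto
  show "{n \<in> N. aq n = 0} = {(x, y). x \<in> carrier P \<and> y \<in> carrier P \<and> \<kappa> (x \<otimes>\<^bsub>P\<^esub> inv\<^bsub>P\<^esub> y) \<in> {\<one>, \<kappa> i}}"
    using *[of _ _ "\<lambda>p q. q = 0"] unfolding ex by auto
  show "{n \<in> N. ap n = aq n} = {(x, y). x \<in> carrier P \<and> y \<in> carrier P \<and> \<kappa> (x \<otimes>\<^bsub>P\<^esub> inv\<^bsub>P\<^esub> y) \<in> {\<one>, \<kappa> i \<otimes> \<kappa> z}}"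
    using *[of _ _ "\<lambda>p q. p = q"] unfolding ex by auto
  show "{n \<in> N. ap n = 0 \<and> aq n = 0} = {(x, y). x \<in> carrier P \<and> y \<in> carrier P \<and> \<kappa> (x \<otimes>\<^bsub>P\<^esub> inv\<^bsub>P\<^esub> y) \<in> {\<one>}}"
    using *[of _ _ "\<lambda>p q. p = 0 \<and> q = 0"] unfolding ex by auto
  show "N = {(x, y). x \<in> carrier P \<and> y \<in> carrier P \<and> \<kappa> (x \<otimes>\<^bsub>P\<^esub> inv\<^bsub>P\<^esub> y) \<in> {\<one>, \<kappa> i, \<kappa> z, \<kappa> i \<otimes> \<kappa> z}}"
    using *[of _ _ "\<lambda>p q. True"] unfolding ex by auto
qed

end

text \<open>The element g makes the character \<open>ca\<close> surjective, while i and z realize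
  all values of the other two entries; the homomorphism is then onto X.\<close>

lemma (in klein_pair) klein_delta:
  assumes g: "g \<in> carrier P" "\<kappa> g \<otimes> \<kappa> i \<noteq> \<kappa> i \<otimes> \<kappa> g"
  shows "tau P P {n \<in> N. ap n = 0} + tau P P {n \<in> N. ca n = 0 \<and> aq n = 0} -
    tau P P {n \<in> N. ca n = 0} - tau P P {n \<in> N. ap n = 0 \<and> aq n = 0} \<in> delta_ideal P P"
proof (rule PP.delta_relation[OF N_subgroup N_hom])
  fix c p q :: bit
  let ?y = "if c = 1 then g else \<one>\<^bsub>P\<^esub>"
  obtain x where "(x, ?y) \<in> N" "ap (x, ?y) = p" "aq (x, ?y) = q" using N_elt[of ?y p q] g(1) P.one_closed by (cases "c = 1") auto
  moreover have "ca (x, ?y) = c" using g(2) by (cases c) (simp_all add: ca_def)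
  ultimately show "\<exists>n\<in>N. ca n = c \<and> ap n = p \<and> aq n = q" by blast
qed

lemma (in klein_pair) klein_delta_central:
  assumes c: "\<And>y. y \<in> carrier P \<Longrightarrow> \<kappa> y \<otimes> \<kappa> i = \<kappa> i \<otimes> \<kappa> y"
  shows "tau P P {n \<in> N. ap n = 0} + (tau P P {n \<in> N. aq n = 0} + tau P P {n \<in> N. ap n = aq n}) -
    (tau P P N + tau P P N) - tau P P {n \<in> N. ap n = 0 \<and> aq n = 0} \<in> delta_ideal P P"
proof (rule PP.delta_relation_abelian[OF N_subgroup N_hom])
  show "ca n = 0" if "n \<in> N" for n using c that by (auto simp: N_def ca_def)
  show "\<exists>n\<in>N. ap n = p \<and> aq n = q" for p q using N_elt[of "\<one>\<^bsub>P\<^esub>" p q] by auto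
qed

lemma involutions_normal:
  fixes P (structure)
  assumes "group P" "K \<subseteq> carrier P" "\<one> \<in> K" "\<And>x y. x \<in> K \<Longrightarrow> y \<in> K \<Longrightarrow> x \<otimes> y \<in> K"
    "\<And>x. x \<in> K \<Longrightarrow> x \<otimes> x = \<one>" "\<And>x y. x \<in> K \<Longrightarrow> y \<in> carrier P \<Longrightarrow> y \<otimes> x = x \<otimes> y"
  shows "K \<lhd> P"
proof -
  interpret group P by fact
  have inv: "inv x = x" if "x \<in> K" for x using assms(2,5) that by (intro inv_equality) auto
  have "subgroup K P" by (rule subgroupI) (use assms inv in auto)
  moreover have "y \<otimes> x \<otimes> inv y \<in> K" if "y \<in> carrier P" "x \<in> K" for x y
    using that assms(2,6) by (auto simp: m_assoc)
  ultimately show ?thesis by (simp add: normal_inv_iff)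
qed

text \<open>Let E be the group generated by a and z. The abelian relation says [P/1] - [P/z] =
  ([P/a] - [P/E]) + ([P/az] - [P/E]) modulo the ideal, where subgroups are named by their
  generators. The two idempotents on the right are orthogonal, as [P/a] times [P/az] is
  [P/E].\<close>

theorem dec_central:
  fixes P :: "'g monoid" (structure)
  assumes P: "finite_group P" and a: "a \<in> carrier P" "a \<otimes> a = \<one>" "a \<noteq> \<one>"
    and z: "z \<in> carrier P" "z \<otimes> z = \<one>" "z \<noteq> \<one>" and az: "a \<noteq> z"
    and ac: "\<And>y. y \<in> carrier P \<Longrightarrow> y \<otimes> a = a \<otimes> y" and zc: "\<And>y. y \<in> carrier P \<Longrightarrow> y \<otimes> z = z \<otimes> y"
  shows "C.dec (edge_ob P {\<one>} {\<one>, z})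
    {#edge_ob P {\<one>, a} {\<one>, a, z, a \<otimes> z}, edge_ob P {\<one>, a \<otimes> z} {\<one>, a, z, a \<otimes> z}#}"
proof -
  let ?Q = "quot_mark P {\<one>, a}"
  let ?A = "{\<one>, a \<otimes> z}"
  interpret group P by (rule finite_groupD[OF P])
  interpret k: klein_pair P P id a z
  proof (rule klein_pair.intro)
    show "id y \<otimes> id z = id z \<otimes> id y" if "y \<in> carrier P" for y using zc[OF that] by simp
    show "id y \<otimes> id a = id a \<otimes> id y \<or> id y \<otimes> id a = id a \<otimes> id z \<otimes> id y"
      if "y \<in> carrier P" for y using ac[OF that] by simp
  qed (use P a z az in \<open>simp_all add: hom_def is_group\<close>)
  interpret PPP: three_groups P P P by unfold_locales (rule P)+
  let ?E = "{\<one>, a, z, a \<otimes> z}"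
  have aa: "a \<otimes> (a \<otimes> x) = x" "z \<otimes> (z \<otimes> x) = x" if "x \<in> carrier P" for x
    using that a z by (simp_all flip: m_assoc)
  have za: "z \<otimes> a = a \<otimes> z" using ac[OF z(1)] .
  have za': "z \<otimes> (a \<otimes> x) = a \<otimes> (z \<otimes> x)" if "x \<in> carrier P" for x
    using that a z za by (simp flip: m_assoc)
  have azc: "y \<otimes> (a \<otimes> z) = a \<otimes> z \<otimes> y" if "y \<in> carrier P" for y
    using that a(1) z(1) ac[OF that] zc[OF that] by (metis m_assoc)
  have comm: "y \<otimes> x = x \<otimes> y" if "x \<in> ?E" "y \<in> carrier P" for x y
    using that ac[OF that(2)] zc[OF that(2)] azc[OF that(2)] by auto
  note sm = aa za za' a(1,2) z(1,2) m_assoc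
  have n: "{\<one>} \<lhd> P" "{\<one>, z} \<lhd> P" "{\<one>, a} \<lhd> P" "?A \<lhd> P" "?E \<lhd> P"
  proof -
    have S: "S \<lhd> P" if "S \<subseteq> ?E" "\<one> \<in> S" "\<And>x y. x \<in> S \<Longrightarrow> y \<in> S \<Longrightarrow> x \<otimes> y \<in> S" for S
    proof (rule involutions_normal[OF is_group])
      show "S \<subseteq> carrier P" using that(1) a(1) z(1) by auto
      show "x \<otimes> x = \<one>" if "x \<in> S" for x
      proof -
        have "x \<in> ?E" using that \<open>S \<subseteq> ?E\<close> by blast
        then show ?thesis by (auto simp: sm)
      qed
      show "y \<otimes> x = x \<otimes> y" if "x \<in> S" "y \<in> carrier P" for x y
        using comm[OF _ that(2)] that(1) \<open>S \<subseteq> ?E\<close> by blast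
    qed (use that in auto)
    show "{\<one>} \<lhd> P" by (rule one_is_normal)
    show "{\<one>, z} \<lhd> P" by (rule S) (auto simp: sm)
    show "{\<one>, a} \<lhd> P" by (rule S) (auto simp: sm)
    show "?A \<lhd> P" by (rule S) (auto simp: sm)
    show "?E \<lhd> P" by (rule S) (auto simp: sm)
  qed
  note V = n[THEN quot_mark_vmarks[OF P]]
  note q = quot_mark_comp[OF P]
  have prod: "vcomp P P P ?Q (quot_mark P ?A) = quot_mark P ?E"
    "vcomp P P P (quot_mark P ?A) ?Q = quot_mark P ?E"
  proof -
    \<comment> \<open>Congruences modulo two normal subgroups compose to congruence modulo their
      product, which here is the whole four-group.\<close>
    have "mod_rel P K O mod_rel P L = mod_rel P ?E"
      if KL: "K \<subseteq> ?E" "L \<subseteq> ?E" "\<And>e. e \<in> ?E \<Longrightarrow> \<exists>k\<in>K. \<exists>l\<in>L. e = k \<otimes> l" for K L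
    proof (intro equalityI subrelI)
      fix x y assume "(x, y) \<in> mod_rel P K O mod_rel P L"
      then obtain m where m: "x \<in> carrier P" "y \<in> carrier P" "m \<in> carrier P" "x \<otimes> inv m \<in> ?E" "m \<otimes> inv y \<in> ?E"
        using KL by (auto simp: mod_rel_def)
      have "(x \<otimes> inv m) \<otimes> (m \<otimes> inv y) \<in> ?E"
        using subgroup.m_closed[OF normal_imp_subgroup[OF n(5)] m(4,5)] .
      moreover have "(x \<otimes> inv m) \<otimes> (m \<otimes> inv y) = x \<otimes> inv y"
        using m(1-3) by (simp add: m_assoc) (simp flip: m_assoc)
      ultimately show "(x, y) \<in> mod_rel P ?E" using m(1,2) by (simp add: mod_rel_def)
    next
      fix x y assume "(x, y) \<in> mod_rel P ?E"
      then have xy: "x \<in> carrier P" "y \<in> carrier P" "x \<otimes> inv y \<in> ?E" by (auto simp: mod_rel_def)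
      obtain k l where kl: "k \<in> K" "l \<in> L" "x \<otimes> inv y = k \<otimes> l" using KL(3)[OF xy(3)] by blast
      have c: "k \<in> carrier P" "l \<in> carrier P"
        using kl KL n(5)[THEN normal_imp_subgroup, THEN subgroup.subset] by blast+
      have "x = k \<otimes> l \<otimes> y" using kl(3) xy(1,2) c by (simp add: inv_solve_right')
      then have "x \<otimes> inv (l \<otimes> y) = k" using xy(2) c by (simp add: m_assoc inv_solve_right')
      then show "(x, y) \<in> mod_rel P K O mod_rel P L"
        using kl(1,2) c xy by (intro relcompI[of _ "l \<otimes> y"]) (auto simp: mod_rel_def m_assoc)
    qed
    note * = this
    have 1: "mod_rel P {\<one>, a} O mod_rel P ?A = mod_rel P ?E"
      by (rule *) (auto simp: sm)
    have 2: "mod_rel P ?A O mod_rel P {\<one>, a} = mod_rel P ?E"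
      by (rule *) (auto simp: sm)
    note m = n[THEN mod_rel_subgroup[OF is_group]] and D = mod_rel_Domain[OF is_group]
    show "vcomp P P P ?Q (quot_mark P ?A) = quot_mark P ?E"
      "vcomp P P P (quot_mark P ?A) ?Q = quot_mark P ?E"
      unfolding quot_mark_def PPP.vcomp_tau_Domain[OF m(3) m(4) D(1)[OF n(4)]] PPP.vcomp_tau_Domain[OF m(4) m(3) D(1)[OF n(3)]] 1 2
      by (rule refl)+
  qed
  show ?thesis
  proof (rule C.dec_orthogonal[OF P])
    let ?g = "?Q - quot_mark P ?E" and ?g' = "quot_mark P ?A - quot_mark P ?E"
    show "?g \<in> vmarks P P" "?g' \<in> vmarks P P" "quot_mark P {\<one>} - quot_mark P {\<one>, z} \<in> vmarks P P"
      by (intro k.PP.vmarks_diff V)+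
    show "C.eqv P P (vcomp P P P ?g ?g) ?g"
      by (subst edge_mark_idem[OF P n(3) n(5)]) (auto intro: C.eqv_refl[OF P P])
    show "C.eqv P P (vcomp P P P ?g' ?g') ?g'"
      by (subst edge_mark_idem[OF P n(4) n(5)]) (auto intro: C.eqv_refl[OF P P])
    have "vcomp P P P ?g ?g' = 0"
      using V n by (simp add: PPP.vcomp_diff_left PPP.vcomp_diff_right k.PP.vmarks_diff prod q)
    then show "C.eqv P P (vcomp P P P ?g ?g') 0" by (simp add: C.eqv_refl[OF P P])
    have "vcomp P P P ?g' ?g = 0"
      using V n by (simp add: PPP.vcomp_diff_left PPP.vcomp_diff_right k.PP.vmarks_diff prod q)
    then show "C.eqv P P (vcomp P P P ?g' ?g) 0" by (simp add: C.eqv_refl[OF P P])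
    have s: "{n \<in> k.N. k.ap n = 0} = mod_rel P {\<one>, z}" "{n \<in> k.N. k.aq n = 0} = mod_rel P {\<one>, a}"
      "{n \<in> k.N. k.ap n = k.aq n} = mod_rel P ?A"
      "{n \<in> k.N. k.ap n = 0 \<and> k.aq n = 0} = mod_rel P {\<one>}" "k.N = mod_rel P ?E"
      using k.N_sets by (simp_all only: mod_rel_def id_apply)
    have "quot_mark P {\<one>, z} + (?Q + quot_mark P ?A) -
        (quot_mark P ?E + quot_mark P ?E) - quot_mark P {\<one>} \<in> delta_ideal P P"
      using k.klein_delta_central ac unfolding s(1-4) unfolding s(5) quot_mark_def by simp
    then show "C.eqv P P (?g + ?g') (quot_mark P {\<one>} - quot_mark P {\<one>, z})"
      unfolding C.eqv_def by (simp add: algebra_simps)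
  qed
qed

context section_hom begin

lemma pre_one: "pre {\<one>\<^bsub>Q\<^esub>} = ker" by (auto simp: pre_def ker_def)

text \<open>The hypothesis on \<open>res\<close> and \<open>ind\<close> says that restriction after
  induction is the identity on the edge of Q. The other composite is a difference of two transitive
  bisets and has to be compared with e.\<close>

lemma dec_ind:
  assumes K: "K \<lhd> Q" "K' \<lhd> Q" "K \<subseteq> K'" and e: "e \<in> vmarks P P"
    and ff: "vcomp Q P Q res (vcomp P Q Q ind (quot_mark Q K - quot_mark Q K')) = quot_mark Q K - quot_mark Q K'"
    and c: "C.eqv P P (tau P P (fib (pre K)) - tau P P (fib (pre K'))) e"
  shows "C.dec (P, e) {#edge_ob Q K K'#}"
proof (rule C.dec_sub[OF P e Q _ ind_vmarks res_vmarks])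
  interpret QQP: three_groups Q Q P by unfold_locales (rule P Q)+
  interpret PQP: three_groups P Q P by unfold_locales (rule P Q)+
  let ?f = "quot_mark Q K - quot_mark Q K'"
  note V = quot_mark_vmarks[OF Q K(1)] quot_mark_vmarks[OF Q K(2)]
  show f: "?f \<in> vmarks Q Q" by (rule edge_mark_vmarks[OF Q K(1,2)])
  show "C.eqv Q Q (vcomp Q Q Q ?f ?f) ?f" using C.eqv_refl[OF Q Q] by (simp add: edge_mark_idem[OF Q K])
  show "C.eqv Q Q (vcomp Q Q Q (vcomp Q P Q res ind) ?f) ?f"
    unfolding vcomp_assoc[OF Q P Q Q res_vmarks ind_vmarks f] ff by (rule C.eqv_refl[OF Q Q])
  have "vcomp P Q P ind (vcomp Q Q P ?f res) = tau P P (fib (pre K)) - tau P P (fib (pre K'))"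
    unfolding QQP.vcomp_diff_left[OF V res_vmarks] ind_quot_res[OF K(1), symmetric] ind_quot_res[OF K(2), symmetric]
    by (rule PQP.vcomp_diff_right[OF ind_vmarks QQP.vcomp_closed[OF V(1) res_vmarks] QQP.vcomp_closed[OF V(2) res_vmarks]])
  then show "C.eqv P P (vcomp P Q P ind (vcomp Q Q P ?f res)) e" using c by simp
qed

lemma pre_normal: assumes "A = carrier P" "K \<lhd> Q" shows "pre K \<lhd> P"
proof -
  interpret K: normal K Q by fact
  have "subgroup (pre K) P"
    by (rule P.subgroupI) (use pi_one A.one_closed in \<open>auto simp: pre_def pi_inv pi_mult intro: exI[of _ "\<one>"]\<close>)
  moreover have "x \<otimes> h \<otimes> inv x \<in> pre K" if "x \<in> carrier P" "h \<in> pre K" for x h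
    using that K.inv_op_closed2 unfolding pre_def assms(1)[symmetric] by (simp add: pi_inv pi_mult pi_closed)
  ultimately show ?thesis by (simp add: P.normal_inv_iff)
qed

lemma fib_mod_rel: "A = carrier P \<Longrightarrow> fib K = mod_rel P K"
  unfolding fib_def mod_rel_def by simp

text \<open>With A the whole group, this is deflation after inflation, which is the identity of
  Q.\<close>

lemma res_ind:
  assumes "A = carrier P"
  shows "vcomp Q P Q res ind = quot_mark Q {\<one>\<^bsub>Q\<^esub>}"
proof -
  let ?M = "mod_rel Q {\<one>\<^bsub>Q\<^esub>}"
  let ?H = "hom_graph A \<pi>"
  interpret QPQ: three_groups Q P Q by unfold_locales (rule P Q)+
  have "?H\<inverse> O ?H = ?M"
  proof (intro equalityI subrelI)
    fix x y assume "(x, y) \<in> ?H\<inverse> O ?H"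
    then show "(x, y) \<in> ?M" by (auto simp: hom_graph_def mod_rel_def pi_closed)
  next
    fix x y assume "(x, y) \<in> ?M"
    then have "x \<in> carrier Q" "y = x" by (auto simp: mod_rel_def Q.inv_solve_right')
    moreover obtain a where "a \<in> A" "\<pi> a = x" using surj \<open>x \<in> carrier Q\<close> by (metis imageE)
    ultimately show "(x, y) \<in> ?H\<inverse> O ?H"
      by (intro relcompI[of _ a]) (auto simp: hom_graph_def)
  qed
  moreover have "Domain ?H = carrier P" using assms by (auto simp: hom_graph_def)
  ultimately show ?thesis unfolding res_def ind_def quot_mark_def
    using QPQ.vcomp_tau_Domain[OF graphs(2,1)] by simp
qed

theorem dec_epi:
  assumes A: "A = carrier P" and K: "K \<lhd> Q" "K' \<lhd> Q" "K \<subseteq> K'"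
  shows "C.dec (edge_ob P (pre K) (pre K')) {#edge_ob Q K K'#}"
proof (rule dec_ind[OF K])
  let ?f = "quot_mark Q K - quot_mark Q K'"
  have f: "?f \<in> vmarks Q Q" by (rule edge_mark_vmarks[OF Q K(1,2)])
  show "quot_mark P (pre K) - quot_mark P (pre K') \<in> vmarks P P"
    by (intro edge_mark_vmarks P pre_normal A K)
  show "vcomp Q P Q res (vcomp P Q Q ind ?f) = ?f"
    unfolding vcomp_assoc[OF Q P Q Q res_vmarks ind_vmarks f, symmetric] res_ind[OF A] id_mark[OF Q, symmetric]
    by (rule vcomp_id(1)[OF Q Q f])
  show "C.eqv P P (tau P P (fib (pre K)) - tau P P (fib (pre K'))) (quot_mark P (pre K) - quot_mark P (pre K'))"
    unfolding fib_mod_rel[OF A] quot_mark_def by (rule C.eqv_refl[OF P P])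
qed

lemma dec_epi_whole:
  assumes A: "A = carrier P"
  shows "C.dec (P, quot_mark P ker) {#(Q, quot_mark Q {\<one>\<^bsub>Q\<^esub>})#}"
proof (rule C.dec_sub[OF P _ Q _ ind_vmarks res_vmarks])
  let ?f = "quot_mark Q {\<one>\<^bsub>Q\<^esub>}"
  note n = one_normal[OF Q]
  show "quot_mark P ker \<in> vmarks P P"
    using quot_mark_vmarks[OF P pre_normal[OF A n]] unfolding pre_one .
  show f: "?f \<in> vmarks Q Q" by (rule quot_mark_vmarks[OF Q n])
  show 1: "C.eqv Q Q (vcomp Q Q Q ?f ?f) ?f" using C.eqv_refl[OF Q Q] by (simp add: quot_mark_comp[OF Q n n])
  then show "C.eqv Q Q (vcomp Q Q Q (vcomp Q P Q res ind) ?f) ?f" unfolding res_ind[OF A] .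
  show "C.eqv P P (vcomp P Q P ind (vcomp Q Q P ?f res)) (quot_mark P ker)"
    unfolding ind_quot_res[OF n] pre_one fib_mod_rel[OF A] unfolding quot_mark_def by (rule C.eqv_refl[OF P P])
qed

text \<open>The quotient by the kernel splits off as a copy of Q; the complementary idempotent is
  the edge relative to the kernel.\<close>

theorem dec_quotient:
  assumes A: "A = carrier P"
  shows "C.dec (P, quot_mark P {\<one>}) {#(Q, quot_mark Q {\<one>\<^bsub>Q\<^esub>}), edge_ob P {\<one>} ker#}"
proof -
  let ?q = "quot_mark P ker"
  let ?Q = "quot_mark P {\<one>} - ?q"
  interpret PPP: three_groups P P P by unfold_locales (rule P)+
  interpret PP: two_groups P P by unfold_locales (rule P)+
  have n: "{\<one>} \<lhd> P" "ker \<lhd> P" using one_normal[OF P] pre_normal[OF A one_normal[OF Q]] by (simp_all add: pre_one)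
  have s: "{\<one>} \<subseteq> ker" using A.one_closed pi_one by (simp add: ker_def)
  note V = quot_mark_vmarks[OF P n(1)] quot_mark_vmarks[OF P n(2)] edge_mark_vmarks[OF P n]
  note q = quot_mark_comp[OF P n s] quot_mark_comp[OF P n(2) n(2) order_refl]
  have "C.dec (P, quot_mark P {\<one>}) {#(P, ?q), edge_ob P {\<one>} ker#}"
  proof (rule C.dec_orthogonal[OF P V(2,3,1)])
    show "C.eqv P P (vcomp P P P ?q ?q) ?q"
      unfolding q by (rule C.eqv_refl[OF P P])
    show "C.eqv P P (vcomp P P P ?Q ?Q)
        ?Q"
      unfolding edge_mark_idem[OF P n s] by (rule C.eqv_refl[OF P P])
    show "C.eqv P P (vcomp P P P ?q ?Q) 0"
      unfolding PPP.vcomp_diff_right[OF V(2,1,2)] q by (simp add: C.eqv_refl[OF P P])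
    show "C.eqv P P (vcomp P P P ?Q ?q) 0"
      unfolding PPP.vcomp_diff_left[OF V(1,2,2)] q by (simp add: C.eqv_refl[OF P P])
    show "C.eqv P P (?q + ?Q) (quot_mark P {\<one>})"
      by (simp add: C.eqv_refl[OF P P])
  qed
  from C.dec_subst[OF this dec_epi_whole[OF A]] show ?thesis by (simp add: add_mset_commute)
qed

end

text \<open>Modulo the kernel of \<kappa>, A is the centralizer of i and Q its quotient by i; g is a
  witness that i is not central.\<close>

locale klein_section = klein_pair P B \<kappa> i z + section_hom P Q A \<pi>
  for P :: "'g monoid" (structure) and Q :: "'g monoid" and B :: "'b monoid" and \<kappa> i z A \<pi> +
  fixes g
  assumes A_eq: "A = {y \<in> carrier P. \<kappa> y \<otimes>\<^bsub>B\<^esub> \<kappa> i = \<kappa> i \<otimes>\<^bsub>B\<^esub> \<kappa> y}"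
    and ker_eq: "\<And>x. x \<in> A \<Longrightarrow> \<pi> x = \<one>\<^bsub>Q\<^esub> \<longleftrightarrow> \<kappa> x = \<one>\<^bsub>B\<^esub> \<or> \<kappa> x = \<kappa> i"
    and g: "g \<in> carrier P" "\<kappa> g \<otimes>\<^bsub>B\<^esub> \<kappa> i \<noteq> \<kappa> i \<otimes>\<^bsub>B\<^esub> \<kappa> g"
begin

lemma A_ca: "y \<in> A \<longleftrightarrow> y \<in> carrier P \<and> ca (x, y) = 0"
  unfolding A_eq ca_def by simp

lemma diag_N: "y \<in> carrier P \<Longrightarrow> (y, y) \<in> N"
  unfolding N_sets(5) by simp

lemma ca_mult: "x \<in> carrier P \<Longrightarrow> y \<in> carrier P \<Longrightarrow> ca (x \<otimes> y, x \<otimes> y) = ca (x, x) + ca (y, y)"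
  using N_mult(2)[OF diag_N diag_N] by simp

text \<open>On the diagonal of N the character \<open>ca\<close> is a homomorphism from P to the
  field with two elements with kernel A, so A has index two.\<close>

lemma A_two: assumes "h \<in> carrier P" "h \<notin> A" shows "h \<otimes> inv g \<in> A"
proof -
  have 1: "ca (h, h) = 1" "ca (g, g) = 1" using assms(1) g assms(2) unfolding A_eq ca_def by auto
  have "ca (g, g) + ca (inv g, inv g) = ca (\<one>, \<one>)" using ca_mult[of g "inv g"] g(1) by simp
  also have "\<dots> = 0" by (simp add: ca_def)
  finally have "ca (inv g, inv g) = 1" using 1 by (cases "ca (inv g, inv g)") simp_all
  then have "ca (h \<otimes> inv g, h \<otimes> inv g) = 0" using ca_mult[OF assms(1), of "inv g"] g(1) 1 by simp
  then show ?thesis using A_ca[of "h \<otimes> inv g" "h \<otimes> inv g"] assms(1) g(1) by simp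
qed

lemma iA: "i \<in> A" and zA: "z \<in> A" using i z zi1 unfolding A_eq by simp_all

lemma pi_i: "\<pi> i = \<one>\<^bsub>Q\<^esub>" using ker_eq[OF iA] by simp

lemma pi_eq_z: assumes "x \<in> A" shows "\<pi> x = \<pi> z \<longleftrightarrow> \<kappa> x = \<kappa> z \<or> \<kappa> x = \<kappa> i \<otimes>\<^bsub>B\<^esub> \<kappa> z"
proof -
  have x: "x \<in> carrier P" "\<kappa> x \<in> carrier B" using assms by simp_all
  have xz: "x \<otimes> inv z \<in> A" using assms zA by simp
  have "\<pi> x = \<pi> z \<longleftrightarrow> \<pi> (x \<otimes> inv z) = \<one>\<^bsub>Q\<^esub>"
    using assms zA by (simp add: pi_mult pi_inv pi_closed Q.inv_solve_right')
  also have "\<dots> \<longleftrightarrow> \<kappa> x \<otimes>\<^bsub>B\<^esub> inv\<^bsub>B\<^esub> \<kappa> z = \<one>\<^bsub>B\<^esub> \<or> \<kappa> x \<otimes>\<^bsub>B\<^esub> inv\<^bsub>B\<^esub> \<kappa> z = \<kappa> i"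
    using ker_eq[OF xz] x z(1) by simp
  also have "\<dots> \<longleftrightarrow> \<kappa> x = \<kappa> z \<or> \<kappa> x = \<kappa> i \<otimes>\<^bsub>B\<^esub> \<kappa> z"
    using x by (simp add: B.inv_solve_right')
  finally show ?thesis .
qed

lemma pi_z: "\<pi> z \<in> carrier Q" "\<pi> z \<otimes>\<^bsub>Q\<^esub> \<pi> z = \<one>\<^bsub>Q\<^esub>" "\<pi> z \<noteq> \<one>\<^bsub>Q\<^esub>"
  "y \<in> carrier Q \<Longrightarrow> y \<otimes>\<^bsub>Q\<^esub> \<pi> z = \<pi> z \<otimes>\<^bsub>Q\<^esub> y"
proof -
  show "\<pi> z \<in> carrier Q" using zA pi_closed by simp
  have "\<pi> (z \<otimes> z) = \<one>\<^bsub>Q\<^esub>" using ker_eq[of "z \<otimes> z"] zA z by simp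
  then show "\<pi> z \<otimes>\<^bsub>Q\<^esub> \<pi> z = \<one>\<^bsub>Q\<^esub>" using pi_mult[OF zA zA] by simp
  show "\<pi> z \<noteq> \<one>\<^bsub>Q\<^esub>" using ker_eq[OF zA] z iz by auto
  assume "y \<in> carrier Q"
  then obtain x where x: "x \<in> A" "y = \<pi> x" using surj by (metis imageE)
  have xc: "x \<in> carrier P" using x by simp
  have m: "inv (z \<otimes> x) \<otimes> (x \<otimes> z) \<in> A" using x zA by simp
  have "\<kappa> (inv (z \<otimes> x) \<otimes> (x \<otimes> z)) = inv\<^bsub>B\<^esub> (\<kappa> z \<otimes>\<^bsub>B\<^esub> \<kappa> x) \<otimes>\<^bsub>B\<^esub> (\<kappa> x \<otimes>\<^bsub>B\<^esub> \<kappa> z)"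
    using xc z(1) by simp
  also have "\<dots> = \<one>\<^bsub>B\<^esub>" using zc[OF xc] xc z(1) by simp
  finally have "\<pi> (inv (z \<otimes> x) \<otimes> (x \<otimes> z)) = \<one>\<^bsub>Q\<^esub>" using ker_eq[OF m] by simp
  then have "inv\<^bsub>Q\<^esub> (\<pi> z \<otimes>\<^bsub>Q\<^esub> \<pi> x) \<otimes>\<^bsub>Q\<^esub> (\<pi> x \<otimes>\<^bsub>Q\<^esub> \<pi> z) = \<one>\<^bsub>Q\<^esub>"
    using x zA by (simp add: pi_mult pi_inv del: P.inv_mult_group)
  then show "y \<otimes>\<^bsub>Q\<^esub> \<pi> z = \<pi> z \<otimes>\<^bsub>Q\<^esub> y"
    using x zA pi_closed by (simp add: Q.inv_solve_left')
qed

lemma pi_z_normal: "{\<one>\<^bsub>Q\<^esub>, \<pi> z} \<lhd> Q"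
proof (rule involutions_normal[OF Q.is_group])
  show "y \<otimes>\<^bsub>Q\<^esub> x = x \<otimes>\<^bsub>Q\<^esub> y" if "x \<in> {\<one>\<^bsub>Q\<^esub>, \<pi> z}" "y \<in> carrier Q" for x y
    using that(1) pi_z(4)[OF that(2)] that(2) by auto
qed (use pi_z(1-3) in auto)

text \<open>These two sets are the terms I and IZ of \<delta>, whereas J and JZ give the edge of P.
  The relation \<open>klein_delta\<close> therefore equates the edge of P at z with the part induced
  from Q.\<close>

lemma fib_N:
  "fib ker = {n \<in> N. ca n = 0 \<and> aq n = 0}" "fib (pre {\<one>\<^bsub>Q\<^esub>, \<pi> z}) = {n \<in> N. ca n = 0}"
proof -
  let ?N = "{n \<in> N. ca n = 0 \<and> aq n = 0}"
  let ?F = "fib (pre {\<one>\<^bsub>Q\<^esub>, \<pi> z})"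
  let ?B = "{\<one>\<^bsub>B\<^esub>, \<kappa> i, \<kappa> z, \<kappa> i \<otimes>\<^bsub>B\<^esub> \<kappa> z}"
  have xy: "x \<in> A" if "x \<otimes> inv y \<in> A" "y \<in> A" "x \<in> carrier P" for x y
    using A.m_closed[OF that(1,2)] that(2,3) by (simp add: P.m_assoc)
  have comm: "x \<in> A" if "x \<in> carrier P" "\<kappa> x \<in> ?B" for x
    using that zi1 zi2 unfolding A_eq by (auto simp: B.m_assoc)
  have c: "ca (x, y) = 0 \<longleftrightarrow> y \<in> A" if "y \<in> carrier P" for x y using A_ca[of y x] that by simp
  show "fib ker = ?N"
  proof (intro equalityI subrelI)
    fix x y assume "(x, y) \<in> fib ker"
    then have a: "x \<in> A" "y \<in> A" "x \<otimes> inv y \<in> A" "\<pi> (x \<otimes> inv y) = \<one>\<^bsub>Q\<^esub>"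
      unfolding fib_def ker_def by simp_all
    have 1: "x \<in> carrier P" "y \<in> carrier P" "y \<in> A" "\<kappa> (x \<otimes> inv y) \<in> {\<one>\<^bsub>B\<^esub>, \<kappa> i}"
      using ker_eq[OF a(3)] a by simp_all
    then have "(x, y) \<in> {n \<in> N. aq n = 0}" unfolding N_sets(2) by simp
    then show "(x, y) \<in> ?N" using c 1 by simp
  next
    fix x y assume 1: "(x, y) \<in> ?N"
    then have "(x, y) \<in> {n \<in> N. aq n = 0}" by simp
    then have 2: "x \<in> carrier P" "y \<in> carrier P" "\<kappa> (x \<otimes> inv y) \<in> {\<one>\<^bsub>B\<^esub>, \<kappa> i}" unfolding N_sets(2) by blast+
    moreover have yA: "y \<in> A" using 1 2 c by simp
    moreover have m: "x \<otimes> inv y \<in> A" using comm[of "x \<otimes> inv y"] 2 by auto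
    ultimately show "(x, y) \<in> fib ker" using xy[OF m yA] ker_eq[OF m] by (auto simp: fib_def ker_def)
  qed
  show "?F = {n \<in> N. ca n = 0}"
  proof (intro equalityI subrelI)
    fix x y assume "(x, y) \<in> ?F"
    then have a: "x \<in> A" "y \<in> A" "x \<otimes> inv y \<in> A" "\<pi> (x \<otimes> inv y) = \<one>\<^bsub>Q\<^esub> \<or> \<pi> (x \<otimes> inv y) = \<pi> z"
      unfolding fib_def pre_def by simp_all
    have 1: "x \<in> carrier P" "y \<in> carrier P" "y \<in> A" "\<kappa> (x \<otimes> inv y) \<in> ?B"
      using a(4) ker_eq[OF a(3)] pi_eq_z[OF a(3)] a by auto
    then have "(x, y) \<in> N" unfolding N_sets(5) by simp
    then show "(x, y) \<in> {n \<in> N. ca n = 0}" using c 1 by simp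
  next
    fix x y assume 1: "(x, y) \<in> {n \<in> N. ca n = 0}"
    then have "(x, y) \<in> N" by simp
    then have 2: "x \<in> carrier P" "y \<in> carrier P" "\<kappa> (x \<otimes> inv y) \<in> ?B" unfolding N_sets(5) by blast+
    moreover have yA: "y \<in> A" using 1 2 c by simp
    moreover have m: "x \<otimes> inv y \<in> A" using comm[of "x \<otimes> inv y"] 2 by simp
    ultimately show "(x, y) \<in> ?F" using xy[OF m yA] ker_eq[OF m] pi_eq_z[OF m] by (auto simp: fib_def pre_def)
  qed
qed

text \<open>The term that the double coset of g contributes to restriction after induction.\<close>

definition tw :: "'g set \<Rightarrow> ('g \<times> 'g) set" where
  "tw K = {(k, q). \<exists>h\<in>carrier P. (k, g \<otimes> h \<otimes> inv g) \<in> (hom_graph A \<pi>)\<inverse> \<and> (h, q) \<in> hom_graph A \<pi> O mod_rel Q K}"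

text \<open>A has index two in P, so restricting what was induced returns the quotient biset of Q
  together with its twist by g.\<close>

lemma res_ind_quot:
  assumes K: "K \<lhd> Q"
  shows "vcomp P Q Q ind (quot_mark Q K) = tau P Q (hom_graph A \<pi> O mod_rel Q K)"
    "vcomp Q P Q res (vcomp P Q Q ind (quot_mark Q K)) = quot_mark Q K + tau Q Q (tw K)"
proof -
  let ?H = "hom_graph A \<pi> O mod_rel Q K"
  interpret PQQ: three_groups P Q Q by unfold_locales (rule P Q)+
  interpret QPQ: three_groups Q P Q by unfold_locales (rule P Q)+
  note m = mod_rel_subgroup[OF Q.is_group K] and D = mod_rel_Domain[OF Q.is_group K]
  note G = relcomp_subgroup[OF P.is_group Q.is_group Q.is_group graphs(1) m]
  show 1: "vcomp P Q Q ind (quot_mark Q K) = tau P Q ?H"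
    unfolding ind_def quot_mark_def by (rule PQQ.vcomp_tau_Domain[OF graphs(1) m D(1)])
  have R: "Range ((hom_graph A \<pi>)\<inverse>) = A" by (auto simp: hom_graph_def)
  have gA: "g \<notin> A" using g unfolding A_eq by simp
  have "(hom_graph A \<pi>)\<inverse> O ?H = mod_rel Q K"
  proof (intro equalityI subrelI)
    fix x y assume "(x, y) \<in> (hom_graph A \<pi>)\<inverse> O ?H"
    then show "(x, y) \<in> mod_rel Q K" by (auto simp: hom_graph_def)
  next
    fix x y assume *: "(x, y) \<in> mod_rel Q K"
    then have "x \<in> carrier Q" by (simp add: mod_rel_def)
    then obtain a where "a \<in> A" "x = \<pi> a" using surj by (metis imageE)
    then show "(x, y) \<in> (hom_graph A \<pi>)\<inverse> O ?H"
      using * unfolding hom_graph_def by blast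
  qed
  moreover have "Domain ?H \<subseteq> A" by (auto simp: hom_graph_def)
  ultimately show "vcomp Q P Q res (vcomp P Q Q ind (quot_mark Q K)) = quot_mark Q K + tau Q Q (tw K)"
    unfolding 1 unfolding res_def tw_def quot_mark_def
    using QPQ.vcomp_tau_two[OF graphs(2) G R _ A g(1) gA A_two] by simp
qed

text \<open>The conjugate \<open>inv g \<otimes> i \<otimes> g\<close> has the image of iz under
  \<kappa>. Multiplying h by it changes the image of h under \<pi> by that of z, but multiplies the
  conjugate of h by i, which \<pi> sends to 1. So passing to the larger subgroup adds nothing to the
  twisted term.\<close>

lemma tw_eq: "tw {\<one>\<^bsub>Q\<^esub>, \<pi> z} = tw {\<one>\<^bsub>Q\<^esub>}"
proof (intro equalityI subrelI)
  fix k q assume "(k, q) \<in> tw {\<one>\<^bsub>Q\<^esub>}"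
  then show "(k, q) \<in> tw {\<one>\<^bsub>Q\<^esub>, \<pi> z}" by (force simp: tw_def mod_rel_def)
next
  fix k q assume "(k, q) \<in> tw {\<one>\<^bsub>Q\<^esub>, \<pi> z}"
  then obtain h where h: "h \<in> carrier P" "h \<in> A" "g \<otimes> h \<otimes> inv g \<in> A" "k = \<pi> (g \<otimes> h \<otimes> inv g)"
    "q \<in> carrier Q" "\<pi> h \<otimes>\<^bsub>Q\<^esub> inv\<^bsub>Q\<^esub> q \<in> {\<one>\<^bsub>Q\<^esub>, \<pi> z}"
    by (auto simp: tw_def mod_rel_def hom_graph_def)
  show "(k, q) \<in> tw {\<one>\<^bsub>Q\<^esub>}"
  proof (cases "\<pi> h \<otimes>\<^bsub>Q\<^esub> inv\<^bsub>Q\<^esub> q = \<one>\<^bsub>Q\<^esub>")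
    case True
    then show ?thesis using h(1-5) pi_closed unfolding tw_def mod_rel_def hom_graph_def by blast
  next
    case False
    then have hz: "\<pi> h \<otimes>\<^bsub>Q\<^esub> inv\<^bsub>Q\<^esub> q = \<pi> z" using h(6) by simp
    let ?i = "inv g \<otimes> i \<otimes> g"
    have "\<kappa> g \<otimes>\<^bsub>B\<^esub> (\<kappa> i \<otimes>\<^bsub>B\<^esub> \<kappa> z) = \<kappa> i \<otimes>\<^bsub>B\<^esub> \<kappa> g"
    proof -
      have "\<kappa> g \<otimes>\<^bsub>B\<^esub> (\<kappa> i \<otimes>\<^bsub>B\<^esub> \<kappa> z) = \<kappa> g \<otimes>\<^bsub>B\<^esub> \<kappa> i \<otimes>\<^bsub>B\<^esub> \<kappa> z" using g(1) by (simp add: B.m_assoc)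
      also have "\<dots> = \<kappa> i \<otimes>\<^bsub>B\<^esub> \<kappa> z \<otimes>\<^bsub>B\<^esub> (\<kappa> g \<otimes>\<^bsub>B\<^esub> \<kappa> z)" using ic[OF g(1)] g by (simp add: B.m_assoc)
      also have "\<dots> = \<kappa> i \<otimes>\<^bsub>B\<^esub> \<kappa> g" unfolding zc[OF g(1)] using g(1) by (simp add: B.m_assoc sq)
      finally show ?thesis .
    qed
    then have "\<kappa> ?i = \<kappa> i \<otimes>\<^bsub>B\<^esub> \<kappa> z" using g(1) i(1) by (simp add: B.m_assoc B.inv_solve_left')
    moreover have ic: "?i \<in> carrier P" using g(1) i(1) by simp
    ultimately have iA': "?i \<in> A" using zi1 zi2 unfolding A_eq by (auto simp: B.m_assoc)
    have iz: "\<pi> ?i = \<pi> z" using pi_eq_z[OF iA'] \<open>\<kappa> ?i = \<kappa> i \<otimes>\<^bsub>B\<^esub> \<kappa> z\<close> by simp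
    let ?h = "?i \<otimes> h"
    have c: "g \<otimes> ?h \<otimes> inv g = i \<otimes> (g \<otimes> h \<otimes> inv g)"
      using g(1) i(1) h(1) by (simp add: P.m_assoc) (simp flip: P.m_assoc)
    have "\<pi> (g \<otimes> ?h \<otimes> inv g) = k" "g \<otimes> ?h \<otimes> inv g \<in> A"
      unfolding c using iA h pi_i by (simp_all add: pi_mult pi_closed)
    moreover have "\<pi> ?h \<otimes>\<^bsub>Q\<^esub> inv\<^bsub>Q\<^esub> q = \<one>\<^bsub>Q\<^esub>"
    proof -
      have "\<pi> ?h \<otimes>\<^bsub>Q\<^esub> inv\<^bsub>Q\<^esub> q = \<pi> z \<otimes>\<^bsub>Q\<^esub> (\<pi> h \<otimes>\<^bsub>Q\<^esub> inv\<^bsub>Q\<^esub> q)"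
        unfolding pi_mult[OF iA' h(2)] iz using h pi_z(1) pi_closed by (simp add: Q.m_assoc)
      then show ?thesis unfolding hz using pi_z(2) by simp
    qed
    moreover have "?h \<in> A" "?h \<in> carrier P" using iA' h ic by simp_all
    ultimately show ?thesis using h(5) pi_closed
      unfolding tw_def mod_rel_def hom_graph_def by blast
  qed
qed

text \<open>Restriction after induction adds a twisted term to each of the two quotients of Q. By
  \<open>tw_eq\<close> the two terms cancel in the difference, so induction embeds the edge of Q,
  and \<open>klein_delta\<close> shows that its image is the edge of P.\<close>

theorem dec_klein:
  "C.dec (edge_ob P {x \<in> carrier P. \<kappa> x = \<one>\<^bsub>B\<^esub>} {x \<in> carrier P. \<kappa> x \<in> {\<one>\<^bsub>B\<^esub>, \<kappa> z}}) {#edge_ob Q {\<one>\<^bsub>Q\<^esub>} {\<one>\<^bsub>Q\<^esub>, \<pi> z}#}"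
proof (rule dec_ind[OF one_normal[OF Q] pi_z_normal])
  let ?q = "quot_mark Q {\<one>\<^bsub>Q\<^esub>}"
  let ?Q = "quot_mark Q {\<one>\<^bsub>Q\<^esub>, \<pi> z}"
  let ?x = "{x \<in> carrier P. \<kappa> x = \<one>\<^bsub>B\<^esub>}"
  let ?X = "{x \<in> carrier P. \<kappa> x \<in> {\<one>\<^bsub>B\<^esub>, \<kappa> z}}"
  interpret PQQ: three_groups P Q Q by unfold_locales (rule P Q)+
  interpret QPQ: three_groups Q P Q by unfold_locales (rule P Q)+
  note V = quot_mark_vmarks[OF Q one_normal[OF Q]] quot_mark_vmarks[OF Q pi_z_normal]
  have e: "quot_mark P ?x = tau P P {n \<in> N. ap n = 0 \<and> aq n = 0}"
    "quot_mark P ?X = tau P P {n \<in> N. ap n = 0}"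
    unfolding quot_mark_def N_sets(1,4) by (rule arg_cong[where f = "tau P P"]; auto simp: mod_rel_def simp del: K.hom_mult)+
  have n0: "?x \<lhd> P" using K.normal_kernel by (simp add: kernel_def)
  have n1: "?X \<lhd> P"
  proof -
    have "inv\<^bsub>B\<^esub> \<kappa> z = \<kappa> z" by (rule B.inv_equality) (use z in auto)
    then have "subgroup ?X P"
      by (intro P.subgroupI) (use z(2) in auto)
    moreover have "\<kappa> y \<otimes>\<^bsub>B\<^esub> \<kappa> z \<otimes>\<^bsub>B\<^esub> inv\<^bsub>B\<^esub> \<kappa> y = \<kappa> z" if "y \<in> carrier P" for y
      using zc[OF that] that by (simp add: B.m_assoc)
    ultimately show ?thesis by (auto simp: P.normal_inv_iff)
  qed
  show "quot_mark P ?x - quot_mark P ?X \<in> vmarks P P"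
    by (rule edge_mark_vmarks[OF P n0 n1])
  show "C.eqv P P (tau P P (fib (pre {\<one>\<^bsub>Q\<^esub>})) - tau P P (fib (pre {\<one>\<^bsub>Q\<^esub>, \<pi> z})))
     (quot_mark P ?x - quot_mark P ?X)"
    using klein_delta[OF g] unfolding C.eqv_def e pre_one fib_N by (simp add: algebra_simps)
  have "vcomp Q P Q res (vcomp P Q Q ind (?q - ?Q)) =
     vcomp Q P Q res (vcomp P Q Q ind ?q) - vcomp Q P Q res (vcomp P Q Q ind ?Q)"
    unfolding PQQ.vcomp_diff_right[OF ind_vmarks V]
    by (rule QPQ.vcomp_diff_right[OF res_vmarks PQQ.vcomp_closed[OF ind_vmarks V(1)] PQQ.vcomp_closed[OF ind_vmarks V(2)]])
  then show "vcomp Q P Q res (vcomp P Q Q ind (?q - ?Q)) =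
     ?q - ?Q"
    unfolding res_ind_quot(2)[OF one_normal[OF Q]] res_ind_quot(2)[OF pi_z_normal] tw_eq by simp
qed simp

end

section \<open>Transport to groups of natural numbers\<close>

abbreviation nu :: "'a monoid \<Rightarrow> 'a \<Rightarrow> nat" where "nu G \<equiv> to_nat_on (carrier G)"
abbreviation un :: "'a monoid \<Rightarrow> nat \<Rightarrow> 'a" where "un G \<equiv> inv_into (carrier G) (nu G)"

locale finite_grp = fixes G :: "'a monoid" (structure) assumes fin: "finite_group G"
begin

sublocale group G by (rule finite_groupD[OF fin])

lemma nu_inj: "inj_on (nu G) (carrier G)"
  using finite_groupD(2)[OF fin] by (intro inj_on_to_nat_on countable_finite)

lemma nu_iso: "nu G \<in> iso G (nat_copy G)"
  unfolding nat_copy_def by (rule inj_imp_image_group_iso[OF nu_inj])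

lemma nc_fin: "finite_group (nat_copy G)"
  unfolding finite_group_def nat_copy_def
  using inj_imp_image_group_is_group[OF nu_inj] finite_groupD(2)[OF fin] by (simp add: image_group_carrier)

lemma nc_carrier: "carrier (nat_copy G) = nu G ` carrier G" by (simp add: nat_copy_def image_group_carrier)
lemma nc_one: "\<one>\<^bsub>nat_copy G\<^esub> = nu G \<one>" by (simp add: nat_copy_def image_group_one)

lemma un_nu: "x \<in> carrier G \<Longrightarrow> un G (nu G x) = x" by (rule inv_into_f_f[OF nu_inj])

lemma nu_mult: "x \<in> carrier G \<Longrightarrow> y \<in> carrier G \<Longrightarrow> nu G x \<otimes>\<^bsub>nat_copy G\<^esub> nu G y = nu G (x \<otimes> y)"
  using nu_iso by (simp add: iso_def hom_def)

lemma nu_eq: "x \<in> carrier G \<Longrightarrow> y \<in> carrier G \<Longrightarrow> nu G x = nu G y \<longleftrightarrow> x = y"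
  using nu_inj by (auto dest: inj_onD)

lemma nu_closed: "x \<in> carrier G \<Longrightarrow> nu G x \<in> carrier (nat_copy G)" by (simp add: nc_carrier)

lemma nc_cases: assumes "y \<in> carrier (nat_copy G)" obtains x where "x \<in> carrier G" "y = nu G x"
  using assms by (auto simp: nc_carrier)

lemma nu_set: "nu G ` {x \<in> carrier G. S x} = {y \<in> carrier (nat_copy G). S (un G y)}"
  by (auto simp: nc_carrier un_nu)

lemma nc_group: "group (nat_copy G)" by (rule finite_groupD[OF nc_fin])

lemma nu_group_hom: "group_hom G (nat_copy G) (nu G)"
  unfolding group_hom_def group_hom_axioms_def using nu_iso nc_group is_group by (simp add: iso_def)

lemma nu_normal: assumes "K \<lhd> G" shows "nu G ` K \<lhd> nat_copy G"
proof -
  interpret K: normal K G by fact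
  interpret h: group_hom G "nat_copy G" "nu G" by (rule nu_group_hom)
  have "x \<otimes>\<^bsub>nat_copy G\<^esub> nu G k \<otimes>\<^bsub>nat_copy G\<^esub> inv\<^bsub>nat_copy G\<^esub> x \<in> nu G ` K"
    if x: "x \<in> carrier (nat_copy G)" and k: "k \<in> K" for x k
  proof -
    obtain a where a: "a \<in> carrier G" "x = nu G a" using x by (rule nc_cases)
    have "x \<otimes>\<^bsub>nat_copy G\<^esub> nu G k \<otimes>\<^bsub>nat_copy G\<^esub> inv\<^bsub>nat_copy G\<^esub> x = nu G (a \<otimes> k \<otimes> inv a)"
      unfolding a(2) using a(1) k by simp
    then show ?thesis using K.inv_op_closed2[OF a(1) k] by simp
  qed
  then show ?thesis
    unfolding group.normal_inv_iff[OF nc_group] using h.subgroup_img_is_subgroup[OF K.is_subgroup] by blast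
qed

lemma un_hom: "un G \<in> hom (nat_copy G) G"
  by (auto simp: hom_def nc_carrier un_nu nu_mult)

end

text \<open>The object of the whole group: by \<open>id_mark\<close> its idempotent is the
  identity.\<close>

definition RO :: "'a monoid \<Rightarrow> nat monoid \<times> (nat, nat) vmark" where
  "RO G = (nat_copy G, quot_mark (nat_copy G) {\<one>\<^bsub>nat_copy G\<^esub>})"

definition EO :: "'a monoid \<Rightarrow> 'a set \<Rightarrow> 'a set \<Rightarrow> nat monoid \<times> (nat, nat) vmark" where
  "EO G K K' = edge_ob (nat_copy G) (nu G ` K) (nu G ` K')"

text \<open>The edge at z. It agrees with \<open>edge\<close> when every nontrivial normal subgroup
  contains z (\<open>f_one_eq\<close>). In direct products, where that can fail, it is still the
  object with which the reduction steps begin and end.\<close>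

abbreviation DO :: "'a monoid \<Rightarrow> 'a \<Rightarrow> nat monoid \<times> (nat, nat) vmark" where
  "DO G z \<equiv> EO G {\<one>\<^bsub>G\<^esub>} {\<one>\<^bsub>G\<^esub>, z}"

definition central_inv :: "'a monoid \<Rightarrow> 'a \<Rightarrow> bool" where
  "central_inv G z \<longleftrightarrow> z \<in> carrier G \<and> z \<otimes>\<^bsub>G\<^esub> z = \<one>\<^bsub>G\<^esub> \<and> z \<noteq> \<one>\<^bsub>G\<^esub> \<and> (\<forall>y\<in>carrier G. y \<otimes>\<^bsub>G\<^esub> z = z \<otimes>\<^bsub>G\<^esub> y)"

lemma central_inv_normal:
  fixes G (structure)
  assumes "group G" "central_inv G z" shows "{\<one>, z} \<lhd> G"
proof -
  interpret group G by fact
  show ?thesis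
  proof (rule involutions_normal[OF assms(1)])
    show "y \<otimes> x = x \<otimes> y" if "x \<in> {\<one>, z}" "y \<in> carrier G" for x y
      using that assms(2) unfolding central_inv_def by fastforce
  qed (use assms(2) in \<open>auto simp: central_inv_def\<close>)
qed

abbreviation kern where "kern G H \<phi> \<equiv> {x \<in> carrier G. \<phi> x = \<one>\<^bsub>H\<^esub>}"

locale epi = G: finite_grp G + H: finite_grp H for G :: "'a monoid" (structure) and H :: "'b monoid" +
  fixes \<phi> assumes phi: "\<phi> \<in> hom G H" and phi_surj: "\<phi> ` carrier G = carrier H"
begin

sublocale section_hom "nat_copy G" "nat_copy H" "carrier (nat_copy G)" "nu H \<circ> \<phi> \<circ> un G"
proof (rule section_hom.intro)
  show "nu H \<circ> \<phi> \<circ> un G \<in> hom (nat_copy G\<lparr>carrier := carrier (nat_copy G)\<rparr>) (nat_copy H)"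
    using phi G.un_hom H.nu_iso by (auto simp: hom_def iso_def Pi_iff)
  show "(nu H \<circ> \<phi> \<circ> un G) ` carrier (nat_copy G) = carrier (nat_copy H)"
    unfolding G.nc_carrier H.nc_carrier phi_surj[symmetric] by (auto simp: G.un_nu image_iff)
next
  show "subgroup (carrier (nat_copy G)) (nat_copy G)" by (rule group.subgroup_self[OF G.nc_group])
qed (rule G.nc_fin H.nc_fin)+

lemma phi_carrier: "x \<in> carrier G \<Longrightarrow> \<phi> x \<in> carrier H" using phi_surj by auto

lemma pre_nu: assumes "K \<subseteq> carrier H" shows "pre (nu H ` K) = nu G ` {x \<in> carrier G. \<phi> x \<in> K}"
  unfolding pre_def unfolding G.nc_carrier
  using assms by (auto simp: G.un_nu H.nu_eq phi_carrier subset_iff)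

lemma EO_epi:
  assumes K: "K \<lhd> H" "K' \<lhd> H" "K \<subseteq> K'"
  shows "C.dec (EO G {x \<in> carrier G. \<phi> x \<in> K} {x \<in> carrier G. \<phi> x \<in> K'}) {#EO H K K'#}"
proof -
  have s: "K \<subseteq> carrier H" "K' \<subseteq> carrier H" using K(1,2)[THEN normal_imp_subgroup, THEN subgroup.subset] by simp_all
  show ?thesis
    using dec_epi[OF refl K(1,2)[THEN H.nu_normal] image_mono[OF K(3)]]
    unfolding EO_def pre_nu[OF s(1)] pre_nu[OF s(2)] .
qed

lemma RO_quot: "C.dec (RO G) {#RO H, EO G {\<one>} (kern G H \<phi>)#}"
proof -
  have "ker = nu G ` (kern G H \<phi>)"
    using pre_nu[of "{\<one>\<^bsub>H\<^esub>}"] pre_one by (simp add: H.nc_one)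
  then show ?thesis using dec_quotient[OF refl] by (simp add: RO_def EO_def G.nc_one)
qed

lemma EO_epi_edge:
  assumes "z \<in> carrier G" "central_inv H (\<phi> z)"
  shows "C.dec (EO G (kern G H \<phi>) {x \<in> carrier G. \<phi> x \<in> {\<one>\<^bsub>H\<^esub>, \<phi> z}}) {#DO H (\<phi> z)#}"
  using EO_epi[OF H.one_is_normal central_inv_normal[OF H.is_group assms(2)]] by simp

end

theorem DO_central:
  fixes G (structure)
  assumes G: "finite_group G" and a: "central_inv G a" and z: "central_inv G z" and az: "a \<noteq> z"
  shows "C.dec (DO G z) {#EO G {\<one>, a} {\<one>, a, z, a \<otimes> z}, EO G {\<one>, a \<otimes> z} {\<one>, a, z, a \<otimes> z}#}"
proof -
  interpret finite_grp G by unfold_locales fact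
  have c: "nu G w \<in> carrier (nat_copy G)" "nu G w \<otimes>\<^bsub>nat_copy G\<^esub> nu G w = \<one>\<^bsub>nat_copy G\<^esub>" "nu G w \<noteq> \<one>\<^bsub>nat_copy G\<^esub>"
    "y \<in> carrier (nat_copy G) \<Longrightarrow> y \<otimes>\<^bsub>nat_copy G\<^esub> nu G w = nu G w \<otimes>\<^bsub>nat_copy G\<^esub> y"
    if "central_inv G w" for w y
    using that by (auto simp: central_inv_def nc_carrier nu_mult nc_one nu_eq)
  have "nu G a \<noteq> nu G z" using nu_eq[of a z] a z az by (simp add: central_inv_def)
  from dec_central[OF nc_fin c(1-3)[OF a] c(1-3)[OF z] this c(4)[OF a] c(4)[OF z]]
  moreover have "a \<in> carrier G" "z \<in> carrier G" using a z by (simp_all add: central_inv_def)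
  ultimately show ?thesis by (simp add: EO_def nc_one nu_mult)
qed

text \<open>The second reduction for groups on arbitrary types. \<kappa> and \<pi> are precomposed
  with the inverse of the numbering of G, and \<pi> is followed by the numbering of Q.\<close>

theorem EO_klein:
  fixes B :: "'b monoid" (structure)
  assumes G: "finite_group G" and Q: "finite_group Q" and B: "group B" and \<kappa>: "\<kappa> \<in> hom G B"
    and i: "i \<in> carrier G" "\<kappa> i \<otimes> \<kappa> i = \<one>" "\<kappa> i \<noteq> \<one>"
    and z: "z \<in> carrier G" "\<kappa> z \<otimes> \<kappa> z = \<one>" "\<kappa> z \<noteq> \<one>" and iz: "\<kappa> i \<noteq> \<kappa> z"
    and zc: "\<And>y. y \<in> carrier G \<Longrightarrow> \<kappa> y \<otimes> \<kappa> z = \<kappa> z \<otimes> \<kappa> y"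
    and ic: "\<And>y. y \<in> carrier G \<Longrightarrow> \<kappa> y \<otimes> \<kappa> i = \<kappa> i \<otimes> \<kappa> y \<or> \<kappa> y \<otimes> \<kappa> i = \<kappa> i \<otimes> \<kappa> z \<otimes> \<kappa> y"
    and A: "A = {y \<in> carrier G. \<kappa> y \<otimes> \<kappa> i = \<kappa> i \<otimes> \<kappa> y}"
    and \<pi>: "\<pi> \<in> hom (G\<lparr>carrier := A\<rparr>) Q" "\<pi> ` A = carrier Q"
    and ker: "\<And>x. x \<in> A \<Longrightarrow> \<pi> x = \<one>\<^bsub>Q\<^esub> \<longleftrightarrow> \<kappa> x = \<one> \<or> \<kappa> x = \<kappa> i"
    and g: "g \<in> carrier G" "\<kappa> g \<otimes> \<kappa> i \<noteq> \<kappa> i \<otimes> \<kappa> g"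
  shows "C.dec (EO G {x \<in> carrier G. \<kappa> x = \<one>} {x \<in> carrier G. \<kappa> x \<in> {\<one>, \<kappa> z}}) {#DO Q (\<pi> z)#}"
proof -
  let ?C = "carrier (nat_copy G)"
  let ?U = "\<kappa> \<circ> un G"
  interpret G: finite_grp G by unfold_locales fact
  interpret Q: finite_grp Q by unfold_locales fact
  interpret B: group B by fact
  interpret k: group_hom G B \<kappa> by unfold_locales fact
  interpret N: group "nat_copy G" by (rule finite_groupD[OF G.nc_fin])
  have AG: "A \<subseteq> carrier G" using A by auto
  have sub: "subgroup A G"
  proof (rule G.subgroupI)
    fix x y assume x: "x \<in> A" and y: "y \<in> A"
    have kx: "\<kappa> x \<in> carrier B" "\<kappa> y \<in> carrier B" "\<kappa> i \<in> carrier B" using x y AG i by auto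
    have 1: "\<kappa> x \<otimes> \<kappa> i = \<kappa> i \<otimes> \<kappa> x" "\<kappa> y \<otimes> \<kappa> i = \<kappa> i \<otimes> \<kappa> y" using x y unfolding A by auto
    have "\<kappa> x \<otimes> \<kappa> y \<otimes> \<kappa> i = \<kappa> x \<otimes> \<kappa> i \<otimes> \<kappa> y" using kx 1(2) by (simp add: B.m_assoc)
    also have "\<dots> = \<kappa> i \<otimes> (\<kappa> x \<otimes> \<kappa> y)" using kx 1(1) by (simp add: B.m_assoc)
    finally show "x \<otimes>\<^bsub>G\<^esub> y \<in> A" using x y AG unfolding A by auto
    have "inv \<kappa> x \<otimes> \<kappa> i = inv \<kappa> x \<otimes> (\<kappa> i \<otimes> \<kappa> x) \<otimes> inv \<kappa> x" using kx by (simp add: B.m_assoc)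
    also have "\<dots> = \<kappa> i \<otimes> inv \<kappa> x" unfolding 1(1)[symmetric] using kx by (simp flip: B.m_assoc)
    finally show "inv\<^bsub>G\<^esub> x \<in> A" using x AG unfolding A by auto
  next
    have "\<one>\<^bsub>G\<^esub> \<in> A" unfolding A using i by simp
    then show "A \<noteq> {}" by auto
  qed (use AG in auto)
  have pc: "\<pi> x \<in> carrier Q" if "x \<in> A" for x using that \<pi>(2) by auto
  interpret s: klein_section "nat_copy G" "nat_copy Q" B "\<kappa> \<circ> un G" "nu G i" "nu G z" "nu G ` A" "nu Q \<circ> \<pi> \<circ> un G" "nu G g"
  proof (intro klein_section.intro klein_pair.intro section_hom.intro klein_section_axioms.intro)
    show "\<kappa> \<circ> un G \<in> hom (nat_copy G) B" using G.un_hom \<kappa> by (auto simp: hom_def Pi_iff)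
    show "subgroup (nu G ` A) (nat_copy G)"
      by (rule group_hom.subgroup_img_is_subgroup[OF G.nu_group_hom sub])
    show "nu Q \<circ> \<pi> \<circ> un G \<in> hom (nat_copy G\<lparr>carrier := nu G ` A\<rparr>) (nat_copy Q)"
    proof -
      have 1: "nu G x \<otimes>\<^bsub>nat_copy G\<^esub> nu G y = nu G (x \<otimes>\<^bsub>G\<^esub> y)" "un G (nu G (x \<otimes>\<^bsub>G\<^esub> y)) = x \<otimes>\<^bsub>G\<^esub> y"
        "un G (nu G x) = x" "un G (nu G y) = y" "\<pi> (x \<otimes>\<^bsub>G\<^esub> y) = \<pi> x \<otimes>\<^bsub>Q\<^esub> \<pi> y"
        if "x \<in> A" "y \<in> A" for x y
        using that[THEN subsetD[OF AG]] that \<pi>(1) by (simp_all add: G.nu_mult[of x y] G.un_nu hom_def)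
      show ?thesis using 1 pc Q.nu_closed Q.nu_mult by (auto simp: hom_def)
    qed
    show "(nu Q \<circ> \<pi> \<circ> un G) ` nu G ` A = carrier (nat_copy Q)"
      unfolding Q.nc_carrier \<pi>(2)[symmetric] using AG by (auto simp: image_image G.un_nu subset_iff image_iff)
    show "nu G ` A = {y \<in> ?C. ?U y \<otimes> ?U (nu G i) = ?U (nu G i) \<otimes> ?U y}"
      unfolding A G.nu_set using i by (simp add: G.un_nu)
    show "(nu Q \<circ> \<pi> \<circ> un G) x = \<one>\<^bsub>nat_copy Q\<^esub> \<longleftrightarrow> ?U x = \<one> \<or> ?U x = ?U (nu G i)"
      if "x \<in> nu G ` A" for x
    proof -
      obtain y where y: "x = nu G y" "y \<in> A" using \<open>x \<in> nu G ` A\<close> by auto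
      have 1: "un G x = y" using y AG by (auto simp: G.un_nu)
      then show ?thesis using ker[OF y(2)] i pc[OF y(2)] by (simp add: 1 Q.nc_one Q.nu_eq G.un_nu)
    qed
    show "?U y \<otimes> ?U (nu G z) = ?U (nu G z) \<otimes> ?U y"
      if y: "y \<in> ?C" for y
    proof -
      obtain x where x: "x \<in> carrier G" "y = nu G x" using y by (rule G.nc_cases)
      show ?thesis using zc[OF x(1)] unfolding o_apply x(2) G.un_nu[OF x(1)] G.un_nu[OF z(1)] .
    qed
    show "?U y \<otimes> ?U (nu G i) = ?U (nu G i) \<otimes> ?U y \<or>
        ?U y \<otimes> ?U (nu G i) = ?U (nu G i) \<otimes> ?U (nu G z) \<otimes> ?U y"
      if y: "y \<in> ?C" for y
    proof -
      obtain x where x: "x \<in> carrier G" "y = nu G x" using y by (rule G.nc_cases)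
      show ?thesis using ic[OF x(1)] unfolding o_apply x(2) G.un_nu[OF x(1)] G.un_nu[OF i(1)] G.un_nu[OF z(1)] .
    qed
  qed (use G.nc_fin Q.nc_fin i z iz g in \<open>simp_all add: G.un_nu G.nu_closed\<close>)
  have "{x \<in> ?C. ?U x = \<one>} = nu G ` {x \<in> carrier G. \<kappa> x = \<one>}"
    "{x \<in> ?C. ?U x \<in> {\<one>, ?U (nu G z)}} = nu G ` {x \<in> carrier G. \<kappa> x \<in> {\<one>, \<kappa> z}}"
    unfolding G.nu_set using z(1) by (simp_all add: G.un_nu)
  then show ?thesis using s.dec_klein z(1) unfolding EO_def by (simp only: Q.nc_one image_insert image_empty o_apply G.un_nu)
qed

lemma epiI:
  assumes "finite_group G" "finite_group H" "\<And>x. x \<in> carrier G \<Longrightarrow> \<phi> x \<in> carrier H"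
    and "\<And>x y. x \<in> carrier G \<Longrightarrow> y \<in> carrier G \<Longrightarrow> \<phi> (x \<otimes>\<^bsub>G\<^esub> y) = \<phi> x \<otimes>\<^bsub>H\<^esub> \<phi> y"
    and "\<And>y. y \<in> carrier H \<Longrightarrow> \<exists>x\<in>carrier G. \<phi> x = y"
  shows "epi G H \<phi>"
  unfolding epi_def epi_axioms_def finite_grp_def hom_def using assms by (auto simp: image_iff) (metis assms(5))

context epi begin

sublocale h: group_hom G H \<phi> by unfold_locales (rule phi)

lemma central_image:
  assumes "central_inv G z" "\<phi> z \<noteq> \<one>\<^bsub>H\<^esub>" shows "central_inv H (\<phi> z)"
proof -
  have z: "z \<in> carrier G" "z \<otimes> z = \<one>" "\<And>y. y \<in> carrier G \<Longrightarrow> y \<otimes> z = z \<otimes> y"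
    using assms(1) unfolding central_inv_def by blast+
  have "y \<otimes>\<^bsub>H\<^esub> \<phi> z = \<phi> z \<otimes>\<^bsub>H\<^esub> y" if y: "y \<in> carrier H" for y
  proof -
    obtain x where x: "x \<in> carrier G" "y = \<phi> x" using y phi_surj by (metis imageE)
    show ?thesis
      using arg_cong[OF z(3)[OF x(1)], of \<phi>] unfolding x(2) h.hom_mult[OF x(1) z(1)] h.hom_mult[OF z(1) x(1)] .
  qed
  moreover have "\<phi> z \<otimes>\<^bsub>H\<^esub> \<phi> z = \<one>\<^bsub>H\<^esub>" using arg_cong[OF z(2), of \<phi>] z(1) by simp
  ultimately show ?thesis unfolding central_inv_def using assms(2) phi_carrier[OF z(1)] by blast
qed

lemma preimage_pair:
  assumes "z \<in> carrier G" "kern G H \<phi> = {\<one>, s}"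
  shows "{x \<in> carrier G. \<phi> x \<in> {\<one>\<^bsub>H\<^esub>, \<phi> z}} = {\<one>, s, z, s \<otimes> z}"
proof -
  have s: "s \<in> carrier G" "\<phi> s = \<one>\<^bsub>H\<^esub>" using assms(2) by auto
  have "\<phi> x = \<phi> z \<longleftrightarrow> x = z \<or> x = s \<otimes> z" if x: "x \<in> carrier G" for x
  proof -
    have "\<phi> x = \<phi> z \<longleftrightarrow> \<phi> (x \<otimes> inv z) = \<one>\<^bsub>H\<^esub>" using x assms(1) by (simp add: H.inv_solve_right')
    also have "\<dots> \<longleftrightarrow> x \<otimes> inv z \<in> kern G H \<phi>" using x assms(1) by simp
    also have "\<dots> \<longleftrightarrow> x = z \<or> x = s \<otimes> z"
      unfolding assms(2) using x assms(1) s(1) by (simp add: G.inv_solve_right')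
    finally show ?thesis .
  qed
  moreover have "\<phi> x = \<one>\<^bsub>H\<^esub> \<longleftrightarrow> x = \<one> \<or> x = s" if "x \<in> carrier G" for x using assms(2) that by blast
  ultimately show ?thesis using assms(1) s(1) by auto
qed

lemma EO_pair:
  assumes z: "central_inv G z" "z \<noteq> s" and k: "kern G H \<phi> = {\<one>, s}"
  shows "C.dec (EO G {\<one>, s} {\<one>, s, z, s \<otimes> z}) {#DO H (\<phi> z)#}"
proof -
  have z': "z \<in> carrier G" "z \<noteq> \<one>" using z by (auto simp: central_inv_def)
  then have n: "\<phi> z \<noteq> \<one>\<^bsub>H\<^esub>" using k z(2) by blast
  show ?thesis using EO_epi_edge[OF z'(1) central_image[OF z(1) n]] unfolding preimage_pair[OF z'(1) k] k .
qed

lemma RO_split: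
  assumes "kern G H \<phi> = {\<one>, z}"
  shows "C.dec (RO G) {#RO H, DO G z#}"
  using RO_quot unfolding assms .

lemma DO_iso:
  assumes z: "central_inv G z" and k: "kern G H \<phi> = {\<one>}"
  shows "C.dec (DO G z) {#DO H (\<phi> z)#}"
proof -
  have "z \<in> carrier G" "z \<noteq> \<one>" using z by (auto simp: central_inv_def)
  then show ?thesis using EO_pair[OF z, of "\<one>"] k by simp
qed

lemma RO_iso:
  assumes k: "kern G H \<phi> = {\<one>}"
  shows "C.dec (RO G) {#RO H#}"
proof -
  have "ker = nu G ` {\<one>}"
    using pre_nu[of "{\<one>\<^bsub>H\<^esub>}"] pre_one k by (simp add: H.nc_one)
  then show ?thesis using dec_epi_whole[OF refl] by (simp add: RO_def G.nc_one)
qed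

lemma DO_split:
  assumes a: "central_inv G a" and z: "central_inv G z" and az: "a \<noteq> z"
    and k: "kern G H \<phi> = {\<one>, a}"
  shows "C.dec (DO G z) {#DO H (\<phi> z), EO G {\<one>, a \<otimes> z} {\<one>, a, z, a \<otimes> z}#}"
  using C.dec_subst[OF DO_central[OF G.fin a z az] EO_pair[OF z az[symmetric] k]] by (simp add: add_mset_commute)

end

text \<open>The summands of \<open>DO_central\<close> are relative to the subgroups generated by a
  and by az. These are the kernels of the two epimorphisms, so each summand is an edge of the
  corresponding quotient.\<close>

lemma DO_split2:
  fixes G (structure)
  assumes "epi G H \<phi>" "epi G H' \<phi>'"
    and a: "central_inv G a" and z: "central_inv G z" and az: "a \<noteq> z"
    and k: "kern G H \<phi> = {\<one>, a}"
    and k': "kern G H' \<phi>' = {\<one>, a \<otimes> z}"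
  shows "C.dec (DO G z) {#DO H (\<phi> z), DO H' (\<phi>' z)#}"
proof -
  interpret e: epi G H \<phi> by fact
  interpret e': epi G H' \<phi>' by fact
  have c: "a \<in> carrier G" "a \<noteq> \<one>" "z \<in> carrier G" "z \<otimes> z = \<one>" using a z by (auto simp: central_inv_def)
  have zs: "z \<noteq> a \<otimes> z"
  proof
    assume "z = a \<otimes> z"
    then have "\<one> \<otimes> z = a \<otimes> z" using c by simp
    then show False using c e.G.right_cancel[of z "\<one>" a] by simp
  qed
  \<comment> \<open>The four-group has to be listed once from a and once from az; both lists give
    the same set.\<close>
  have "a \<otimes> z \<otimes> z = a" using c by (simp add: e.G.m_assoc)
  then have s: "{\<one>, a \<otimes> z, z, a \<otimes> z \<otimes> z} = {\<one>, a, z, a \<otimes> z}" by auto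
  have "C.dec (DO G z) (add_mset (EO G {\<one>, a \<otimes> z} {\<one>, a, z, a \<otimes> z}) {#DO H (\<phi> z)#})"
    using e.DO_split[OF a z az k] by (simp add: add_mset_commute)
  from C.dec_subst[OF this e'.EO_pair[OF z zs k', unfolded s]] show ?thesis by (simp add: add_mset_commute)
qed

text \<open>\<open>EO_klein\<close> for reduction modulo a central s of order at most two, with the
  commutation rules spelled out inside G. The case s = 1 is included; the two subgroups are then the
  trivial one and the one generated by z.\<close>

theorem EO_klein_pair:
  fixes G (structure)
  assumes G: "finite_group G" and Q: "finite_group Q"
    and s: "s \<in> carrier G" "s \<otimes> s = \<one>" "\<And>y. y \<in> carrier G \<Longrightarrow> y \<otimes> s = s \<otimes> y"
    and z: "central_inv G z" "z \<noteq> s"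
    and i: "i \<in> carrier G" "i \<otimes> i \<in> {\<one>, s}" "i \<notin> {\<one>, s, z, s \<otimes> z}"
    and A: "A \<subseteq> carrier G" "\<And>y. y \<in> A \<Longrightarrow> y \<otimes> i \<in> {i \<otimes> y, s \<otimes> (i \<otimes> y)}"
      "\<And>y. y \<in> carrier G \<Longrightarrow> y \<notin> A \<Longrightarrow> y \<otimes> i \<in> {z \<otimes> (i \<otimes> y), s \<otimes> (z \<otimes> (i \<otimes> y))}"
    and g: "g \<in> carrier G" "g \<notin> A"
    and \<pi>: "\<And>x. x \<in> A \<Longrightarrow> \<pi> x \<in> carrier Q" "\<And>x y. x \<in> A \<Longrightarrow> y \<in> A \<Longrightarrow> \<pi> (x \<otimes> y) = \<pi> x \<otimes>\<^bsub>Q\<^esub> \<pi> y"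
      "\<And>y. y \<in> carrier Q \<Longrightarrow> \<exists>x\<in>A. \<pi> x = y"
    and ker: "\<And>x. x \<in> A \<Longrightarrow> \<pi> x = \<one>\<^bsub>Q\<^esub> \<longleftrightarrow> x \<in> {\<one>, s, i, s \<otimes> i}"
  shows "C.dec (EO G {\<one>, s} {\<one>, s, z, s \<otimes> z}) {#DO Q (\<pi> z)#}"
proof -
  interpret group G by (rule finite_groupD[OF G])
  have K: "{\<one>, s} \<lhd> G"
  proof (rule involutions_normal[OF is_group])
    show "y \<otimes> x = x \<otimes> y" if "x \<in> {\<one>, s}" "y \<in> carrier G" for x y
      using that(1) s(3)[OF that(2)] that(2) by auto
  qed (use s(1,2) in auto)
  interpret K: normal "{\<one>, s}" G by (rule K)
  let ?B = "G Mod {\<one>, s}" and ?k = "\<lambda>x. {\<one>, s} #> x"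
  have B: "group ?B" by (rule K.factorgroup_is_group)
  have z': "z \<in> carrier G" "z \<otimes> z = \<one>" "z \<noteq> \<one>" and zc: "y \<in> carrier G \<Longrightarrow> y \<otimes> z = z \<otimes> y" for y
    using z by (auto simp: central_inv_def)
  have hom: "?k \<in> hom G ?B" by (rule K.r_coset_hom_Mod)
  have m: "?k x \<otimes>\<^bsub>?B\<^esub> ?k y = ?k (x \<otimes> y)" if "x \<in> carrier G" "y \<in> carrier G" for x y
    using hom_mult[OF hom that] by simp
  have ss: "s \<otimes> (s \<otimes> x) = x" if "x \<in> carrier G" for x using that s(1,2) by (simp flip: m_assoc)
  have k: "?k x = ?k y \<longleftrightarrow> x \<in> {y, s \<otimes> y}" if "x \<in> carrier G" "y \<in> carrier G" for x y
  proof -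
    have "?k x = {x, s \<otimes> x}" "?k y = {y, s \<otimes> y}" using that by (auto simp: r_coset_def)
    then show ?thesis using ss[OF that(1)] ss[OF that(2)] by (auto simp: doubleton_eq_iff)
  qed
  have o: "\<one>\<^bsub>?B\<^esub> = ?k \<one>" using K.subset by simp
  have k1: "?k x = \<one>\<^bsub>?B\<^esub> \<longleftrightarrow> x \<in> {\<one>, s}" if "x \<in> carrier G" for x
    unfolding o using k[OF that one_closed] s(1) by simp
  \<comment> \<open>An element outside A cannot commute with i modulo s: comparing the two forms of
    the product would place z in the subgroup generated by s.\<close>
  have comm: "?k y \<otimes>\<^bsub>?B\<^esub> ?k i = ?k i \<otimes>\<^bsub>?B\<^esub> ?k y \<longleftrightarrow> y \<in> A" if y: "y \<in> carrier G" for y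
  proof -
    have "?k y \<otimes>\<^bsub>?B\<^esub> ?k i = ?k i \<otimes>\<^bsub>?B\<^esub> ?k y \<longleftrightarrow> y \<otimes> i \<in> {i \<otimes> y, s \<otimes> (i \<otimes> y)}"
      unfolding m[OF y i(1)] m[OF i(1) y] using y i(1) by (intro k) auto
    moreover have False if "y \<notin> A" "y \<otimes> i \<in> {i \<otimes> y, s \<otimes> (i \<otimes> y)}"
    proof -
      let ?w = "i \<otimes> y"
      have w: "?w \<in> carrier G" using i(1) y by simp
      have 1: "u = v" if "u \<otimes> ?w = v \<otimes> ?w" "u \<in> carrier G" "v \<in> carrier G" for u v
        using that w by simp
      have "\<exists>u\<in>{\<one>, s}. \<exists>v\<in>{z, s \<otimes> z}. u \<otimes> ?w = v \<otimes> ?w"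
        using A(3)[OF y that(1)] that(2) w s(1) z'(1) by (auto simp: m_assoc)
      then obtain u v where uv: "u \<in> {\<one>, s}" "v \<in> {z, s \<otimes> z}" "u \<otimes> ?w = v \<otimes> ?w" by blast
      have "u = v" by (rule 1[OF uv(3)]) (use uv(1,2) s(1) z'(1) in auto)
      then have "v \<in> {\<one>, s}" using uv(1) by simp
      then have "z \<in> {\<one>, s} \<or> s \<otimes> z \<in> {\<one>, s}" using uv(2) by auto
      then have "z \<in> {\<one>, s}"
        using ss[OF z'(1)] s(1,2) by auto
      then show False using z'(3) z(2) by simp
    qed
    ultimately show ?thesis using A(2) by blast
  qed
  have e1: "kern G ?B ?k = {\<one>, s}"
  proof -
    have "kern G ?B ?k = {x \<in> carrier G. x \<in> {\<one>, s}}"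
      by (rule Collect_cong) (use k1 in blast)
    also have "\<dots> = {\<one>, s}" using s(1) by auto
    finally show ?thesis .
  qed
  have e2: "{x \<in> carrier G. ?k x \<in> {\<one>\<^bsub>?B\<^esub>, ?k z}} = {\<one>, s, z, s \<otimes> z}"
  proof -
    have "{x \<in> carrier G. ?k x \<in> {\<one>\<^bsub>?B\<^esub>, ?k z}} = {x \<in> carrier G. x \<in> {\<one>, s, z, s \<otimes> z}}"
      by (rule Collect_cong) (use k1 k[OF _ z'(1)] in blast)
    also have "\<dots> = {\<one>, s, z, s \<otimes> z}" using s(1) z'(1) by auto
    finally show ?thesis .
  qed
  have "C.dec (EO G (kern G ?B ?k) {x \<in> carrier G. ?k x \<in> {\<one>\<^bsub>?B\<^esub>, ?k z}}) {#DO Q (\<pi> z)#}"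
  proof (rule EO_klein[OF G Q B hom i(1) _ _ z'(1), where A = A and g = g])
    show "?k i \<otimes>\<^bsub>?B\<^esub> ?k i = \<one>\<^bsub>?B\<^esub>" unfolding m[OF i(1) i(1)] using k1[of "i \<otimes> i"] i by simp
    show "?k i \<noteq> \<one>\<^bsub>?B\<^esub>" using k1[OF i(1)] i(3) by blast
    show "?k z \<otimes>\<^bsub>?B\<^esub> ?k z = \<one>\<^bsub>?B\<^esub>" unfolding m[OF z'(1) z'(1)] using k1[of "z \<otimes> z"] z' by simp
    show "?k z \<noteq> \<one>\<^bsub>?B\<^esub>" using k1[OF z'(1)] z'(3) z(2) by blast
    show "?k i \<noteq> ?k z" using k[OF i(1) z'(1)] i(3) by blast
    show "?k y \<otimes>\<^bsub>?B\<^esub> ?k z = ?k z \<otimes>\<^bsub>?B\<^esub> ?k y" if "y \<in> carrier G" for y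
      unfolding m[OF that z'(1)] m[OF z'(1) that] zc[OF that] ..
    show "?k y \<otimes>\<^bsub>?B\<^esub> ?k i = ?k i \<otimes>\<^bsub>?B\<^esub> ?k y \<or> ?k y \<otimes>\<^bsub>?B\<^esub> ?k i = ?k i \<otimes>\<^bsub>?B\<^esub> ?k z \<otimes>\<^bsub>?B\<^esub> ?k y"
      if y: "y \<in> carrier G" for y
    proof (cases "y \<in> A")
      case True
      then show ?thesis using comm[OF y] by blast
    next
      case False
      have "?k i \<otimes>\<^bsub>?B\<^esub> ?k z \<otimes>\<^bsub>?B\<^esub> ?k y = ?k (i \<otimes> z \<otimes> y)"
        using m[OF i(1) z'(1)] m[of "i \<otimes> z" y] i(1) z'(1) y by simp
      also have "i \<otimes> z \<otimes> y = z \<otimes> (i \<otimes> y)" unfolding zc[OF i(1)] using i(1) z'(1) y by (simp add: m_assoc)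
      also have "?k (z \<otimes> (i \<otimes> y)) = ?k (y \<otimes> i)"
        using k[of "y \<otimes> i" "z \<otimes> (i \<otimes> y)"] A(3)[OF y False] i(1) z'(1) y by simp
      finally show ?thesis using m[OF y i(1)] by simp
    qed
    show "A = {y \<in> carrier G. ?k y \<otimes>\<^bsub>?B\<^esub> ?k i = ?k i \<otimes>\<^bsub>?B\<^esub> ?k y}" using comm A(1) by blast
    show "\<pi> \<in> hom (G\<lparr>carrier := A\<rparr>) Q" using \<pi> by (simp add: hom_def)
    show "\<pi> ` A = carrier Q" using \<pi>(1,3) by (auto simp: image_iff)
    show "\<pi> x = \<one>\<^bsub>Q\<^esub> \<longleftrightarrow> ?k x = \<one>\<^bsub>?B\<^esub> \<or> ?k x = ?k i" if "x \<in> A" for x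
      using ker[OF that] k1[of x] k[of x i] that A(1) i(1) by blast
    show "g \<in> carrier G" by (rule g(1))
    show "?k g \<otimes>\<^bsub>?B\<^esub> ?k i \<noteq> ?k i \<otimes>\<^bsub>?B\<^esub> ?k g" using comm[OF g(1)] g(2) by blast
  qed
  then show ?thesis unfolding e1 e2 .
qed

lemma epi_id: "finite_group G \<Longrightarrow> epi G G (\<lambda>x. x)" by (rule epiI) auto

lemma epi_prod:
  assumes "epi G H \<phi>" "epi G' H' \<phi>'"
  shows "epi (G \<times>\<times> G') (H \<times>\<times> H') (map_prod \<phi> \<phi>')"
proof -
  interpret e: epi G H \<phi> by fact
  interpret e': epi G' H' \<phi>' by fact
  have s: "\<exists>x\<in>carrier G. \<phi> x = y" if "y \<in> carrier H" for y using that e.phi_surj by (metis imageE)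
  have s': "\<exists>x\<in>carrier G'. \<phi>' x = y" if "y \<in> carrier H'" for y using that e'.phi_surj by (metis imageE)
  show ?thesis
  proof (rule epiI)
    fix y assume "y \<in> carrier (H \<times>\<times> H')"
    then show "\<exists>x\<in>carrier (G \<times>\<times> G'). map_prod \<phi> \<phi>' x = y" using s[of "fst y"] s'[of "snd y"] by (cases y) fastforce
  qed (use e.G.fin e.H.fin e'.G.fin e'.H.fin e.phi_carrier e'.phi_carrier in \<open>auto intro: finite_group_DirProd\<close>)
qed

lemma central_inv_left: "group G \<Longrightarrow> group H \<Longrightarrow> central_inv G z \<Longrightarrow> central_inv (G \<times>\<times> H) (z, \<one>\<^bsub>H\<^esub>)"
  by (auto simp: central_inv_def group.is_monoid)

lemma central_inv_right: "group G \<Longrightarrow> group H \<Longrightarrow> central_inv H z \<Longrightarrow> central_inv (G \<times>\<times> H) (\<one>\<^bsub>G\<^esub>, z)"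
  by (auto simp: central_inv_def group.is_monoid)

section \<open>Dihedral groups\<close>

declare One_nat_def [simp del]

text \<open>Indexed by the number of rotations, half the order of the group. Thus
  \<open>dih 1\<close> is cyclic of order two and \<open>dih 2\<close> is the Klein
  four-group.\<close>

definition dih :: "nat \<Rightarrow> (int \<times> bool) monoid" where "dih N = dihedral_group (2 * N)"

lemma dih_simps [simp]:
  "carrier (dih N) = {0..<int N} \<times> UNIV" "\<one>\<^bsub>dih N\<^esub> = (0, False)"
  "(a, s) \<otimes>\<^bsub>dih N\<^esub> (b, t) = ((if s then a - b else a + b) mod int N, s \<noteq> t)"
  by (simp_all add: dih_def dihedral_group_def)

lemma dih_finite: assumes "N > 0" shows "finite_group (dih N)"
  unfolding finite_group_def
proof
  show "group (dih N)"
  proof (rule groupI)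
    fix x y z assume "x \<in> carrier (dih N)" "y \<in> carrier (dih N)" "z \<in> carrier (dih N)"
    then show "x \<otimes>\<^bsub>dih N\<^esub> y \<otimes>\<^bsub>dih N\<^esub> z = x \<otimes>\<^bsub>dih N\<^esub> (y \<otimes>\<^bsub>dih N\<^esub> z)"
      by (cases x; cases y; cases z) (auto simp: mod_simps algebra_simps)
  next
    fix x assume "x \<in> carrier (dih N)"
    then show "\<exists>y\<in>carrier (dih N). y \<otimes>\<^bsub>dih N\<^esub> x = \<one>\<^bsub>dih N\<^esub>"
      using assms by (intro bexI[of _ "if snd x then x else (- fst x mod int N, False)"]) (auto simp: mod_simps)
  qed (use assms in auto)
qed simp

lemma dih_red: assumes "N > 0" "M > 0" shows "epi (dih (M * N)) (dih N) (\<lambda>(x, s). (x mod int N, s))"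
proof (rule epiI)
  show "finite_group (dih (M * N))" "finite_group (dih N)" using assms by (intro dih_finite; simp)+
  have m: "x mod (int M * int N) mod int N = x mod int N" for x by (simp add: mod_mod_cancel)
  fix x y assume "x \<in> carrier (dih (M * N))" "y \<in> carrier (dih (M * N))"
  then show "(case x \<otimes>\<^bsub>dih (M * N)\<^esub> y of (x, s) \<Rightarrow> (x mod int N, s)) =
      (case x of (x, s) \<Rightarrow> (x mod int N, s)) \<otimes>\<^bsub>dih N\<^esub> (case y of (x, s) \<Rightarrow> (x mod int N, s))"
    by (cases x; cases y) (simp add: m mod_simps)
next
  fix y assume "y \<in> carrier (dih N)"
  then obtain a t where y: "y = (a, t)" "0 \<le> a" "a < int N" by (cases y) auto
  have le: "a < int M * int N" by (rule less_le_trans[OF y(3)]) (use assms in simp)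
  then have "(a, t) \<in> carrier (dih (M * N))" using y by (simp add: mult.commute)
  then show "\<exists>x\<in>carrier (dih (M * N)). (case x of (x, s) \<Rightarrow> (x mod int N, s)) = y" using y by (intro bexI[of _ "(a, t)"]) auto
qed (use assms in auto)

lemma mod_zero_cases: fixes x n :: int assumes "0 \<le> x" "x < 2 * n" shows "x mod n = 0 \<longleftrightarrow> x = 0 \<or> x = n"
proof
  assume "x mod n = 0"
  then obtain k where k: "x = n * k" by (auto simp: mod_eq_0_iff_dvd)
  have n: "n > 0" using assms by linarith
  have "0 \<le> k" using k assms(1) n by (simp add: zero_le_mult_iff)
  moreover have "k < 2" using k assms(2) n by (simp add: mult.commute)
  ultimately show "x = 0 \<or> x = n" using k by (cases "k = 0") auto
qed auto

lemma dih_red_kernel: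
  assumes "N > 0"
  shows "kern (dih (2 * N)) (dih N) (\<lambda>(x, s). (x mod int N, s)) = {\<one>\<^bsub>dih (2 * N)\<^esub>, (int N, False)}"
  using mod_zero_cases[of _ "int N"] assms by (auto simp del: mod_eq_0_iff_dvd mod_mod_trivial simp flip: mod_eq_0_iff_dvd)

lemma dih_central: assumes "N > 0" shows "central_inv (dih (2 * N)) (int N, False)"
proof -
  have "(a - int N) mod (2 * int N) = (int N + a) mod (2 * int N)" for a
    by (simp add: mod_eq_dvd_iff)
  then show ?thesis using assms by (auto simp: central_inv_def add.commute)
qed

lemma dih1_central: "central_inv (dih 1) (0, True)"
  by (auto simp: central_inv_def)

lemma kernel_prod_left:
  assumes "group G'" "kern G H \<phi> = {\<one>\<^bsub>G\<^esub>, a}"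
  shows "kern (G \<times>\<times> G') (H \<times>\<times> G') (map_prod \<phi> (\<lambda>x. x)) = {\<one>\<^bsub>G \<times>\<times> G'\<^esub>, (a, \<one>\<^bsub>G'\<^esub>)}"
proof -
  have "\<one>\<^bsub>G'\<^esub> \<in> carrier G'" using assms(1) by (simp add: group.is_monoid)
  then have "kern (G \<times>\<times> G') (H \<times>\<times> G') (map_prod \<phi> (\<lambda>x. x)) = kern G H \<phi> \<times> {\<one>\<^bsub>G'\<^esub>}" by auto
  then show ?thesis unfolding assms(2) by auto
qed

lemma kernel_prod_right:
  assumes "group G'" "kern G H \<phi> = {\<one>\<^bsub>G\<^esub>, a}"
  shows "kern (G' \<times>\<times> G) (G' \<times>\<times> H) (map_prod (\<lambda>x. x) \<phi>) = {\<one>\<^bsub>G' \<times>\<times> G\<^esub>, (\<one>\<^bsub>G'\<^esub>, a)}"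
proof -
  have "\<one>\<^bsub>G'\<^esub> \<in> carrier G'" using assms(1) by (simp add: group.is_monoid)
  then have "kern (G' \<times>\<times> G) (G' \<times>\<times> H) (map_prod (\<lambda>x. x) \<phi>) = {\<one>\<^bsub>G'\<^esub>} \<times> kern G H \<phi>" by auto
  then show ?thesis unfolding assms(2) by auto
qed

section \<open>First splittings of a dihedral factor\<close>

context
  fixes H :: "'h monoid" (structure) assumes H: "finite_group H"
begin

interpretation H: group H by (rule finite_groupD[OF H])

lemma RO_dih: assumes "N > 0"
  shows "C.dec (RO (dih (2 * N) \<times>\<times> H)) {#RO (dih N \<times>\<times> H), DO (dih (2 * N) \<times>\<times> H) ((int N, False), \<one>)#}"
  using epi.RO_split[OF epi_prod[OF dih_red[OF assms, of 2] epi_id[OF H]] kernel_prod_left[OF H.is_group dih_red_kernel[OF assms]]]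
  by simp

lemma RO_dih1: "C.dec (RO (dih 1 \<times>\<times> H)) {#RO H, DO (dih 1 \<times>\<times> H) ((0, True), \<one>)#}"
proof (rule epi.RO_split[where \<phi> = snd])
  show "epi (dih 1 \<times>\<times> H) H snd"
  proof (rule epiI)
    show "\<exists>x\<in>carrier (dih 1 \<times>\<times> H). snd x = y" if "y \<in> carrier H" for y
      using that by (intro bexI[of _ "((0, False), y)"]) auto
  qed (auto intro: H dih_finite finite_group_DirProd)
  show "{x \<in> carrier (dih 1 \<times>\<times> H). snd x = \<one>} = {\<one>\<^bsub>dih 1 \<times>\<times> H\<^esub>, ((0, True), \<one>)}" by auto
qed

text \<open>The Klein group is split at the rotation z along the reflection a. The quotients by a
  and by az both have order two and send z to the generator, so the same edge appears twice.\<close>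

lemma DO_dih2:
  "C.dec (DO (dih 2 \<times>\<times> H) ((1, False), \<one>))
    {#DO (dih 1 \<times>\<times> H) ((0, True), \<one>), DO (dih 1 \<times>\<times> H) ((0, True), \<one>)#}"
proof -
  have two: "{0..<2} = {0, 1 :: int}" "{0..<1} = {0 :: int}" by auto
  have e: "epi (dih 2) (dih 1) (\<lambda>(x, s). (0, x = 1))" "epi (dih 2) (dih 1) (\<lambda>(x, s). (0, (x = 1) \<noteq> s))"
  proof -
    show "epi (dih 2) (dih 1) (\<lambda>(x, s). (0, x = 1))"
      by (rule epiI) (auto intro: dih_finite simp: two)
    show "epi (dih 2) (dih 1) (\<lambda>(x, s). (0, (x = 1) \<noteq> s))"
      by (rule epiI) (auto intro: dih_finite simp: two)
  qed
  have k: "kern (dih 2) (dih 1) (\<lambda>(x, s). (0, x = 1)) = {\<one>\<^bsub>dih 2\<^esub>, (0, True)}"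
    "kern (dih 2) (dih 1) (\<lambda>(x, s). (0, (x = 1) \<noteq> s)) = {\<one>\<^bsub>dih 2\<^esub>, (1, True)}"
    by (auto simp: two)
  have c: "central_inv (dih 2) (0, True)" "central_inv (dih 2) (1, False)" by (auto simp: central_inv_def two)
  note g = finite_groupD(1)[OF dih_finite[of 2]]
  have "(0, True) \<otimes>\<^bsub>dih 2\<^esub> (1, False) = (1, True)" by simp
  then show ?thesis
    using DO_split2[OF epi_prod[OF e(1) epi_id[OF H]] epi_prod[OF e(2) epi_id[OF H]]
      central_inv_left[OF _ H.is_group c(1)] central_inv_left[OF _ H.is_group c(2)] _ kernel_prod_left[OF H.is_group k(1)]]
      kernel_prod_left[OF H.is_group k(2)] g by simp
qed

text \<open>The second reduction with i a reflection: in the dihedral group its centralizer is the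
  four-group generated by i and the half turn, and dividing by i leaves order two. Hence the
  dihedral group of order 8 contributes no new type of edge.\<close>

lemma DO_dih4: "C.dec (DO (dih 4 \<times>\<times> H) ((2, False), \<one>)) {#DO (dih 1 \<times>\<times> H) ((0, True), \<one>)#}"
proof -
  let ?G = "dih 4 \<times>\<times> H" and ?p = "\<lambda>((x :: int, s :: bool), h :: 'h). ((0 :: int, x = 2), h)"
  have four: "{0..<4} = {0, 1, 2, 3 :: int}" "{0..<1} = {0 :: int}" by auto
  interpret G: group ?G by (intro DirProd_group H.is_group finite_groupD dih_finite) simp
  have c: "central_inv (dih 4) (2, False)" using dih_central[of 2] by simp
  \<comment> \<open>s is the neutral element here, which is why it is repeated in both sets; the
    repetitions disappear on simplification.\<close>
  have "C.dec (EO ?G {\<one>\<^bsub>?G\<^esub>, \<one>\<^bsub>?G\<^esub>} {\<one>\<^bsub>?G\<^esub>, \<one>\<^bsub>?G\<^esub>, ((2, False), \<one>), \<one>\<^bsub>?G\<^esub> \<otimes>\<^bsub>?G\<^esub> ((2, False), \<one>)})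
    {#DO (dih 1 \<times>\<times> H) (?p ((2, False), \<one>))#}"
  proof (rule EO_klein_pair[where \<pi> = ?p and i = "((0, True), \<one>)" and g = "((1, False), \<one>)" and A = "({0, 2} \<times> UNIV) \<times> carrier H"])
    show "finite_group ?G" "finite_group (dih 1 \<times>\<times> H)" by (intro finite_group_DirProd H dih_finite; simp)+
    show "central_inv ?G ((2, False), \<one>)" by (rule central_inv_left[OF _ H.is_group c]) (intro finite_groupD dih_finite; simp)
    show "\<exists>x\<in>({0, 2} \<times> UNIV) \<times> carrier H. ?p x = y"
      if "y \<in> carrier (dih 1 \<times>\<times> H)" for y :: "(int \<times> bool) \<times> 'h"
      using that by (intro bexI[of _ "((if snd (fst y) then 2 else 0, False), snd y)"]) auto
  qed (auto simp: four split: if_splits)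
  then show ?thesis by simp
qed

end

text \<open>Dividing by a gives \<open>G \<times>\<times> D'\<close>, and dividing by az gives the
  same group: the character \<open>ch\<close>, nontrivial on a, is used to multiply the component in
  G by z, and the kernel of the twisted map is generated by az.\<close>

lemma DO_twist:
  fixes G (structure)
  assumes G: "finite_group G" and D: "epi D D' \<phi>" and z: "central_inv G z" and a: "central_inv D a"
    and k: "kern D D' \<phi> = {\<one>\<^bsub>D\<^esub>, a}"
    and ch: "\<And>x y. x \<in> carrier D \<Longrightarrow> y \<in> carrier D \<Longrightarrow> ch (x \<otimes>\<^bsub>D\<^esub> y) \<longleftrightarrow> ch x \<noteq> ch y" "ch a"
  shows "C.dec (DO (G \<times>\<times> D) (z, \<one>\<^bsub>D\<^esub>)) {#DO (G \<times>\<times> D') (z, \<one>\<^bsub>D'\<^esub>), DO (G \<times>\<times> D') (z, \<one>\<^bsub>D'\<^esub>)#}"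
proof -
  let ?Z = "(z, \<one>\<^bsub>D\<^esub>)"
  let ?g = "G \<times>\<times> D'"
  let ?G = "G \<times>\<times> D"
  interpret G: finite_grp G by unfold_locales (rule G)
  interpret D: epi D D' \<phi> by (rule D)
  have z': "z \<in> carrier G" "z \<otimes> z = \<one>" "z \<noteq> \<one>" "y \<in> carrier G \<Longrightarrow> y \<otimes> z = z \<otimes> y" for y
    using z unfolding central_inv_def by blast+
  have a': "a \<in> carrier D" using a by (simp add: central_inv_def)
  have ch1: "\<not> ch \<one>\<^bsub>D\<^esub>" using ch(1)[of "\<one>\<^bsub>D\<^esub>" "\<one>\<^bsub>D\<^esub>"] by simp
  let ?q = "\<lambda>(g, d). (if ch d then z \<otimes> g else g, \<phi> d)"
  have zz: "z \<otimes> (z \<otimes> g) = g" if "g \<in> carrier G" for g using that z'(1,2) by (simp flip: G.m_assoc)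
  have gz: "g \<otimes> (z \<otimes> g') = z \<otimes> (g \<otimes> g')" if "g \<in> carrier G" "g' \<in> carrier G" for g g'
    using that z'(1) z'(4)[OF that(1)] by (simp flip: G.m_assoc)
  have e: "epi ?G ?g ?q"
  proof (rule epiI)
    fix x y assume "x \<in> carrier ?G" "y \<in> carrier ?G"
    then obtain g d g' d' where xy: "x = (g, d)" "y = (g', d')" "g \<in> carrier G" "d \<in> carrier D" "g' \<in> carrier G" "d' \<in> carrier D"
      by auto
    then show "?q (x \<otimes>\<^bsub>G \<times>\<times> D\<^esub> y) = ?q x \<otimes>\<^bsub>G \<times>\<times> D'\<^esub> ?q y"
      using z'(1) by (simp add: ch(1) gz[OF xy(3,5)] zz G.m_assoc)
  next
    fix y assume "y \<in> carrier ?g"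
    then obtain g d where y: "y = (g, \<phi> d)" "g \<in> carrier G" "d \<in> carrier D" using D.phi_surj by (cases y) auto
    then show "\<exists>x\<in>carrier ?G. ?q x = y"
      using z'(1) by (intro bexI[of _ "(if ch d then z \<otimes> g else g, d)"]) (auto simp: zz)
  qed (use z'(1) D.phi_carrier in \<open>auto intro: finite_group_DirProd G D.G.fin D.H.fin\<close>)
  have k2: "kern ?G ?g ?q = {\<one>\<^bsub>G \<times>\<times> D\<^esub>, (\<one>, a) \<otimes>\<^bsub>G \<times>\<times> D\<^esub> ?Z}"
  proof -
    have "z \<otimes> g = \<one> \<longleftrightarrow> g = z" if "g \<in> carrier G" for g
      using zz[OF that] z'(1,2) by (metis G.r_one)
    moreover have "\<phi> d = \<one>\<^bsub>D'\<^esub> \<longleftrightarrow> d = \<one>\<^bsub>D\<^esub> \<or> d = a" if "d \<in> carrier D" for d using k that by blast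
    ultimately show ?thesis using ch1 ch(2) z'(1) a' by (auto split: if_splits)
  qed
  have "C.dec (DO ?G ?Z)
      {#DO ?g (map_prod (\<lambda>x. x) \<phi> ?Z), DO ?g (?q ?Z)#}"
    by (rule DO_split2[OF epi_prod[OF epi_id[OF G] D] e central_inv_right[OF G.is_group D.G.is_group a]
      central_inv_left[OF G.is_group D.G.is_group z] _ kernel_prod_right[OF G.is_group k] k2]) (use z'(3) in auto)
  then show ?thesis using ch1 by simp
qed

lemma DO_dih1_right:
  fixes H (structure)
  assumes G: "finite_group G" and H: "finite_group H" and z: "central_inv G z"
  shows "C.dec (DO (G \<times>\<times> (dih 1 \<times>\<times> H)) (z, ((0, False), \<one>))) {#DO (G \<times>\<times> H) (z, \<one>), DO (G \<times>\<times> H) (z, \<one>)#}"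
proof -
  let ?D = "dih 1 \<times>\<times> H"
  interpret H: finite_grp H by unfold_locales (rule H)
  have d: "finite_group (dih 1)" by (simp add: dih_finite)
  have e: "epi ?D H snd"
  proof (rule epiI)
    show "\<exists>x\<in>carrier ?D. snd x = y" if "y \<in> carrier H" for y
      using that by (intro bexI[of _ "((0, False), y)"]) auto
  qed (auto intro: H d finite_group_DirProd)
  have k: "{x \<in> carrier ?D. snd x = \<one>} = {\<one>\<^bsub>dih 1 \<times>\<times> H\<^esub>, ((0, True), \<one>)}" by auto
  have "C.dec (DO (G \<times>\<times> ?D) (z, \<one>\<^bsub>dih 1 \<times>\<times> H\<^esub>)) {#DO (G \<times>\<times> H) (z, \<one>), DO (G \<times>\<times> H) (z, \<one>)#}"
    by (rule DO_twist[OF G e z central_inv_left[OF finite_groupD(1)[OF d] H.is_group dih1_central] k, where ch = "\<lambda>x. snd (fst x)"]) (auto split: if_splits)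
  then show ?thesis by simp
qed

text \<open>The Klein factor is removed in two steps of index two, each of which doubles the number
  of copies.\<close>

lemma DO_dih2_right:
  fixes H (structure)
  assumes G: "finite_group G" and H: "finite_group H" and z: "central_inv G z"
  shows "C.dec (DO (G \<times>\<times> (dih 2 \<times>\<times> H)) (z, ((0, False), \<one>)))
    {#DO (G \<times>\<times> H) (z, \<one>), DO (G \<times>\<times> H) (z, \<one>), DO (G \<times>\<times> H) (z, \<one>), DO (G \<times>\<times> H) (z, \<one>)#}"
proof -
  let ?d = "DO (G \<times>\<times> (dih 2 \<times>\<times> H))"
  let ?D = "DO (G \<times>\<times> (dih 1 \<times>\<times> H))"
  interpret H: finite_grp H by unfold_locales (rule H)
  have d: "group (dih 2)" by (intro finite_groupD dih_finite) simp
  let ?X = "?D (z, ((0, False), \<one>))" and ?Y = "DO (G \<times>\<times> H) (z, \<one>)"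
  have two: "{0..<2} = {0, 1 :: int}" by auto
  have e: "epi (dih 2) (dih 1) (\<lambda>(x, s). (x mod int 1, s))" using dih_red[of 1 2] by simp
  have k: "kern (dih 2) (dih 1) (\<lambda>(x, s). (x mod int 1, s)) = {\<one>\<^bsub>dih 2\<^esub>, (1, False)}"
    using dih_red_kernel[of 1] by simp
  have c: "central_inv (dih 2) (1, False)" using dih_central[of 1] by simp
  have "C.dec (?d (z, \<one>\<^bsub>dih 2 \<times>\<times> H\<^esub>))
      {#?D (z, \<one>\<^bsub>dih 1 \<times>\<times> H\<^esub>), ?D (z, \<one>\<^bsub>dih 1 \<times>\<times> H\<^esub>)#}"
    by (rule DO_twist[OF G epi_prod[OF e epi_id[OF H]] z central_inv_left[OF d H.is_group c]
        kernel_prod_left[OF H.is_group k], where ch = "\<lambda>x. fst (fst x) = 1"]) (auto simp: two split: if_splits)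
  then have 1: "C.dec (?d (z, ((0, False), \<one>))) {#?X, ?X#}" by simp
  note X = DO_dih1_right[OF G H z]
  from C.dec_subst[OF 1 X] have "C.dec (?d (z, ((0, False), \<one>))) {#?X, ?Y, ?Y#}"
    by (simp add: add_mset_commute)
  from C.dec_subst[OF this X] show ?thesis by (simp add: add_mset_commute)
qed

text \<open>At the generator t of the group of order two, the quotient by ta is D itself with t sent
  to a. The second summand is therefore the edge of D at a.\<close>

lemma DO_dih1_left:
  fixes D (structure)
  assumes D: "epi D D' \<phi>" and a: "central_inv D a" and k: "kern D D' \<phi> = {\<one>, a}"
  shows "C.dec (DO (dih 1 \<times>\<times> D) ((0, True), \<one>)) {#DO (dih 1 \<times>\<times> D') ((0, True), \<one>\<^bsub>D'\<^esub>), DO D a#}"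
proof -
  let ?D = "dih 1 \<times>\<times> D"
  interpret D: epi D D' \<phi> by (rule D)
  have d1: "finite_group (dih 1)" by (simp add: dih_finite)
  have a': "a \<in> carrier D" "a \<otimes> a = \<one>" "y \<in> carrier D \<Longrightarrow> y \<otimes> a = a \<otimes> y" for y
    using a unfolding central_inv_def by blast+
  have aa: "a \<otimes> (a \<otimes> g) = g" if "g \<in> carrier D" for g using that a'(1,2) by (simp flip: D.G.m_assoc)
  have ga: "g \<otimes> (a \<otimes> g') = a \<otimes> (g \<otimes> g')" if "g \<in> carrier D" "g' \<in> carrier D" for g g'
    using that a'(1) a'(3)[OF that(1)] by (simp flip: D.G.m_assoc)
  let ?q = "\<lambda>(c, d). if snd c then a \<otimes> d else d"
  have e: "epi ?D D ?q"
  proof (rule epiI)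
    fix x y assume "x \<in> carrier ?D" "y \<in> carrier ?D"
    then obtain c s g c' s' g' where xy: "x = ((c, s), g)" "y = ((c', s'), g')" "g \<in> carrier D" "g' \<in> carrier D"
      by auto
    then show "?q (x \<otimes>\<^bsub>dih 1 \<times>\<times> D\<^esub> y) = ?q x \<otimes> ?q y"
      using a'(1) by (simp add: ga[OF xy(3,4)] aa D.G.m_assoc)
  next
    show "\<exists>x\<in>carrier ?D. ?q x = y" if "y \<in> carrier D" for y
      using that by (intro bexI[of _ "((0, False), y)"]) auto
  qed (use a'(1) in \<open>auto intro: finite_group_DirProd d1 D.G.fin\<close>)
  have k2: "{x \<in> carrier ?D. ?q x = \<one>} = {\<one>\<^bsub>dih 1 \<times>\<times> D\<^esub>, (\<one>\<^bsub>dih 1\<^esub>, a) \<otimes>\<^bsub>dih 1 \<times>\<times> D\<^esub> ((0, True), \<one>)}"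
  proof -
    have "a \<otimes> g = \<one> \<longleftrightarrow> g = a" if "g \<in> carrier D" for g
      using aa[OF that] a'(1,2) by (metis D.G.r_one)
    then show ?thesis using a'(1) by (auto split: if_splits)
  qed
  have "C.dec (DO ?D ((0, True), \<one>))
      {#DO (dih 1 \<times>\<times> D') (map_prod (\<lambda>x. x) \<phi> ((0, True), \<one>)), DO D (?q ((0 :: int, True), \<one>))#}"
    by (rule DO_split2[OF epi_prod[OF epi_id[OF d1] D] e
      central_inv_right[OF finite_groupD(1)[OF d1] D.G.is_group a]
      central_inv_left[OF finite_groupD(1)[OF d1] D.G.is_group dih1_central] _
      kernel_prod_right[OF finite_groupD(1)[OF d1] k] k2]) auto
  then show ?thesis using a'(1) by simp
qed

text \<open>The splitting runs along the half turn of the dihedral factor. Dividing by it halves the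
  number of rotations; the other summand, in which it is identified with z, is left for the second
  reduction.\<close>

lemma DO_dih_step:
  fixes H (structure)
  assumes G: "finite_group G" and H: "finite_group H" and z: "central_inv G z" and N: "N > 0"
  shows "C.dec (DO (G \<times>\<times> (dih (2 * N) \<times>\<times> H)) (z, ((0, False), \<one>)))
    {#DO (G \<times>\<times> (dih N \<times>\<times> H)) (z, ((0, False), \<one>)),
      EO (G \<times>\<times> (dih (2 * N) \<times>\<times> H)) {\<one>\<^bsub>G \<times>\<times> (dih (2 * N) \<times>\<times> H)\<^esub>, (z, ((int N, False), \<one>))}
        {\<one>\<^bsub>G \<times>\<times> (dih (2 * N) \<times>\<times> H)\<^esub>, (\<one>\<^bsub>G\<^esub>, ((int N, False), \<one>)), (z, ((0, False), \<one>)), (z, ((int N, False), \<one>))}#}"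
proof -
  let ?D = "dih (2 * N) \<times>\<times> H" and ?a = "((int N, False), \<one>)"
  interpret H: finite_grp H by unfold_locales (rule H)
  interpret G: finite_grp G by unfold_locales (rule G)
  have dN: "finite_group (dih (2 * N))" using N by (simp add: dih_finite)
  interpret D: finite_grp ?D by unfold_locales (intro finite_group_DirProd dN H)
  have z': "z \<in> carrier G" "z \<noteq> \<one>\<^bsub>G\<^esub>" using z by (auto simp: central_inv_def)
  have a: "central_inv ?D ?a"
    using central_inv_left[OF finite_groupD(1)[OF dN] H.is_group dih_central[OF N]] .
  show ?thesis
    using epi.DO_split[OF epi_prod[OF epi_id[OF G] epi_prod[OF dih_red[OF N, of 2] epi_id[OF H]]]
        central_inv_right[OF G.is_group D.is_group a] central_inv_left[OF G.is_group D.is_group z] _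
        kernel_prod_right[OF G.is_group kernel_prod_left[OF H.is_group dih_red_kernel[OF N]]]] z' N
    by simp
qed

section \<open>Dihedral extensions of a product of two cyclic groups\<close>

definition dih2 :: "nat \<Rightarrow> nat \<Rightarrow> ((int \<times> int) \<times> bool) monoid" where
  "dih2 A B = \<lparr>carrier = ({0..<int A} \<times> {0..<int B}) \<times> UNIV,
     monoid.mult = (\<lambda>((a, b), s) ((a', b'), t). (((if s then a - a' else a + a') mod int A, (if s then b - b' else b + b') mod int B), s \<noteq> t)),
     one = ((0, 0), False)\<rparr>"

lemma dih2_simps [simp]:
  "carrier (dih2 A B) = ({0..<int A} \<times> {0..<int B}) \<times> UNIV" "\<one>\<^bsub>dih2 A B\<^esub> = ((0, 0), False)"
  "((a, b), s) \<otimes>\<^bsub>dih2 A B\<^esub> ((a', b'), t) = (((if s then a - a' else a + a') mod int A, (if s then b - b' else b + b') mod int B), s \<noteq> t)"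
  by (simp_all add: dih2_def)

lemma dih2_finite: assumes "A > 0" "B > 0" shows "finite_group (dih2 A B)"
  unfolding finite_group_def
proof
  let ?C = "carrier (dih2 A B)"
  show "group (dih2 A B)"
  proof (rule groupI)
    fix x y z assume "x \<in> ?C" "y \<in> ?C" "z \<in> ?C"
    then show "x \<otimes>\<^bsub>dih2 A B\<^esub> y \<otimes>\<^bsub>dih2 A B\<^esub> z = x \<otimes>\<^bsub>dih2 A B\<^esub> (y \<otimes>\<^bsub>dih2 A B\<^esub> z)"
      by (cases x; cases y; cases z) (auto simp: mod_simps algebra_simps)
  next
    fix x assume "x \<in> ?C"
    then show "\<exists>y\<in>carrier (dih2 A B). y \<otimes>\<^bsub>dih2 A B\<^esub> x = \<one>\<^bsub>dih2 A B\<^esub>"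
      using assms by (intro bexI[of _ "if snd x then x else ((- fst (fst x) mod int A, - snd (fst x) mod int B), False)"]) (auto simp: mod_simps)
  qed (use assms in auto)
qed simp

text \<open>A shear followed by reduction. It kills (A, c A), which generates its kernel in the
  cases treated below, so varying c gives different quotients of the same shape.\<close>

definition rot :: "int \<Rightarrow> nat \<Rightarrow> nat \<Rightarrow> int \<Rightarrow> int \<Rightarrow> int \<times> int" where
  "rot c A B x y = (x mod int A, (y - c * x) mod int B)"

lemma rot_mod:
  assumes "int A dvd n" "int B dvd c * n" "int B dvd m"
  shows "rot c A B (x mod n) (y mod m) = rot c A B x y"
proof -
  have "c * (x mod n) mod int B = c * x mod int B"
    using assms(2) by (metis mod_mod_cancel mult_mod_right)
  moreover have "y mod m mod int B = y mod int B" using assms(3) by (rule mod_mod_cancel)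
  ultimately have "(y mod m - c * (x mod n)) mod int B = (y - c * x) mod int B" by (intro mod_diff_cong)
  then show ?thesis using assms(1) by (simp add: rot_def mod_mod_cancel)
qed

lemma rot_add:
  "rot c A B (x + x') (y + y') = ((fst (rot c A B x y) + fst (rot c A B x' y')) mod int A, (snd (rot c A B x y) + snd (rot c A B x' y')) mod int B)"
  "rot c A B (x - x') (y - y') = ((fst (rot c A B x y) - fst (rot c A B x' y')) mod int A, (snd (rot c A B x y) - snd (rot c A B x' y')) mod int B)"
  by (simp_all add: rot_def mod_simps) (simp_all add: algebra_simps)

lemma rot_range: "A > 0 \<Longrightarrow> B > 0 \<Longrightarrow> rot c A B x y \<in> {0..<int A} \<times> {0..<int B}"
  by (simp add: rot_def)

lemma rot_surj:
  assumes "0 \<le> p" "p < int A" "0 \<le> q" "q < int B"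
  shows "rot c A B p ((q + c * p) mod int B) = (p, q)"
  using assms by (simp add: rot_def mod_simps)

lemma dih2_central: assumes "A > 0" "B > 0"
  shows "central_inv (dih2 A (2 * B)) ((0, int B), False)" "central_inv (dih2 (2 * A) B) ((int A, 0), False)"
proof -
  have "(a - int B) mod (2 * int B) = (a + int B) mod (2 * int B)" "(a - int A) mod (2 * int A) = (a + int A) mod (2 * int A)" for a
    by (simp_all add: mod_eq_dvd_iff)
  then show "central_inv (dih2 A (2 * B)) ((0, int B), False)" "central_inv (dih2 (2 * A) B) ((int A, 0), False)"
    using assms by (auto simp: central_inv_def add.commute)
qed

lemma dih2_red:
  assumes "A > 0" "B > 0" "int B dvd c * (2 * int A)"
  shows "epi (dih2 (2 * A) B) (dih2 A B) (\<lambda>((x, y), s). (rot c A B x y, s))"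
proof (rule epiI)
  show "finite_group (dih2 (2 * A) B)" "finite_group (dih2 A B)" using assms by (intro dih2_finite; simp)+
  have m: "rot c A B (x mod (2 * int A)) (y mod int B) = rot c A B x y" for x y
    by (rule rot_mod) (use assms(3) in auto)
  have p: "\<exists>a b. rot c A B x y = (a, b)" for x y by (simp add: rot_def)
  fix x y assume "x \<in> carrier (dih2 (2 * A) B)" "y \<in> carrier (dih2 (2 * A) B)"
  obtain a b s a' b' t where xy: "x = ((a, b), s)" "y = ((a', b'), t)" by (metis prod.collapse)
  obtain u v u' v' where r: "rot c A B a b = (u, v)" "rot c A B a' b' = (u', v')" using p by metis
  show "(case x \<otimes>\<^bsub>dih2 (2 * A) B\<^esub> y of (xa, s) \<Rightarrow> (case xa of (x, y) \<Rightarrow> \<lambda>s. (rot c A B x y, s)) s) =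
      (case x of (xa, s) \<Rightarrow> (case xa of (x, y) \<Rightarrow> \<lambda>s. (rot c A B x y, s)) s) \<otimes>\<^bsub>dih2 A B\<^esub>
      (case y of (xa, s) \<Rightarrow> (case xa of (x, y) \<Rightarrow> \<lambda>s. (rot c A B x y, s)) s)"
    unfolding xy using m[of "a + a'" "b + b'"] m[of "a - a'" "b - b'"] by (simp add: rot_add r)
next
  fix y assume "y \<in> carrier (dih2 A B)"
  then obtain p q t where y: "y = ((p, q), t)" "0 \<le> p" "p < int A" "0 \<le> q" "q < int B" by auto
  then show "\<exists>x\<in>carrier (dih2 (2 * A) B). (case x of (xa, s) \<Rightarrow> (case xa of (x, y) \<Rightarrow> \<lambda>s. (rot c A B x y, s)) s) = y"
    by (intro bexI[of _ "((p, (q + c * p) mod int B), t)"]) (auto simp: rot_surj)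
qed (use rot_range[OF assms(1,2)] in \<open>auto simp: rot_def assms(1,2)\<close>)

lemma rot_kernel2:
  assumes "A > 0" "B > 0" "0 \<le> x" "x < 2 * int A" "0 \<le> y" "y < int B" "0 \<le> c" "c * int A < int B"
  shows "rot c A B x y = (0, 0) \<longleftrightarrow> (x, y) = (0, 0) \<or> (x, y) = (int A, c * int A)"
proof -
  have x: "x mod int A = 0 \<longleftrightarrow> x = 0 \<or> x = int A" using mod_zero_cases[of x "int A"] assms by simp
  have y: "(y - w) mod int B = 0 \<longleftrightarrow> y = w" if "0 \<le> w" "w < int B" for w
    using that assms(5,6) by (metis mod_pos_pos_trivial mod_eq_dvd_iff mod_0_imp_dvd dvd_imp_mod_0)
  have y': "y mod int B = 0 \<longleftrightarrow> y = 0" "(y - c * int A) mod int B = 0 \<longleftrightarrow> y = c * int A"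
    using y[of 0] y[OF _ assms(8)] assms by simp_all
  have "rot c A B x y = (0, 0) \<longleftrightarrow> (x = 0 \<or> x = int A) \<and> (y - c * x) mod int B = 0"
    unfolding rot_def prod.inject x ..
  also have "\<dots> \<longleftrightarrow> (x, y) = (0, 0) \<or> (x, y) = (int A, c * int A)"
    using y' assms(1) by (cases "x = 0"; cases "x = int A") (simp_all del: mod_eq_0_iff_dvd)
  finally show ?thesis .
qed

lemma dih2_red_kernel:
  assumes "A > 0" "B > 0" "c * A < B"
  shows "kern (dih2 (2 * A) B) (dih2 A B) (\<lambda>((x, y), s). (rot (int c) A B x y, s)) =
    {\<one>\<^bsub>dih2 (2 * A) B\<^esub>, ((int A, int (c * A)), False)}"
proof -
  have "int c * int A < int B" using assms(3) by (simp flip: of_nat_mult)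
  then have "rot (int c) A B x y = (0, 0) \<longleftrightarrow> (x, y) = (0, 0) \<or> (x, y) = (int A, int c * int A)"
    if "0 \<le> x" "x < 2 * int A" "0 \<le> y" "y < int B" for x y
    using rot_kernel2[OF assms(1,2) that, of "int c"] by simp
  then show ?thesis using assms \<open>int c * int A < int B\<close> by auto
qed

text \<open>At z = (0, cA), splitting along a = (A, 0) makes az equal to (A, cA). These generate the
  kernels of \<open>rot\<close> with coefficients 0 and c, and both quotients are the same group
  with z in the same place.\<close>

lemma DO_dih2_halve:
  fixes H (structure)
  assumes H: "finite_group H" and "A > 0" "c > 0"
  shows "C.dec (DO (dih2 (2 * A) (2 * (c * A)) \<times>\<times> H) (((0, int (c * A)), False), \<one>))
    {#DO (dih2 A (2 * (c * A)) \<times>\<times> H) (((0, int (c * A)), False), \<one>),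
      DO (dih2 A (2 * (c * A)) \<times>\<times> H) (((0, int (c * A)), False), \<one>)#}"
proof -
  let ?D = "dih2 (2 * A)"
  let ?I = "(((0, int (c * A)), False), \<one>)"
  interpret H: finite_grp H by unfold_locales (rule H)
  let ?B = "2 * (c * A)"
  have B: "?B > 0" "0 < c * A" using assms by auto
  have g: "group (?D ?B)" using assms B by (intro finite_groupD dih2_finite) auto
  have e: "epi (?D ?B) (dih2 A ?B) (\<lambda>((x, y), s). (rot (int 0) A ?B x y, s))"
    "epi (?D ?B) (dih2 A ?B) (\<lambda>((x, y), s). (rot (int c) A ?B x y, s))"
    by (rule dih2_red[OF assms(2) B(1)]; simp)+
  note k = dih2_red_kernel[OF assms(2) B(1), of 0] dih2_red_kernel[OF assms(2) B(1), of c]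
  have c: "central_inv (?D ?B) ((int A, 0), False)" "central_inv (?D ?B) ((0, int (c * A)), False)"
    using dih2_central(2)[OF assms(2) B(1)] dih2_central(1)[of "2 * A" "c * A"] assms B by simp_all
  have k1: "kern (?D ?B) (dih2 A ?B) (\<lambda>((x, y), s). (rot (int 0) A ?B x y, s)) = {\<one>\<^bsub>dih2 (2 * A) ?B\<^esub>, ((int A, 0), False)}"
    using k(1) B by simp
  have k2: "kern (?D ?B) (dih2 A ?B) (\<lambda>((x, y), s). (rot (int c) A ?B x y, s)) = {\<one>\<^bsub>dih2 (2 * A) ?B\<^esub>, ((int A, int (c * A)), False)}"
    using k(2) B by simp
  have az: "(((int A, 0), False), \<one>) \<otimes>\<^bsub>dih2 (2 * A) ?B \<times>\<times> H\<^esub> ?I = (((int A, int (c * A)), False), \<one>)"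
    using assms B by (simp add: zmod_trivial_iff)
  have r: "rot d A ?B 0 (int (c * A)) = (0, int (c * A))" for d using B by (simp add: rot_def)
  have "C.dec (DO (?D ?B \<times>\<times> H) ?I)
     {#DO (dih2 A ?B \<times>\<times> H) (map_prod (\<lambda>((x, y), s). (rot (int 0) A ?B x y, s)) (\<lambda>x. x) ?I),
       DO (dih2 A ?B \<times>\<times> H) (map_prod (\<lambda>((x, y), s). (rot (int c) A ?B x y, s)) (\<lambda>x. x) ?I)#}"
    by (rule DO_split2[OF epi_prod[OF e(1) epi_id[OF H]] epi_prod[OF e(2) epi_id[OF H]] central_inv_left[OF g H.is_group c(1)]
      central_inv_left[OF g H.is_group c(2)] _ kernel_prod_left[OF H.is_group k1] kernel_prod_left[OF H.is_group k2, folded az]])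
      (use assms in simp)
  then show ?thesis by (simp add: r del: of_nat_mult)
qed

lemma DO_dih2_trivial:
  fixes H (structure)
  assumes H: "finite_group H" and "B > 0"
  shows "C.dec (DO (dih2 1 (2 * B) \<times>\<times> H) (((0, int B), False), \<one>)) {#DO (dih (2 * B) \<times>\<times> H) ((int B, False), \<one>)#}"
proof -
  let ?D = "dih2 1 (2 * B) \<times>\<times> H"
  interpret H: finite_grp H by unfold_locales (rule H)
  have g: "finite_group (dih2 1 (2 * B))" "finite_group (dih (2 * B))" using assms by (simp_all add: dih2_finite dih_finite)
  have "epi (dih2 1 (2 * B)) (dih (2 * B)) (\<lambda>((x, y), s). (y, s))"
  proof (rule epiI)
    show "\<exists>x\<in>carrier (dih2 1 (2 * B)). (\<lambda>((x, y), s). (y, s)) x = y" if "y \<in> carrier (dih (2 * B))" for y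
      using that by (intro bexI[of _ "((0, fst y), snd y)"]) auto
  qed (use g in auto)
  then have e: "epi ?D (dih (2 * B) \<times>\<times> H) (map_prod (\<lambda>((x, y), s). (y, s)) (\<lambda>x. x))"
    by (rule epi_prod[OF _ epi_id[OF H]])
  have c: "central_inv ?D (((0, int B), False), \<one>)"
    by (rule central_inv_left[OF finite_groupD(1)[OF g(1)] H.is_group dih2_central(1)]) (use assms in auto)
  have "C.dec (DO ?D (((0, int B), False), \<one>))
     {#DO (dih (2 * B) \<times>\<times> H) (map_prod (\<lambda>((x, y), s). (y, s)) (\<lambda>x. x) (((0 :: int, int B), False), \<one>))#}"
    by (rule epi.DO_iso[OF e c]) (use assms in auto)
  then show ?thesis by simp
qed

text \<open>Each halving of the first cyclic factor doubles the number of copies. The bound on t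
  makes its order divide that of the second factor, so that the coefficient
  \<open>2 ^ (b - t)\<close> is available in each step.\<close>

lemma DO_dih2_pow:
  fixes H (structure)
  assumes H: "finite_group H" and "t \<le> Suc b"
  shows "C.dec (DO (dih2 (2 ^ t) (2 ^ Suc b) \<times>\<times> H) (((0, 2 ^ b), False), \<one>))
    (replicate_mset (2 ^ t) (DO (dih (2 ^ Suc b) \<times>\<times> H) ((2 ^ b, False), \<one>)))"
  using assms(2)
proof (induction t)
  case 0
  show ?case using DO_dih2_trivial[OF H, of "2 ^ b"] by (simp add: One_nat_def)
next
  case (Suc t)
  let ?X = "DO (dih2 (2 ^ t) (2 ^ Suc b) \<times>\<times> H) (((0, 2 ^ b), False), \<one>)"
  let ?Y = "DO (dih (2 ^ Suc b) \<times>\<times> H) ((2 ^ b, False), \<one>)"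
  have e: "(2 :: nat) ^ b = 2 ^ (b - t) * 2 ^ t" using Suc.prems by (simp flip: power_add)
  have 1: "C.dec (DO (dih2 (2 ^ Suc t) (2 ^ Suc b) \<times>\<times> H) (((0, 2 ^ b), False), \<one>)) {#?X, ?X#}"
    using DO_dih2_halve[OF H, of "2 ^ t" "2 ^ (b - t)", folded e] by simp
  have m: "replicate_mset (2 ^ Suc t) ?Y = replicate_mset (2 ^ t) ?Y + replicate_mset (2 ^ t) ?Y" by (rule multiset_eqI) simp
  have IH: "C.dec ?X (replicate_mset (2 ^ t) ?Y)" using Suc by simp
  show ?case unfolding m using C.dec_subst[OF C.dec_subst[OF 1 IH, unfolded union_mset_add_mset_right] IH] by simp
qed

section \<open>Two dihedral groups with identified half turns\<close>

abbreviation EO_dd where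
  "EO_dd M K H \<equiv> EO (dih (4 * M) \<times>\<times> (dih (4 * K) \<times>\<times> H)) {\<one>\<^bsub>dih (4 * M) \<times>\<times> (dih (4 * K) \<times>\<times> H)\<^esub>, ((2 * int M, False), ((2 * int K, False), \<one>\<^bsub>H\<^esub>))}
     {\<one>\<^bsub>dih (4 * M) \<times>\<times> (dih (4 * K) \<times>\<times> H)\<^esub>, (\<one>\<^bsub>dih (4 * M)\<^esub>, ((2 * int K, False), \<one>\<^bsub>H\<^esub>)), ((2 * int M, False), ((0, False), \<one>\<^bsub>H\<^esub>)), ((2 * int M, False), ((2 * int K, False), \<one>\<^bsub>H\<^esub>))}"

text \<open>The pair i = (M, K) of quarter turns squares to s. An element that inverts both
  components of i, or neither, commutes with i modulo s; one that inverts exactly one sends i to iz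
  modulo s. \<rho> divides the rotations by the subgroup of order four generated by i.\<close>

lemma EO_dih_dih:
  fixes H (structure) and \<rho> :: "int \<Rightarrow> int \<Rightarrow> int \<times> int"
  assumes H: "finite_group H" and M: "M > 0" and K: "K > 0" and AB: "A > 0" "B > 0"
    and \<rho>: "\<And>x y. \<rho> x y \<in> {0..<int A} \<times> {0..<int B}"
      "\<And>x y x' y'. \<rho> ((x + x') mod (4 * int M)) ((y + y') mod (4 * int K)) =
         ((fst (\<rho> x y) + fst (\<rho> x' y')) mod int A, (snd (\<rho> x y) + snd (\<rho> x' y')) mod int B)"
      "\<And>x y x' y'. \<rho> ((x - x') mod (4 * int M)) ((y - y') mod (4 * int K)) =
         ((fst (\<rho> x y) - fst (\<rho> x' y')) mod int A, (snd (\<rho> x y) - snd (\<rho> x' y')) mod int B)"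
      "\<And>p q. 0 \<le> p \<Longrightarrow> p < int A \<Longrightarrow> 0 \<le> q \<Longrightarrow> q < int B \<Longrightarrow> \<exists>x\<in>{0..<4 * int M}. \<exists>y\<in>{0..<4 * int K}. \<rho> x y = (p, q)"
      "\<And>x y. x \<in> {0..<4 * int M} \<Longrightarrow> y \<in> {0..<4 * int K} \<Longrightarrow> \<rho> x y = (0, 0) \<longleftrightarrow>
         (x, y) \<in> {(0, 0), (int M, int K), (2 * int M, 2 * int K), (3 * int M, 3 * int K)}"
  shows "C.dec (EO_dd M K H) {#DO (dih2 A B \<times>\<times> H) ((\<rho> (2 * int M) 0, False), \<one>)#}"
proof -
  let ?D = "dih2 A B \<times>\<times> H"
  interpret H: finite_grp H by unfold_locales (rule H)
  let ?G = "dih (4 * M) \<times>\<times> (dih (4 * K) \<times>\<times> H)"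
  let ?s = "((2 * int M, False), ((2 * int K, False), \<one>))" and ?z = "((2 * int M, False), ((0 :: int, False), \<one>))"
  let ?i = "((int M, False), ((int K, False), \<one>))"
  let ?A = "{x \<in> carrier ?G. snd (fst x) = snd (fst (snd x))}"
  let ?p = "\<lambda>((x :: int, s :: bool), ((y :: int, t :: bool), h :: 'a)). ((\<rho> x y, s), h)"
  have d: "finite_group (dih (4 * M))" "finite_group (dih (4 * K))" using M K by (simp_all add: dih_finite)
  have z: "central_inv (dih (4 * M)) (2 * int M, False)" "central_inv (dih (4 * K)) (2 * int K, False)"
    using dih_central[of "2 * M"] dih_central[of "2 * K"] M K by simp_all
  \<comment> \<open>Normal forms for the multiples of a quarter turn m that occur when commutation
    with s, z and i is checked.\<close>
  have m: "(a - m) mod (4 * m) = (a + 3 * m) mod (4 * m)" "(2 * m + (2 * m + (m + a))) mod (4 * m) = (a + m) mod (4 * m)"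
     "(2 * m + (m + a)) mod (4 * m) = (a + 3 * m) mod (4 * m)" "(m + a) mod (4 * m) = (a + m) mod (4 * m)"
     "(2 * m + a) mod (4 * m) = (a + 2 * m) mod (4 * m)" "(a - 2 * m) mod (4 * m) = (a + 2 * m) mod (4 * m)"
     "(3 * m + a) mod (4 * m) = (a + 3 * m) mod (4 * m)" "(5 * m + a) mod (4 * m) = (a + m) mod (4 * m)" for a m :: int
    by (simp_all add: mod_eq_dvd_iff algebra_simps)
  have lt: "2 * int M mod (4 * int M) = 2 * int M" "2 * int K mod (4 * int K) = 2 * int K" "3 * int M mod (4 * int M) = 3 * int M"
    "3 * int K mod (4 * int K) = 3 * int K" using M K by simp_all
  have p: "\<exists>a b. \<rho> x y = (a, b)" for x y by (cases "\<rho> x y") auto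
  have "C.dec (EO ?G {\<one>\<^bsub>?G\<^esub>, ?s} {\<one>\<^bsub>?G\<^esub>, ?s, ?z, ?s \<otimes>\<^bsub>?G\<^esub> ?z}) {#DO ?D (?p ?z)#}"
  proof (rule EO_klein_pair[where i = ?i and g = "((0, True), ((0, False), \<one>))" and A = ?A and \<pi> = ?p])
    show "finite_group ?G" "finite_group ?D" by (intro finite_group_DirProd d H dih2_finite AB)+
    have "central_inv (dih (4 * K) \<times>\<times> H) ((2 * int K, False), \<one>)"
      by (rule central_inv_left[OF finite_groupD(1)[OF d(2)] H.is_group z(2)])
    show "central_inv ?G ?z"
      using central_inv_left[OF finite_groupD(1)[OF d(1)] DirProd_group[OF finite_groupD(1)[OF d(2)] H.is_group] z(1)] by simp
    show "?p x \<in> carrier ?D" if "x \<in> ?A" for x using that \<rho>(1) by auto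
    show "?p (x \<otimes>\<^bsub>?G\<^esub> y) = ?p x \<otimes>\<^bsub>dih2 A B \<times>\<times> H\<^esub> ?p y" if x: "x \<in> ?A" and y: "y \<in> ?A" for x y
    proof -
      obtain a s b h where x': "x = ((a, s), ((b, s), h))" using x by (cases x) auto
      obtain a' t b' h' where y': "y = ((a', t), ((b', t), h'))" using y by (cases y) auto
      obtain u v u' v' where r: "\<rho> a b = (u, v)" "\<rho> a' b' = (u', v')" using p by metis
      show ?thesis unfolding x' y' using \<rho>(2)[of a a' b b'] \<rho>(3)[of a a' b b'] by (simp add: r)
    qed
    show "\<exists>x\<in>?A. ?p x = y" if y: "y \<in> carrier ?D" for y
    proof -
      obtain p q s h where y': "y = (((p, q), s), h)" "0 \<le> p" "p < int A" "0 \<le> q" "q < int B" "h \<in> carrier H" using y by auto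
      obtain a b where "a \<in> {0..<4 * int M}" "b \<in> {0..<4 * int K}" "\<rho> a b = (p, q)" using \<rho>(4)[OF y'(2-5)] by blast
      then show ?thesis using y' by (intro bexI[of _ "((a, s), ((b, s), h))"]) auto
    qed
    show "?p x = \<one>\<^bsub>dih2 A B \<times>\<times> H\<^esub> \<longleftrightarrow> x \<in> {\<one>\<^bsub>?G\<^esub>, ?s, ?i, ?s \<otimes>\<^bsub>?G\<^esub> ?i}"
      if x: "x \<in> ?A" for x
    proof -
      obtain a s b h where x': "x = ((a, s), ((b, s), h))" "a \<in> {0..<4 * int M}" "b \<in> {0..<4 * int K}" using x by (cases x) auto
      show ?thesis unfolding x'(1) using \<rho>(5)[OF x'(2,3)] by (auto simp: lt)
    qed
    show "y \<otimes>\<^bsub>?G\<^esub> ?s = ?s \<otimes>\<^bsub>?G\<^esub> y" if "y \<in> carrier ?G" for y using that by (auto simp: m)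
    show "y \<otimes>\<^bsub>?G\<^esub> ?i \<in> {?i \<otimes>\<^bsub>?G\<^esub> y, ?s \<otimes>\<^bsub>?G\<^esub> (?i \<otimes>\<^bsub>?G\<^esub> y)}" if y: "y \<in> ?A" for y
    proof -
      obtain a s b h where y': "y = ((a, s), ((b, s), h))" "h \<in> carrier H" using y by (cases y) auto
      show ?thesis unfolding y'(1) using y'(2) by (cases s) (simp_all add: mod_simps m)
    qed
    show "y \<otimes>\<^bsub>?G\<^esub> ?i \<in> {?z \<otimes>\<^bsub>?G\<^esub> (?i \<otimes>\<^bsub>?G\<^esub> y), ?s \<otimes>\<^bsub>?G\<^esub> (?z \<otimes>\<^bsub>?G\<^esub> (?i \<otimes>\<^bsub>?G\<^esub> y))}"
      if y: "y \<in> carrier ?G" "y \<notin> ?A" for y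
    proof -
      obtain a s b t h where y': "y = ((a, s), ((b, t), h))" "h \<in> carrier H" "t = (\<not> s)" using y by (cases y) auto
      show ?thesis unfolding y'(1,3) using y'(2) by (cases s) (simp_all add: mod_simps m)
    qed
  qed (use M K in auto)
  moreover have "?s \<otimes>\<^bsub>?G\<^esub> ?z = (\<one>\<^bsub>dih (4 * M)\<^esub>, ((2 * int K, False), \<one>))" by (simp add: lt)
  ultimately show ?thesis by (simp add: insert_commute mult.commute[of "int K" 2])
qed

text \<open>x has to be one of the four multiples of M. Then y is congruent to c x, and the two are
  equal because c x also lies below the modulus.\<close>

lemma rot_kernel4:
  assumes "M > 0" "0 \<le> x" "x < 4 * int M" "0 \<le> y" "y < 4 * int (c * M)"
  shows "rot (int c) M (4 * (c * M)) x y = (0, 0) \<longleftrightarrow>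
    (x, y) \<in> {(0, 0), (int M, int (c * M)), (2 * int M, 2 * int (c * M)), (3 * int M, 3 * int (c * M))}"
proof -
  have c: "0 < c" using assms(4,5) by (cases c) auto
  have x: "x mod int M = 0 \<longleftrightarrow> x \<in> {0, int M, 2 * int M, 3 * int M}"
  proof
    assume "x mod int M = 0"
    then obtain k where k: "x = int M * k" by (auto simp: mod_eq_0_iff_dvd)
    have "0 \<le> k" using k assms(1,2) by (simp add: zero_le_mult_iff)
    moreover have "int M * k < int M * 4" using k assms(3) by simp
    then have "k < 4" using assms(1) by (simp only: mult_less_cancel_left_pos of_nat_0_less_iff)
    ultimately have "k = 0 \<or> k = 1 \<or> k = 2 \<or> k = 3" by auto
    then show "x \<in> {0, int M, 2 * int M, 3 * int M}" using k by auto
  qed auto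
  have cx: "0 \<le> int c * x" "int c * x < 4 * int (c * M)"
    using assms(2,3) c mult_strict_left_mono[of x "4 * int M" "int c"] by (simp_all add: algebra_simps)
  have y: "(y - int c * x) mod int (4 * (c * M)) = 0 \<longleftrightarrow> y = int c * x"
    using cx assms(4,5) by (metis mod_pos_pos_trivial mod_eq_dvd_iff mod_0_imp_dvd dvd_imp_mod_0 of_nat_mult of_nat_numeral)
  have "rot (int c) M (4 * (c * M)) x y = (0, 0) \<longleftrightarrow> x \<in> {0, int M, 2 * int M, 3 * int M} \<and> y = int c * x"
    unfolding rot_def prod.inject x y ..
  also have "\<dots> \<longleftrightarrow> (x, y) \<in> {(0, 0), (int M, int (c * M)), (2 * int M, 2 * int (c * M)), (3 * int M, 3 * int (c * M))}"
    using assms(1) by auto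
  finally show ?thesis .
qed

text \<open>If M divides K, the pair of quarter turns is (M, cM), so \<open>rot\<close> with the
  integral coefficient c serves as \<rho>.\<close>

lemma EO_dih_dih_le:
  fixes H (structure)
  assumes H: "finite_group H" and M: "M > 0" and c: "c > 0" and K: "K = c * M"
  shows "C.dec (EO_dd M K H) {#DO (dih2 M (4 * K) \<times>\<times> H) (((0, 2 * int K), False), \<one>)#}"
proof -
  let ?R = "rot (int c) M (4 * K)"
  have "K > 0" using assms by simp
  have r: "?R (x mod (4 * int M)) (y mod (4 * int K)) = ?R x y" for x y
    by (rule rot_mod) (use K in auto)
  \<comment> \<open>z is sent to the negative of the half turn, which is the half turn
    again.\<close>
  have "(- (2 * int K)) mod (4 * int K) = 2 * int K mod (4 * int K)"
    unfolding mod_eq_dvd_iff by simp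
  moreover have w: "int c * (2 * int M) = 2 * int K" unfolding K by simp
  ultimately have z: "?R (2 * int M) 0 = (0, 2 * int K)" using \<open>K > 0\<close> by (simp add: rot_def w)
  show ?thesis
  proof (rule EO_dih_dih[OF H M \<open>K > 0\<close> M, of "4 * K" "?R", unfolded z])
    show "\<exists>x\<in>{0..<4 * int M}. \<exists>y\<in>{0..<4 * int K}. ?R x y = (p, q)"
      if "0 \<le> p" "p < int M" "0 \<le> q" "q < int (4 * K)" for p q
      by (rule bexI[of _ p], rule bexI[of _ "(q + int c * p) mod (4 * int K)"]) (use rot_surj[OF that] that \<open>K > 0\<close> in auto)
    show "?R x y = (0, 0) \<longleftrightarrow> (x, y) \<in> {(0, 0), (int M, int K), (2 * int M, 2 * int K), (3 * int M, 3 * int K)}"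
      if "x \<in> {0..<4 * int M}" "y \<in> {0..<4 * int K}" for x y
      using rot_kernel4[OF M, of x y c] that unfolding K by simp
  qed (use \<open>K > 0\<close> M rot_range[OF M, of "4 * K"] in \<open>simp_all add: r rot_add\<close>)
qed

text \<open>The coordinates are exchanged so that the coefficient is again an integer. Now z already
  lies in the coordinate of larger order.\<close>

lemma EO_dih_dih_ge:
  fixes H (structure)
  assumes H: "finite_group H" and K: "K > 0" and c: "c > 0" and M: "M = c * K"
  shows "C.dec (EO_dd M K H) {#DO (dih2 K (4 * M) \<times>\<times> H) (((0, 2 * int M), False), \<one>)#}"
proof -
  have "M > 0" using assms by simp
  have r: "rot (int c) K (4 * M) (x mod (4 * int K)) (y mod (4 * int M)) = rot (int c) K (4 * M) x y" for x y
    by (rule rot_mod) (use M in auto)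
  have z: "rot (int c) K (4 * M) 0 (2 * int M) = (0, 2 * int M)" using \<open>M > 0\<close> by (simp add: rot_def)
  show ?thesis
  proof (rule EO_dih_dih[OF H \<open>M > 0\<close> K K, of "4 * M" "\<lambda>y x. rot (int c) K (4 * M) x y", unfolded z])
    show "\<exists>y\<in>{0..<4 * int M}. \<exists>x\<in>{0..<4 * int K}. rot (int c) K (4 * M) x y = (p, q)"
      if "0 \<le> p" "p < int K" "0 \<le> q" "q < int (4 * M)" for p q
      by (rule bexI[of _ "(q + int c * p) mod (4 * int M)"], rule bexI[of _ p]) (use rot_surj[OF that] that \<open>M > 0\<close> in auto)
    show "rot (int c) K (4 * M) x y = (0, 0) \<longleftrightarrow> (y, x) \<in> {(0, 0), (int M, int K), (2 * int M, 2 * int K), (3 * int M, 3 * int K)}"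
      if "y \<in> {0..<4 * int M}" "x \<in> {0..<4 * int K}" for x y
      using rot_kernel4[OF K, of x y c] that unfolding M by auto
  qed (use \<open>M > 0\<close> K rot_range[OF K, of "4 * M"] in \<open>simp_all add: r rot_add\<close>)
qed

section \<open>The decomposition of a power of a dihedral group\<close>

definition msum :: "nat set \<Rightarrow> (nat \<Rightarrow> nat) \<Rightarrow> (nat \<Rightarrow> 'o) \<Rightarrow> 'o multiset" where
  "msum A f Z = (\<Sum>k\<in>A. replicate_mset (f k) (Z k))"

lemma replicate_mset_plus: "replicate_mset (m + n) x = replicate_mset m x + replicate_mset n x"
  by (rule multiset_eqI) simp

lemma msum_add: "msum A f Z + msum A g Z = msum A (\<lambda>k. f k + g k) Z"
  by (simp add: msum_def sum.distrib replicate_mset_plus)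

lemma msum_single: "finite A \<Longrightarrow> j \<in> A \<Longrightarrow> replicate_mset m (Z j) = msum A (\<lambda>k. if k = j then m else 0) Z"
  unfolding msum_def by (subst sum.remove[of A j]) (auto intro!: sum.neutral)

lemma msum_cong: "(\<And>k. k \<in> A \<Longrightarrow> f k = g k) \<Longrightarrow> msum A f Z = msum A g Z"
  by (simp add: msum_def)

lemma msum_subst: "S (msum A f Z) \<Longrightarrow> (\<And>k. k \<in> A \<Longrightarrow> f k = g k) \<Longrightarrow> S (msum A g Z)"
  using msum_cong[of A f g Z] by simp

text \<open>Substituting a decomposition into every summand multiplies the vector f of
  multiplicities by the matrix c.\<close>

lemma (in category_mod_ideal) dec_msum:
  assumes "dec X (msum A f Z + N)" "finite A" "\<And>k. k \<in> A \<Longrightarrow> dec (Z k) (msum B (c k) Z')"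
  shows "dec X (msum B (\<lambda>i. \<Sum>k\<in>A. f k * c k i) Z' + N)"
proof -
  let ?K = "\<lambda>k. k"
  have 1: "msum A f Z = image_mset Z (msum A f ?K)"
    using assms(2) unfolding msum_def by (induction A) simp_all
  have 2: "(\<Sum>k\<in>#msum A f ?K. msum B (c k) Z') = msum B (\<lambda>i. \<Sum>k\<in>A. f k * c k i) Z'"
    using assms(2)
  proof (induction A)
    case empty
    then show ?case by (simp add: msum_def)
  next
    case (insert a A)
    have "(\<Sum>k\<in>#replicate_mset n a. msum B (c k) Z') = msum B (\<lambda>i. n * c a i) Z'" for n
      by (induction n) (simp_all add: msum_add, simp add: msum_def)
    moreover have "msum (insert a A) f ?K = replicate_mset (f a) a + msum A f ?K"
      using insert by (simp add: msum_def)
    ultimately show ?case using insert by (simp add: msum_add)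
  qed
  have "k \<in> A" if "k \<in># msum A f ?K" for k
    using that assms(2) unfolding msum_def by (auto simp: set_mset_sum split: if_splits)
  then show ?thesis using dec_subst_all[of X Z "msum A f ?K" N "\<lambda>k. msum B (c k) Z'"] assms(1,3) unfolding 1 2 by blast
qed

text \<open>\<open>edge_group 2\<close> has order 2: the edges of \<open>C\<^sub>2\<close> and of the dihedral group of order 8 are isomorphic.\<close>

definition edge_group :: "nat \<Rightarrow> (int \<times> bool) monoid" where
  "edge_group j = (if j = 2 then dih 1 else dih (2 ^ j))"

definition edge_inv :: "nat \<Rightarrow> int \<times> bool" where
  "edge_inv j = (if j = 2 then (0, True) else (2 ^ (j - 1), False))"

text \<open>For j at least 3, type j belongs to the dihedral group of order
  \<open>2 ^ (j + 1)\<close>. The factor H holds what has not yet been decomposed.\<close>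

definition edge_type :: "nat \<Rightarrow> 'h monoid \<Rightarrow> nat monoid \<times> (nat, nat) vmark" where
  "edge_type j H = DO (edge_group j \<times>\<times> H) (edge_inv j, \<one>\<^bsub>H\<^esub>)"

lemma edge_group_finite: "finite_group (edge_group j)" by (simp add: edge_group_def dih_finite)

lemma edge_inv_central: assumes "j \<ge> 2" shows "central_inv (edge_group j) (edge_inv j)"
proof -
  obtain i where "j = Suc i" using assms by (cases j) auto
  then show ?thesis using dih_central[of "2 ^ i"] dih1_central by (simp add: edge_group_def edge_inv_def)
qed

lemma DO_refl:
  fixes G (structure)
  assumes "finite_group G" "central_inv G z" shows "C.dec (DO G z) {#DO G z#}"
proof -
  have "\<one> \<in> carrier G" using finite_groupD(1)[OF assms(1)] by (simp add: group.is_monoid)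
  then have "{x \<in> carrier G. x = \<one>} = {\<one>}" by auto
  then show ?thesis by (rule epi.DO_iso[OF epi_id[OF assms(1)] assms(2)])
qed

context
  fixes H :: "'h monoid" (structure) assumes H: "finite_group H"
begin

interpretation H: group H by (rule finite_groupD[OF H])

lemma DO_dih_edge_type:
  assumes "e \<ge> 2"
  shows "C.dec (DO (dih (2 ^ e) \<times>\<times> H) ((2 ^ (e - 1), False), \<one>)) {#edge_type e H#}"
proof (cases "e = 2")
  case True
  then show ?thesis using DO_dih4[OF H] by (simp add: edge_type_def edge_group_def edge_inv_def)
next
  case False
  have "C.dec (edge_type e H) {#edge_type e H#}" unfolding edge_type_def
    by (rule DO_refl[OF finite_group_DirProd[OF edge_group_finite H] central_inv_left[OF finite_groupD(1)[OF edge_group_finite] H.is_group edge_inv_central[OF assms]]])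
  then show ?thesis using False by (simp add: edge_type_def edge_group_def edge_inv_def)
qed

text \<open>The number of rotations is halved repeatedly. Type 2 arises once from the group of order
  two, twice from the Klein group and once from the group of order 8, which explains the coefficient
  4.\<close>

lemma RO_dih_pow:
  assumes "e \<ge> 2"
  shows "C.dec (RO (dih (2 ^ e) \<times>\<times> H)) (add_mset (RO H) (msum {2..e} (\<lambda>k. if k = 2 then 4 else 1) (\<lambda>k. edge_type k H)))"
  using assms
proof (induction e rule: dec_induct)
  let ?D = "dih 4 \<times>\<times> H"
  case base
  have Y2: "edge_type 2 H = DO (dih 1 \<times>\<times> H) ((0, True), \<one>)" by (simp add: edge_type_def edge_group_def edge_inv_def)
  have r1: "C.dec (RO (dih 1 \<times>\<times> H)) {#RO H, edge_type 2 H#}" using RO_dih1[OF H] by (simp add: Y2)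
  have r2: "C.dec (RO (dih 2 \<times>\<times> H)) {#RO (dih 1 \<times>\<times> H), DO (dih 2 \<times>\<times> H) ((1, False), \<one>)#}"
    using RO_dih[OF H, of 1] by simp
  have r4: "C.dec (RO ?D) {#RO (dih 2 \<times>\<times> H), DO ?D ((2, False), \<one>)#}"
    using RO_dih[OF H, of 2] by simp
  have "C.dec (RO (dih 2 \<times>\<times> H)) (add_mset (DO (dih 2 \<times>\<times> H) ((1, False), \<one>)) {#RO H, edge_type 2 H#})"
    using C.dec_subst[OF r2 r1] by (simp add: add_mset_commute)
  from C.dec_subst[OF this DO_dih2[OF H]] have s2: "C.dec (RO (dih 2 \<times>\<times> H)) {#RO H, edge_type 2 H, edge_type 2 H, edge_type 2 H#}"
    by (simp add: Y2 add_mset_commute)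
  have "C.dec (RO ?D) (add_mset (DO ?D ((2, False), \<one>)) {#RO H, edge_type 2 H, edge_type 2 H, edge_type 2 H#})"
    using C.dec_subst[OF r4 s2] by (simp add: add_mset_commute)
  from C.dec_subst[OF this DO_dih4[OF H]] have "C.dec (RO ?D) {#RO H, edge_type 2 H, edge_type 2 H, edge_type 2 H, edge_type 2 H#}"
    by (simp add: Y2 add_mset_commute)
  then show ?case by (simp add: msum_def numeral_eq_Suc)
next
  case (step e)
  have r: "C.dec (RO (dih (2 ^ Suc e) \<times>\<times> H)) {#RO (dih (2 ^ e) \<times>\<times> H), DO (dih (2 ^ Suc e) \<times>\<times> H) ((2 ^ e, False), \<one>)#}"
    using RO_dih[OF H, of "2 ^ e"] by simp
  let ?N = "add_mset (RO H) (msum {2..e} (\<lambda>k. if k = 2 then 4 else 1) (\<lambda>k. edge_type k H))"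
  have "C.dec (RO (dih (2 ^ Suc e) \<times>\<times> H)) (add_mset (DO (dih (2 ^ Suc e) \<times>\<times> H) ((2 ^ e, False), \<one>)) ?N)"
    using C.dec_subst[OF r step.IH] by (simp add: add_mset_commute)
  moreover have "C.dec (DO (dih (2 ^ Suc e) \<times>\<times> H) ((2 ^ e, False), \<one>)) {#edge_type (Suc e) H#}"
    using DO_dih_edge_type[of "Suc e"] step.hyps by simp
  ultimately have "C.dec (RO (dih (2 ^ Suc e) \<times>\<times> H)) ({#edge_type (Suc e) H#} + ?N)" by (rule C.dec_subst)
  moreover have "msum {2..Suc e} (\<lambda>k. if k = 2 then 4 else 1) (\<lambda>k. edge_type k H) =
      add_mset (edge_type (Suc e) H) (msum {2..e} (\<lambda>k. if k = 2 then 4 else 1) (\<lambda>k. edge_type k H))"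
  proof -
    have "{2..Suc e} = insert (Suc e) {2..e}" "Suc e \<noteq> 2" using step.hyps by auto
    then show ?thesis by (simp add: msum_def One_nat_def del: Suc_eq_numeral)
  qed
  ultimately show ?case by simp
qed

text \<open>For l > 2 the second summand is the edge of two dihedral groups with identified half
  turns, where M is \<open>2 ^ (l - 2)\<close> and K is \<open>2 ^ (k - 2)\<close>. It breaks into
  as many copies of the edge of the larger group as the smaller of M and K. For l = 2 the first
  group has order two and \<open>DO_dih1_left\<close> yields the single copy.\<close>

lemma edge_type_dih_step:
  assumes l: "l \<ge> 2" and k: "k \<ge> 2"
  shows "C.dec (edge_type l (dih (2 ^ k) \<times>\<times> H)) (add_mset (edge_type l (dih (2 ^ (k - 1)) \<times>\<times> H)) (replicate_mset (2 ^ (min k l - 2)) (edge_type (max k l) H)))"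
proof -
  obtain k' where k': "k = Suc k'" "k' \<ge> 1" using k by (cases k) auto
  show ?thesis
  proof (cases "l = 2")
    case True
    have d: "finite_group (dih (2 * 2 ^ k'))" by (simp add: dih_finite)
    have "C.dec (DO (dih 1 \<times>\<times> (dih (2 * 2 ^ k') \<times>\<times> H)) ((0, True), \<one>\<^bsub>dih (2 * 2 ^ k') \<times>\<times> H\<^esub>))
      {#DO (dih 1 \<times>\<times> (dih (2 ^ k') \<times>\<times> H)) ((0, True), \<one>\<^bsub>dih (2 ^ k') \<times>\<times> H\<^esub>), DO (dih (2 * 2 ^ k') \<times>\<times> H) ((int (2 ^ k'), False), \<one>)#}"
      by (rule DO_dih1_left[OF epi_prod[OF dih_red epi_id[OF H]] central_inv_left[OF finite_groupD(1)[OF d] H.is_group dih_central]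
        kernel_prod_left[OF H.is_group dih_red_kernel]]) simp_all
    then have "C.dec (edge_type l (dih (2 ^ k) \<times>\<times> H)) (add_mset (DO (dih (2 ^ k) \<times>\<times> H) ((2 ^ (k - 1), False), \<one>)) {#edge_type l (dih (2 ^ (k - 1)) \<times>\<times> H)#})"
      using True k'(1) by (simp add: edge_type_def edge_group_def edge_inv_def add_mset_commute)
    from C.dec_subst[OF this DO_dih_edge_type[OF k]] show ?thesis using True k by (simp add: max_absorb1 min_absorb2 add_mset_commute One_nat_def)
  next
    case False
    obtain l' where l': "l = Suc (Suc l')" "l' \<ge> 1" using l False by (cases l; cases "l - 1") auto
    obtain k'' where k'': "k = Suc (Suc k'')" using k by (cases k; cases "k - 1") auto
    let ?M = "2 ^ l' :: nat" and ?K = "2 ^ k'' :: nat" and ?t = "min k'' l'" and ?b = "Suc (max k'' l')"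
    let ?E = "EO_dd ?M ?K H"
    have E: "C.dec ?E {#DO (dih2 (2 ^ ?t) (2 ^ Suc ?b) \<times>\<times> H) (((0, 2 ^ ?b), False), \<one>)#}"
    proof (cases "l' \<le> k''")
      case True
      then have "?K = 2 ^ (k'' - l') * ?M" by (simp flip: power_add)
      from EO_dih_dih_le[OF H _ _ this] show ?thesis using True by (simp add: min_absorb2 max_absorb1)
    next
      case False
      then have "?M = 2 ^ (l' - k'') * ?K" by (simp flip: power_add)
      from EO_dih_dih_ge[OF H _ _ this] show ?thesis using False by (simp add: min_absorb1 max_absorb2)
    qed
    have "?t \<le> Suc ?b" by simp
    from C.dec_subst[OF E DO_dih2_pow[OF H this]]
    have E': "C.dec ?E (replicate_mset (2 ^ ?t) (DO (dih (2 ^ Suc ?b) \<times>\<times> H) ((2 ^ ?b, False), \<one>)))" by simp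
    have Ym: "edge_type (max k l) H = DO (dih (2 ^ Suc ?b) \<times>\<times> H) ((2 ^ ?b, False), \<one>)"
    proof -
      have j: "edge_type j H = DO (dih (2 ^ j) \<times>\<times> H) ((2 ^ (j - 1), False), \<one>)" if "j \<noteq> 2" for j
        using that by (simp add: edge_type_def edge_group_def edge_inv_def)
      have m: "max k l = Suc ?b" "max k l \<noteq> 2" using l' k'' by auto
      show ?thesis unfolding j[OF m(2)] unfolding m(1) diff_Suc_1 ..
    qed
    have mn: "min k l - 2 = ?t" using l' k'' by simp
    have z: "central_inv (dih (4 * ?M)) (2 * int ?M, False)" using dih_central[of "2 * ?M"] by simp
    have "C.dec (DO (dih (4 * ?M) \<times>\<times> (dih (2 * (2 * ?K)) \<times>\<times> H)) ((2 * int ?M, False), ((0, False), \<one>)))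
      (add_mset ?E {#DO (dih (4 * ?M) \<times>\<times> (dih (2 * ?K) \<times>\<times> H)) ((2 * int ?M, False), ((0, False), \<one>))#})"
      using DO_dih_step[OF dih_finite H z, of "2 * ?K"] by (simp add: add_mset_commute)
    from C.dec_subst[OF this E'] show ?thesis
      unfolding Ym mn using l' k'' by (simp add: edge_type_def edge_group_def edge_inv_def)
  qed
qed

text \<open>The step is iterated starting from the Klein group, which gives 4 copies. While k is at
  most l, the new copies, 1, 2, 4 and so on, are of type l and sum to the coefficient
  \<open>3 + 2 ^ (min k l - 1)\<close>. Each later step adds \<open>2 ^ (l - 2)\<close> copies of
  the new type k.\<close>

lemma edge_type_dih_pow:
  assumes l: "l \<ge> 2" "l \<le> e" and k: "k \<ge> 1" "k \<le> e"
  shows "C.dec (edge_type l (dih (2 ^ k) \<times>\<times> H))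
    (msum {2..e} (\<lambda>i. if i = l then 3 + 2 ^ (min k l - 1) else if l < i \<and> i \<le> k then 2 ^ (l - 2) else 0) (\<lambda>i. edge_type i H))"
  using k
proof (induction k rule: dec_induct)
  case base
  have "C.dec (edge_type l (dih 2 \<times>\<times> H)) (replicate_mset 4 (edge_type l H))"
    using DO_dih2_right[OF edge_group_finite H edge_inv_central[OF l(1)]] by (simp add: edge_type_def numeral_eq_Suc)
  moreover have "replicate_mset 4 (edge_type l H) = msum {2..e} (\<lambda>i. if i = l then 4 else 0) (\<lambda>i. edge_type i H)"
    by (rule msum_single) (use l in auto)
  moreover have "msum {2..e} (\<lambda>i. if i = l then 3 + 2 ^ (min 1 l - 1) else if l < i \<and> i \<le> 1 then 2 ^ (l - 2) else 0) (\<lambda>i. edge_type i H) =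
      msum {2..e} (\<lambda>i. if i = l then 4 else 0) (\<lambda>i. edge_type i H)"
    by (rule msum_cong) (use l in \<open>auto simp: min_def\<close>)
  ultimately show ?case by simp
next
  case (step k)
  let ?f = "\<lambda>k i. if i = l then (3 :: nat) + 2 ^ (min k l - 1) else if l < i \<and> i \<le> k then 2 ^ (l - 2) else 0"
  have "C.dec (edge_type l (dih (2 ^ Suc k) \<times>\<times> H)) (msum {2..e} (?f k) (\<lambda>i. edge_type i H) + replicate_mset (2 ^ (min (Suc k) l - 2)) (edge_type (max (Suc k) l) H))"
    using C.dec_subst[OF edge_type_dih_step[OF l(1), of "Suc k", unfolded diff_Suc_1] step.IH[OF Suc_leD[OF step.prems]]] step.hyps by simp
  moreover have "replicate_mset (2 ^ (min (Suc k) l - 2)) (edge_type (max (Suc k) l) H) =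
      msum {2..e} (\<lambda>i. if i = max (Suc k) l then 2 ^ (min (Suc k) l - 2) else 0) (\<lambda>i. edge_type i H)"
    by (rule msum_single) (use l step in auto)
  moreover have "?f k i + (if i = max (Suc k) l then 2 ^ (min (Suc k) l - 2) else 0) = ?f (Suc k) i" for i
  proof (cases "Suc k \<le> l")
    case True
    obtain j where "k = Suc j" using step by (cases k) auto
    then show ?thesis using True by (simp add: max_absorb2 min_absorb1)
  next
    case False
    then show ?thesis using l by (auto simp: max_absorb1 min_absorb2)
  qed
  ultimately show ?case by (simp only: msum_add)
qed

end

text \<open>\<open>q_coef j n\<close> is the closed form of \<open>q (n + 1) = (3 + 2 ^ (j - 2)) * q n + (3 + 2 ^ (j - 1)) ^ n\<close>.\<close>

fun q_coef :: "nat \<Rightarrow> nat \<Rightarrow> nat" where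
  "q_coef j 0 = 0"
| "q_coef j (Suc n) = (3 + 2 ^ (j - 2)) * q_coef j n + (3 + 2 ^ (j - 1)) ^ n"

text \<open>The bases of the two powers differ by \<open>2 ^ (j - 2)\<close>, so the difference of
  the powers satisfies the recursion up to this factor. Subtraction and division of natural numbers
  are avoided here and return in \<open>q_coef_div\<close>.\<close>

lemma q_coef_eq:
  assumes "j \<ge> 2" shows "2 ^ (j - 2) * q_coef j n + (3 + 2 ^ (j - 2)) ^ n = (3 + 2 ^ (j - 1)) ^ n"
proof (induction n)
  case (Suc n)
  obtain i where j: "j = i + 2" using assms by (metis le_add_diff_inverse2)
  let ?a = "2 ^ i :: nat"
  have "?a * q_coef j (Suc n) + (3 + ?a) ^ Suc n = (3 + ?a) * (?a * q_coef j n + (3 + ?a) ^ n) + ?a * (3 + 2 * ?a) ^ n"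
    by (simp add: j algebra_simps)
  also have "\<dots> = (3 + 2 * ?a) ^ Suc n" using Suc by (simp add: j algebra_simps)
  finally show ?case by (simp add: j)
qed simp

section \<open>Powers of a finite group\<close>

abbreviation pow_group :: "'g monoid \<Rightarrow> nat \<Rightarrow> (nat \<Rightarrow> 'g) monoid" where
  "pow_group G n \<equiv> product_group {..<n} (\<lambda>_. G)"

context
  fixes G :: "'g monoid" (structure) assumes G: "finite_group G"
begin

interpretation G: group G by (rule finite_groupD[OF G])

lemma pow_group_finite: "finite_group (pow_group G n)"
  using finite_groupD(2)[OF G] by (auto simp: finite_group_def G.is_group intro!: finite_PiE)

lemma pow_group_Suc:
  shows "epi (pow_group G (Suc n)) (G \<times>\<times> pow_group G n) (\<lambda>x. (x n, restrict x {..<n}))"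
  "kern (pow_group G (Suc n)) (G \<times>\<times> pow_group G n) (\<lambda>x. (x n, restrict x {..<n})) = {\<one>\<^bsub>pow_group G (Suc n)\<^esub>}"
proof -
  let ?I = "\<lambda>i\<in>{..<Suc n}. \<one>"
  let ?p = "{\<one>\<^bsub>pow_group G (Suc n)\<^esub>}"
  let ?P = "pow_group G (Suc n)"
  let ?G = "G \<times>\<times> pow_group G n"
  let ?K = "kern ?P ?G (\<lambda>x. (x n, restrict x {..<n}))"
  show "epi ?P ?G (\<lambda>x. (x n, restrict x {..<n}))"
  proof (rule epiI)
    show "finite_group ?P" "finite_group ?G"
      by (intro finite_group_DirProd G pow_group_finite)+
    show "(x n, restrict x {..<n}) \<in> carrier ?G" if "x \<in> carrier ?P" for x
      using that by (auto simp: PiE_iff)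
    show "((x \<otimes>\<^bsub>pow_group G (Suc n)\<^esub> y) n, restrict (x \<otimes>\<^bsub>pow_group G (Suc n)\<^esub> y) {..<n}) =
        (x n, restrict x {..<n}) \<otimes>\<^bsub>G \<times>\<times> pow_group G n\<^esub> (y n, restrict y {..<n})" for x y
      by (simp add: restrict_def fun_eq_iff)
    show "\<exists>x\<in>carrier ?P. (x n, restrict x {..<n}) = y" if "y \<in> carrier ?G" for y
    proof (rule bexI[of _ "(snd y)(n := fst y)"])
      have y: "fst y \<in> carrier G" "snd y \<in> {..<n} \<rightarrow>\<^sub>E carrier G" using that by (cases y; simp)+
      show "(((snd y)(n := fst y)) n, restrict ((snd y)(n := fst y)) {..<n}) = y"
        using y(2) by (cases y) (auto simp: fun_eq_iff restrict_def PiE_def extensional_def)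
      show "(snd y)(n := fst y) \<in> carrier ?P"
        using y by (auto simp: PiE_def extensional_def Pi_iff less_Suc_eq)
    qed
  qed
  show "?K = ?p"
  proof (intro equalityI subsetI)
    fix x assume "x \<in> ?K"
    then have x: "x \<in> extensional {..<Suc n}" "x n = \<one>" "restrict x {..<n} = (\<lambda>i\<in>{..<n}. \<one>)" by (auto simp: PiE_def)
    have "x i = ?I i" for i
    proof (cases "i < n")
      case True
      then show ?thesis using fun_cong[OF x(3), of i] by simp
    next
      case False
      then show ?thesis using x(1,2) by (cases "i = n") (auto simp: extensional_def)
    qed
    then have "x = ?I" by (rule ext)
    then show "x \<in> ?p" by simp
  next
    fix x assume "x \<in> ?p"
    then have x: "x = ?I" by simp
    show "x \<in> ?K"
      unfolding x using group.is_monoid[OF finite_groupD(1)[OF pow_group_finite[of "Suc n"]], THEN monoid.one_closed]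
      by (auto simp: fun_eq_iff)
  qed
qed

lemma RO_pow_Suc: "C.dec (RO (pow_group G (Suc n))) {#RO (G \<times>\<times> pow_group G n)#}"
  by (rule epi.RO_iso[OF pow_group_Suc])

lemma RO_pow_0: "C.dec (RO (pow_group G 0)) {#RO trivial_grp#}"
proof (rule epi.RO_iso[where \<phi> = "\<lambda>_. ()"])
  show "epi (pow_group G 0) trivial_grp (\<lambda>_. ())"
    by (rule epiI[OF pow_group_finite finite_group_trivial]) (auto simp: singleton_group_def)
qed (auto simp: singleton_group_def)

lemma kernel_prod_right_trivial:
  assumes "group G'" "kern K L \<phi> = {\<one>\<^bsub>K\<^esub>}"
  shows "kern (G' \<times>\<times> K) (G' \<times>\<times> L) (map_prod (\<lambda>x. x) \<phi>) = {\<one>\<^bsub>G' \<times>\<times> K\<^esub>}"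
  using kernel_prod_right[of G' K \<phi> L "\<one>\<^bsub>K\<^esub>"] assms by simp

lemma edge_type_pow_Suc:
  assumes "j \<ge> 2" shows "C.dec (edge_type j (pow_group G (Suc n))) {#edge_type j (G \<times>\<times> pow_group G n)#}"
proof -
  note Yg = finite_groupD(1)[OF edge_group_finite[of j]]
  interpret e: epi "pow_group G (Suc n)" "G \<times>\<times> pow_group G n" "\<lambda>x. (x n, restrict x {..<n})" by (rule pow_group_Suc(1))
  have "C.dec (DO (edge_group j \<times>\<times> pow_group G (Suc n)) (edge_inv j, \<one>\<^bsub>pow_group G (Suc n)\<^esub>))
      {#DO (edge_group j \<times>\<times> (G \<times>\<times> pow_group G n)) (map_prod (\<lambda>x. x) (\<lambda>x. (x n, restrict x {..<n})) (edge_inv j, \<one>\<^bsub>pow_group G (Suc n)\<^esub>))#}"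
    by (rule epi.DO_iso[OF epi_prod[OF epi_id[OF edge_group_finite] pow_group_Suc(1)]
      central_inv_left[OF Yg e.G.is_group edge_inv_central[OF assms]] kernel_prod_right_trivial[OF Yg pow_group_Suc(2)]])
  then show ?thesis unfolding edge_type_def map_prod_simp e.h.hom_one .
qed

lemma edge_type_pow_0:
  assumes "j \<ge> 2" shows "C.dec (edge_type j (pow_group G 0)) {#DO (edge_group j) (edge_inv j)#}"
proof -
  let ?E = "edge_group j \<times>\<times> pow_group G 0"
  note Yg = finite_groupD(1)[OF edge_group_finite[of j]]
  have "epi ?E (edge_group j) fst"
  proof (rule epiI)
    show "\<exists>x\<in>carrier ?E. fst x = y" if "y \<in> carrier (edge_group j)" for y
      using that by (intro bexI[of _ "(y, \<lambda>_. undefined)"]) auto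
  qed (use pow_group_finite[of 0] in \<open>auto intro!: finite_group_DirProd edge_group_finite\<close>)
  moreover have "kern ?E (edge_group j) fst = {\<one>\<^bsub>edge_group j \<times>\<times> pow_group G 0\<^esub>}"
    using group.is_monoid[OF Yg] by (auto simp: restrict_def fun_eq_iff)
  ultimately have "C.dec (DO ?E (edge_inv j, \<one>\<^bsub>pow_group G 0\<^esub>))
      {#DO (edge_group j) (fst (edge_inv j, \<one>\<^bsub>pow_group G 0\<^esub>))#}"
    by (intro epi.DO_iso central_inv_left Yg edge_inv_central assms finite_groupD(1)[OF pow_group_finite])
  then show ?thesis by (simp add: edge_type_def)
qed

end

text \<open>A geometric sum whose initial part up to l is missing; with the value of that part
  added, \<open>2 ^ (l - 1)\<close>, the result depends on i alone.\<close>

lemma sum_pow_between: assumes "2 \<le> l" "l < i" shows "(\<Sum>k\<in>{l<..<i}. 2 ^ (k - 2)) + 2 ^ (l - 1) = (2 :: nat) ^ (i - 2)"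
proof -
  have "(\<Sum>k\<in>{l<..<l + Suc d}. 2 ^ (k - 2)) + 2 ^ (l - 1) = (2 :: nat) ^ (l + Suc d - 2)" for d
  proof (induction d)
    case 0
    have "{l<..<l + Suc 0} = {}" by auto
    then show ?case using assms(1) by simp
  next
    case (Suc d)
    have "{l<..<l + Suc (Suc d)} = insert (l + Suc d) {l<..<l + Suc d}" by auto
    moreover obtain a where "l = a + 2" using assms(1) by (metis le_add_diff_inverse2)
    ultimately show ?case using Suc by simp
  qed
  moreover obtain d where "i = l + Suc d" using assms(2) less_iff_Suc_add by auto
  ultimately show ?thesis by simp
qed

lemma sum_split_at:
  fixes f :: "nat \<Rightarrow> nat"
  assumes "2 \<le> l" "l < i" "i \<le> e" "\<And>k. 2 \<le> k \<Longrightarrow> k < l \<Longrightarrow> f k = 0" "\<And>k. k > i \<Longrightarrow> f k = 0"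
  shows "(\<Sum>k\<in>{2..e}. f k) = f l + (\<Sum>k\<in>{l<..<i}. f k) + f i"
proof -
  have "(\<Sum>k\<in>{2..e}. f k) = (\<Sum>k\<in>{l..i}. f k)"
    by (rule sum.mono_neutral_right) (use assms in \<open>auto simp: not_le\<close>)
  moreover have "{l..i} = insert l (insert i {l<..<i})" using assms(2) by auto
  ultimately show ?thesis using assms(2) by simp
qed

text \<open>A further dihedral factor acts on the types by a triangular matrix with diagonal entry
  \<open>3 + 2 ^ (l - 1)\<close> in row l and all entries to the right of it equal to
  \<open>2 ^ (l - 2)\<close>. The coefficients are the entries of its n-th power.\<close>

lemma edge_type_pow:
  assumes l: "2 \<le> l" "l \<le> e"
  shows "C.dec (edge_type l (pow_group (dih (2 ^ e)) n))
    (msum {2..e} (\<lambda>k. if k = l then (3 + 2 ^ (l - 1)) ^ n else if l < k then 2 ^ (l - 2) * q_coef k n else 0)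
      (\<lambda>k. DO (edge_group k) (edge_inv k)))"
  using l
proof (induction n arbitrary: l)
  case 0
  have "replicate_mset 1 (DO (edge_group l) (edge_inv l)) = msum {2..e} (\<lambda>k. if k = l then 1 else 0) (\<lambda>k. DO (edge_group k) (edge_inv k))"
    by (rule msum_single) (use 0 in auto)
  then show ?case using edge_type_pow_0[OF dih_finite 0(1), of "2 ^ e"]
    by (simp add: One_nat_def cong: msum_cong if_cong)
next
  case (Suc n)
  let ?c = "\<lambda>l k. if k = l then (3 + 2 ^ (l - 1)) ^ n else if l < k then 2 ^ (l - 2) * q_coef k n else 0"
  let ?g = "\<lambda>i. if i = l then 3 + 2 ^ (min e l - 1) else if l < i \<and> i \<le> e then 2 ^ (l - 2) else 0"
  have d: "finite_group (dih (2 ^ e))" by (simp add: dih_finite)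
  have IH: "C.dec (edge_type k (pow_group (dih (2 ^ e)) n)) (msum {2..e} (?c k) (\<lambda>k. DO (edge_group k) (edge_inv k)))" if "k \<in> {2..e}" for k
    by (rule Suc.IH) (use that in auto)
  have "C.dec (edge_type l (pow_group (dih (2 ^ e)) (Suc n))) (msum {2..e} ?g (\<lambda>i. edge_type i (pow_group (dih (2 ^ e)) n)) + {#})"
    by (rule C.dec_subst[OF edge_type_pow_Suc[OF d Suc.prems(1)] edge_type_dih_pow[OF pow_group_finite[OF d] Suc.prems _ order_refl]])
      (use Suc.prems in simp)
  from C.dec_msum[OF this finite_atLeastAtMost IH]
  have "C.dec (edge_type l (pow_group (dih (2 ^ e)) (Suc n))) (msum {2..e} (\<lambda>i. \<Sum>k\<in>{2..e}. ?g k * ?c k i) (\<lambda>k. DO (edge_group k) (edge_inv k)))"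
    unfolding add_0_right .
  moreover have E: "(\<Sum>k\<in>{2..e}. ?g k * ?c k i) =
      (if i = l then (3 + 2 ^ (l - 1)) ^ Suc n else if l < i then 2 ^ (l - 2) * q_coef i (Suc n) else 0)" if i: "i \<in> {2..e}" for i
  proof (cases "l < i")
    case True
    have "(\<Sum>k\<in>{2..e}. ?g k * ?c k i) = ?g l * ?c l i + (\<Sum>k\<in>{l<..<i}. ?g k * ?c k i) + ?g i * ?c i i"
      by (rule sum_split_at) (use Suc.prems i True in auto)
    also have "(\<Sum>k\<in>{l<..<i}. ?g k * ?c k i) = (\<Sum>k\<in>{l<..<i}. 2 ^ (k - 2)) * (2 ^ (l - 2) * q_coef i n)"
      unfolding sum_distrib_right by (rule sum.cong) (use i in auto)
    \<comment> \<open>The types strictly between l and i enter through the geometric sum. It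
      completes the factor of \<open>q_coef i n\<close> to \<open>3 + 2 ^ (i - 2)\<close>, whatever
      l is.\<close>
    also have "?g l * ?c l i + (\<Sum>k\<in>{l<..<i}. 2 ^ (k - 2)) * (2 ^ (l - 2) * q_coef i n) + ?g i * ?c i i =
        2 ^ (l - 2) * ((3 + ((\<Sum>k\<in>{l<..<i}. 2 ^ (k - 2)) + 2 ^ (l - 1))) * q_coef i n + (3 + 2 ^ (i - 1)) ^ n)"
      using True i Suc.prems by (simp add: min_absorb2 algebra_simps)
    also have "\<dots> = 2 ^ (l - 2) * q_coef i (Suc n)" unfolding sum_pow_between[OF Suc.prems(1) True] by simp
    finally show ?thesis using True by simp
  next
    case False
    have "?g k * ?c k i = (if k = l then ?g l * ?c l i else 0)" for k using False by auto
    then have "(\<Sum>k\<in>{2..e}. ?g k * ?c k i) = (\<Sum>k\<in>{2..e}. if k = l then ?g l * ?c l i else 0)" by (rule sum.cong[OF refl])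
    also have "\<dots> = ?g l * ?c l i" using Suc.prems by (subst sum.delta) auto
    finally show ?thesis using False Suc.prems by (auto simp: min_absorb2)
  qed
  ultimately show ?case by (rule msum_subst[of "C.dec (edge_type l (pow_group (dih (2 ^ e)) (Suc n)))"])
qed

text \<open>Type 2 collects the edges from the groups of orders 2 and 4 along with those of order 8.
  It therefore grows by \<open>4 * 5 ^ n\<close> in each step and does not follow
  \<open>q_coef\<close>.\<close>

theorem RO_pow:
  assumes e: "e \<ge> 2"
  shows "C.dec (RO (pow_group (dih (2 ^ e)) n))
    (add_mset (RO trivial_grp) (msum {2..e} (\<lambda>k. if k = 2 then 5 ^ n - 1 else q_coef k n) (\<lambda>k. DO (edge_group k) (edge_inv k))))"
proof (induction n)
  case 0
  have "msum {2..e} (\<lambda>k. if k = 2 then 5 ^ 0 - 1 else q_coef k 0) (\<lambda>k. DO (edge_group k) (edge_inv k)) = {#}"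
    by (auto simp: msum_def intro!: sum.neutral)
  then show ?case using RO_pow_0[OF dih_finite, of "2 ^ e"] by simp
next
  case (Suc n)
  let ?c = "\<lambda>l k. if k = l then (3 + 2 ^ (l - 1)) ^ n else if l < k then 2 ^ (l - 2) * q_coef k n else 0"
  let ?g = "\<lambda>k :: nat. if k = 2 then 4 else 1 :: nat"
  let ?h = "\<lambda>n k. if k = 2 then 5 ^ n - 1 else q_coef k n"
  let ?Z = "\<lambda>k. DO (edge_group k) (edge_inv k)"
  have d: "finite_group (dih (2 ^ e))" by (simp add: dih_finite)
  have Y: "C.dec (edge_type k (pow_group (dih (2 ^ e)) n)) (msum {2..e} (?c k) ?Z)" if "k \<in> {2..e}" for k
    by (rule edge_type_pow) (use that in auto)
  have "C.dec (RO (pow_group (dih (2 ^ e)) (Suc n))) (add_mset (RO (pow_group (dih (2 ^ e)) n)) (msum {2..e} ?g (\<lambda>i. edge_type i (pow_group (dih (2 ^ e)) n))))"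
    using C.dec_subst[OF RO_pow_Suc[OF d] RO_dih_pow[OF pow_group_finite[OF d] e]] unfolding add_0_right .
  from C.dec_subst[OF this Suc]
  have "C.dec (RO (pow_group (dih (2 ^ e)) (Suc n))) (msum {2..e} ?g (\<lambda>i. edge_type i (pow_group (dih (2 ^ e)) n)) + add_mset (RO trivial_grp) (msum {2..e} (?h n) ?Z))"
    unfolding add.commute[of "add_mset _ _"] .
  from C.dec_msum[OF this finite_atLeastAtMost Y]
  have "C.dec (RO (pow_group (dih (2 ^ e)) (Suc n))) (add_mset (RO trivial_grp) (msum {2..e} (\<lambda>i. (\<Sum>k\<in>{2..e}. ?g k * ?c k i) + ?h n i) ?Z))"
    unfolding union_mset_add_mset_right msum_add .
  moreover have E: "(\<Sum>k\<in>{2..e}. ?g k * ?c k i) + ?h n i = ?h (Suc n) i" if i: "i \<in> {2..e}" for i :: nat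
  proof (cases "i = 2")
    case True
    have "?g k * ?c k i = (if k = 2 then 4 * 5 ^ n else 0)" if "k \<in> {2..e}" for k using True that by auto
    then have "(\<Sum>k\<in>{2..e}. ?g k * ?c k i) = (\<Sum>k\<in>{2..e}. if k = 2 then 4 * 5 ^ n else 0)" by (rule sum.cong[OF refl])
    also have "\<dots> = 4 * 5 ^ n" using e by (subst sum.delta) auto
    finally show ?thesis using True by simp
  next
    case False
    then have i2: "2 < i" using i by simp
    have "(\<Sum>k\<in>{2..e}. ?g k * ?c k i) = ?g 2 * ?c 2 i + (\<Sum>k\<in>{2<..<i}. ?g k * ?c k i) + ?g i * ?c i i"
      by (rule sum_split_at) (use i i2 in auto)
    also have "(\<Sum>k\<in>{2<..<i}. ?g k * ?c k i) = (\<Sum>k\<in>{2<..<i}. 2 ^ (k - 2)) * q_coef i n"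
      unfolding sum_distrib_right by (rule sum.cong) (use i in auto)
    \<comment> \<open>The coefficient 4 of type 2 is split as 2 + 2. One 2 completes the geometric
      sum; the other becomes 3 with the copy contributed by the previous power.\<close>
    also have "?g 2 * ?c 2 i + (\<Sum>k\<in>{2<..<i}. 2 ^ (k - 2)) * q_coef i n + ?g i * ?c i i =
        (2 + ((\<Sum>k\<in>{2<..<i}. 2 ^ (k - 2)) + 2 ^ (2 - 1))) * q_coef i n + (3 + 2 ^ (i - 1)) ^ n"
      using i2 by (simp add: algebra_simps)
    finally show ?thesis unfolding sum_pow_between[OF order_refl i2] using i2 by (simp add: algebra_simps)
  qed
  ultimately show ?case by (rule msum_subst[of "\<lambda>N. C.dec (RO (pow_group (dih (2 ^ e)) (Suc n))) (add_mset (RO trivial_grp) N)"])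
qed

section \<open>Morphisms of the Roquette category\<close>

text \<open>Turns a product in a multiplicatively written group into a sum of marks. It serves both
  for Burnside groups and for groups of morphisms.\<close>

lemma (in comm_group) finprod_additive:
  assumes V: "0 \<in> V" and one: "\<one> = h 0" and add: "\<And>x y. x \<in> V \<Longrightarrow> y \<in> V \<Longrightarrow> x + y \<in> V \<and> h x \<otimes> h y = h (x + y)"
    and car: "\<And>x. x \<in> V \<Longrightarrow> h x \<in> carrier G"
    and A: "finite A" "\<And>k. k \<in> A \<Longrightarrow> x k \<in> V" "\<And>k. k \<in> A \<Longrightarrow> c k = h (x k)"
  shows "finprod G c A = h (\<Sum>k\<in>A. x k)"
proof -
  have "finprod G c A = h (\<Sum>k\<in>A. x k) \<and> (\<Sum>k\<in>A. x k) \<in> V"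
    using A
  proof (induction A)
    case empty
    then show ?case by (simp only: finprod_empty one sum.empty V)
  next
    case (insert a A)
    then have IH: "finprod G c A = h (\<Sum>k\<in>A. x k)" "(\<Sum>k\<in>A. x k) \<in> V" by simp_all
    have "finprod G c (insert a A) = c a \<otimes> finprod G c A"
      by (rule finprod_insert[OF insert.hyps]) (use insert.prems car in auto)
    then show ?case using add[OF insert.prems(1)[OF insertI1] IH(2)]
      by (simp only: insert.prems(2)[OF insertI1] IH(1) sum.insert[OF insert.hyps])
  qed
  then show ?thesis ..
qed

definition hcls :: "'q monoid \<Rightarrow> 'p monoid \<Rightarrow> ('q, 'p) vmark \<Rightarrow> ('q, 'p) smor" where
  "hcls Q P x = to_sharp Q P (of_mark Q P x)"

context two_groups begin

lemma burnside_delta_normal: "burnside_delta H G \<lhd> burnside H G"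
proof -
  let ?B = "burnside_delta H G"
  interpret B: comm_group "burnside H G" by (rule burnside_comm_group)
  have "subgroup ?B (burnside H G)"
  proof (rule B.subgroupI)
    show "?B \<subseteq> carrier (burnside H G)" by (auto simp: burnside_delta_def)
    show "?B \<noteq> {}" unfolding burnside_delta_eq using delta_ideal_zero by blast
    fix x assume "x \<in> ?B"
    then obtain a where a: "a \<in> delta_ideal H G" "x = of_mark H G a" unfolding burnside_delta_eq by blast
    show "inv\<^bsub>burnside H G\<^esub> x \<in> ?B"
      unfolding a(2) burnside_inv[OF delta_ideal_vmarks[OF a(1)]] burnside_delta_eq using delta_ideal_minus[OF a(1)] by blast
    fix y assume "y \<in> ?B"
    then obtain b where b: "b \<in> delta_ideal H G" "y = of_mark H G b" unfolding burnside_delta_eq by blast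
    show "x \<otimes>\<^bsub>burnside H G\<^esub> y \<in> ?B"
      unfolding a(2) b(2) burnside_mult[OF delta_ideal_vmarks[OF a(1)] delta_ideal_vmarks[OF b(1)]] burnside_delta_eq
      using delta_ideal_add[OF a(1) b(1)] by blast
  qed
  then show ?thesis by (rule B.subgroup_imp_normal)
qed

lemma of_mark_carrier: "x \<in> vmarks H G \<Longrightarrow> of_mark H G x \<in> carrier (burnside H G)"
  unfolding burnside_carrier by blast

lemma hcls_set: assumes x: "x \<in> vmarks H G" shows "hcls H G x = of_mark H G ` {y \<in> vmarks H G. y - x \<in> delta_ideal H G}"
proof (intro equalityI subsetI)
  fix c assume "c \<in> hcls H G x"
  then obtain d where d: "d \<in> delta_ideal H G" "c = of_mark H G d \<otimes>\<^bsub>burnside H G\<^esub> of_mark H G x"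
    unfolding hcls_def to_sharp_def r_coset_def burnside_delta_eq by blast
  have "c = of_mark H G (d + x)" unfolding d(2) by (rule burnside_mult[OF delta_ideal_vmarks[OF d(1)] x])
  then show "c \<in> of_mark H G ` {y \<in> vmarks H G. y - x \<in> delta_ideal H G}"
    using vmarks_add[OF delta_ideal_vmarks[OF d(1)] x] d(1) by (intro image_eqI[of _ _ "d + x"]) auto
next
  fix c assume "c \<in> of_mark H G ` {y \<in> vmarks H G. y - x \<in> delta_ideal H G}"
  then obtain y where y: "y \<in> vmarks H G" "y - x \<in> delta_ideal H G" "c = of_mark H G y" by blast
  have "c = of_mark H G (y - x) \<otimes>\<^bsub>burnside H G\<^esub> of_mark H G x"
    using burnside_mult[OF delta_ideal_vmarks[OF y(2)] x] y(3) by simp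
  then show "c \<in> hcls H G x" unfolding hcls_def to_sharp_def r_coset_def burnside_delta_eq using y(2) by blast
qed

lemma hcls_eqI: assumes "x \<in> vmarks H G" "y \<in> vmarks H G" "x - y \<in> delta_ideal H G" shows "hcls H G x = hcls H G y"
proof -
  have "w - x \<in> delta_ideal H G \<longleftrightarrow> w - y \<in> delta_ideal H G" for w
    using delta_ideal_add[OF _ assms(3), of "w - x"] delta_ideal_diff[OF _ assms(3), of "w - y"] by auto
  then show ?thesis unfolding hcls_set[OF assms(1)] hcls_set[OF assms(2)] by simp
qed

lemma Hom_carrier: "carrier (Hom_sharp G H) = hcls H G ` vmarks H G"
  unfolding Hom_sharp_def carrier_FactGroup burnside_carrier hcls_def to_sharp_def by (simp only: image_image)

lemma Hom_comm_group: "comm_group (Hom_sharp G H)"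
proof -
  interpret B: comm_group "burnside H G" by (rule burnside_comm_group)
  show ?thesis unfolding Hom_sharp_def
    by (rule B.abelian_FactGroup[OF normal_imp_subgroup[OF burnside_delta_normal]])
qed

lemma Hom_mult: assumes "x \<in> vmarks H G" "y \<in> vmarks H G"
  shows "hcls H G x \<otimes>\<^bsub>Hom_sharp G H\<^esub> hcls H G y = hcls H G (x + y)"
  unfolding Hom_sharp_def mult_FactGroup hcls_def to_sharp_def burnside_mult[OF assms, symmetric]
  by (rule normal.rcos_sum[OF burnside_delta_normal]) (intro of_mark_carrier assms)+

lemma Hom_one: "\<one>\<^bsub>Hom_sharp G H\<^esub> = hcls H G 0"
proof -
  interpret B: comm_group "burnside H G" by (rule burnside_comm_group)
  have "burnside_delta H G \<subseteq> carrier (burnside H G)"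
    by (rule subgroup.subset[OF normal_imp_subgroup[OF burnside_delta_normal]])
  from B.coset_mult_one[OF this] show ?thesis
    unfolding Hom_sharp_def one_FactGroup hcls_def to_sharp_def burnside_one by simp
qed

lemma Hom_finprod:
  assumes "finite A" "\<And>k. k \<in> A \<Longrightarrow> x k \<in> vmarks H G" "\<And>k. k \<in> A \<Longrightarrow> c k = hcls H G (x k)"
  shows "finprod (Hom_sharp G H) c A = hcls H G (\<Sum>k\<in>A. x k)"
  by (rule comm_group.finprod_additive[where h = "hcls H G", OF Hom_comm_group vmarks_zero Hom_one])
    (use assms in \<open>simp_all add: vmarks_add Hom_mult Hom_carrier\<close>)

lemma burnside_finprod:
  assumes "finite A" "\<And>k. k \<in> A \<Longrightarrow> x k \<in> vmarks H G" "\<And>k. k \<in> A \<Longrightarrow> c k = of_mark H G (x k)"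
  shows "finprod (burnside H G) c A = of_mark H G (\<Sum>k\<in>A. x k)"
  by (rule comm_group.finprod_additive[where h = "of_mark H G", OF burnside_comm_group vmarks_zero burnside_one])
    (use assms in \<open>simp_all add: vmarks_add burnside_mult of_mark_carrier\<close>)

end

text \<open>Changing either factor by an element of the ideal changes the composite by an element of
  the ideal, so the union over representatives is constant.\<close>

lemma (in three_groups) comp_sharp_hcls:
  assumes y: "y \<in> vmarks K H" and x: "x \<in> vmarks H G"
  shows "comp_sharp K H G (hcls K H y) (hcls H G x) = hcls K G (vcomp K H G y x)"
proof -
  have *: "burnside_delta K G #>\<^bsub>burnside K G\<^esub> bcomp K H G v u = hcls K G (vcomp K H G y x)"
    if "v \<in> hcls K H y" "u \<in> hcls H G x" for v u
  proof -
    obtain y' where y': "y' \<in> vmarks K H" "y' - y \<in> delta_ideal K H" "v = of_mark K H y'"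
      using \<open>v \<in> hcls K H y\<close> unfolding KH.hcls_set[OF y] by blast
    obtain x' where x': "x' \<in> vmarks H G" "x' - x \<in> delta_ideal H G" "u = of_mark H G x'"
      using \<open>u \<in> hcls H G x\<close> unfolding HG.hcls_set[OF x] by blast
    have "burnside_delta K G #>\<^bsub>burnside K G\<^esub> bcomp K H G v u = hcls K G (vcomp K H G y' x')"
      unfolding y'(3) x'(3) bcomp_of_mark[OF y'(1) x'(1)] hcls_def to_sharp_def ..
    also have "\<dots> = hcls K G (vcomp K H G y x)"
    proof (rule KG.hcls_eqI[OF vcomp_closed[OF y'(1) x'(1)] vcomp_closed[OF y x]])
      have "vcomp K H G y' x' - vcomp K H G y x = vcomp K H G (y' - y) x' + vcomp K H G y (x' - x)"
        unfolding vcomp_diff_left[OF y'(1) y x'(1)] vcomp_diff_right[OF y x'(1) x] by simp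
      then show "vcomp K H G y' x' - vcomp K H G y x \<in> delta_ideal K G"
        using KG.delta_ideal_add[OF delta_ideal_right[OF y'(2) x'(1)] delta_ideal_left[OF y x'(2)]] by simp
    qed
    finally show ?thesis .
  qed
  have ne: "hcls K H y \<noteq> {}" "hcls H G x \<noteq> {}"
    unfolding KH.hcls_set[OF y] HG.hcls_set[OF x] using y x KH.delta_ideal_zero HG.delta_ideal_zero by force+
  have "comp_sharp K H G (hcls K H y) (hcls H G x) = (\<Union>v\<in>hcls K H y. \<Union>u\<in>hcls H G x. hcls K G (vcomp K H G y x))"
    unfolding comp_sharp_def by (intro SUP_cong refl *)
  then show ?thesis using ne by simp
qed

abbreviation hob :: "nat monoid \<times> (nat, nat) vmark \<Rightarrow> nat monoid \<times> (nat, nat) smor" where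
  "hob \<equiv> \<lambda>(Q, f). (Q, hcls Q Q f)"

lemma two_group_finite: "two_group P \<Longrightarrow> finite_group P"
  by (simp add: two_group_def finite_group_def)

lemma comp_sharp_eq:
  assumes "finite_group R" "finite_group Q" "finite_group P" "g \<in> vmarks R Q" "f \<in> vmarks Q P" "h \<in> vmarks R P"
    "C.eqv R P (vcomp R Q P g f) h"
  shows "comp_sharp R Q P (hcls R Q g) (hcls Q P f) = hcls R P h"
proof -
  interpret three_groups R Q P by unfold_locales (rule assms)+
  show ?thesis unfolding comp_sharp_hcls[OF assms(4,5)]
    by (rule KG.hcls_eqI[OF vcomp_closed[OF assms(4,5)] assms(6)]) (use assms(7) in \<open>simp add: C.eqv_def\<close>)
qed

lemma hcls_eqv:
  assumes "finite_group Q" "finite_group P" "x \<in> vmarks Q P" "y \<in> vmarks Q P" "C.eqv Q P x y"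
  shows "hcls Q P x = hcls Q P y"
proof -
  interpret two_groups Q P by unfold_locales (rule assms)+
  show ?thesis by (rule hcls_eqI) (use assms in \<open>simp_all add: C.eqv_def\<close>)
qed

text \<open>Morphisms between the summands are those of the form \<open>f a e\<close>; b has this
  form because it absorbs both idempotents.\<close>

lemma hcls_comp_hom:
  assumes P: "finite_group P" "e \<in> vmarks P P" and Q: "finite_group Q" "f \<in> vmarks Q Q" and b: "b \<in> vmarks Q P"
    "C.eqv Q P (vcomp Q P P b e) b" "C.eqv Q P (vcomp Q Q P f b) b"
  shows "hcls Q P b \<in> comp_hom (P, hcls P P e) (Q, hcls Q Q f)"
proof -
  interpret two_groups Q P by unfold_locales (rule P Q)+
  have "hcls Q P b = comp_sharp Q Q P (hcls Q Q f) (comp_sharp Q P P (hcls Q P b) (hcls P P e))"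
    by (simp only: comp_sharp_eq[OF Q(1) P(1) P(1) b(1) P(2) b(1,2)] comp_sharp_eq[OF Q(1) Q(1) P(1) Q(2) b(1) b(1,3)])
  moreover have "hcls Q P b \<in> carrier (Hom_sharp P Q)" unfolding Hom_carrier using b(1) by blast
  ultimately show ?thesis unfolding comp_hom_def prod.case by blast
qed

lemma roq_object_hob:
  assumes "\<And>P e. (P, e) \<in> set A \<Longrightarrow> two_group P \<and> e \<in> vmarks P P \<and> C.eqv P P (vcomp P P P e e) e"
  shows "roq_object (map hob A)"
proof -
  have "two_group P \<and> hcls P P e \<in> carrier (Hom_sharp P P) \<and> comp_sharp P P P (hcls P P e) (hcls P P e) = hcls P P e"
    if "(P, e) \<in> set A" for P e
  proof -
    note a = assms[OF that]
    have P: "finite_group P" using a two_group_finite by blast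
    interpret two_groups P P by unfold_locales (rule P)+
    show ?thesis using a comp_sharp_eq[OF P P P, of e e e] unfolding Hom_carrier by blast
  qed
  then show ?thesis unfolding roq_object_def by (fastforce simp: case_prod_beta)
qed

lemma restrict_prod_eqI:
  "(\<And>i j. i \<in> I \<Longrightarrow> j \<in> J \<Longrightarrow> F i j = G i j) \<Longrightarrow> (\<lambda>(i, j)\<in>I \<times> J. F i j) = (\<lambda>(i, j)\<in>I \<times> J. G i j)"
  by (auto intro!: restrict_ext)

lemma restrict_prod_PiE:
  "(\<And>i j. i \<in> I \<Longrightarrow> j \<in> J \<Longrightarrow> F i j \<in> B i j) \<Longrightarrow> (\<lambda>(i, j)\<in>I \<times> J. F i j) \<in> (\<Pi>\<^sub>E (i, j)\<in>I \<times> J. B i j)"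
  by auto

text \<open>The column of projections and the row of inclusions are mutually inverse matrices. One
  product is the sum of the parts, which is e; the other has entries \<open>b a\<close>, equal to f
  on the diagonal and zero elsewhere by orthogonality.\<close>

theorem roq_iso_splits:
  assumes s: "C.splits (P, e) T" and P: "two_group P" and ee: "C.eqv P P (vcomp P P P e e) e"
    and T: "\<And>Q f a b. (Q, f, a, b) \<in> set T \<Longrightarrow> two_group Q"
  shows "[hob (P, e)] \<cong>\<^sub>R map hob (map C.part_ob T)"
proof -
  let ?n = "length T"
  let ?Q = "\<lambda>i. fst (T ! i)" and ?f = "\<lambda>i. fst (snd (T ! i))" and ?a = "\<lambda>i. fst (snd (snd (T ! i)))" and ?b = "\<lambda>i. snd (snd (snd (T ! i)))"
  let ?A = "[hob (P, e)]" and ?C = "map hob (map C.part_ob T)"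
  have Pf: "finite_group P" by (rule two_group_finite[OF P])
  have s': "e \<in> vmarks P P" "\<forall>t\<in>set T. C.part P t" "sorted_wrt (C.orth P) T" "C.eqv P P (C.part_sum P T) e"
    using s by (simp_all add: C.splits_def)
  have Tm: "(?Q i, ?f i, ?a i, ?b i) \<in> set T" if "i < ?n" for i using nth_mem[OF that] by simp
  have two: "two_group (?Q i)" if "i < ?n" for i using T[OF Tm[OF that]] .
  have p: "C.part P (?Q i, ?f i, ?a i, ?b i)" if "i < ?n" for i using s'(2) Tm[OF that] by blast
  have Q: "finite_group (?Q i)" "?f i \<in> vmarks (?Q i) (?Q i)" "?a i \<in> vmarks P (?Q i)" "?b i \<in> vmarks (?Q i) P"
    "C.eqv (?Q i) (?Q i) (vcomp (?Q i) P (?Q i) (?b i) (?a i)) (?f i)" "C.eqv P (?Q i) (vcomp P (?Q i) (?Q i) (?a i) (?f i)) (?a i)"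
    "C.eqv (?Q i) P (vcomp (?Q i) (?Q i) P (?f i) (?b i)) (?b i)" if "i < ?n" for i
    using p[OF that] by (auto simp: C.part_def)
  have abs: "C.eqv P (?Q i) (vcomp P P (?Q i) e (?a i)) (?a i)" "C.eqv (?Q i) P (vcomp (?Q i) P P (?b i) e) (?b i)" if "i < ?n" for i
    using C.splits_absorb[OF s Tm[OF that]] by simp_all
  have C: "?C ! i = (?Q i, hcls (?Q i) (?Q i) (?f i))" if "i < ?n" for i using that by (simp add: case_prod_beta)
  have A: "?A ! 0 = (P, hcls P P e)" "length ?A = 1" "length ?C = ?n" by simp_all
  define f where "f = (\<lambda>(i, j)\<in>{..<?n} \<times> {..<1 :: nat}. hcls (?Q i) P (?b i))"
  define g where "g = (\<lambda>(i, j)\<in>{..<1 :: nat} \<times> {..<?n}. hcls P (?Q j) (?a j))"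
  \<comment> \<open>Idempotence follows from the conditions on a part: f f = f (b a) = (f b) a = b a
    = f modulo the ideal.\<close>
  have ff: "C.eqv (?Q i) (?Q i) (vcomp (?Q i) (?Q i) (?Q i) (?f i) (?f i)) (?f i)" if i: "i < ?n" for i
  proof -
    note q = Q[OF i]
    let ?ba = "vcomp (?Q i) P (?Q i) (?b i) (?a i)"
    have 1: "C.eqv (?Q i) (?Q i) (vcomp (?Q i) (?Q i) (?Q i) (?f i) ?ba) (vcomp (?Q i) (?Q i) (?Q i) (?f i) (?f i))"
      by (rule C.eqv_cmp_right[OF q(1,1,1,2) C.cmp_M[OF q(1) Pf q(1) q(4,3)] q(2,5)])
    have "C.eqv (?Q i) (?Q i) (vcomp (?Q i) P (?Q i) (vcomp (?Q i) (?Q i) P (?f i) (?b i)) (?a i)) ?ba"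
      by (rule C.eqv_cmp_left[OF q(1) Pf q(1) C.cmp_M[OF q(1,1) Pf q(2,4)] q(4,3,7)])
    then have 2: "C.eqv (?Q i) (?Q i) (vcomp (?Q i) (?Q i) (?Q i) (?f i) ?ba) ?ba"
      unfolding vcomp_assoc[OF q(1,1) Pf q(1,2,4,3)] .
    show ?thesis
      by (rule C.eqv_trans[OF q(1,1) C.eqv_sym[OF q(1,1) 1] C.eqv_trans[OF q(1,1) 2 q(5)]])
  qed
  have oA: "roq_object ?A" using roq_object_hob[of "[(P, e)]"] P s'(1) ee by simp
  have oC: "roq_object ?C"
  proof (rule roq_object_hob)
    fix R h assume "(R, h) \<in> set (map C.part_ob T)"
    then obtain i where i': "i < length (map C.part_ob T)" "map C.part_ob T ! i = (R, h)" unfolding in_set_conv_nth by blast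
    then have i: "i < ?n" "C.part_ob (T ! i) = (R, h)" by simp_all
    then have "R = ?Q i" "h = ?f i" by (auto simp: case_prod_beta)
    then show "two_group R \<and> h \<in> vmarks R R \<and> C.eqv R R (vcomp R R R h h) h" using two Q(2) ff i(1) by simp
  qed
  have fh: "f \<in> roq_hom ?A ?C"
    unfolding roq_hom_def f_def A(2,3)
  proof (rule restrict_prod_PiE)
    fix i j :: nat assume "i \<in> {..<?n}" "j \<in> {..<1 :: nat}"
    then have ij: "i < ?n" "j = 0" by auto
    show "hcls (?Q i) P (?b i) \<in> comp_hom (?A ! j) (?C ! i)"
      unfolding ij(2) A(1) C[OF ij(1)] by (rule hcls_comp_hom[OF Pf s'(1) Q(1,2,4)[OF ij(1)] abs(2)[OF ij(1)] Q(7)[OF ij(1)]])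
  qed
  have gh: "g \<in> roq_hom ?C ?A"
    unfolding roq_hom_def g_def A(2,3)
  proof (rule restrict_prod_PiE)
    fix i j :: nat assume "i \<in> {..<1 :: nat}" "j \<in> {..<?n}"
    then have ij: "j < ?n" "i = 0" by auto
    show "hcls P (?Q j) (?a j) \<in> comp_hom (?C ! j) (?A ! i)"
      unfolding ij(2) A(1) C[OF ij(1)] by (rule hcls_comp_hom[OF Q(1,2)[OF ij(1)] Pf s'(1) Q(3)[OF ij(1)] Q(6)[OF ij(1)] abs(1)[OF ij(1)]])
  qed
  have gf: "roq_comp ?A ?C ?A g f = roq_id ?A"
    unfolding roq_comp_def roq_id_def A(2,3)
  proof (rule restrict_prod_eqI)
    fix i j :: nat assume "i \<in> {..<1 :: nat}" "j \<in> {..<1 :: nat}"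
    then have ij: "i = 0" "j = 0" by auto
    interpret PP: two_groups P P by unfold_locales (rule Pf)+
    let ?x = "\<lambda>k. vcomp P (?Q k) P (?a k) (?b k)"
    have x: "?x k \<in> vmarks P P" if "k \<in> {..<?n}" for k using that Q[of k] by (intro C.cmp_M Pf) auto
    have c: "comp_sharp P (fst (?C ! k)) P (g (0, k)) (f (k, 0)) = hcls P P (?x k)" if "k \<in> {..<?n}" for k
    proof -
      have k: "k < ?n" using that by simp
      have "g (0, k) = hcls P (?Q k) (?a k)" "f (k, 0) = hcls (?Q k) P (?b k)" using k by (simp_all add: f_def g_def)
      then show ?thesis unfolding C[OF k] fst_conv
        using comp_sharp_eq[OF Pf Q(1)[OF k] Pf Q(3,4)[OF k] x[OF that] C.eqv_refl[OF Pf Pf]] by simp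
    qed
    have ps: "(\<Sum>k\<in>{..<?n}. ?x k) = C.part_sum P T"
      unfolding C.part_sum_def by (simp add: sum_list_sum_nth case_prod_beta atLeast0LessThan)
    have "finprod (Hom_sharp P P) (\<lambda>k. comp_sharp P (fst (?C ! k)) P (g (0, k)) (f (k, 0))) {..<?n} = hcls P P (C.part_sum P T)"
      unfolding ps[symmetric] by (rule PP.Hom_finprod[OF _ x c]) simp
    also have "\<dots> = hcls P P e" by (rule hcls_eqv[OF Pf Pf C.part_sum_M[OF Pf s'(2)] s'(1,4)])
    finally show "finprod (Hom_sharp (fst (?A ! j)) (fst (?A ! i)))
        (\<lambda>k. comp_sharp (fst (?A ! i)) (fst (?C ! k)) (fst (?A ! j)) (g (i, k)) (f (k, j))) {..<?n} =
      (if i = j then snd (?A ! i) else \<one>\<^bsub>Hom_sharp (fst (?A ! j)) (fst (?A ! i))\<^esub>)"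
      unfolding ij A(1) fst_conv snd_conv by simp
  qed
  have fg: "roq_comp ?C ?A ?C f g = roq_id ?C"
    unfolding roq_comp_def roq_id_def A(2,3)
  proof (rule restrict_prod_eqI)
    fix i j :: nat assume "i \<in> {..<?n}" "j \<in> {..<?n}"
    then have i: "i < ?n" and j: "j < ?n" by auto
    interpret QQ: two_groups "?Q i" "?Q j" by unfold_locales (rule Q(1)[OF i] Q(1)[OF j])+
    let ?x = "vcomp (?Q i) P (?Q j) (?b i) (?a j)"
    have x: "?x \<in> vmarks (?Q i) (?Q j)" by (rule C.cmp_M[OF Q(1)[OF i] Pf Q(1)[OF j] Q(4)[OF i] Q(3)[OF j]])
    have c: "comp_sharp (?Q i) (fst (?A ! k)) (?Q j) (f (i, k)) (g (k, j)) = hcls (?Q i) (?Q j) ?x" if "k \<in> {..<1}" for k :: nat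
    proof -
      have "k = 0" using that by simp
      then have "f (i, k) = hcls (?Q i) P (?b i)" "g (k, j) = hcls P (?Q j) (?a j)" "fst (?A ! k) = P" using i j by (simp_all add: f_def g_def)
      then show ?thesis
        using comp_sharp_eq[OF Q(1)[OF i] Pf Q(1)[OF j] Q(4)[OF i] Q(3)[OF j] x C.eqv_refl[OF Q(1)[OF i] Q(1)[OF j]]] by simp
    qed
    have "finprod (Hom_sharp (?Q j) (?Q i)) (\<lambda>k. comp_sharp (?Q i) (fst (?A ! k)) (?Q j) (f (i, k)) (g (k, j))) {..<1} =
        hcls (?Q i) (?Q j) (\<Sum>k\<in>{..<1 :: nat}. ?x)"
      by (rule QQ.Hom_finprod) (use x c in auto)
    also have "(\<Sum>k\<in>{..<1 :: nat}. ?x) = ?x" by simp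
    also have "hcls (?Q i) (?Q j) ?x = (if i = j then hcls (?Q i) (?Q i) (?f i) else \<one>\<^bsub>Hom_sharp (?Q j) (?Q i)\<^esub>)"
    proof (cases "i = j")
      case True
      then show ?thesis using hcls_eqv[OF Q(1)[OF i] Q(1)[OF i] _ Q(2)[OF i] Q(5)[OF i]] x by simp
    next
      case False
      have "C.eqv (?Q i) (?Q j) ?x 0"
      proof (cases "i < j")
        case True
        have "C.orth P (T ! i) (T ! j)" using s'(3) True j by (simp add: sorted_wrt_iff_nth_less)
        then show ?thesis by (simp add: C.orth_def case_prod_beta)
      next
        case F: False
        then have "j < i" using False by simp
        then have "C.orth P (T ! j) (T ! i)" using s'(3) i by (simp add: sorted_wrt_iff_nth_less)
        then show ?thesis by (simp add: C.orth_def case_prod_beta)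
      qed
      then show ?thesis using hcls_eqv[OF Q(1)[OF i] Q(1)[OF j] x QQ.vmarks_zero] False by (simp add: QQ.Hom_one)
    qed
    finally show "finprod (Hom_sharp (fst (?C ! j)) (fst (?C ! i)))
        (\<lambda>k. comp_sharp (fst (?C ! i)) (fst (?A ! k)) (fst (?C ! j)) (f (i, k)) (g (k, j))) {..<1} =
      (if i = j then snd (?C ! i) else \<one>\<^bsub>Hom_sharp (fst (?C ! j)) (fst (?C ! i))\<^esub>)"
      unfolding C[OF i] C[OF j] fst_conv snd_conv .
  qed
  show ?thesis unfolding roq_iso_def using oA oC fh gh gf fg by blast
qed

section \<open>The edges of the groups in the theorem\<close>

text \<open>For M above y the interval from x contains both x and y, whose values 1 and -1 cancel;
  by induction the other elements below M contribute 0.\<close>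

lemma moebius_unique_atom:
  assumes S: "finite S" "x \<in> S" "y \<in> S" "x < y" and y: "\<And>w. w \<in> S \<Longrightarrow> x < w \<Longrightarrow> y \<le> w"
    and M: "M \<in> S" "x \<le> M"
  shows "moebius S x M = (if M = x then 1 else if M = y then -1 else 0)"
  using M
proof (induction "card {w \<in> S. w < M}" arbitrary: M rule: less_induct)
  case less
  show ?case
  proof (cases "M = x")
    case True
    then show ?thesis using S(1) by (subst moebius.simps) simp
  next
    case False
    let ?I = "{w \<in> S. x \<le> w \<and> w < M}"
    have I: "finite ?I" "x \<in> ?I" using S less.prems False by auto
    have "moebius S x w = (if w = x then 1 else if w = y then -1 else 0)" if w: "w \<in> ?I" for w
    proof (rule less.hyps)
      have "{v \<in> S. v < w} \<subset> {v \<in> S. v < M}" using w by auto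
      then show "card {v \<in> S. v < w} < card {v \<in> S. v < M}" using S(1) by (intro psubset_card_mono) auto
    qed (use w in auto)
    then have "(\<Sum>w\<in>?I. moebius S x w) = (\<Sum>w\<in>?I. (if w = x then 1 else 0) - (if w = y then 1 else 0))"
      using S(4) by (intro sum.cong) auto
    also have "\<dots> = 1 - (if y \<in> ?I then 1 else 0)"
      using I by (simp add: sum_subtractf sum.delta)
    also have "y \<in> ?I \<longleftrightarrow> M \<noteq> y" using y[OF less.prems(1)] less.prems False S(3,4) by (auto simp: order_less_le)
    finally have "(\<Sum>w\<in>?I. moebius S x w) = 1 - (if M \<noteq> y then 1 else 0)" .
    then show ?thesis using S(1) False by (subst moebius.simps) simp
  qed
qed

definition unique_minimal :: "'g monoid \<Rightarrow> 'g \<Rightarrow> bool" where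
  "unique_minimal P z \<longleftrightarrow> (\<forall>M. M \<lhd> P \<longrightarrow> M \<noteq> {\<one>\<^bsub>P\<^esub>} \<longrightarrow> z \<in> M)"

text \<open>The subgroup generated by z is the only atom above the trivial subgroup, so the Moebius
  function removes all other terms of the edge idempotent.\<close>

lemma f_one_eq:
  fixes P (structure)
  assumes P: "finite_group P" and z: "central_inv P z" and m: "unique_minimal P z"
  shows "f_one P = of_mark P P (quot_mark P {\<one>} - quot_mark P {\<one>, z})"
proof -
  interpret two_groups P P by unfold_locales (rule P)+
  interpret B: comm_group "burnside P P" by (rule burnside_comm_group)
  let ?S = "{M. M \<lhd> P}" and ?c = "\<lambda>M. moebius {N. N \<lhd> P} {\<one>} M"
  let ?x = "\<lambda>M. if M = {\<one>} then quot_mark P M else if M = {\<one>, z} then - quot_mark P M else 0"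
  have "?S \<subseteq> Pow (carrier P)" using subgroup.subset normal_imp_subgroup by blast
  then have fS: "finite ?S" using finite_groupD(2)[OF P] by (metis finite_Pow_iff finite_subset)
  have n: "{\<one>} \<lhd> P" "{\<one>, z} \<lhd> P" by (rule one_normal[OF P], rule central_inv_normal[OF H.is_group z])
  have z1: "z \<noteq> \<one>" using z by (simp add: central_inv_def)
  have one: "\<one> \<in> M" if "M \<lhd> P" for M using subgroup.one_closed[OF normal_imp_subgroup[OF that]] .
  have c: "?c M = (if M = {\<one>} then 1 else if M = {\<one>, z} then -1 else 0)" if M: "M \<lhd> P" for M
  proof (rule moebius_unique_atom[OF fS])
    show "{\<one>} < {\<one>, z}" using z1 by auto
    show "{\<one>, z} \<le> w" if "w \<in> ?S" "{\<one>} < w" for w using m that one unfolding unique_minimal_def by blast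
  qed (use n M one in auto)
  have V: "quot_mark P M \<in> vmarks P P" if "M \<lhd> P" for M by (rule quot_mark_vmarks[OF P that])
  have pw: "bclass P P (quot_biset P M) [^]\<^bsub>burnside P P\<^esub> ?c M = of_mark P P (?x M)" if M: "M \<in> ?S" for M
  proof -
    have M': "M \<lhd> P" using M by simp
    have b: "bclass P P (quot_biset P M) = of_mark P P (quot_mark P M)"
      using bclass_eq[OF quot_biset_mark(1)[OF P M']] unfolding quot_biset_mark(2)[OF P M'] .
    have bc: "of_mark P P (quot_mark P M) \<in> carrier (burnside P P)" by (rule of_mark_carrier[OF V[OF M']])
    consider "M = {\<one>}" | "M = {\<one>, z}" "M \<noteq> {\<one>}" | "M \<noteq> {\<one>}" "M \<noteq> {\<one>, z}" by blast
    then show ?thesis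
    proof cases
      case 1
      then have "?c M = 1" "?x M = quot_mark P M" using c[OF M'] by simp_all
      then show ?thesis unfolding b by (simp only: B.int_pow_1[OF bc])
    next
      case 2
      then have "?c M = - 1" "?x M = - quot_mark P M" using c[OF M'] by simp_all
      then show ?thesis unfolding b by (simp only: B.int_pow_neg[OF bc] B.int_pow_1[OF bc] burnside_inv[OF V[OF M']])
    next
      case 3
      then have "?c M = 0" "?x M = 0" using c[OF M'] by simp_all
      then show ?thesis unfolding b by (simp only: int_pow_0 burnside_one)
    qed
  qed
  have "f_one P = of_mark P P (\<Sum>M\<in>?S. ?x M)"
    unfolding f_one_def
  proof (rule burnside_finprod[OF fS _ pw])
    show "?x M \<in> vmarks P P" if "M \<in> ?S" for M
      using V[of M] that vmarks_minus[OF V[of M]] vmarks_zero by (simp only: mem_Collect_eq split: if_split) blast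
  qed
  also have "(\<Sum>M\<in>?S. ?x M) = (\<Sum>M\<in>{{\<one>}, {\<one>, z}}. ?x M)"
    by (rule sum.mono_neutral_right[OF fS]) (use n in auto)
  also have "\<dots> = quot_mark P {\<one>} - quot_mark P {\<one>, z}" using z1 by auto
  finally show ?thesis .
qed

context finite_grp begin

lemma nat_copy_unique_minimal:
  assumes m: "unique_minimal G z" shows "unique_minimal (nat_copy G) (nu G z)"
  unfolding unique_minimal_def
proof (intro allI impI)
  fix M assume M: "M \<lhd> nat_copy G" "M \<noteq> {\<one>\<^bsub>nat_copy G\<^esub>}"
  interpret M: normal M "nat_copy G" by fact
  interpret h: group_hom G "nat_copy G" "nu G" by (rule nu_group_hom)
  let ?K = "{x \<in> carrier G. nu G x \<in> M}"
  have "subgroup ?K G"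
  proof (rule subgroupI)
    have "\<one> \<in> ?K" using M.one_closed h.hom_one by simp
    then show "?K \<noteq> {}" by blast
  qed auto
  moreover have "x \<otimes> k \<otimes> inv x \<in> ?K" if "x \<in> carrier G" "k \<in> ?K" for x k
  proof -
    have k: "k \<in> carrier G" "nu G k \<in> M" using that(2) by simp_all
    have "nu G (x \<otimes> k \<otimes> inv x) = nu G x \<otimes>\<^bsub>nat_copy G\<^esub> nu G k \<otimes>\<^bsub>nat_copy G\<^esub> inv\<^bsub>nat_copy G\<^esub> nu G x"
      by (simp only: h.hom_mult h.hom_inv that(1) k(1) m_closed inv_closed)
    then show ?thesis using M.inv_op_closed2[OF nu_closed[OF that(1)] k(2)] that(1) k(1) by simp
  qed
  ultimately have "?K \<lhd> G" by (simp add: normal_inv_iff)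
  moreover have "?K \<noteq> {\<one>}"
  proof -
    obtain y where y: "y \<in> M" "y \<noteq> \<one>\<^bsub>nat_copy G\<^esub>" using M(2) M.one_closed by auto
    have "y \<in> carrier (nat_copy G)" using y(1) M.subset by blast
    then obtain x where x: "x \<in> carrier G" "y = nu G x" by (rule nc_cases)
    then have "x \<in> ?K" "x \<noteq> \<one>" using y h.hom_one by auto
    then show ?thesis by blast
  qed
  ultimately show "nu G z \<in> M" using m unfolding unique_minimal_def by blast
qed

lemma nat_copy_central_inv: assumes "central_inv G z" shows "central_inv (nat_copy G) (nu G z)"
proof -
  have z: "z \<in> carrier G" "z \<otimes> z = \<one>" "z \<noteq> \<one>" "\<And>y. y \<in> carrier G \<Longrightarrow> y \<otimes> z = z \<otimes> y"
    using assms unfolding central_inv_def by blast+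
  have "y \<otimes>\<^bsub>nat_copy G\<^esub> nu G z = nu G z \<otimes>\<^bsub>nat_copy G\<^esub> y" if y: "y \<in> carrier (nat_copy G)" for y
  proof -
    obtain x where x: "x \<in> carrier G" "y = nu G x" using y by (rule nc_cases)
    show ?thesis unfolding x(2) nu_mult[OF x(1) z(1)] nu_mult[OF z(1) x(1)] z(4)[OF x(1)] ..
  qed
  moreover have "nu G z \<otimes>\<^bsub>nat_copy G\<^esub> nu G z = \<one>\<^bsub>nat_copy G\<^esub>" "nu G z \<noteq> \<one>\<^bsub>nat_copy G\<^esub>"
    using z(1,2,3) by (simp_all add: nu_mult nc_one nu_eq)
  ultimately show ?thesis unfolding central_inv_def using nu_closed[OF z(1)] by blast
qed

lemma edge_nat_copy:
  assumes "central_inv G z" "unique_minimal G z" shows "edge (nat_copy G) = [hob (DO G z)]"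
proof -
  have "f_one (nat_copy G) = of_mark (nat_copy G) (nat_copy G) (quot_mark (nat_copy G) {\<one>\<^bsub>nat_copy G\<^esub>} - quot_mark (nat_copy G) {\<one>\<^bsub>nat_copy G\<^esub>, nu G z})"
    by (rule f_one_eq[OF nc_fin nat_copy_central_inv[OF assms(1)] nat_copy_unique_minimal[OF assms(2)]])
  then show ?thesis by (simp add: edge_def hcls_def EO_def nc_one)
qed

lemma group_ob_nat_copy: "group_ob (nat_copy G) = [hob (RO G)]"
proof -
  interpret N: two_groups "nat_copy G" "nat_copy G" by unfold_locales (rule nc_fin)+
  have "bid (nat_copy G) = of_mark (nat_copy G) (nat_copy G) (quot_mark (nat_copy G) {\<one>\<^bsub>nat_copy G\<^esub>})"
    unfolding bid_def id_mark[OF nc_fin, symmetric] by (rule N.bclass_eq[OF fin_biset_id[OF nc_fin]])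
  then show ?thesis by (simp add: group_ob_def id_sharp_def RO_def hcls_def)
qed

lemma two_group_nat_copy: assumes "card (carrier G) = 2 ^ k" shows "two_group (nat_copy G)"
proof -
  have "card (carrier (nat_copy G)) = 2 ^ k" unfolding nc_carrier using card_image[OF nu_inj] assms by simp
  then show ?thesis using nc_fin unfolding two_group_def finite_group_def order_def by blast
qed

end

text \<open>A nontrivial normal subgroup contains a nontrivial rotation, and repeated doubling of a
  rotation of 2-power order passes through the half turn.\<close>

lemma dih_unique_minimal:
  assumes "e \<ge> 2" shows "unique_minimal (dih (2 ^ e)) (2 ^ (e - 1), False)"
  unfolding unique_minimal_def
proof (intro allI impI)
  fix M assume M: "M \<lhd> dih (2 ^ e)" "M \<noteq> {\<one>\<^bsub>dih (2 ^ e)\<^esub>}"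
  interpret G: group "dih (2 ^ e)" by (intro finite_groupD dih_finite) simp
  interpret M: normal M "dih (2 ^ e)" by fact
  have e1: "(2 :: int) ^ e = 2 * 2 ^ (e - 1)" using assms by (metis power_Suc Suc_pred zero_less_numeral less_le_trans One_nat_def)
  have e4: "(4 :: int) \<le> 2 ^ e" using power_increasing[of 2 e "2 :: int"] assms by simp
  obtain x where x: "x \<in> M" "x \<noteq> \<one>\<^bsub>dih (2 ^ e)\<^esub>" using M(2) M.one_closed by auto
  have "\<exists>a. (a, False) \<in> M \<and> 0 < a \<and> a < 2 ^ e"
  proof (cases x)
    case (Pair a s)
    have c: "0 \<le> a" "a < 2 ^ e" using M.mem_carrier[OF x(1)] Pair by simp_all
    show ?thesis
    proof (cases s)
      case False
      then show ?thesis using x c Pair by (intro exI[of _ a]) auto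
    next
      case True
      have r: "(1, False) \<in> carrier (dih (2 ^ e))" using e4 by simp
      have inv: "inv\<^bsub>dih (2 ^ e)\<^esub> (1, False) = (2 ^ e - 1, False)" by (rule G.inv_equality) (use e4 in simp_all)
      \<comment> \<open>For a reflection x and the rotation r = (1, False), the conjugate of x by r
        times x is the square of r. It is nontrivial because there are at least four
        rotations.\<close>
      have "(1, False) \<otimes>\<^bsub>dih (2 ^ e)\<^esub> x \<otimes>\<^bsub>dih (2 ^ e)\<^esub> inv\<^bsub>dih (2 ^ e)\<^esub> (1, False) \<otimes>\<^bsub>dih (2 ^ e)\<^esub> x \<in> M"
        by (rule M.m_closed[OF M.inv_op_closed2[OF r x(1)] x(1)])
      moreover have "(1, False) \<otimes>\<^bsub>dih (2 ^ e)\<^esub> x \<otimes>\<^bsub>dih (2 ^ e)\<^esub> inv\<^bsub>dih (2 ^ e)\<^esub> (1, False) \<otimes>\<^bsub>dih (2 ^ e)\<^esub> x = ((2 - 2 ^ e) mod 2 ^ e, False)"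
        unfolding inv using Pair True by (simp add: mod_simps)
      moreover have "(2 - 2 ^ e) mod 2 ^ e = (2 :: int)" using e4 by (simp add: mod_diff_right_eq[symmetric])
      ultimately show ?thesis using e4 by (intro exI[of _ 2]) auto
    qed
  qed
  then obtain a where a: "(a, False) \<in> M" "0 < a" "a < 2 ^ e" by blast
  have pw: "(2 ^ j * a mod 2 ^ e, False) \<in> M" for j
  proof (induction j)
    case 0
    then show ?case using a by simp
  next
    case (Suc j)
    have "(2 ^ j * a mod 2 ^ e, False) \<otimes>\<^bsub>dih (2 ^ e)\<^esub> (2 ^ j * a mod 2 ^ e, False) = (2 ^ Suc j * a mod 2 ^ e, False)"
      by (simp add: mod_simps mult.assoc)
    then show ?case using M.m_closed[OF Suc Suc] by simp
  qed
  \<comment> \<open>The half turn is reached one doubling before the rotation becomes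
    trivial.\<close>
  define j where "j = (LEAST j. (2 :: int) ^ e dvd 2 ^ j * a)"
  have "(2 :: int) ^ e dvd 2 ^ e * a" by simp
  then have j: "(2 :: int) ^ e dvd 2 ^ j * a" unfolding j_def by (rule LeastI)
  have "\<not> (2 :: int) ^ e dvd a" using a zdvd_imp_le by fastforce
  then obtain i where i: "j = Suc i" using j by (cases j) auto
  have ni: "\<not> (2 :: int) ^ e dvd 2 ^ i * a" using not_less_Least[of i "\<lambda>j. (2 :: int) ^ e dvd 2 ^ j * a"] i unfolding j_def by simp
  let ?b = "2 ^ i * a mod 2 ^ e"
  have "?b \<noteq> 0" using ni unfolding dvd_eq_mod_eq_0 .
  moreover have "0 \<le> ?b" by (rule pos_mod_sign) simp
  moreover have "?b < 2 ^ e" by (rule pos_mod_bound) simp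
  ultimately have b: "0 < ?b" "?b < 2 * 2 ^ (e - 1)" unfolding e1 by linarith+
  have "2 ^ e dvd 2 * ?b" using j i by (simp add: dvd_eq_mod_eq_0 mod_simps mult.assoc)
  then have "2 ^ (e - 1) dvd ?b" unfolding e1 by simp
  then have "?b mod 2 ^ (e - 1) = 0" by simp
  then have "?b = 2 ^ (e - 1)" using mod_zero_cases[of ?b "2 ^ (e - 1)"] b by simp
  then show "(2 ^ (e - 1), False) \<in> M" using pw[of i] by simp
qed

lemma C2_finite: "finite_group (integer_mod_group 2)"
  by (simp add: finite_group_def carrier_integer_mod_group)

lemma C2_carrier: "carrier (integer_mod_group 2) = {0, 1}"
  by (auto simp: carrier_integer_mod_group)

lemma C2_central: "central_inv (integer_mod_group 2) 1"
  unfolding central_inv_def C2_carrier by (auto simp: mult_integer_mod_group)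

lemma C2_unique_minimal: "unique_minimal (integer_mod_group 2) 1"
  unfolding unique_minimal_def
proof (intro allI impI)
  fix M assume M: "M \<lhd> integer_mod_group 2" "M \<noteq> {\<one>\<^bsub>integer_mod_group 2\<^esub>}"
  then interpret M: normal M "integer_mod_group 2" by simp
  have "0 \<in> M" using subgroup.one_closed[OF normal_imp_subgroup[OF M(1)]] by simp
  then show "1 \<in> M" using M.subset M(2) unfolding C2_carrier one_integer_mod_group by blast
qed

lemma DO_dih1_C2: "C.dec (DO (dih 1) (0, True)) {#DO (integer_mod_group 2) 1#}"
proof -
  have "epi (dih 1) (integer_mod_group 2) (\<lambda>x. of_bool (snd x))"
  proof (rule epiI)
    show "\<exists>x\<in>carrier (dih 1). of_bool (snd x) = y" if "y \<in> carrier (integer_mod_group 2)" for y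
      using that unfolding C2_carrier by (intro bexI[of _ "(0, y = 1)"]) auto
  qed (auto simp: C2_finite C2_carrier dih_finite mult_integer_mod_group)
  moreover have "{x \<in> carrier (dih 1). of_bool (snd x) = \<one>\<^bsub>integer_mod_group 2\<^esub>} = {\<one>\<^bsub>dih 1\<^esub>}" by auto
  ultimately show ?thesis using epi.DO_iso[OF _ dih1_central] by fastforce
qed

text \<open>The same edges on the groups named in the theorem: only \<open>dih 1\<close> has to be
  replaced by the cyclic group of order two.\<close>

definition edge_target :: "nat \<Rightarrow> nat monoid \<times> (nat, nat) vmark" where
  "edge_target k = (if k = 2 then DO (integer_mod_group 2) 1 else DO (dih (2 ^ k)) (2 ^ (k - 1), False))"

lemma DO_edge_target: assumes "k \<ge> 2" shows "C.dec (DO (edge_group k) (edge_inv k)) {#edge_target k#}"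
proof (cases "k = 2")
  case True
  then show ?thesis using DO_dih1_C2 by (simp add: edge_target_def edge_group_def edge_inv_def)
next
  case False
  then show ?thesis using DO_refl[OF edge_group_finite edge_inv_central[OF assms]] by (simp add: edge_target_def edge_group_def edge_inv_def)
qed

lemma RO_pow_target:
  assumes "e \<ge> 2"
  shows "C.dec (RO (pow_group (dih (2 ^ e)) n)) (add_mset (RO trivial_grp) (msum {2..e} (\<lambda>k. if k = 2 then 5 ^ n - 1 else q_coef k n) edge_target))"
proof -
  let ?h = "\<lambda>k. if k = 2 then 5 ^ n - 1 else q_coef k n"
  have 1: "C.dec (DO (edge_group k) (edge_inv k)) (msum {2..e} (\<lambda>i. if i = k then 1 else 0) edge_target)" if "k \<in> {2..e}" for k
    using DO_edge_target[of k] msum_single[of "{2..e}" k 1 edge_target] that by (simp add: One_nat_def)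
  have "C.dec (RO (pow_group (dih (2 ^ e)) n)) (msum {2..e} ?h (\<lambda>k. DO (edge_group k) (edge_inv k)) + {#RO trivial_grp#})"
    using RO_pow[OF assms, of n] by simp
  from C.dec_msum[OF this finite_atLeastAtMost 1]
  have "C.dec (RO (pow_group (dih (2 ^ e)) n)) (add_mset (RO trivial_grp) (msum {2..e} (\<lambda>i. \<Sum>k\<in>{2..e}. ?h k * (if i = k then 1 else 0)) edge_target))"
    by simp
  then show ?thesis
    by (rule msum_subst[of "\<lambda>N. C.dec (RO (pow_group (dih (2 ^ e)) n)) (add_mset (RO trivial_grp) N)"])
      (simp add: if_distrib[of "(*) _"] sum.delta cong: if_cong)
qed

text \<open>The index drops by one because the dihedral group of order \<open>2 ^ l\<close> is
  \<open>dih (2 ^ (l - 1))\<close>. By \<open>q_coef_eq\<close> the division is exact.\<close>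

lemma q_coef_div:
  assumes "l \<ge> 3"
  shows "((3 + 2 ^ (l - 2)) ^ n - (3 + 2 ^ (l - 3)) ^ n) div 2 ^ (l - 3) = q_coef (l - 1) n"
proof -
  have l: "l - 1 - 2 = l - 3" "l - 1 - 1 = l - 2" "2 \<le> l - 1" using assms by auto
  have "(3 + 2 ^ (l - 2)) ^ n - (3 + 2 ^ (l - 3)) ^ n = 2 ^ (l - 3) * q_coef (l - 1) n"
    using q_coef_eq[OF l(3), of n] unfolding l(1,2) by linarith
  then show ?thesis by simp
qed

lemma copies_single: "copies n [x] = replicate n x"
  unfolding copies_def by (induction n) simp_all

theorem proposition5p39:
  fixes m n :: nat
  assumes "m \<ge> 3"
  shows "group_ob (nat_copy (product_group {..<n} (\<lambda>_. dihedral_group (2 ^ m)))) \<cong>\<^sub>R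
    group_ob (nat_copy trivial_grp)
    @ copies (5 ^ n - 1) (edge (nat_copy (integer_mod_group 2)))
    @ concat (map (\<lambda>l. copies (((3 + 2 ^ (l - 2)) ^ n - (3 + 2 ^ (l - 3)) ^ n) div 2 ^ (l - 3))
                          (edge (nat_copy (dihedral_group (2 ^ l)))))
                [4..<Suc m])"
proof -
  \<comment> \<open>There are \<open>2 ^ e\<close> rotations, half the order of the group.\<close>
  obtain e where e: "m = Suc e" "e \<ge> 2" using assms by (cases m) auto
  have dl: "dihedral_group (2 ^ Suc k) = dih (2 ^ k)" for k by (simp add: dih_def)
  let ?G = "pow_group (dih (2 ^ e)) n"
  \<comment> \<open>The summands in the order of the statement. The decomposition is first found as
    a multiset and then arranged along this list by \<open>C.dec_list\<close>.\<close>
  let ?L = "RO trivial_grp # replicate (5 ^ n - 1) (edge_target 2) @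
    concat (map (\<lambda>l. replicate (q_coef (l - 1) n) (edge_target (l - 1))) [4..<Suc m])"
  interpret G: finite_grp ?G by unfold_locales (intro pow_group_finite dih_finite, simp)
  interpret T: finite_grp trivial_grp by unfold_locales (rule finite_group_trivial)
  interpret C2: finite_grp "integer_mod_group 2" by unfold_locales (rule C2_finite)
  have D: "finite_grp (dih (2 ^ k))" for k by (simp add: finite_grp_def dih_finite)
  have edge2: "edge (nat_copy (integer_mod_group 2)) = [hob (edge_target 2)]"
    using C2.edge_nat_copy[OF C2_central C2_unique_minimal] by (simp add: edge_target_def)
  have edge_l: "edge (nat_copy (dihedral_group (2 ^ l))) = [hob (edge_target (l - 1))]" if "l \<ge> 4" for l
  proof -
    have "l = Suc (Suc (l - 2))" "l - 2 \<ge> 2" using that by auto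
    then obtain k where k: "l = Suc (Suc k)" "k \<ge> 2" by blast
    have "central_inv (dih (2 ^ Suc k)) (2 ^ k, False)" using dih_central[of "2 ^ k"] by simp
    moreover have "unique_minimal (dih (2 ^ Suc k)) (2 ^ k, False)" using dih_unique_minimal[of "Suc k"] k by simp
    ultimately show ?thesis using finite_grp.edge_nat_copy[OF D, of "Suc k"] k unfolding k(1) dl by (simp add: edge_target_def)
  qed
  have m: "mset ?L = add_mset (RO trivial_grp) (msum {2..e} (\<lambda>k. if k = 2 then 5 ^ n - 1 else q_coef k n) edge_target)"
  proof -
    have "mset (concat (map (\<lambda>l. replicate (q_coef (l - 1) n) (edge_target (l - 1))) [4..<Suc m])) =
        (\<Sum>l\<in>{4..m}. replicate_mset (q_coef (l - 1) n) (edge_target (l - 1)))"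
      by (simp add: mset_concat interv_sum_list_conv_sum_set_nat comp_def atLeastLessThanSuc_atLeastAtMost del: upt_Suc)
    also have "\<dots> = (\<Sum>k\<in>{3..e}. replicate_mset (q_coef k n) (edge_target k))"
      by (rule sum.reindex_bij_witness[of _ Suc "\<lambda>l. l - 1"]) (use e in auto)
    finally have c: "mset (concat (map (\<lambda>l. replicate (q_coef (l - 1) n) (edge_target (l - 1))) [4..<Suc m])) =
      (\<Sum>k\<in>{3..e}. replicate_mset (q_coef k n) (edge_target k))" .
    have "{2..e} = insert 2 {3..e}" using e by auto
    then show ?thesis by (simp add: c msum_def del: upt_Suc)
  qed
  have "C.dec (RO ?G) (mset ?L)" unfolding m by (rule RO_pow_target[OF e(2)])
  from C.dec_list[OF this] obtain T where T: "C.splits (RO ?G) T" "map C.part_ob T = ?L" by (elim exE conjE)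
  have twoL: "two_group Q" if "(Q, f) \<in> set ?L" for Q f
  proof -
    have t: "two_group (fst (edge_target k))" if "k \<ge> 2" for k
    proof (cases "k = 2")
      case True
      then show ?thesis using C2.two_group_nat_copy[of 1] by (simp add: edge_target_def EO_def C2_carrier)
    next
      case False
      then show ?thesis using finite_grp.two_group_nat_copy[OF D, of k "Suc k"] by (simp add: edge_target_def EO_def card_cartesian_product)
    qed
    have "two_group (fst (RO trivial_grp))" using T.two_group_nat_copy[of 0] by (simp add: RO_def singleton_group_def)
    then show ?thesis using that t[of 2] t by (fastforce simp: image_iff dest: arg_cong[of _ _ fst])
  qed
  have two: "two_group (nat_copy ?G)"
  proof (rule G.two_group_nat_copy[of "Suc e * n"])
    have "card (carrier (dih (2 ^ e))) = 2 ^ Suc e" by (simp add: card_cartesian_product)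
    then show "card (carrier ?G) = 2 ^ (Suc e * n)"
      unfolding carrier_product_group by (simp only: card_PiE[OF finite_lessThan] prod_constant card_lessThan power_mult)
  qed
  have "[hob (RO ?G)] \<cong>\<^sub>R map hob (map C.part_ob T)"
    unfolding RO_def
  proof (rule roq_iso_splits[OF T(1)[unfolded RO_def] two])
    show "C.eqv (nat_copy ?G) (nat_copy ?G)
      (vcomp (nat_copy ?G) (nat_copy ?G) (nat_copy ?G) (quot_mark (nat_copy ?G) {\<one>\<^bsub>nat_copy ?G\<^esub>}) (quot_mark (nat_copy ?G) {\<one>\<^bsub>nat_copy ?G\<^esub>}))
      (quot_mark (nat_copy ?G) {\<one>\<^bsub>nat_copy ?G\<^esub>})"
      unfolding quot_mark_comp(1)[OF G.nc_fin one_normal[OF G.nc_fin] one_normal[OF G.nc_fin] order_refl]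
      by (rule C.eqv_refl[OF G.nc_fin G.nc_fin])
    show "two_group Q" if "(Q, f, a, b) \<in> set T" for Q f a b
    proof -
      have "(Q, f) \<in> set (map C.part_ob T)" using that by force
      then show ?thesis unfolding T(2) by (rule twoL)
    qed
  qed
  moreover have "map hob ?L = group_ob (nat_copy trivial_grp)
    @ copies (5 ^ n - 1) (edge (nat_copy (integer_mod_group 2)))
    @ concat (map (\<lambda>l. copies (((3 + 2 ^ (l - 2)) ^ n - (3 + 2 ^ (l - 3)) ^ n) div 2 ^ (l - 3))
                          (edge (nat_copy (dihedral_group (2 ^ l))))) [4..<Suc m])"
  proof -
    have "map (\<lambda>l. copies (((3 + 2 ^ (l - 2)) ^ n - (3 + 2 ^ (l - 3)) ^ n) div 2 ^ (l - 3)) (edge (nat_copy (dihedral_group (2 ^ l))))) [4..<Suc m] =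
        map (\<lambda>l. map hob (replicate (q_coef (l - 1) n) (edge_target (l - 1)))) [4..<Suc m]"
    proof (rule map_cong[OF refl])
      fix l assume "l \<in> set [4..<Suc m]"
      then have l: "4 \<le> l" "3 \<le> l" by auto
      show "copies (((3 + 2 ^ (l - 2)) ^ n - (3 + 2 ^ (l - 3)) ^ n) div 2 ^ (l - 3)) (edge (nat_copy (dihedral_group (2 ^ l)))) =
          map hob (replicate (q_coef (l - 1) n) (edge_target (l - 1)))"
        unfolding q_coef_div[OF l(2)] edge_l[OF l(1)] copies_single map_replicate ..
    qed
    then show ?thesis unfolding T.group_ob_nat_copy edge2 copies_single
      by (simp only: map_concat map_map comp_def list.map map_append map_replicate append_Cons append_Nil)
  qed
  ultimately show ?thesis unfolding T(2) e(1) dl G.group_ob_nat_copy by simp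
qed

end
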